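(* Let $T$ be an interval exchange map with no connection such that: - for all $\tau>0$, $\|B(n_k,n_{k+1})\|=O(\|B(0,n_k)\|^\tau)$; - for all $\tau>0$, $\|B_s(m,n)\|=O(\|B(0,n)\|^\tau)$ and $\|B_\flat(m,n)^{-1}\|=O(\|B(0,n)\|^\tau)$, uniformly in $0\le m\le n$; - $\dim\Gamma_s(T)=g$. Let $\Gamma_u(T)$ be a subspace of $\Gamma_\partial(T)$ supplementing $\Gamma_s(T)$ in $\Gamma_\partial(T)$. Then there is a bounded linear operator $L_1:C^1_0(\mathbf u(T))\to\Gamma_u(T)$ such that, for $\varphi\in C^1_0(\mathbf u(T))$, the function $\chi=L_1(\varphi)\in\Gamma_u(T)$ is characterized (among elements of $\Gamma_u(T)$) by the property that the special Birkhoff sums of $\varphi-\chi$ satisfy, for any $\tau>0$ and all $n\ge0$, $$\|S(0,n)(\varphi-\chi)\|_{C^0}\le C(\tau)\,\|\varphi\|_{C^1}\,\|B(0,n)\|^\tau ,$$ where $C(\tau)$ is independent of $n$ and $\varphi$. Moreover $L_1$ extends the operator of the cohomological equation: when $T$ is of restricted Roth type and $r>1$, the restriction of $L_1$ to $C^r_0(\mathbf u(T))$ is the bounded operator $\varphi\mapsto\chi\in\Gamma_u(T)$ for which $\varphi=\chi+\psi\circ T-\psi$ with $\psi\in C^0([u_0(T),u_d(T)])$.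
   Context: **Interval exchange maps.** Let $\mathcal A$ be an alphabet with $d\ge 2$ symbols. An interval exchange map (i.e.m.) $T$ on a bounded open interval $I(T)$ is given by two partitions mod $0$, $I(T)=\bigsqcup_\alpha I^t_\alpha(T)=\bigsqcup_\alpha I^b_\alpha(T)$, into open intervals indexed by $\mathcal A$ with $|I^t_\alpha(T)|=|I^b_\alpha(T)|$; $T$ maps each $I^t_\alpha(T)$ onto $I^b_\alpha(T)$ by translation. Write $I(T)=(u_0(T),u_d(T))=(v_0(T),v_d(T))$; the points $u_1(T)<\dots<u_{d-1}(T)$ separating the $I^t_\alpha$ are the singularities of $T$, the points $v_1(T)<\dots<v_{d-1}(T)$ separating the $I^b_\alpha$ are those of $T^{-1}$. The combinatorial data $\pi=(\pi_t,\pi_b)$ are the bijections $\mathcal A\to\{1,\dots,d\}$ with $I^t_\alpha=(u_{\pi_t(\alpha)-1},u_{\pi_t(\alpha)})$, $I^b_\alpha=(v_{\pi_b(\alpha)-1},v_{\pi_b(\alpha)})$. They are always assumed irreducible: $\pi_t^{-1}(\{1,\dots,k\})\neq\pi_b^{-1}(\{1,\dots,k\})$ for $1\le k<d$. A connection is a triple $(u_i,v_j,m)$, $0<i,j<d$, $m\ge0$, with $T^m(v_j)=u_i$. Let $\Omega(\pi)$ be the antisymmetric matrix with $\Omega_{\alpha\beta}=+1$ if $\pi_t(\alpha)<\pi_t(\beta),\ \pi_b(\alpha)>\pi_b(\beta)$, $-1$ if $\pi_t(\alpha)>\pi_t(\beta),\ \pi_b(\alpha)<\pi_b(\beta)$,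 and $0$ otherwise; its rank is $2g$, where $g$ is called the genus. **Rauzy–Veech algorithm.** Let $T$ have no connection, and let $\pi_t(\alpha_t)=\pi_b(\alpha_b)=d$. The elementary step replaces $T$ by its first return map $\widehat T$ to $(u_0(T),\max(u_{d-1}(T),v_{d-1}(T)))$, again an i.e.m. without connection, labeled by $\mathcal A$ as follows. If $u_{d-1}<v_{d-1}$: $\widehat I^t_\alpha=I^t_\alpha$ for $\alpha\ne\alpha_t$, and $\widehat I^t_{\alpha_t}=I^t_{\alpha_t}\cap(u_0,v_{d-1})$. If $u_{d-1}>v_{d-1}$: $\widehat I^t_\alpha=I^t_\alpha$ for $\alpha\neq\alpha_t,\alpha_b$; $\widehat I^t_{\alpha_t}=T^{-1}(I^t_{\alpha_t})$ (the right part of $I^t_{\alpha_b}$), and $\widehat I^t_{\alpha_b}$ is the remaining left part of $I^t_{\alpha_b}$. Iterating from $T(0)=T$ gives i.e.m.'s $T(n)$, $n\ge0$, on decreasing intervals $I(n)=I(T(n))$ with the same left endpoint; for $n\ge m$, $T(n)$ is the first return map of $T(m)$ to $I(n)$. **Function spaces, special Birkhoff sums, cocycle.** For $r\ge0$, $C^r(\mathbf u(T))=\prod_{i=1}^dC^r([u_{i-1}(T),u_i(T)])$ with its product norm (for non-integer $r$, $C^r$ means $C^{\lfloor r\rfloor}$ with $\lfloor r\rfloor$-th derivative Hölder of exponent $r-\lfloor r\rfloor$). $\Gamma(T)\simeq\mathbb R^{\mathcal A}$ is the space of functions constant on each $I^t_\alpha(T)$. For $0\le m\le n$ and $\varphi\in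 C^0(\mathbf u(T(m)))$, the special Birkhoff sum is $S(m,n)\varphi(x)=\sum_{0\le j<r(x)}\varphi(T(m)^j(x))$, where $r(x)$ is the return time of $x$ to $I(n)$ under $T(m)$ (extended continuously to each closed interval), an element of $C^0(\mathbf u(T(n)))$. $S(m,n)$ maps $\Gamma(T(m))$ to $\Gamma(T(n))$; $B(m,n)$ is its matrix there: $B_{\alpha\beta}(m,n)$ is the number of visits of $I^t_\alpha(T(n))$ to $I^t_\beta(T(m))$ under $T(m)$ before returning to $I(n)$. Put $n_0=0$ and let $n_{k+1}$ be the smallest integer such that all coefficients of $B(n_k,n_{k+1})$ are positive. Norms: $\ell_\infty$ norm on $\mathbb R^{\mathcal A}$ and $\|B\|=\max_\alpha\sum_\beta|B_{\alpha\beta}|$. **Boundary operator.** On the $2d$-element set of symbols $\{U_0=V_0,U_1,V_1,\dots,U_{d-1},V_{d-1},U_d=V_d\}$ define the permutation $\sigma_\pi$ by $\sigma_\pi(U_i)=V_j$ with $\pi_b^{-1}(j+1)=\pi_t^{-1}(i+1)$ for $0\le i<d$, and $\sigma_\pi(V_{j'})=U_{i'}$ with $\pi_t^{-1}(i')=\pi_b^{-1}(j')$ for $0<j'\le d$. Let $\Sigma$ be the set of its cycles. For $\varphi\in C^0(\mathbf u(T))$ let $\varphi(u_i-0)$, $\varphi(u_i+0)$ be its values at $u_i$ seen in $[u_{i-1},u_i]$, resp. $[u_i,u_{i+1}]$, with $\varphi(u_0-0)=\varphi(u_d+0)=0$. The boundary operator $\partial:C^0(\mathbf u(T))\to\mathbb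 R^\Sigma$ is $(\partial\varphi)_C=\sum_{0\le i\le d,\,U_i\in C}(\varphi(u_i-0)-\varphi(u_i+0))$. $C^r_0(\mathbf u(T))$ is the kernel of $\partial$ in $C^r(\mathbf u(T))$, and $\Gamma_\partial(T)$ is the kernel of $\partial$ in $\Gamma(T)$ (it equals $\operatorname{Im}\Omega(\pi)$). **Stable space and induced operators.** For $T$ with no connection, $\Gamma_s(T)=\{\chi\in\Gamma(T):\exists\sigma>0,\ \|B(0,n)\chi\|=O(\|B(0,n)\|^{-\sigma})\}$, a subspace of $\Gamma_\partial(T)$. $B(m,n)$ maps $\Gamma_s(T(m))$ onto $\Gamma_s(T(n))$; $B_s(m,n):\Gamma_s(T(m))\to\Gamma_s(T(n))$ and $B_\flat(m,n):\Gamma(T(m))/\Gamma_s(T(m))\to\Gamma(T(n))/\Gamma_s(T(n))$ denote the induced operators (with induced and quotient norms). **Restricted Roth type.** $T$ is of restricted Roth type if it has no connection, satisfies the three conditions listed in the claim, and in addition there is $\theta>0$ with $\|B(0,n)|_{\Gamma_0(T)}\|=O(\|B(0,n)\|^{1-\theta})$, where $\Gamma_0(T)=\{\chi\in\Gamma(T):\int\chi=0\}$. Known fact (Marmi–Moussa–Yoccoz): for $T$ of restricted Roth type and $r>1$, there are unique bounded linear operators $\varphi\mapsto\psi$ from $C^r_0(\mathbf u(T))$ to $C^0([u_0(T),u_d(T)])$ and $\varphi\mapsto\chi$ from $C^r_0(\mathbf u(T))$ to $\Gamma_u(T)$ with $\varphi=\chi+\psi\circ T-\psi$ and $\int\psi=0$.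 *)

theory Defs
  imports
    "HOL-Analysis.Analysis"
    "HOL-Library.Landau_Symbols"
    "HOL-Combinatorics.Orbits"
begin

section \<open>Interval exchange maps\<close>

text \<open>
  The alphabet is the type \<^typ>\<open>'a\<close>, of class finite, and d is its cardinality. The two partitions
  into open intervals are encoded by the left endpoint, the common lengths of the intervals with
  the same label, and the positions (from 1 to d) of the labels in the top and bottom partitions.
\<close>

record 'a iem =
  left_end :: real
  len :: "'a \<Rightarrow> real"
  pos_t :: "'a \<Rightarrow> nat"
  pos_b :: "'a \<Rightarrow> nat"

definition irreducible_data :: "('a::finite \<Rightarrow> nat) \<Rightarrow> ('a \<Rightarrow> nat) \<Rightarrow> bool" where
  "irreducible_data pt pb \<longleftrightarrow>
     (\<forall>k. 1 \<le> k \<and> k < CARD('a) \<longrightarrow> pt -` {1..k} \<noteq> pb -` {1..k})"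

definition is_iem :: "'a::finite iem \<Rightarrow> bool" where
  "is_iem T \<longleftrightarrow>
     (\<forall>\<alpha>. len T \<alpha> > 0) \<and>
     bij_betw (pos_t T) UNIV {1..CARD('a)} \<and>
     bij_betw (pos_b T) UNIV {1..CARD('a)} \<and>
     irreducible_data (pos_t T) (pos_b T)"

definition upt_u :: "'a::finite iem \<Rightarrow> nat \<Rightarrow> real" where
  "upt_u T i = left_end T + (\<Sum>\<alpha> | pos_t T \<alpha> \<le> i. len T \<alpha>)"

definition vpt_v :: "'a::finite iem \<Rightarrow> nat \<Rightarrow> real" where
  "vpt_v T j = left_end T + (\<Sum>\<alpha> | pos_b T \<alpha> \<le> j. len T \<alpha>)"

definition whole_int :: "'a::finite iem \<Rightarrow> real set" where
  "whole_int T = {upt_u T 0 <..< upt_u T CARD('a)}"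

definition top_int :: "'a::finite iem \<Rightarrow> 'a \<Rightarrow> real set" where
  "top_int T \<alpha> = {upt_u T (pos_t T \<alpha> - 1) <..< upt_u T (pos_t T \<alpha>)}"

definition top_cint :: "'a::finite iem \<Rightarrow> 'a \<Rightarrow> real set" where
  "top_cint T \<alpha> = {upt_u T (pos_t T \<alpha> - 1) .. upt_u T (pos_t T \<alpha>)}"

definition iem_dom :: "'a::finite iem \<Rightarrow> real set" where
  "iem_dom T = (\<Union>\<alpha>. top_int T \<alpha>)"

definition label_of :: "'a::finite iem \<Rightarrow> real \<Rightarrow> 'a" where
  "label_of T x = (THE \<alpha>. x \<in> top_int T \<alpha>)"

text \<open>
  The map is only meaningful on \<^const>\<open>iem_dom\<close>. Everything below evaluates it there only: for x in
  an open interval of the top partition of T(n), the orbit of x under T(m), m at most n, stays in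
  the domain of T(m) until it returns to I(n).
\<close>

definition iem_map :: "'a::finite iem \<Rightarrow> real \<Rightarrow> real" where
  "iem_map T x =
     (let \<alpha> = label_of T x
      in x + (vpt_v T (pos_b T \<alpha> - 1) - upt_u T (pos_t T \<alpha> - 1)))"

definition is_connection :: "'a::finite iem \<Rightarrow> nat \<Rightarrow> nat \<Rightarrow> nat \<Rightarrow> bool" where
  "is_connection T i j m \<longleftrightarrow>
     0 < i \<and> i < CARD('a) \<and> 0 < j \<and> j < CARD('a) \<and>
     (\<forall>l<m. (iem_map T ^^ l) (vpt_v T j) \<in> iem_dom T) \<and>
     (iem_map T ^^ m) (vpt_v T j) = upt_u T i"

definition no_connection :: "'a::finite iem \<Rightarrow> bool" where
  "no_connection T \<longleftrightarrow> (\<nexists>i j m. is_connection T i j m)"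

definition Omega :: "'a::finite iem \<Rightarrow> real^'a^'a" where
  "Omega T = (\<chi> \<alpha> \<beta>.
     if pos_t T \<alpha> < pos_t T \<beta> \<and> pos_b T \<alpha> > pos_b T \<beta> then 1
     else if pos_t T \<alpha> > pos_t T \<beta> \<and> pos_b T \<alpha> < pos_b T \<beta> then -1
     else 0)"

definition genus :: "'a::finite iem \<Rightarrow> nat" where
  "genus T = rank (Omega T) div 2"


section \<open>The Rauzy--Veech algorithm\<close>

definition return_time :: "'a::finite iem \<Rightarrow> real set \<Rightarrow> real \<Rightarrow> nat" where
  "return_time T J x = (LEAST r. 0 < r \<and> (iem_map T ^^ r) x \<in> J)"

text \<open>
  In the second case below the remaining left part of the interval of \<open>\<alpha>b\<close> has to be an open
  interval, whence the interior.
\<close>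

definition rauzy_step :: "'a::finite iem \<Rightarrow> 'a iem \<Rightarrow> bool" where
  "rauzy_step T T' \<longleftrightarrow>
     (let d = CARD('a); \<alpha>t = inv (pos_t T) d; \<alpha>b = inv (pos_b T) d;
          u = upt_u T (d - 1); v = vpt_v T (d - 1);
          R = {x \<in> iem_dom T. iem_map T x \<in> top_int T \<alpha>t}
      in is_iem T' \<and>
         whole_int T' = {upt_u T 0 <..< max u v} \<and>
         (\<forall>x\<in>iem_dom T'. iem_map T' x = (iem_map T ^^ return_time T (whole_int T') x) x) \<and>
         (u < v \<longrightarrow>
            (\<forall>\<alpha>. \<alpha> \<noteq> \<alpha>t \<longrightarrow> top_int T' \<alpha> = top_int T \<alpha>) \<and>
            top_int T' \<alpha>t = top_int T \<alpha>t \<inter> {upt_u T 0 <..< v}) \<and>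
         (u > v \<longrightarrow>
            (\<forall>\<alpha>. \<alpha> \<noteq> \<alpha>t \<and> \<alpha> \<noteq> \<alpha>b \<longrightarrow> top_int T' \<alpha> = top_int T \<alpha>) \<and>
            top_int T' \<alpha>t = R \<and>
            top_int T' \<alpha>b = interior (top_int T \<alpha>b - R)))"

text \<open>If T has no connection there is exactly one iem T' with \<^term>\<open>rauzy_step T T'\<close>.\<close>

definition rauzy :: "'a::finite iem \<Rightarrow> 'a iem" where
  "rauzy T = (THE T'. rauzy_step T T')"

definition rv :: "'a::finite iem \<Rightarrow> nat \<Rightarrow> 'a iem" where
  "rv T n = (rauzy ^^ n) T"


section \<open>The cocycle\<close>

text \<open>
  The number of visits does not depend on the point of the interval; we count at the midpoint.
\<close>

definition Bmat :: "'a::finite iem \<Rightarrow> nat \<Rightarrow> nat \<Rightarrow> real^'a^'a" where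
  "Bmat T m n = (\<chi> \<alpha> \<beta>.
     let x = (upt_u (rv T n) (pos_t (rv T n) \<alpha> - 1) + upt_u (rv T n) (pos_t (rv T n) \<alpha>)) / 2
     in real (card {j. j < return_time (rv T m) (whole_int (rv T n)) x \<and>
                       (iem_map (rv T m) ^^ j) x \<in> top_int (rv T m) \<beta>}))"

definition mat_norm :: "real^'a^'a \<Rightarrow> real" where
  "mat_norm B = Max (range (\<lambda>\<alpha>. \<Sum>\<beta>\<in>UNIV. \<bar>B $ \<alpha> $ \<beta>\<bar>))"

fun accel :: "'a::finite iem \<Rightarrow> nat \<Rightarrow> nat" where
  "accel T 0 = 0"
| "accel T (Suc k) = (LEAST n. accel T k \<le> n \<and> (\<forall>\<alpha> \<beta>. Bmat T (accel T k) n $ \<alpha> $ \<beta> > 0))"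


section \<open>Function spaces\<close>

text \<open>
  An element of the product of the spaces of r-regular functions on the closed intervals of the top
  partition is a family of functions indexed by the labels, of which only the values on the
  corresponding closed intervals matter. Derivatives are taken within the interval (hence
  one-sided at its endpoints).
\<close>

type_synonym 'a pfun = "'a \<Rightarrow> real \<Rightarrow> real"

fun nderiv_within :: "real set \<Rightarrow> nat \<Rightarrow> (real \<Rightarrow> real) \<Rightarrow> real \<Rightarrow> real" where
  "nderiv_within S 0 f = f"
| "nderiv_within S (Suc k) f = (\<lambda>x. vector_derivative (nderiv_within S k f) (at x within S))"

definition Cr_on :: "real \<Rightarrow> real set \<Rightarrow> (real \<Rightarrow> real) \<Rightarrow> bool" where
  "Cr_on r S f \<longleftrightarrow>
     (let k = nat \<lfloor>r\<rfloor>; g = nderiv_within S k f in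
        (\<forall>j<k. nderiv_within S j f differentiable_on S) \<and>
        continuous_on S g \<and>
        (r \<noteq> real k \<longrightarrow> (\<exists>C. \<forall>x\<in>S. \<forall>y\<in>S. \<bar>g x - g y\<bar> \<le> C * \<bar>x - y\<bar> powr (r - real k))))"

definition Cr_norm_on :: "real \<Rightarrow> real set \<Rightarrow> (real \<Rightarrow> real) \<Rightarrow> real" where
  "Cr_norm_on r S f =
     (let k = nat \<lfloor>r\<rfloor>; g = nderiv_within S k f in
        (\<Sum>j\<le>k. SUP x\<in>S. \<bar>nderiv_within S j f x\<bar>) +
        (if r = real k then 0
         else Sup {\<bar>g x - g y\<bar> / \<bar>x - y\<bar> powr (r - real k) | x y. x \<in> S \<and> y \<in> S \<and> x \<noteq> y}))"

definition Cr_space :: "real \<Rightarrow> 'a::finite iem \<Rightarrow> 'a pfun set" where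
  "Cr_space r T = {\<phi>. \<forall>\<alpha>. Cr_on r (top_cint T \<alpha>) (\<phi> \<alpha>)}"

definition Cr_norm :: "real \<Rightarrow> 'a::finite iem \<Rightarrow> 'a pfun \<Rightarrow> real" where
  "Cr_norm r T \<phi> = Max (range (\<lambda>\<alpha>. Cr_norm_on r (top_cint T \<alpha>) (\<phi> \<alpha>)))"

text \<open>
  The space of functions constant on each interval is \<^typ>\<open>real^'a\<close>, with the supremum norm
  \<^const>\<open>infnorm\<close>.
\<close>

definition gamma_fun :: "real^'a \<Rightarrow> 'a pfun" where
  "gamma_fun c = (\<lambda>\<alpha> x. c $ \<alpha>)"

definition pintegral :: "'a::finite iem \<Rightarrow> 'a pfun \<Rightarrow> real" where
  "pintegral T \<phi> = (\<Sum>\<alpha>\<in>UNIV. integral (top_cint T \<alpha>) (\<phi> \<alpha>))"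

definition birkhoff_open :: "'a::finite iem \<Rightarrow> nat \<Rightarrow> nat \<Rightarrow> 'a pfun \<Rightarrow> real \<Rightarrow> real" where
  "birkhoff_open T m n \<phi> x =
     (\<Sum>j < return_time (rv T m) (whole_int (rv T n)) x.
        let y = (iem_map (rv T m) ^^ j) x in \<phi> (label_of (rv T m) y) y)"

definition special_birkhoff :: "'a::finite iem \<Rightarrow> nat \<Rightarrow> nat \<Rightarrow> 'a pfun \<Rightarrow> 'a pfun" where
  "special_birkhoff T m n \<phi> = (\<lambda>\<alpha> x.
     if x \<in> top_int (rv T n) \<alpha> then birkhoff_open T m n \<phi> x
     else Lim (at x within top_int (rv T n) \<alpha>) (birkhoff_open T m n \<phi>))"


section \<open>The boundary operator\<close>

text \<open>
  The 2d symbols are \<open>U 0, \<dots>, U d, V 1, \<dots>, V (d - 1)\<close>; \<open>Vsym\<close> implements the identifications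
  of \<open>V 0\<close> with \<open>U 0\<close> and of \<open>V d\<close> with \<open>U d\<close>.
\<close>

datatype bsym = U nat | V nat

definition Vsym :: "nat \<Rightarrow> nat \<Rightarrow> bsym" where
  "Vsym d j = (if j = 0 then U 0 else if j = d then U d else V j)"

definition bsyms :: "nat \<Rightarrow> bsym set" where
  "bsyms d = U ` {0..d} \<union> Vsym d ` {0..d}"

fun sigma_perm :: "'a::finite iem \<Rightarrow> bsym \<Rightarrow> bsym" where
  "sigma_perm T (U i) =
     (if i < CARD('a) then Vsym CARD('a) (pos_b T (inv (pos_t T) (i + 1)) - 1)
      else if i = CARD('a) then U (pos_t T (inv (pos_b T) CARD('a)))
      else U i)"
| "sigma_perm T (V j) =
     (if 0 < j \<and> j < CARD('a) then U (pos_t T (inv (pos_b T) j)) else V j)"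

definition sigma_cycles :: "'a::finite iem \<Rightarrow> bsym set set" where
  "sigma_cycles T = orbit (sigma_perm T) ` bsyms CARD('a)"

definition val_left :: "'a::finite iem \<Rightarrow> 'a pfun \<Rightarrow> nat \<Rightarrow> real" where
  "val_left T \<phi> i = (if i = 0 then 0 else \<phi> (inv (pos_t T) i) (upt_u T i))"

definition val_right :: "'a::finite iem \<Rightarrow> 'a pfun \<Rightarrow> nat \<Rightarrow> real" where
  "val_right T \<phi> i = (if i = CARD('a) then 0 else \<phi> (inv (pos_t T) (i + 1)) (upt_u T i))"

definition boundary :: "'a::finite iem \<Rightarrow> 'a pfun \<Rightarrow> bsym set \<Rightarrow> real" where
  "boundary T \<phi> C = (\<Sum>i | i \<le> CARD('a) \<and> U i \<in> C. val_left T \<phi> i - val_right T \<phi> i)"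

definition Cr0_space :: "real \<Rightarrow> 'a::finite iem \<Rightarrow> 'a pfun set" where
  "Cr0_space r T = {\<phi> \<in> Cr_space r T. \<forall>C\<in>sigma_cycles T. boundary T \<phi> C = 0}"

definition Gamma_bd :: "'a::finite iem \<Rightarrow> (real^'a) set" where
  "Gamma_bd T = {c. \<forall>C\<in>sigma_cycles T. boundary T (gamma_fun c) C = 0}"


section \<open>Stable space and induced operators\<close>

definition Gamma_s :: "'a::finite iem \<Rightarrow> (real^'a) set" where
  "Gamma_s T = {c. \<exists>\<sigma>>0. (\<lambda>n. infnorm (Bmat T 0 n *v c)) \<in> O(\<lambda>n. mat_norm (Bmat T 0 n) powr (-\<sigma>))}"

definition Gamma_0 :: "'a::finite iem \<Rightarrow> (real^'a) set" where
  "Gamma_0 T = {c. pintegral T (gamma_fun c) = 0}"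

definition op_norm_on :: "(real^'a) set \<Rightarrow> real^'a^'a \<Rightarrow> real" where
  "op_norm_on W B = Sup {infnorm (B *v c) | c. c \<in> W \<and> infnorm c \<le> 1}"

text \<open>Quotient spaces are sets of cosets, with the quotient of the supremum norm.\<close>

definition cosets :: "(real^'a) set \<Rightarrow> (real^'a) set set" where
  "cosets W = range (\<lambda>c. (\<lambda>w. c + w) ` W)"

definition coset_norm :: "(real^'a) set \<Rightarrow> real" where
  "coset_norm X = Inf (infnorm ` X)"

definition B_flat :: "'a::finite iem \<Rightarrow> nat \<Rightarrow> nat \<Rightarrow> (real^'a) set \<Rightarrow> (real^'a) set" where
  "B_flat T m n X = {Bmat T m n *v c + w | c w. c \<in> X \<and> w \<in> Gamma_s (rv T n)}"

definition B_flat_inv :: "'a::finite iem \<Rightarrow> nat \<Rightarrow> nat \<Rightarrow> (real^'a) set \<Rightarrow> (real^'a) set" where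
  "B_flat_inv T m n = inv_into (cosets (Gamma_s (rv T m))) (B_flat T m n)"

definition B_s_norm :: "'a::finite iem \<Rightarrow> nat \<Rightarrow> nat \<Rightarrow> real" where
  "B_s_norm T m n = op_norm_on (Gamma_s (rv T m)) (Bmat T m n)"

definition B_flat_inv_norm :: "'a::finite iem \<Rightarrow> nat \<Rightarrow> nat \<Rightarrow> real" where
  "B_flat_inv_norm T m n =
     Sup {coset_norm (B_flat_inv T m n Y) | Y. Y \<in> cosets (Gamma_s (rv T n)) \<and> coset_norm Y \<le> 1}"


section \<open>Diophantine conditions\<close>

definition matrix_growth :: "'a::finite iem \<Rightarrow> bool" where
  "matrix_growth T \<longleftrightarrow>
     (\<forall>\<tau>>0. (\<lambda>k. mat_norm (Bmat T (accel T k) (accel T (Suc k))))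
              \<in> O(\<lambda>k. mat_norm (Bmat T 0 (accel T k)) powr \<tau>))"

definition coherence :: "'a::finite iem \<Rightarrow> bool" where
  "coherence T \<longleftrightarrow>
     (\<forall>\<tau>>0. \<exists>C. \<forall>m n. m \<le> n \<longrightarrow>
        B_s_norm T m n \<le> C * mat_norm (Bmat T 0 n) powr \<tau> \<and>
        B_flat_inv_norm T m n \<le> C * mat_norm (Bmat T 0 n) powr \<tau>)"

definition hyperbolic :: "'a::finite iem \<Rightarrow> bool" where
  "hyperbolic T \<longleftrightarrow> dim (Gamma_s T) = genus T"

definition spectral_gap :: "'a::finite iem \<Rightarrow> bool" where
  "spectral_gap T \<longleftrightarrow>
     (\<exists>\<theta>>0. (\<lambda>n. op_norm_on (Gamma_0 T) (Bmat T 0 n))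
              \<in> O(\<lambda>n. mat_norm (Bmat T 0 n) powr (1 - \<theta>)))"

definition restricted_roth :: "'a::finite iem \<Rightarrow> bool" where
  "restricted_roth T \<longleftrightarrow>
     no_connection T \<and> matrix_growth T \<and> coherence T \<and> hyperbolic T \<and> spectral_gap T"


section \<open>Complements and operators\<close>

definition supplements :: "(real^'a) set \<Rightarrow> (real^'a) set \<Rightarrow> (real^'a) set \<Rightarrow> bool" where
  "supplements W S E \<longleftrightarrow> subspace W \<and> W \<inter> S = {0} \<and> {w + s | w s. w \<in> W \<and> s \<in> S} = E"

text \<open>
  Boundedness and linearity force L to depend only on the values of the families on the closed
  intervals: the norm of the difference of two families that agree there vanishes.
\<close>

definition bounded_linear_op ::
  "real \<Rightarrow> 'a::finite iem \<Rightarrow> (real^'a) set \<Rightarrow> ('a pfun \<Rightarrow> real^'a) \<Rightarrow> bool" where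
  "bounded_linear_op r T W L \<longleftrightarrow>
     (\<forall>\<phi>\<in>Cr0_space r T. L \<phi> \<in> W) \<and>
     (\<forall>\<phi>\<in>Cr0_space r T. \<forall>\<psi>\<in>Cr0_space r T. \<forall>a b.
        L (\<lambda>\<alpha> x. a * \<phi> \<alpha> x + b * \<psi> \<alpha> x) = a *\<^sub>R L \<phi> + b *\<^sub>R L \<psi>) \<and>
     (\<exists>K. \<forall>\<phi>\<in>Cr0_space r T. infnorm (L \<phi>) \<le> K * Cr_norm r T \<phi>)"

definition sub_const :: "'a pfun \<Rightarrow> real^'a \<Rightarrow> 'a pfun" where
  "sub_const \<phi> c = (\<lambda>\<alpha> x. \<phi> \<alpha> x - gamma_fun c \<alpha> x)"

text \<open>
  The equation \<open>\<phi> = c + \<psi> \<circ> T - \<psi>\<close>. It is required on the open intervals; by continuity it then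
  holds on the closed ones for the continuous extension of \<open>\<psi> \<circ> T\<close>.
\<close>

definition cohomological_eq :: "'a::finite iem \<Rightarrow> 'a pfun \<Rightarrow> real^'a \<Rightarrow> (real \<Rightarrow> real) \<Rightarrow> bool" where
  "cohomological_eq T \<phi> c \<psi> \<longleftrightarrow>
     (\<forall>\<alpha>. \<forall>x\<in>top_int T \<alpha>. \<phi> \<alpha> x = gamma_fun c \<alpha> x + \<psi> (iem_map T x) - \<psi> x)"

end

theory Submission
  imports Defs
begin

text \<open>
  Pairing the endpoint values of a piecewise function with the kernel of Omega gives quantities that
  are invariant under special Birkhoff sums and vanish when the boundary operator does. So the special
  Birkhoff sums of such a function stay, up to their oscillation on the intervals of T(n), in the
  image of Omega, where the cocycle is symplectic and the stable space is Lagrangian. Coherence on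
  the stable space and on the quotient then lets one sum up the successive errors into a single
  correction, unique in the complement of the stable space.

  For a function of class C^r with r > 1, comparing the derivative with its means on the intervals of
  an intermediate level, and using the spectral gap for the means, makes the oscillation decay like
  a negative power of the norm of the cocycle. The corrected Birkhoff sums then decay too, and summing
  them along the tower from its foot up to a point yields a uniformly convergent series for the
  transfer function. For every threshold only finitely many points have a larger jump; since jumps
  are invariant under the map, whose orbits are infinite, there are none.
\<close>

subsection \<open>Partial sums along an ordering of the letters\<close>

text \<open>For a function of class C^1 the oscillation of S(0,n) \<phi> stays bounded but need not
  shrink, so replacing S(0,n) \<phi> by a vector in the image of \<open>Omega\<close> costs an error
  of order one at every step. Three facts keep these errors harmless. The number of steps is itself
  smaller than any power of the norm. Errors in stable directions are carried forward with a loss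
  smaller than any power. Errors transverse to them are never projected to a complement: they are
  seen only through their pairing with stable vectors, where invariance of the form turns them into
  a series dominated by the decay of those vectors. Its limit is a functional on the stable space,
  and the correction is the vector that represents it.

  The algorithm is given by a definite description, its sums by return times and limits. The proof
  works with an explicit step on lengths and orders and with sums and matrices defined by recursion
  on the steps, and identifies these with the given objects once.\<close>

definition psum :: "('a::finite \<Rightarrow> nat) \<Rightarrow> ('a \<Rightarrow> real) \<Rightarrow> 'a \<Rightarrow> real" where
  "psum p f \<alpha> = (\<Sum>\<beta> | p \<beta> < p \<alpha>. f \<beta>)"

definition is_numbering :: "('a::finite \<Rightarrow> nat) \<Rightarrow> bool" where
  "is_numbering p \<longleftrightarrow> bij_betw p UNIV {1..CARD('a)}"

lemma numbering_inj: "is_numbering p \<Longrightarrow> p \<alpha> = p \<beta> \<longleftrightarrow> \<alpha> = \<beta>"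
  unfolding is_numbering_def bij_betw_def by (meson UNIV_I inj_on_def)

lemma numbering_range:
  fixes p :: "'a::finite \<Rightarrow> nat"
  assumes "is_numbering p"
  shows "1 \<le> p \<alpha>" "p \<alpha> \<le> CARD('a)"
  using assms unfolding is_numbering_def bij_betw_def by force+

lemma numbering_surj:
  fixes p :: "'a::finite \<Rightarrow> nat"
  assumes "is_numbering p" "1 \<le> i" "i \<le> CARD('a)"
  obtains \<alpha> where "p \<alpha> = i"
proof -
  have "i \<in> range p" using assms unfolding is_numbering_def bij_betw_def by auto
  then show ?thesis using that by auto
qed

lemma numbering_inv:
  fixes p :: "'a::finite \<Rightarrow> nat"
  assumes "is_numbering p" "1 \<le> i" "i \<le> CARD('a)"
  shows "p (inv p i) = i"
  using numbering_surj[OF assms] by (metis f_inv_into_f rangeI)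

lemma numbering_inv':
  assumes "is_numbering p"
  shows "inv p (p \<alpha>) = \<alpha>"
  using assms numbering_inj[OF assms] by (metis injI inv_f_f)

lemma numberingI:
  fixes p :: "'a::finite \<Rightarrow> nat"
  assumes "inj p" "\<And>\<alpha>. 1 \<le> p \<alpha> \<and> p \<alpha> \<le> CARD('a)"
  shows "is_numbering p"
  unfolding is_numbering_def bij_betw_def
proof
  show "inj p" by fact
  have "range p \<subseteq> {1..CARD('a)}" using assms(2) by auto
  moreover have "card (range p) = card {1..CARD('a)}" using assms(1) by (simp add: card_image)
  ultimately show "range p = {1..CARD('a)}" by (simp add: card_subset_eq)
qed

lemma numbering_card:
  fixes r :: "'a::finite \<Rightarrow> nat"
  assumes r: "is_numbering r"
  shows "card {\<beta>. r \<beta> \<le> r \<alpha>} = r \<alpha>"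
proof -
  have "r ` {\<beta>. r \<beta> \<le> r \<alpha>} = {1..r \<alpha>}"
  proof (intro equalityI subsetI)
    fix i assume "i \<in> {1..r \<alpha>}"
    then have "1 \<le> i" "i \<le> CARD('a)" "i \<le> r \<alpha>" using numbering_range[OF r, of \<alpha>] by auto
    then obtain \<beta> where "r \<beta> = i" using numbering_surj[OF r] by metis
    then show "i \<in> r ` {\<beta>. r \<beta> \<le> r \<alpha>}" using \<open>i \<le> r \<alpha>\<close> by auto
  qed (use numbering_range[OF r] in auto)
  moreover have "inj_on r {\<beta>. r \<beta> \<le> r \<alpha>}" using numbering_inj[OF r] by (auto simp: inj_on_def)
  ultimately show ?thesis by (metis card_atLeastAtMost card_image diff_Suc_1)
qed

text \<open>Everything placed before a letter of D lies in D, so that letter has position at most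
  \<open>card D\<close>; equality of cardinalities does the rest. It produces the common initial
  segments that irreducibility excludes.\<close>

lemma numbering_initial:
  fixes r :: "'a::finite \<Rightarrow> nat"
  assumes r: "is_numbering r" and D: "\<And>\<alpha> \<beta>. \<alpha> \<in> D \<Longrightarrow> \<beta> \<notin> D \<Longrightarrow> r \<alpha> < r \<beta>"
  shows "r -` {1..card D} = D"
proof (rule sym, rule card_subset_eq)
  have "r \<alpha> \<le> card D" if "\<alpha> \<in> D" for \<alpha>
  proof -
    have "{\<beta>. r \<beta> \<le> r \<alpha>} \<subseteq> D" using D[OF that] by (auto simp: not_less[symmetric])
    then show ?thesis using numbering_card[OF r, of \<alpha>] card_mono[of D "{\<beta>. r \<beta> \<le> r \<alpha>}"] by simp
  qed
  then show sub: "D \<subseteq> r -` {1..card D}" using numbering_range(1)[OF r] by (intro subsetI vimageI2) simp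
  have "card (r -` {1..card D}) \<le> card {1..card D}"
    using numbering_inj[OF r] by (intro card_inj_on_le[of r]) (auto simp: inj_on_def)
  then show "card D = card (r -` {1..card D})" using card_mono[OF _ sub] by simp
qed simp

text \<open>A position is the number of letters at or before it, hence is recovered from the order
  alone. This is how the combinatorial data are read off from the order of the endpoints.\<close>

lemma numbering_unique:
  fixes p q :: "'a::finite \<Rightarrow> nat"
  assumes p: "is_numbering p" and q: "is_numbering q"
    and o: "\<And>\<alpha> \<beta>. p \<alpha> < p \<beta> \<longleftrightarrow> q \<alpha> < q \<beta>"
  shows "p = q"
proof
  fix \<alpha>
  have "{\<beta>. p \<beta> \<le> p \<alpha>} = {\<beta>. q \<beta> \<le> q \<alpha>}" using o by (auto simp: not_less[symmetric])
  then show "p \<alpha> = q \<alpha>" using numbering_card[OF p, of \<alpha>] numbering_card[OF q, of \<alpha>] by simp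
qed

lemma psum_nonneg: "(\<And>\<beta>. f \<beta> \<ge> 0) \<Longrightarrow> psum p f \<alpha> \<ge> 0"
  by (simp add: psum_def sum_nonneg)

lemma psum_incl:
  fixes p :: "'a::finite \<Rightarrow> nat"
  assumes "is_numbering p"
  shows "psum p f \<alpha> + f \<alpha> = (\<Sum>\<beta> | p \<beta> \<le> p \<alpha>. f \<beta>)"
proof -
  have "{\<beta>. p \<beta> \<le> p \<alpha>} = insert \<alpha> {\<beta>. p \<beta> < p \<alpha>}"
    using numbering_inj[OF assms] by (auto simp: le_less)
  then show ?thesis by (simp add: psum_def)
qed

lemma psum_mono:
  assumes "is_numbering p" "\<And>\<beta>. f \<beta> \<ge> 0" "p \<alpha> < p \<beta>"
  shows "psum p f \<alpha> + f \<alpha> \<le> psum p f \<beta>"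
  unfolding psum_incl[OF assms(1)]
  unfolding psum_def using assms by (intro sum_mono2) auto

lemma psum_le_total:
  assumes "is_numbering p" "\<And>\<beta>. f \<beta> \<ge> 0"
  shows "psum p f \<alpha> + f \<alpha> \<le> sum f UNIV"
  unfolding psum_incl[OF assms(1)] using assms by (intro sum_mono2) auto

lemma psum_last:
  fixes p :: "'a::finite \<Rightarrow> nat"
  assumes "is_numbering p" "p \<alpha> = CARD('a)"
  shows "psum p f \<alpha> + f \<alpha> = sum f UNIV"
  unfolding psum_incl[OF assms(1)] using numbering_range[OF assms(1)] assms(2) by (simp)

lemma psum_first: "is_numbering p \<Longrightarrow> p \<alpha> = 1 \<Longrightarrow> psum p f \<alpha> = 0"
proof -
  assume "is_numbering p" "p \<alpha> = 1"
  then have "{\<beta>. p \<beta> < p \<alpha>} = {}" using numbering_range(1)[of p] by (auto simp: Suc_le_eq)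
  then show ?thesis by (simp add: psum_def)
qed

lemma psum_pos:
  assumes "is_numbering p" "\<And>\<beta>. f \<beta> > 0" "p \<alpha> \<noteq> 1"
  shows "psum p f \<alpha> > 0"
proof -
  have "1 \<le> CARD('a)" by (simp add: Suc_leI)
  then obtain \<beta> where "p \<beta> = 1" using numbering_surj[OF assms(1)] by blast
  then have "p \<beta> < p \<alpha>" using assms(1,3) numbering_range(1)[OF assms(1), of \<alpha>] by auto
  from psum_mono[OF assms(1) _ this, of f] assms(2) psum_nonneg[of f p \<beta>]
  show ?thesis by (smt (verit, best))
qed

lemma psum_succ:
  assumes "is_numbering p" "p \<beta> = Suc (p \<alpha>)"
  shows "psum p f \<beta> = psum p f \<alpha> + f \<alpha>"
  unfolding psum_incl[OF assms(1)] unfolding psum_def using assms(2) by (simp add: less_Suc_eq_le)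

text \<open>The letter sought is the one of largest position whose partial sum does not exceed x;
  half-open intervals leave no gaps.\<close>

lemma psum_cover:
  fixes p :: "'a::finite \<Rightarrow> nat"
  assumes p: "is_numbering p" and "0 \<le> x" "x < sum f UNIV"
  obtains \<alpha> where "psum p f \<alpha> \<le> x" "x < psum p f \<alpha> + f \<alpha>"
proof -
  let ?S = "{\<alpha>. psum p f \<alpha> \<le> x}"
  have "1 \<le> CARD('a)" by (simp add: Suc_leI)
  then obtain \<beta> where "p \<beta> = 1" using numbering_surj[OF p] by blast
  then have ne: "?S \<noteq> {}" using psum_first[OF p, of \<beta> f] assms(2) by (auto intro!: exI[of _ \<beta>])
  define \<alpha> where "\<alpha> = arg_max_on p ?S"
  have \<alpha>: "\<alpha> \<in> ?S" "\<And>\<beta>. \<beta> \<in> ?S \<Longrightarrow> p \<beta> \<le> p \<alpha>"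
  proof -
    have "Max (p ` ?S) \<in> p ` ?S" using ne by (intro Max_in) auto
    then obtain \<gamma> where "\<gamma> \<in> ?S" "p \<gamma> = Max (p ` ?S)" by auto
    then have "is_arg_max p (\<lambda>x. x \<in> ?S) \<gamma>" by (auto simp: is_arg_max_linorder)
    then have "is_arg_max p (\<lambda>x. x \<in> ?S) \<alpha>"
      unfolding \<alpha>_def arg_max_on_def arg_max_def by (rule someI)
    then show "\<alpha> \<in> ?S" "\<And>\<beta>. \<beta> \<in> ?S \<Longrightarrow> p \<beta> \<le> p \<alpha>" by (auto simp: is_arg_max_linorder)
  qed
  have "x < psum p f \<alpha> + f \<alpha>"
  proof (rule ccontr)
    assume n: "\<not> ?thesis"
    show False
    proof (cases "p \<alpha> = CARD('a)")
      case True
      with psum_last[OF p True, of f] n assms(3) show False by simp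
    next
      case False
      then have "Suc (p \<alpha>) \<le> CARD('a)" using numbering_range[OF p, of \<alpha>] by simp
      then obtain \<beta> where b: "p \<beta> = Suc (p \<alpha>)" using numbering_surj[OF p, of "Suc (p \<alpha>)"] by auto
      then have "\<beta> \<in> ?S" using psum_succ[OF p b] n by auto
      then show False using \<alpha>(2) b by fastforce
    qed
  qed
  then show ?thesis using that \<alpha>(1) by auto
qed

lemma psum_inj_interval:
  assumes "is_numbering p" "\<And>\<beta>. f \<beta> \<ge> 0"
    "psum p f \<alpha> \<le> x" "x < psum p f \<alpha> + f \<alpha>" "psum p f \<beta> \<le> x" "x < psum p f \<beta> + f \<beta>"
  shows "\<alpha> = \<beta>"
  using psum_mono[of p f \<alpha> \<beta>] psum_mono[of p f \<beta> \<alpha>] assms numbering_inj[OF assms(1)]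
  by (smt (verit) nat_neq_iff)

lemma psum_order:
  assumes "is_numbering p" "\<And>\<beta>. f \<beta> > 0"
  shows "psum p f \<alpha> < psum p f \<beta> \<longleftrightarrow> p \<alpha> < p \<beta>"
  using psum_mono[of p f \<alpha> \<beta>] psum_mono[of p f \<beta> \<alpha>] assms numbering_inj[OF assms(1)]
  by (smt (verit) nat_neq_iff)


subsection \<open>Moving the last letter\<close>

text \<open>The transposed elementary matrix acting on vectors
  (\<open>step_mat_transpose_mult\<close>). With w the winner and l the loser, it turns the lengths
  after a step back into the lengths before it (\<open>nxt_len\<close>).\<close>

definition push :: "'a \<Rightarrow> 'a \<Rightarrow> ('a \<Rightarrow> real) \<Rightarrow> 'a \<Rightarrow> real" where
  "push w l f = f(w := f w + f l)"

text \<open>Rauzy's combinatorial move on the order in which the loser l comes last. The order in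
  which the winner w comes last is left unchanged by the step.\<close>

definition move_last :: "('a \<Rightarrow> nat) \<Rightarrow> 'a \<Rightarrow> 'a \<Rightarrow> 'a \<Rightarrow> nat" where
  "move_last p w l = (\<lambda>\<beta>. if \<beta> = l then p w + 1 else if p w < p \<beta> then p \<beta> + 1 else p \<beta>)"

lemma numbering_move_last:
  fixes p :: "'a::finite \<Rightarrow> nat"
  assumes p: "is_numbering p" and l: "p l = CARD('a)" and "w \<noteq> l"
  shows "is_numbering (move_last p w l)"
proof (rule numberingI)
  note i = numbering_inj[OF p] and r = numbering_range[OF p]
  have "p w < CARD('a)" using i[of w l] r(2)[of w] l assms(3) by auto
  moreover have lt: "p \<beta> < CARD('a)" if "\<beta> \<noteq> l" for \<beta>
    using i[of \<beta> l] r(2)[of \<beta>] l that by auto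
  ultimately show "1 \<le> move_last p w l \<alpha> \<and> move_last p w l \<alpha> \<le> CARD('a)" for \<alpha>
    using r[of \<alpha>] r[of w] lt[of \<alpha>] unfolding move_last_def by (auto simp: Suc_leI)
  show "inj (move_last p w l)"
    using i by (auto simp: inj_def move_last_def split: if_splits)
qed

lemma psum_push_last:
  fixes q :: "'a::finite \<Rightarrow> nat"
  assumes q: "is_numbering q" and "q w = CARD('a)"
  shows "psum q (push w l f) \<alpha> = psum q f \<alpha>"
  unfolding psum_def push_def
  using numbering_range(2)[OF q, of \<alpha>] assms(2) by (intro sum.cong) auto

lemma sum_push: "w \<noteq> l \<Longrightarrow> sum (push w l f) (UNIV :: 'a::finite set) = sum f UNIV + f l"
  unfolding push_def by (subst (1 2) sum.remove[of UNIV w]) auto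

text \<open>In the new order l sits directly to the right of w, so w and l together fill the place
  that w alone occupies for the pushed function. Keeping f arbitrary makes the formula available for
  vectors of any sign, as needed for \<open>Omega\<close> and for \<open>pairing\<close>.\<close>

lemma psum_move_last:
  fixes p :: "'a::finite \<Rightarrow> nat"
  assumes p: "is_numbering p" and l: "p l = CARD('a)" and wl: "w \<noteq> l"
  shows "psum (move_last p w l) f \<alpha> =
    (if \<alpha> = l then psum p (push w l f) w + push w l f w - f l else psum p (push w l f) \<alpha>)"
proof -
  note i = numbering_inj[OF p] and r = numbering_range[OF p]
  have lt: "p \<beta> < CARD('a)" if "\<beta> \<noteq> l" for \<beta>
    using i[of \<beta> l] r(2)[of \<beta>] l that by auto
  show ?thesis
  proof (cases "\<alpha> = l")
    case True
    have "{\<beta>. move_last p w l \<beta> < move_last p w l l} = insert w {\<beta>. p \<beta> < p w}"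
    proof (intro set_eqI)
      fix \<beta>
      have "p w < CARD('a)" "\<beta> \<noteq> l \<Longrightarrow> p \<beta> < CARD('a)" "p \<beta> = p w \<longleftrightarrow> \<beta> = w"
        using lt[of w] lt[of \<beta>] wl i by auto
      then show "\<beta> \<in> {\<beta>. move_last p w l \<beta> < move_last p w l l} \<longleftrightarrow> \<beta> \<in> insert w {\<beta>. p \<beta> < p w}"
        using wl l by (cases "\<beta> = l") (auto simp: move_last_def)
    qed
    then have "psum (move_last p w l) f l = f w + psum p f w" by (simp add: psum_def)
    moreover have "psum p (push w l f) w = psum p f w"
      unfolding psum_def push_def by (intro sum.cong) auto
    ultimately show ?thesis using True wl by (simp add: push_def)
  next
    case False
    show ?thesis
    proof (cases "p w < p \<alpha>")
      case True
      have "{\<beta>. move_last p w l \<beta> < move_last p w l \<alpha>} = insert l {\<beta>. p \<beta> < p \<alpha>}"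
        using False True lt[OF False] l by (auto simp: move_last_def split: if_splits)
      then have "psum (move_last p w l) f \<alpha> = f l + psum p f \<alpha>"
        using lt[OF False] l by (simp add: psum_def)
      moreover have "psum p (push w l f) \<alpha> = f l + psum p f \<alpha>"
        unfolding psum_def push_def using True by (subst (1 2) sum.remove[of _ w]) auto
      ultimately show ?thesis using False by simp
    next
      case nlt: False
      have "{\<beta>. move_last p w l \<beta> < move_last p w l \<alpha>} = {\<beta>. p \<beta> < p \<alpha>}"
        using False nlt lt[OF False] l by (auto simp: move_last_def split: if_splits)
      then have "psum (move_last p w l) f \<alpha> = psum p f \<alpha>" by (simp add: psum_def)
      moreover have "psum p (push w l f) \<alpha> = psum p f \<alpha>"
        unfolding psum_def push_def using nlt by (intro sum.cong) auto
      ultimately show ?thesis using False by simp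
    qed
  qed
qed

lemma irreducible_sym: "irreducible_data p q \<longleftrightarrow> irreducible_data q p"
  unfolding irreducible_data_def by metis

text \<open>A common last letter would make its complement a common initial segment of
  \<open>CARD('a) - 1\<close> letters, which is not empty when there are two letters or
  more.\<close>

lemma irreducible_last:
  fixes p q :: "'a::finite \<Rightarrow> nat"
  assumes d: "CARD('a) \<ge> 2" and p: "is_numbering p" and q: "is_numbering q"
    and irr: "irreducible_data p q" and "p t = CARD('a)" "q a = CARD('a)"
  shows "t \<noteq> a"
proof
  assume "t = a"
  have *: "r -` {1..CARD('a) - 1} = - {a}" if r: "is_numbering r" "r a = CARD('a)" for r :: "'a \<Rightarrow> nat"
  proof -
    have "r \<beta> \<in> {1..CARD('a) - 1} \<longleftrightarrow> \<beta> \<noteq> a" for \<beta>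
      using numbering_range[OF r(1), of \<beta>] numbering_inj[OF r(1), of \<beta> a] r(2) d by auto
    then have "r -` {1..CARD('a) - 1} = {\<beta>. \<beta> \<noteq> a}" unfolding vimage_def by (rule Collect_cong)
    also have "\<dots> = - {a}" by blast
    finally show ?thesis .
  qed
  have "p -` {1..CARD('a) - 1} = q -` {1..CARD('a) - 1}"
    using *[OF p] *[OF q] assms \<open>t = a\<close> by simp
  moreover have "1 \<le> CARD('a) - 1 \<and> CARD('a) - 1 < CARD('a)" using d by simp
  ultimately show False using irr unfolding irreducible_data_def by blast
qed

text \<open>A common initial segment that does not reach past w was already common before the move.
  One that does contains w, which is last for q, so it is the whole alphabet.\<close>

lemma irreducible_move_last:
  fixes p q :: "'a::finite \<Rightarrow> nat"
  assumes p: "is_numbering p" and q: "is_numbering q"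
    and irr: "irreducible_data q p" and "q w = CARD('a)" "p l = CARD('a)" "w \<noteq> l"
  shows "irreducible_data q (move_last p w l)"
  unfolding irreducible_data_def
proof (intro allI impI notI)
  fix k assume k: "1 \<le> k \<and> k < CARD('a)" and e: "q -` {1..k} = move_last p w l -` {1..k}"
  note r = numbering_range[OF p]
  have lt: "p \<beta> < CARD('a)" if "\<beta> \<noteq> l" for \<beta>
    using numbering_inj[OF p, of \<beta> l] r(2)[of \<beta>] assms(5) that by auto
  show False
  proof (cases "k \<le> p w")
    case True
    have "move_last p w l \<beta> \<in> {1..k} \<longleftrightarrow> p \<beta> \<in> {1..k}" for \<beta>
      using True k assms(5) by (auto simp: move_last_def)
    then have "move_last p w l -` {1..k} = p -` {1..k}" unfolding vimage_def by (rule Collect_cong)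
    then have "q -` {1..k} = p -` {1..k}" using e by (rule trans[rotated])
    then show False using irr k unfolding irreducible_data_def by blast
  next
    case False
    then have "w \<in> move_last p w l -` {1..k}" using r(1)[of w] assms(6) by (auto simp: move_last_def)
    then have "w \<in> q -` {1..k}" using e by simp
    then show False using assms(4) k by auto
  qed
qed

subsection \<open>Endpoints and translation lengths\<close>

definition topl :: "'a::finite iem \<Rightarrow> 'a \<Rightarrow> real" where
  "topl T \<alpha> = left_end T + psum (pos_t T) (len T) \<alpha>"

definition botl :: "'a::finite iem \<Rightarrow> 'a \<Rightarrow> real" where
  "botl T \<alpha> = left_end T + psum (pos_b T) (len T) \<alpha>"

definition right_end :: "'a::finite iem \<Rightarrow> real" where
  "right_end T = left_end T + sum (len T) UNIV"

definition shift :: "'a::finite iem \<Rightarrow> 'a \<Rightarrow> real" where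
  "shift T \<alpha> = botl T \<alpha> - topl T \<alpha>"

definition last_t :: "'a::finite iem \<Rightarrow> 'a" where
  "last_t T = inv (pos_t T) CARD('a)"

definition last_b :: "'a::finite iem \<Rightarrow> 'a" where
  "last_b T = inv (pos_b T) CARD('a)"

lemma is_iem_alt:
  "is_iem T \<longleftrightarrow> (\<forall>\<alpha>. len T \<alpha> > 0) \<and> is_numbering (pos_t T) \<and> is_numbering (pos_b T) \<and>
     irreducible_data (pos_t T) (pos_b T)"
  by (simp add: is_iem_def is_numbering_def)

lemma is_iemD:
  assumes "is_iem T"
  shows "len T \<alpha> > 0" "is_numbering (pos_t T)" "is_numbering (pos_b T)"
    "irreducible_data (pos_t T) (pos_b T)"
  using assms by (auto simp: is_iem_alt)

lemma upt_u_right: "is_iem T \<Longrightarrow> upt_u T (pos_t T \<alpha>) = topl T \<alpha> + len T \<alpha>"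
  using psum_incl[of "pos_t T" "len T" \<alpha>] by (simp add: upt_u_def topl_def is_iem_alt)

lemma upt_u_left:
  assumes "is_iem T" shows "upt_u T (pos_t T \<alpha> - 1) = topl T \<alpha>"
proof -
  have "1 \<le> pos_t T \<alpha>" using numbering_range[OF is_iemD(2)[OF assms]] by auto
  then have "{\<beta>. pos_t T \<beta> \<le> pos_t T \<alpha> - 1} = {\<beta>. pos_t T \<beta> < pos_t T \<alpha>}" by (intro Collect_cong) linarith
  then show ?thesis by (simp add: upt_u_def topl_def psum_def)
qed

lemma vpt_v_left:
  assumes "is_iem T" shows "vpt_v T (pos_b T \<alpha> - 1) = botl T \<alpha>"
proof -
  have "1 \<le> pos_b T \<alpha>" using numbering_range[OF is_iemD(3)[OF assms]] by auto
  then have "{\<beta>. pos_b T \<beta> \<le> pos_b T \<alpha> - 1} = {\<beta>. pos_b T \<beta> < pos_b T \<alpha>}" by (intro Collect_cong) linarith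
  then show ?thesis by (simp add: vpt_v_def botl_def psum_def)
qed

lemma upt_u_0:
  assumes "is_iem T" shows "upt_u T 0 = left_end T"
proof -
  have "{\<beta>. pos_t T \<beta> \<le> 0} = {}" using numbering_range(1)[OF is_iemD(2)[OF assms]] by (auto simp: Suc_le_eq)
  then show ?thesis unfolding upt_u_def by (simp only: sum.empty)
qed

lemma upt_u_card:
  fixes T :: "'a::finite iem"
  assumes "is_iem T" shows "upt_u T CARD('a) = right_end T"
  using numbering_range(2)[OF is_iemD(2)[OF assms]] by (simp add: upt_u_def right_end_def)

lemma whole_int_eq: "is_iem T \<Longrightarrow> whole_int T = {left_end T <..< right_end T}"
  by (simp add: whole_int_def upt_u_0 upt_u_card)

lemma top_int_eq: "is_iem T \<Longrightarrow> top_int T \<alpha> = {topl T \<alpha> <..< topl T \<alpha> + len T \<alpha>}"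
  by (simp add: top_int_def upt_u_left upt_u_right del: One_nat_def)

lemma top_cint_eq: "is_iem T \<Longrightarrow> top_cint T \<alpha> = {topl T \<alpha> .. topl T \<alpha> + len T \<alpha>}"
  by (simp add: top_cint_def upt_u_left upt_u_right del: One_nat_def)

lemma iem_bounds:
  assumes "is_iem T"
  shows "left_end T \<le> topl T \<alpha>" "topl T \<alpha> + len T \<alpha> \<le> right_end T"
    "left_end T \<le> botl T \<alpha>" "botl T \<alpha> + len T \<alpha> \<le> right_end T"
  using psum_nonneg[of "len T" "pos_t T" \<alpha>] psum_le_total[of "pos_t T" "len T" \<alpha>]
    psum_nonneg[of "len T" "pos_b T" \<alpha>] psum_le_total[of "pos_b T" "len T" \<alpha>] is_iemD[OF assms]
  by (auto simp: topl_def botl_def right_end_def less_imp_le)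

lemma topl_cover:
  assumes "is_iem T" "left_end T \<le> x" "x < right_end T"
  obtains \<alpha> where "topl T \<alpha> \<le> x" "x < topl T \<alpha> + len T \<alpha>"
  using psum_cover[of "pos_t T" "x - left_end T" "len T"] assms is_iemD[OF assms(1)]
  by (auto simp: topl_def right_end_def algebra_simps)

lemma botl_cover:
  assumes "is_iem T" "left_end T \<le> x" "x < right_end T"
  obtains \<alpha> where "botl T \<alpha> \<le> x" "x < botl T \<alpha> + len T \<alpha>"
  using psum_cover[of "pos_b T" "x - left_end T" "len T"] assms is_iemD[OF assms(1)]
  by (auto simp: botl_def right_end_def algebra_simps)

lemma topl_unique:
  assumes "is_iem T" "topl T \<alpha> \<le> x" "x < topl T \<alpha> + len T \<alpha>" "topl T \<beta> \<le> x" "x < topl T \<beta> + len T \<beta>"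
  shows "\<alpha> = \<beta>"
  using psum_inj_interval[of "pos_t T" "len T" \<alpha> "x - left_end T" \<beta>] assms is_iemD[OF assms(1)]
  by (auto simp: topl_def less_imp_le algebra_simps)

lemma botl_unique:
  assumes "is_iem T" "botl T \<alpha> \<le> x" "x < botl T \<alpha> + len T \<alpha>" "botl T \<beta> \<le> x" "x < botl T \<beta> + len T \<beta>"
  shows "\<alpha> = \<beta>"
  using psum_inj_interval[of "pos_b T" "len T" \<alpha> "x - left_end T" \<beta>] assms is_iemD[OF assms(1)]
  by (auto simp: botl_def less_imp_le algebra_simps)

lemma label_of_eq: "is_iem T \<Longrightarrow> x \<in> top_int T \<alpha> \<Longrightarrow> label_of T x = \<alpha>"
  unfolding label_of_def using topl_unique[of T _ x \<alpha>]
  by (intro the_equality) (auto simp: top_int_eq)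

lemma iem_map_eq: "is_iem T \<Longrightarrow> x \<in> top_int T \<alpha> \<Longrightarrow> iem_map T x = x + shift T \<alpha>"
  by (simp add: iem_map_def label_of_eq Let_def vpt_v_left upt_u_left shift_def del: One_nat_def)

lemma iem_map_bot:
  "is_iem T \<Longrightarrow> x \<in> top_int T \<alpha> \<Longrightarrow> iem_map T x \<in> {botl T \<alpha> <..< botl T \<alpha> + len T \<alpha>}"
  by (auto simp: iem_map_eq shift_def top_int_eq)

lemma iem_map_whole: "is_iem T \<Longrightarrow> x \<in> iem_dom T \<Longrightarrow> iem_map T x \<in> whole_int T"
proof -
  assume T: "is_iem T" and "x \<in> iem_dom T"
  then obtain \<alpha> where "x \<in> top_int T \<alpha>" by (auto simp: iem_dom_def)
  then show ?thesis using iem_map_bot[OF T, of x \<alpha>] iem_bounds[OF T, of \<alpha>] by (auto simp: whole_int_eq[OF T])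
qed

lemma last_pos:
  fixes T :: "'a::finite iem"
  assumes "is_iem T"
  shows "pos_t T (last_t T) = CARD('a)" "pos_b T (last_b T) = CARD('a)"
  unfolding last_t_def last_b_def using is_iemD[OF assms] by (auto intro!: numbering_inv simp: Suc_leI)

lemma last_neq:
  fixes T :: "'a::finite iem"
  assumes "CARD('a) \<ge> 2" "is_iem T"
  shows "last_t T \<noteq> last_b T"
  using irreducible_last[OF assms(1)] is_iemD[OF assms(2)] last_pos[OF assms(2)] by blast

lemma last_endpoints:
  assumes "is_iem T"
  shows "topl T (last_t T) + len T (last_t T) = right_end T" "botl T (last_b T) + len T (last_b T) = right_end T"
  using psum_last[of "pos_t T" "last_t T"] psum_last[of "pos_b T" "last_b T"] last_pos[OF assms] is_iemD[OF assms]
  by (auto simp: topl_def botl_def right_end_def)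


subsection \<open>The elementary step\<close>

text \<open>Exchanging the two orders gives the inverse map. The step in which the bottom letter
  wins is the top step for the inverse, so only \<open>topstep\<close> has to be analysed.\<close>

definition swap :: "'a::finite iem \<Rightarrow> 'a iem" where
  "swap T = T\<lparr>pos_t := pos_b T, pos_b := pos_t T\<rparr>"

definition topstep :: "'a::finite iem \<Rightarrow> 'a iem" where
  "topstep T = T\<lparr>len := (len T)(last_t T := len T (last_t T) - len T (last_b T)),
     pos_b := move_last (pos_b T) (last_t T) (last_b T)\<rparr>"

definition nxt :: "'a::finite iem \<Rightarrow> 'a iem" where
  "nxt T = (if len T (last_b T) < len T (last_t T) then topstep T else swap (topstep (swap T)))"

definition loser :: "'a::finite iem \<Rightarrow> 'a" where
  "loser T = (if len T (last_b T) < len T (last_t T) then last_b T else last_t T)"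

definition winner :: "'a::finite iem \<Rightarrow> 'a" where
  "winner T = (if len T (last_b T) < len T (last_t T) then last_t T else last_b T)"

lemma swap_simps [simp]:
  "len (swap T) = len T" "pos_t (swap T) = pos_b T" "pos_b (swap T) = pos_t T"
  "left_end (swap T) = left_end T" "last_t (swap T) = last_b T" "last_b (swap T) = last_t T"
  by (simp_all add: swap_def last_t_def last_b_def)

lemma is_iem_swap [simp]: "is_iem (swap T) \<longleftrightarrow> is_iem T"
  by (auto simp: is_iem_alt irreducible_sym)

lemma topstep_simps [simp]:
  "len (topstep T) = (len T)(last_t T := len T (last_t T) - len T (last_b T))"
  "pos_t (topstep T) = pos_t T" "left_end (topstep T) = left_end T"
  "pos_b (topstep T) = move_last (pos_b T) (last_t T) (last_b T)"
  by (simp_all add: topstep_def)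

lemma is_iem_topstep:
  fixes T :: "'a::finite iem"
  assumes d: "CARD('a) \<ge> 2" and T: "is_iem T" and "len T (last_b T) < len T (last_t T)"
  shows "is_iem (topstep T)"
  unfolding is_iem_alt
  using is_iemD[OF T] last_pos[OF T] last_neq[OF d T] assms(3)
  by (auto intro!: numbering_move_last irreducible_move_last)

text \<open>
  The two cases of the algorithm have one description in terms of the winner and the loser among
  the last letters.
\<close>

lemma nxt_facts:
  fixes T :: "'a::finite iem"
  assumes d: "CARD('a) \<ge> 2" and T: "is_iem T" and ne: "len T (last_b T) \<noteq> len T (last_t T)"
  shows nxt_is_iem: "is_iem (nxt T)"
    and nxt_left_end: "left_end (nxt T) = left_end T"
    and nxt_len: "len T = push (winner T) (loser T) (len (nxt T))"
    and nxt_psum_t: "psum (pos_t (nxt T)) f \<alpha> =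
      (if \<alpha> = loser T then psum (pos_t T) (push (winner T) (loser T) f) (last_b T)
         + push (winner T) (loser T) f (last_b T) - f (loser T)
       else psum (pos_t T) (push (winner T) (loser T) f) \<alpha>)"
    and nxt_psum_b: "psum (pos_b (nxt T)) f \<alpha> =
      (if \<alpha> = loser T then psum (pos_b T) (push (winner T) (loser T) f) (last_t T)
         + push (winner T) (loser T) f (last_t T) - f (loser T)
       else psum (pos_b T) (push (winner T) (loser T) f) \<alpha>)"
proof -
  have "is_iem (nxt T) \<and> left_end (nxt T) = left_end T \<and> len T = push (winner T) (loser T) (len (nxt T)) \<and>
    psum (pos_t (nxt T)) f \<alpha> =
      (if \<alpha> = loser T then psum (pos_t T) (push (winner T) (loser T) f) (last_b T)
         + push (winner T) (loser T) f (last_b T) - f (loser T)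
       else psum (pos_t T) (push (winner T) (loser T) f) \<alpha>) \<and>
    psum (pos_b (nxt T)) f \<alpha> =
      (if \<alpha> = loser T then psum (pos_b T) (push (winner T) (loser T) f) (last_t T)
         + push (winner T) (loser T) f (last_t T) - f (loser T)
       else psum (pos_b T) (push (winner T) (loser T) f) \<alpha>)"
  proof (cases "len T (last_b T) < len T (last_t T)")
    case True
    then have *: "nxt T = topstep T" "winner T = last_t T" "loser T = last_b T"
      by (auto simp: nxt_def winner_def loser_def)
    show ?thesis unfolding *
      using is_iem_topstep[OF d T True] last_neq[OF d T] last_pos[OF T] is_iemD[OF T]
      by (auto simp: push_def[of _ _ "len (topstep T)"] psum_push_last psum_move_last)
         (auto simp: push_def)
  next
    case False
    then have l: "len T (last_t T) < len T (last_b T)" using ne by simp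
    have *: "nxt T = swap (topstep (swap T))" "winner T = last_b T" "loser T = last_t T"
      using False by (auto simp: nxt_def winner_def loser_def)
    have "is_iem (topstep (swap T))" using l T by (intro is_iem_topstep[OF d]) auto
    then show ?thesis unfolding *
      using last_neq[OF d T] last_pos[OF T] is_iemD[OF T]
      by (auto simp: push_def[of _ _ "len (swap (topstep (swap T)))"] psum_push_last psum_move_last)
         (auto simp: push_def)
  qed
  then show "is_iem (nxt T)" "left_end (nxt T) = left_end T" "len T = push (winner T) (loser T) (len (nxt T))"
    "psum (pos_t (nxt T)) f \<alpha> =
      (if \<alpha> = loser T then psum (pos_t T) (push (winner T) (loser T) f) (last_b T)
         + push (winner T) (loser T) f (last_b T) - f (loser T)
       else psum (pos_t T) (push (winner T) (loser T) f) \<alpha>)"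
    "psum (pos_b (nxt T)) f \<alpha> =
      (if \<alpha> = loser T then psum (pos_b T) (push (winner T) (loser T) f) (last_t T)
         + push (winner T) (loser T) f (last_t T) - f (loser T)
       else psum (pos_b T) (push (winner T) (loser T) f) \<alpha>)" by blast+
qed


context
  fixes T :: "'a::finite iem"
  assumes d: "CARD('a) \<ge> 2" and T: "is_iem T" and ne: "len T (last_b T) \<noteq> len T (last_t T)"
begin

lemma winner_loser_cases:
  "winner T = last_t T \<and> loser T = last_b T \<and> len T (last_b T) < len T (last_t T) \<or>
   winner T = last_b T \<and> loser T = last_t T \<and> len T (last_t T) < len T (last_b T)"
  using ne by (auto simp: winner_def loser_def)

lemma winner_neq_loser: "winner T \<noteq> loser T"
  using winner_loser_cases last_neq[OF d T] by auto

lemma len_loser_le_last: "len T (loser T) \<le> len T (last_b T)" "len T (loser T) \<le> len T (last_t T)"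
  using winner_loser_cases by auto

lemma step_len:
  "len (nxt T) \<alpha> = (if \<alpha> = winner T then len T \<alpha> - len T (loser T) else len T \<alpha>)"
  using fun_cong[OF nxt_len[OF d T ne], of \<alpha>] fun_cong[OF nxt_len[OF d T ne], of "loser T"] winner_neq_loser
  by (auto simp: push_def split: if_splits)

lemma step_topl:
  "topl (nxt T) \<alpha> = (if \<alpha> = loser T then topl T (last_b T) + len T (last_b T) - len T (loser T) else topl T \<alpha>)"
  using step_len[of "loser T"] winner_neq_loser unfolding topl_def nxt_psum_t[OF d T ne] nxt_left_end[OF d T ne]
    nxt_len[OF d T ne, symmetric] by auto

lemma step_botl:
  "botl (nxt T) \<alpha> = (if \<alpha> = loser T then botl T (last_t T) + len T (last_t T) - len T (loser T) else botl T \<alpha>)"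
  using step_len[of "loser T"] winner_neq_loser unfolding botl_def nxt_psum_b[OF d T ne] nxt_left_end[OF d T ne]
    nxt_len[OF d T ne, symmetric] by auto

lemma step_right_end: "right_end (nxt T) = right_end T - len T (loser T)"
  using sum_push[OF winner_neq_loser, of "len (nxt T)"] step_len[of "loser T"] winner_neq_loser
  unfolding right_end_def nxt_left_end[OF d T ne] nxt_len[OF d T ne, symmetric] by auto

text \<open>A point of the new interval of the loser moves with \<open>last_b\<close>, then with
  \<open>last_t\<close>, before it returns, whichever of the two is the loser. All other points
  return at once.\<close>

lemma step_shift:
  "shift (nxt T) \<alpha> = (if \<alpha> = loser T then shift T (last_b T) + shift T (last_t T) else shift T \<alpha>)"
  using last_endpoints[OF T] by (auto simp: shift_def step_topl step_botl)

lemma step_len_le: "len (nxt T) \<alpha> \<le> len T \<alpha>"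
  using is_iemD(1)[OF T, of "loser T"] by (auto simp: step_len)

lemma step_dom:
  assumes "x \<in> top_int (nxt T) \<alpha>" "\<alpha> \<noteq> loser T"
  shows "x \<in> top_int T \<alpha>" "iem_map T x = iem_map (nxt T) x"
proof -
  show *: "x \<in> top_int T \<alpha>"
    using assms step_len_le[of \<alpha>] by (auto simp: top_int_eq[OF T] top_int_eq[OF nxt_is_iem[OF d T ne]] step_topl)
  show "iem_map T x = iem_map (nxt T) x"
    using assms by (simp add: iem_map_eq[OF T *] iem_map_eq[OF nxt_is_iem[OF d T ne]] step_shift)
qed

lemma step_dom_loser:
  assumes "x \<in> top_int (nxt T) (loser T)"
  shows "x \<in> top_int T (last_b T)" "iem_map T x \<in> top_int T (last_t T)" "iem_map T x \<notin> whole_int (nxt T)"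
    "iem_map T (iem_map T x) = iem_map (nxt T) x"
proof -
  have l: "len (nxt T) (loser T) = len T (loser T)" using winner_neq_loser by (simp add: step_len)
  show 1: "x \<in> top_int T (last_b T)"
    using assms len_loser_le_last by (auto simp: l top_int_eq[OF T] top_int_eq[OF nxt_is_iem[OF d T ne]] step_topl)
  show 2: "iem_map T x \<in> top_int T (last_t T)"
    using assms len_loser_le_last last_endpoints[OF T] iem_map_eq[OF T 1]
    by (auto simp: l top_int_eq[OF T] top_int_eq[OF nxt_is_iem[OF d T ne]] step_topl shift_def)
  show "iem_map T x \<notin> whole_int (nxt T)"
    using assms last_endpoints[OF T] iem_map_eq[OF T 1]
    by (auto simp: l whole_int_eq[OF nxt_is_iem[OF d T ne]] top_int_eq[OF nxt_is_iem[OF d T ne]]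
        step_right_end step_topl shift_def)
  show "iem_map T (iem_map T x) = iem_map (nxt T) x"
    using iem_map_eq[OF T 1] iem_map_eq[OF T 2] iem_map_eq[OF nxt_is_iem[OF d T ne] assms] by (simp add: step_shift)
qed

lemma step_whole_subset: "whole_int (nxt T) \<subseteq> whole_int T"
  using is_iemD(1)[OF T, of "loser T"]
  by (auto simp: whole_int_eq[OF T] whole_int_eq[OF nxt_is_iem[OF d T ne]] step_right_end nxt_left_end[OF d T ne])

end

lemma return_timeI:
  assumes "0 < r" "(iem_map T ^^ r) x \<in> J" "\<And>i. 0 < i \<Longrightarrow> i < r \<Longrightarrow> (iem_map T ^^ i) x \<notin> J"
  shows "return_time T J x = r"
  unfolding return_time_def using assms by (intro Least_equality) (auto simp: not_less[symmetric])

lemma rauzy_step_nxt: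
  fixes T :: "'a::finite iem"
  assumes d: "CARD('a) \<ge> 2" and T: "is_iem T" and ne: "len T (last_b T) \<noteq> len T (last_t T)"
  shows "rauzy_step T (nxt T)"
proof -
  let ?T' = "nxt T"
  note T' = nxt_is_iem[OF d T ne]
  note facts = step_len[OF d T ne] step_topl[OF d T ne] step_right_end[OF d T ne]
  have u: "upt_u T (CARD('a) - 1) = right_end T - len T (last_t T)"
    using upt_u_left[OF T, of "last_t T"] last_pos[OF T] last_endpoints[OF T] by simp
  have v: "vpt_v T (CARD('a) - 1) = right_end T - len T (last_b T)"
    using vpt_v_left[OF T, of "last_b T"] last_pos[OF T] last_endpoints[OF T] by simp
  have mx: "whole_int ?T' = {upt_u T 0 <..< max (right_end T - len T (last_t T)) (right_end T - len T (last_b T))}"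
    using winner_loser_cases[OF d T ne]
    by (auto simp: whole_int_eq[OF T'] upt_u_0[OF T] nxt_left_end[OF d T ne] facts)
  have ret: "iem_map ?T' x = (iem_map T ^^ return_time T (whole_int ?T') x) x" if x: "x \<in> iem_dom ?T'" for x
  proof -
    obtain \<alpha> where a: "x \<in> top_int ?T' \<alpha>" using x by (auto simp: iem_dom_def)
    have w: "iem_map ?T' x \<in> whole_int ?T'" by (rule iem_map_whole[OF T' x])
    show ?thesis
    proof (cases "\<alpha> = loser T")
      case False
      have "return_time T (whole_int ?T') x = 1"
        using w step_dom(2)[OF d T ne a False] by (intro return_timeI) auto
      then show ?thesis using step_dom(2)[OF d T ne a False] by simp
    next
      case True
      note s = step_dom_loser[OF d T ne a[unfolded True]]
      have "return_time T (whole_int ?T') x = 2"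
        using w s by (intro return_timeI) (auto simp: numeral_2_eq_2 less_Suc_eq)
      then show ?thesis using s by (simp add: numeral_2_eq_2)
    qed
  qed
  have A: "(\<forall>\<alpha>. \<alpha> \<noteq> last_t T \<longrightarrow> top_int ?T' \<alpha> = top_int T \<alpha>) \<and>
      top_int ?T' (last_t T) = top_int T (last_t T) \<inter> {upt_u T 0 <..< right_end T - len T (last_b T)}"
    if "len T (last_b T) < len T (last_t T)"
  proof -
    have wl: "winner T = last_t T" "loser T = last_b T" using that by (auto simp: winner_def loser_def)
    have "left_end T \<le> topl T (last_t T)" by (rule iem_bounds[OF T])
    then show ?thesis
      using last_neq[OF d T] last_endpoints[OF T] that is_iemD(1)[OF T]
      by (auto simp: top_int_eq[OF T] top_int_eq[OF T'] facts wl upt_u_0[OF T])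
  qed
  let ?R = "{x \<in> iem_dom T. iem_map T x \<in> top_int T (last_t T)}"
  have B: "(\<forall>\<alpha>. \<alpha> \<noteq> last_t T \<and> \<alpha> \<noteq> last_b T \<longrightarrow> top_int ?T' \<alpha> = top_int T \<alpha>) \<and>
      top_int ?T' (last_t T) = ?R \<and>
      top_int ?T' (last_b T) = interior (top_int T (last_b T) - ?R)"
    if l: "\<not> len T (last_b T) < len T (last_t T)"
  proof -
    have wl: "winner T = last_b T" "loser T = last_t T" using that by (auto simp: winner_def loser_def)
    have l': "len T (last_t T) < len T (last_b T)" using that ne by auto
    have t: "len T (last_t T) > 0" by (rule is_iemD[OF T])
    have R: "?R = {topl T (last_b T) + len T (last_b T) - len T (last_t T) <..< topl T (last_b T) + len T (last_b T)}"
    proof (intro equalityI subsetI)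
      fix x assume "x \<in> ?R"
      then obtain \<alpha> where a: "x \<in> top_int T \<alpha>" and m: "iem_map T x \<in> top_int T (last_t T)"
        by (auto simp: iem_dom_def)
      \<comment> \<open>The top interval of \<open>last_t\<close> ends at the right end of I and is
        shorter than the bottom interval of \<open>last_b\<close>, which ends there too; so only
        that bottom interval can contain the image point.\<close>
      have "\<alpha> = last_b T"
        using iem_map_bot[OF T a] m last_endpoints[OF T] l'
        by (intro botl_unique[OF T, of \<alpha> "iem_map T x"]) (auto simp: top_int_eq[OF T])
      then show "x \<in> {topl T (last_b T) + len T (last_b T) - len T (last_t T) <..< topl T (last_b T) + len T (last_b T)}"
        using a m last_endpoints[OF T] iem_map_eq[OF T a] by (auto simp: top_int_eq[OF T] shift_def)
    next
      fix x assume x: "x \<in> {topl T (last_b T) + len T (last_b T) - len T (last_t T) <..< topl T (last_b T) + len T (last_b T)}"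
      then have a: "x \<in> top_int T (last_b T)" using l' by (auto simp: top_int_eq[OF T])
      then show "x \<in> ?R"
        using x last_endpoints[OF T] iem_map_eq[OF T a] by (auto simp: top_int_eq[OF T] shift_def iem_dom_def)
    qed
    have "top_int T (last_b T) - ?R = {topl T (last_b T) <.. topl T (last_b T) + len T (last_b T) - len T (last_t T)}"
      unfolding R using l' t by (auto simp: top_int_eq[OF T])
    then have I: "interior (top_int T (last_b T) - ?R) = {topl T (last_b T) <..< topl T (last_b T) + len T (last_b T) - len T (last_t T)}"
      by simp
    have "top_int ?T' (last_b T) = interior (top_int T (last_b T) - ?R)"
      unfolding I using last_neq[OF d T] by (simp add: top_int_eq[OF T'] facts wl algebra_simps)
    moreover have "top_int ?T' (last_t T) = ?R"
      unfolding R using last_neq[OF d T] by (simp add: top_int_eq[OF T'] facts wl algebra_simps)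
    ultimately show ?thesis
      using last_neq[OF d T] by (simp add: top_int_eq[OF T] top_int_eq[OF T'] facts wl)
  qed
  show ?thesis
    unfolding rauzy_step_def Let_def u v last_t_def[symmetric] last_b_def[symmetric]
    using T' mx ret A B ne by auto
qed

lemma open_interval_eq:
  fixes a b c d :: real
  assumes "{a<..<b} = {c<..<d}" "a < b"
  shows "a = c" "b = d"
proof -
  have "{c<..<d} \<noteq> {}" using assms by (metis greaterThanLessThan_empty_iff not_less)
  then have "c < d" by (simp add: not_le)
  then show "a = c" "b = d"
    using assms by (metis closure_greaterThanLessThan Icc_eq_Icc less_imp_le)+
qed

text \<open>Lengths come from the top intervals, translation lengths from the value of the map at
  one midpoint per interval, and both orders from the resulting endpoints.\<close>

lemma iem_eqI:
  fixes T1 T2 :: "'a::finite iem"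
  assumes T1: "is_iem T1" and T2: "is_iem T2"
    and w: "whole_int T1 = whole_int T2" and t: "\<And>\<alpha>. top_int T1 \<alpha> = top_int T2 \<alpha>"
    and m: "\<And>x. x \<in> iem_dom T1 \<Longrightarrow> iem_map T1 x = iem_map T2 x"
  shows "T1 = T2"
proof -
  have p: "left_end T1 < right_end T1"
    using is_iemD(1)[OF T1] by (auto simp: right_end_def intro!: sum_pos)
  have l: "left_end T1 = left_end T2"
    using open_interval_eq(1)[OF w[unfolded whole_int_eq[OF T1] whole_int_eq[OF T2]] p] .
  have tp: "topl T1 \<alpha> = topl T2 \<alpha>" "len T1 \<alpha> = len T2 \<alpha>" for \<alpha>
    using open_interval_eq[OF t[of \<alpha>, unfolded top_int_eq[OF T1] top_int_eq[OF T2]]] is_iemD(1)[OF T1, of \<alpha>] by auto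
  have sh: "shift T1 \<alpha> = shift T2 \<alpha>" for \<alpha>
  proof -
    have a: "topl T1 \<alpha> + len T1 \<alpha> / 2 \<in> top_int T1 \<alpha>" using is_iemD(1)[OF T1, of \<alpha>] by (auto simp: top_int_eq[OF T1])
    then have "topl T1 \<alpha> + len T1 \<alpha> / 2 \<in> iem_dom T1" by (auto simp: iem_dom_def)
    from m[OF this] iem_map_eq[OF T1 a] iem_map_eq[OF T2 a[unfolded t]] show ?thesis by simp
  qed
  have bt: "botl T1 \<alpha> = botl T2 \<alpha>" for \<alpha> using sh[of \<alpha>] tp(1)[of \<alpha>] by (simp add: shift_def)
  have ord: "topl T \<alpha> < topl T \<beta> \<longleftrightarrow> pos_t T \<alpha> < pos_t T \<beta>" "botl T \<alpha> < botl T \<beta> \<longleftrightarrow> pos_b T \<alpha> < pos_b T \<beta>"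
    if "is_iem T" for T :: "'a iem" and \<alpha> \<beta>
    using psum_order[of "pos_t T" "len T" \<alpha> \<beta>] psum_order[of "pos_b T" "len T" \<alpha> \<beta>] is_iemD[OF that]
    by (auto simp: topl_def botl_def)
  have "pos_t T1 = pos_t T2"
    using ord(1)[OF T1] ord(1)[OF T2] tp is_iemD[OF T1] is_iemD[OF T2] by (intro numbering_unique) auto
  moreover have "pos_b T1 = pos_b T2"
    using ord(2)[OF T1] ord(2)[OF T2] bt is_iemD[OF T1] is_iemD[OF T2] by (intro numbering_unique) auto
  moreover have "len T1 = len T2" using tp by auto
  ultimately show ?thesis using l by (cases T1; cases T2) auto
qed

text \<open>\<open>rauzy_step\<close> fixes the whole interval, the labelled top intervals and the
  map, so by \<open>iem_eqI\<close> the definite description has exactly one candidate.\<close>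

lemma rauzy_eq_nxt:
  fixes T :: "'a::finite iem"
  assumes d: "CARD('a) \<ge> 2" and T: "is_iem T" and ne: "len T (last_b T) \<noteq> len T (last_t T)"
  shows "rauzy T = nxt T"
  unfolding rauzy_def
proof (rule the_equality)
  show n: "rauzy_step T (nxt T)" by (rule rauzy_step_nxt[OF assms])
  fix S assume s: "rauzy_step T S"
  have S: "is_iem S" and w: "whole_int S = whole_int (nxt T)"
    using s n unfolding rauzy_step_def Let_def by auto
  have t: "top_int S \<alpha> = top_int (nxt T) \<alpha>" for \<alpha>
  proof -
    have "upt_u T (CARD('a) - 1) = right_end T - len T (last_t T)"
      using upt_u_left[OF T, of "last_t T"] last_pos[OF T] last_endpoints[OF T] by simp
    moreover have "vpt_v T (CARD('a) - 1) = right_end T - len T (last_b T)"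
      using vpt_v_left[OF T, of "last_b T"] last_pos[OF T] last_endpoints[OF T] by simp
    ultimately have "upt_u T (CARD('a) - 1) < vpt_v T (CARD('a) - 1) \<or> upt_u T (CARD('a) - 1) > vpt_v T (CARD('a) - 1)"
      using ne by auto
    then have uv: "upt_u T (CARD('a) - 1) < vpt_v T (CARD('a) - 1) \<or>
      \<not> upt_u T (CARD('a) - 1) < vpt_v T (CARD('a) - 1) \<and> upt_u T (CARD('a) - 1) > vpt_v T (CARD('a) - 1)" by linarith
    have "top_int S' \<alpha> =
      (if upt_u T (CARD('a) - 1) < vpt_v T (CARD('a) - 1)
       then if \<alpha> = last_t T then top_int T (last_t T) \<inter> {upt_u T 0 <..< vpt_v T (CARD('a) - 1)} else top_int T \<alpha>
       else if \<alpha> = last_t T then {x \<in> iem_dom T. iem_map T x \<in> top_int T (last_t T)}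
         else if \<alpha> = last_b T
           then interior (top_int T (last_b T) - {x \<in> iem_dom T. iem_map T x \<in> top_int T (last_t T)})
           else top_int T \<alpha>)" if r: "rauzy_step T S'" for S'
    proof -
      note r' = r[unfolded rauzy_step_def Let_def last_t_def[symmetric] last_b_def[symmetric]]
      from uv show ?thesis
      proof (elim disjE conjE)
        assume "upt_u T (CARD('a) - 1) < vpt_v T (CARD('a) - 1)"
        with r' show ?thesis by simp
      next
        assume "\<not> upt_u T (CARD('a) - 1) < vpt_v T (CARD('a) - 1)" "upt_u T (CARD('a) - 1) > vpt_v T (CARD('a) - 1)"
        with r' show ?thesis by simp
      qed
    qed
    from this[OF s] this[OF n] show ?thesis by simp
  qed
  show "S = nxt T"
  proof (rule iem_eqI[OF S nxt_is_iem[OF assms] w t])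
    fix x assume x: "x \<in> iem_dom S"
    then have "x \<in> iem_dom (nxt T)" using t by (simp add: iem_dom_def)
    then show "iem_map S x = iem_map (nxt T) x"
      using s n x w unfolding rauzy_step_def Let_def by auto
  qed
qed

subsection \<open>Absence of connections\<close>

text \<open>Both end points are arbitrary, so that pieces of orbits can be concatenated; only the
  points before the last one have to lie in the domain.\<close>

definition connects :: "'a::finite iem \<Rightarrow> real \<Rightarrow> real \<Rightarrow> bool" where
  "connects T x y \<longleftrightarrow> (\<exists>m. (\<forall>l<m. (iem_map T ^^ l) x \<in> iem_dom T) \<and> (iem_map T ^^ m) x = y)"

text \<open>Absence of connections in terms of labels: the left endpoints other than the leftmost
  one are exactly the interior singularities. In this form it passes from one step to the next
  without renumbering.\<close>

definition keane :: "'a::finite iem \<Rightarrow> bool" where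
  "keane T \<longleftrightarrow> (\<forall>\<alpha> \<beta>. topl T \<alpha> \<noteq> left_end T \<longrightarrow> botl T \<beta> \<noteq> left_end T \<longrightarrow> \<not> connects T (botl T \<beta>) (topl T \<alpha>))"

lemma topl_left_iff:
  assumes T: "is_iem T"
  shows "topl T \<alpha> = left_end T \<longleftrightarrow> pos_t T \<alpha> = 1" "botl T \<alpha> = left_end T \<longleftrightarrow> pos_b T \<alpha> = 1"
  using psum_pos[of "pos_t T" "len T" \<alpha>] psum_pos[of "pos_b T" "len T" \<alpha>]
    psum_first[of "pos_t T" \<alpha> "len T"] psum_first[of "pos_b T" \<alpha> "len T"] is_iemD[OF T]
  by (force simp: topl_def botl_def)+

lemma no_connection_keane:
  fixes T :: "'a::finite iem"
  assumes T: "is_iem T" and n: "no_connection T"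
  shows "keane T"
  unfolding keane_def
proof (intro allI impI notI)
  fix \<alpha> \<beta> assume t: "topl T \<alpha> \<noteq> left_end T" and b: "botl T \<beta> \<noteq> left_end T" and "connects T (botl T \<beta>) (topl T \<alpha>)"
  then obtain m where m: "\<forall>l<m. (iem_map T ^^ l) (botl T \<beta>) \<in> iem_dom T" "(iem_map T ^^ m) (botl T \<beta>) = topl T \<alpha>"
    by (auto simp: connects_def)
  have "1 \<le> pos_t T \<alpha>" "pos_t T \<alpha> \<le> CARD('a)" "1 \<le> pos_b T \<beta>" "pos_b T \<beta> \<le> CARD('a)"
    using numbering_range is_iemD[OF T] by blast+
  \<comment> \<open>The left endpoint of the letter in position i is the point of index i - 1, and
    this index is positive because the endpoint is not the leftmost one.\<close>
  then have "is_connection T (pos_t T \<alpha> - 1) (pos_b T \<beta> - 1) m"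
    unfolding is_connection_def using t b m topl_left_iff[OF T] upt_u_left[OF T] vpt_v_left[OF T] by auto
  then show False using n unfolding no_connection_def by blast
qed

lemma connects_refl: "connects T x x"
  unfolding connects_def by (rule exI[of _ 0]) simp

lemma connects_step: "x \<in> iem_dom T \<Longrightarrow> connects T (iem_map T x) y \<Longrightarrow> connects T x y"
  unfolding connects_def
proof (elim exE conjE)
  fix m assume "x \<in> iem_dom T" "\<forall>l<m. (iem_map T ^^ l) (iem_map T x) \<in> iem_dom T" "(iem_map T ^^ m) (iem_map T x) = y"
  then show "\<exists>m. (\<forall>l<m. (iem_map T ^^ l) x \<in> iem_dom T) \<and> (iem_map T ^^ m) x = y"
    by (intro exI[of _ "Suc m"]) (auto simp: funpow_swap1 less_Suc_eq_0_disj)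
qed

lemma connects_induct [consumes 1, case_names refl step]:
  assumes "connects T x y" "P y"
    "\<And>x. x \<in> iem_dom T \<Longrightarrow> connects T (iem_map T x) y \<Longrightarrow> P (iem_map T x) \<Longrightarrow> P x"
  shows "P x"
proof -
  obtain m where "\<forall>l<m. (iem_map T ^^ l) x \<in> iem_dom T" "(iem_map T ^^ m) x = y"
    using assms(1) by (auto simp: connects_def)
  then show ?thesis
  proof (induction m arbitrary: x)
    case 0 then show ?case using assms(2) by simp
  next
    case (Suc m)
    have a: "\<forall>l<m. (iem_map T ^^ l) (iem_map T x) \<in> iem_dom T" "(iem_map T ^^ m) (iem_map T x) = y"
      using Suc.prems by (auto simp: funpow_swap1 dest: spec[of _ "Suc _"])
    have "x \<in> iem_dom T" using Suc.prems(1) by (auto dest: spec[of _ 0])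
    moreover have "connects T (iem_map T x) y" unfolding connects_def using a by blast
    ultimately show ?case using Suc.IH[OF a] by (rule assms(3))
  qed
qed

lemma connects_trans: "connects T x y \<Longrightarrow> connects T y z \<Longrightarrow> connects T x z"
  by (induction rule: connects_induct) (auto intro: connects_step)

text \<open>Equality would make the last singularity of T coincide with that of its inverse, a
  connection with m = 0.\<close>

lemma keane_last:
  fixes T :: "'a::finite iem"
  assumes d: "CARD('a) \<ge> 2" and T: "is_iem T" and k: "keane T"
  shows "len T (last_b T) \<noteq> len T (last_t T)"
proof
  assume "len T (last_b T) = len T (last_t T)"
  then have "botl T (last_b T) = topl T (last_t T)" using last_endpoints[OF T] by simp
  then have "connects T (botl T (last_b T)) (topl T (last_t T))" by (simp add: connects_refl)
  then show False using k d topl_left_iff[OF T] last_pos[OF T] unfolding keane_def by (metis Suc_1 not_less_eq_eq order_refl One_nat_def)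
qed

text \<open>Each step of the induced map consists of one or two steps of T through the
  domain.\<close>

lemma connects_nxt:
  fixes T :: "'a::finite iem"
  assumes d: "CARD('a) \<ge> 2" and T: "is_iem T" and ne: "len T (last_b T) \<noteq> len T (last_t T)"
    and "connects (nxt T) x y"
  shows "connects T x y"
  using assms(4)
proof (induction rule: connects_induct)
  case refl show ?case by (rule connects_refl)
next
  case (step x)
  then obtain \<alpha> where a: "x \<in> top_int (nxt T) \<alpha>" by (auto simp: iem_dom_def)
  show ?case
  proof (cases "\<alpha> = loser T")
    case False
    note s = step_dom[OF d T ne a False]
    have "x \<in> iem_dom T" using s(1) unfolding iem_dom_def by blast
    then show ?thesis using step.IH unfolding s(2)[symmetric] by (rule connects_step)
  next
    case True
    note s = step_dom_loser[OF d T ne a[unfolded True]]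
    have "x \<in> iem_dom T" "iem_map T x \<in> iem_dom T" using s(1,2) unfolding iem_dom_def by blast+
    then show ?thesis using step.IH unfolding s(4)[symmetric] by (intro connects_step[of x] connects_step[of "iem_map T x"])
  qed
qed

text \<open>Only an endpoint of the loser can be new. On top it is mapped by T onto the old left
  endpoint of \<open>last_t\<close>; on the bottom it is the image of the old left endpoint of
  \<open>last_b\<close>. A connection after the step would therefore extend to one before
  it.\<close>

lemma keane_nxt:
  fixes T :: "'a::finite iem"
  assumes d: "CARD('a) \<ge> 2" and T: "is_iem T" and k: "keane T"
  shows "keane (nxt T)"
proof -
  note ne = keane_last[OF assms]
  note wl = winner_loser_cases[OF d T ne]
  have pos: "len T \<alpha> > 0" for \<alpha> by (rule is_iemD[OF T])
  have U: "\<exists>\<alpha>'. topl T \<alpha>' \<noteq> left_end T \<and> connects T (topl (nxt T) \<alpha>) (topl T \<alpha>')"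
    if t: "topl (nxt T) \<alpha> \<noteq> left_end T" for \<alpha>
  proof (cases "\<alpha> = loser T \<and> loser T = last_t T")
    case False
    then have "\<exists>\<alpha>'. topl (nxt T) \<alpha> = topl T \<alpha>'" using wl by (auto simp: step_topl[OF d T ne])
    then show ?thesis using t connects_refl by metis
  next
    case True
    then have w: "len T (last_t T) < len T (last_b T)" "loser T = last_t T" using wl last_neq[OF d T] by auto
    have e: "topl (nxt T) \<alpha> = topl T (last_b T) + len T (last_b T) - len T (last_t T)"
      using True by (simp add: step_topl[OF d T ne])
    have i: "topl (nxt T) \<alpha> \<in> top_int T (last_b T)" using w pos unfolding e by (auto simp: top_int_eq[OF T])
    have "iem_map T (topl (nxt T) \<alpha>) = topl T (last_t T)"
      using iem_map_eq[OF T i] e last_endpoints[OF T] by (simp add: shift_def)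
    then have "connects T (topl (nxt T) \<alpha>) (topl T (last_t T))"
      using i connects_step[OF _ connects_refl] by (metis UN_I UNIV_I iem_dom_def)
    moreover have "topl T (last_t T) \<noteq> left_end T"
      using last_endpoints[OF T] w iem_bounds[OF T, of "last_b T"] by auto
    ultimately show ?thesis by blast
  qed
  have V: "\<exists>\<beta>'. botl T \<beta>' \<noteq> left_end T \<and> connects T (botl T \<beta>') (botl (nxt T) \<beta>)"
    if t: "botl (nxt T) \<beta> \<noteq> left_end T" for \<beta>
  proof (cases "\<beta> = loser T \<and> loser T = last_b T")
    case False
    then have "\<exists>\<beta>'. botl (nxt T) \<beta> = botl T \<beta>'" using wl by (auto simp: step_botl[OF d T ne])
    then show ?thesis using t connects_refl by metis
  next
    case True
    then have w: "len T (last_b T) < len T (last_t T)" "loser T = last_b T" using wl last_neq[OF d T] by auto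
    have e: "botl (nxt T) \<beta> = botl T (last_t T) + len T (last_t T) - len T (last_b T)"
      using True by (simp add: step_botl[OF d T ne])
    have i: "botl T (last_b T) \<in> top_int T (last_t T)"
      using w pos[of "last_b T"] last_endpoints[OF T] by (auto simp: top_int_eq[OF T])
    have "iem_map T (botl T (last_b T)) = botl (nxt T) \<beta>"
      using iem_map_eq[OF T i] e last_endpoints[OF T] by (simp add: shift_def)
    then have "connects T (botl T (last_b T)) (botl (nxt T) \<beta>)"
      using i connects_step[OF _ connects_refl] by (metis UN_I UNIV_I iem_dom_def)
    moreover have "botl T (last_b T) \<noteq> left_end T"
      using last_endpoints[OF T] w iem_bounds[OF T, of "last_t T"] by auto
    ultimately show ?thesis by blast
  qed
  show ?thesis
    unfolding keane_def nxt_left_end[OF d T ne]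
  proof (intro allI impI notI)
    fix \<alpha> \<beta> assume "topl (nxt T) \<alpha> \<noteq> left_end T" "botl (nxt T) \<beta> \<noteq> left_end T"
      and "connects (nxt T) (botl (nxt T) \<beta>) (topl (nxt T) \<alpha>)"
    then show False
      using U[of \<alpha>] V[of \<beta>] connects_nxt[OF d T ne] connects_trans k unfolding keane_def by metis
  qed
qed


subsection \<open>Iterating the algorithm\<close>

definition good :: "'a::finite iem \<Rightarrow> bool" where
  "good T \<longleftrightarrow> CARD('a) \<ge> 2 \<and> is_iem T \<and> keane T"

lemma goodD:
  assumes "good (T :: 'a::finite iem)"
  shows "CARD('a) \<ge> 2" "is_iem T" "keane T" "len T (last_b T) \<noteq> len T (last_t T)"
  using assms keane_last unfolding good_def by auto

lemma good_rauzy: "good T \<Longrightarrow> good (rauzy T)"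
proof -
  assume T: "good T"
  note g = goodD[OF T]
  show ?thesis unfolding good_def rauzy_eq_nxt[OF g(1,2,4)]
    using g(1) nxt_is_iem[OF g(1,2,4)] keane_nxt[OF g(1-3)] by blast
qed

lemma rv_0 [simp]: "rv T 0 = T" by (simp add: rv_def)

lemma rv_Suc: "rv T (Suc n) = rauzy (rv T n)" by (simp add: rv_def)

lemma rv_add: "rv T (m + k) = rv (rv T m) k"
  by (simp add: rv_def funpow_add add.commute[of m k])

lemma good_rv: "good T \<Longrightarrow> good (rv T n)"
  by (induction n) (auto simp: rv_Suc good_rauzy)

lemma rv_Suc_nxt: "good T \<Longrightarrow> rv T (Suc n) = nxt (rv T n)"
  unfolding rv_Suc by (intro rauzy_eq_nxt goodD good_rv)

lemma rv_is_iem: "good T \<Longrightarrow> is_iem (rv T n)"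
  using goodD(2)[OF good_rv] .

text \<open>Special Birkhoff sums built from elementary steps: the sum over the loser's tower is the
  sum over two stacked towers. Being a total function for each label, \<open>Sb\<close> contains its
  own continuous extension to the closed interval, so no limits occur before
  \<open>special_birkhoff_eq\<close>.\<close>

primrec Sb :: "'a::finite iem \<Rightarrow> nat \<Rightarrow> 'a pfun \<Rightarrow> 'a pfun" where
  "Sb T 0 \<phi> = \<phi>"
| "Sb T (Suc n) \<phi> = (\<lambda>\<alpha> x. if \<alpha> = loser (rv T n)
     then Sb T n \<phi> (last_b (rv T n)) x + Sb T n \<phi> (last_t (rv T n)) (x + shift (rv T n) (last_b (rv T n)))
     else Sb T n \<phi> \<alpha> x)"

definition step_mat :: "'a::finite iem \<Rightarrow> real^'a^'a" where
  "step_mat T = (\<chi> \<alpha> \<beta>. (if \<alpha> = \<beta> then 1 else 0) + (if \<alpha> = loser T \<and> \<beta> = winner T then 1 else 0))"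

primrec Bp :: "'a::finite iem \<Rightarrow> nat \<Rightarrow> real^'a^'a" where
  "Bp T 0 = mat 1"
| "Bp T (Suc n) = step_mat (rv T n) ** Bp T n"

lemma step_mat_mult: "(step_mat T *v c) $ \<alpha> = c $ \<alpha> + (if \<alpha> = loser T then c $ winner T else 0)"
proof -
  have "(step_mat T *v c) $ \<alpha> = (\<Sum>\<beta>\<in>UNIV. (if \<alpha> = \<beta> then c $ \<beta> else 0)) +
     (\<Sum>\<beta>\<in>UNIV. (if \<alpha> = loser T \<and> \<beta> = winner T then c $ \<beta> else 0))"
    unfolding matrix_vector_mult_def step_mat_def
    unfolding sum.distrib[symmetric] vec_lambda_beta by (intro sum.cong) auto
  also have "(\<Sum>\<beta>\<in>UNIV. (if \<alpha> = loser T \<and> \<beta> = winner T then c $ \<beta> else 0)) = (if \<alpha> = loser T then c $ winner T else 0)"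
    by (cases "\<alpha> = loser T") auto
  finally show ?thesis by simp
qed

lemma step_mat_transpose_mult:
  "(transpose (step_mat T) *v c) $ \<beta> = push (winner T) (loser T) (($) c) \<beta>"
proof -
  have "(transpose (step_mat T) *v c) $ \<beta> = (\<Sum>\<alpha>\<in>UNIV. (if \<alpha> = \<beta> then c $ \<alpha> else 0)) +
     (\<Sum>\<alpha>\<in>UNIV. (if \<beta> = winner T \<and> \<alpha> = loser T then c $ \<alpha> else 0))"
    unfolding matrix_vector_mult_def step_mat_def transpose_def
    unfolding sum.distrib[symmetric] vec_lambda_beta by (intro sum.cong) auto
  also have "(\<Sum>\<alpha>\<in>UNIV. (if \<beta> = winner T \<and> \<alpha> = loser T then c $ \<alpha> else 0)) = (if \<beta> = winner T then c $ loser T else 0)"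
    by (cases "\<beta> = winner T") auto
  finally show ?thesis by (simp add: push_def)
qed

lemma Bp_add: "Bp T (m + k) = Bp (rv T m) k ** Bp T m"
  by (induction k) (auto simp: rv_add matrix_mul_assoc)

lemma Sb_add: "Sb T n (\<lambda>\<alpha> x. a * \<phi> \<alpha> x + b * \<psi> \<alpha> x) = (\<lambda>\<alpha> x. a * Sb T n \<phi> \<alpha> x + b * Sb T n \<psi> \<alpha> x)"
  by (induction n) (auto simp: fun_eq_iff algebra_simps)

lemma last_winner_loser:
  "last_b T = loser T \<and> last_t T = winner T \<or> last_b T = winner T \<and> last_t T = loser T"
  by (simp add: loser_def winner_def)

lemma Sb_gamma: "Sb T n (gamma_fun c) \<alpha> x = (Bp T n *v c) $ \<alpha>"
proof (induction n arbitrary: \<alpha> x)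
  case 0 then show ?case by (simp add: gamma_fun_def)
next
  case (Suc n)
  have "(Bp T (Suc n) *v c) $ \<alpha> = (step_mat (rv T n) *v (Bp T n *v c)) $ \<alpha>"
    by (simp add: matrix_vector_mul_assoc)
  then show ?case using last_winner_loser[of "rv T n"] by (auto simp: Suc.IH step_mat_mult)
qed

text \<open>For the loser the orbit is the concatenation of two returns to I(n), of lengths N and M,
  whose junction lies in the part of I(n) that is cut off. The quantifier over \<phi> stands inside,
  so that one return time serves all functions, in particular indicator functions.\<close>

lemma return_structure:
  fixes T :: "'a::finite iem"
  assumes T: "good T" and "x \<in> top_int (rv T n) \<alpha>"
  shows "\<exists>N>0. (iem_map T ^^ N) x = iem_map (rv T n) x \<and>
    (\<forall>i. 0 < i \<and> i < N \<longrightarrow> (iem_map T ^^ i) x \<notin> whole_int (rv T n)) \<and>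
    (\<forall>i<N. (iem_map T ^^ i) x \<in> iem_dom T) \<and>
    (\<forall>\<phi>. (\<Sum>j<N. \<phi> (label_of T ((iem_map T ^^ j) x)) ((iem_map T ^^ j) x)) = Sb T n \<phi> \<alpha> x)"
  using assms(2)
proof (induction n arbitrary: x \<alpha>)
  case 0
  then show ?case using goodD(2)[OF T]
    by (intro exI[of _ 1]) (auto simp: iem_dom_def label_of_eq)
next
  case (Suc n)
  let ?S = "rv T n"
  note S = goodD[OF good_rv[OF T, of n]]
  note R = rv_Suc_nxt[OF T, of n]
  note step = step_dom[OF S(1,2,4)] step_dom_loser[OF S(1,2,4)] step_whole_subset[OF S(1,2,4)]
  show ?case
  proof (cases "\<alpha> = loser ?S")
    case False
    note s = step(1,2)[OF Suc.prems[unfolded R] False]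
    from Suc.IH[OF s(1)] obtain N where N: "N > 0" "(iem_map T ^^ N) x = iem_map ?S x"
      "\<forall>i. 0 < i \<and> i < N \<longrightarrow> (iem_map T ^^ i) x \<notin> whole_int ?S"
      "\<forall>i<N. (iem_map T ^^ i) x \<in> iem_dom T"
      "\<forall>\<phi>. (\<Sum>j<N. \<phi> (label_of T ((iem_map T ^^ j) x)) ((iem_map T ^^ j) x)) = Sb T n \<phi> \<alpha> x" by blast
    show ?thesis unfolding R
      using N s(2) step(7) False by (intro exI[of _ N]) (auto simp: R[symmetric])
  next
    case True
    note s = step(3-6)[OF Suc.prems[unfolded R True]]
    define y where "y = iem_map ?S x"
    from Suc.IH[OF s(1)] obtain N where N: "N > 0" "(iem_map T ^^ N) x = y"
      "\<forall>i. 0 < i \<and> i < N \<longrightarrow> (iem_map T ^^ i) x \<notin> whole_int ?S"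
      "\<forall>i<N. (iem_map T ^^ i) x \<in> iem_dom T"
      "\<forall>\<phi>. (\<Sum>j<N. \<phi> (label_of T ((iem_map T ^^ j) x)) ((iem_map T ^^ j) x)) = Sb T n \<phi> (last_b ?S) x"
      unfolding y_def by blast
    from Suc.IH[OF s(2)] obtain M where M: "M > 0" "(iem_map T ^^ M) y = iem_map ?S y"
      "\<forall>i. 0 < i \<and> i < M \<longrightarrow> (iem_map T ^^ i) y \<notin> whole_int ?S"
      "\<forall>i<M. (iem_map T ^^ i) y \<in> iem_dom T"
      "\<forall>\<phi>. (\<Sum>j<M. \<phi> (label_of T ((iem_map T ^^ j) y)) ((iem_map T ^^ j) y)) = Sb T n \<phi> (last_t ?S) y"
      unfolding y_def[symmetric] by blast
    have it: "(iem_map T ^^ (i + N)) x = (iem_map T ^^ i) y" for i using N(2) by (simp add: funpow_add)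
    have sh: "y = x + shift ?S (last_b ?S)" unfolding y_def by (rule iem_map_eq[OF S(2) s(1)])
    have it': "(iem_map T ^^ i) x = (iem_map T ^^ (i - N)) y" if "N \<le> i" for i
      using it[of "i - N"] that by simp
    have sum: "(\<Sum>j<M+N. f ((iem_map T ^^ j) x)) = (\<Sum>j<N. f ((iem_map T ^^ j) x)) + (\<Sum>j<M. f ((iem_map T ^^ j) y))"
      for f :: "real \<Rightarrow> real"
    proof -
      have "(\<Sum>j<M+N. f ((iem_map T ^^ j) x)) = (\<Sum>j<N. f ((iem_map T ^^ j) x)) + (\<Sum>j=N..<M+N. f ((iem_map T ^^ j) x))"
        using sum.atLeastLessThan_concat[of 0 N "M+N" "\<lambda>j. f ((iem_map T ^^ j) x)"] by (simp add: atLeast0LessThan)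
      also have "(\<Sum>j=N..<M+N. f ((iem_map T ^^ j) x)) = (\<Sum>j<M. f ((iem_map T ^^ j) y))"
        using sum.shift_bounds_nat_ivl[of "\<lambda>j. f ((iem_map T ^^ j) x)" 0 N M] it by (simp add: atLeast0LessThan)
      finally show ?thesis .
    qed
    have notin: "(iem_map T ^^ i) x \<notin> whole_int (nxt ?S)" if i: "0 < i" "i < M + N" for i
    proof -
      consider "i < N" | "i = N" | "N < i" by linarith
      then show ?thesis
      proof cases
        case 1 then show ?thesis using N(3) i step(7) by auto
      next
        case 2 then show ?thesis using N(2) s(3) by (simp add: y_def)
      next
        case 3
        then have "0 < i - N" "i - N < M" using i by auto
        then show ?thesis using M(3) it'[of i] 3 step(7) by auto
      qed
    qed
    have dom: "(iem_map T ^^ i) x \<in> iem_dom T" if i: "i < M + N" for i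
      using N(4) M(4) it'[of i] i by (cases "i < N") auto
    show ?thesis unfolding R
    proof (intro exI[of _ "M + N"] conjI allI impI)
      show "0 < M + N" using N by simp
      show "(iem_map T ^^ (M + N)) x = iem_map (nxt ?S) x" using it[of M] M(2) s(4) by (simp add: y_def)
      show "(\<Sum>j<M+N. \<phi> (label_of T ((iem_map T ^^ j) x)) ((iem_map T ^^ j) x)) = Sb T (Suc n) \<phi> \<alpha> x" for \<phi>
        using sum[of "\<lambda>y. \<phi> (label_of T y) y"] N(5) M(5) True by (simp add: sh)
    qed (use notin dom in auto)
  qed
qed

text \<open>Visits to an interval are counted by the Birkhoff sum of its indicator, the piecewise
  constant function of an \<open>axis\<close> vector; so both claims come from the same structure of
  returns.\<close>

lemma
  assumes T: "good T" and x: "x \<in> top_int (rv T n) \<alpha>"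
  shows birkhoff_open_eq: "birkhoff_open T 0 n \<phi> x = Sb T n \<phi> \<alpha> x"
    and visits_eq: "real (card {j. j < return_time T (whole_int (rv T n)) x \<and> (iem_map T ^^ j) x \<in> top_int T \<beta>}) = Bp T n $ \<alpha> $ \<beta>"
proof -
  obtain N where N: "N > 0" "(iem_map T ^^ N) x = iem_map (rv T n) x"
      "\<forall>i. 0 < i \<and> i < N \<longrightarrow> (iem_map T ^^ i) x \<notin> whole_int (rv T n)"
      "\<forall>i<N. (iem_map T ^^ i) x \<in> iem_dom T"
      "\<forall>\<phi>. (\<Sum>j<N. \<phi> (label_of T ((iem_map T ^^ j) x)) ((iem_map T ^^ j) x)) = Sb T n \<phi> \<alpha> x"
    using return_structure[OF assms] by blast
  have "iem_map (rv T n) x \<in> whole_int (rv T n)"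
    using x by (intro iem_map_whole rv_is_iem T) (auto simp: iem_dom_def)
  then have r: "return_time T (whole_int (rv T n)) x = N" using N by (intro return_timeI) auto
  show "birkhoff_open T 0 n \<phi> x = Sb T n \<phi> \<alpha> x" using N(5) by (simp add: birkhoff_open_def r Let_def)
  have lab: "(iem_map T ^^ j) x \<in> top_int T \<beta> \<longleftrightarrow> label_of T ((iem_map T ^^ j) x) = \<beta>" if "j < N" for j
    using N(4) that label_of_eq[OF goodD(2)[OF T]] by (fastforce simp: iem_dom_def)
  have "real (card {j. j < N \<and> (iem_map T ^^ j) x \<in> top_int T \<beta>}) =
      (\<Sum>j<N. if (iem_map T ^^ j) x \<in> top_int T \<beta> then 1 else 0)"
    by (simp add: sum.If_cases lessThan_def Int_def)
  also have "\<dots> = (\<Sum>j<N. gamma_fun (axis \<beta> 1) (label_of T ((iem_map T ^^ j) x)) ((iem_map T ^^ j) x))"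
    using lab by (intro sum.cong) (auto simp: gamma_fun_def axis_def)
  also have "\<dots> = (Bp T n *v axis \<beta> 1) $ \<alpha>" using N(5) Sb_gamma by metis
  also have "\<dots> = Bp T n $ \<alpha> $ \<beta>" by (simp add: matrix_vector_mul_component inner_axis)
  finally show "real (card {j. j < return_time T (whole_int (rv T n)) x \<and> (iem_map T ^^ j) x \<in> top_int T \<beta>}) = Bp T n $ \<alpha> $ \<beta>"
    by (simp add: r)
qed

lemma Bmat_eq:
  assumes "good T" "m \<le> n"
  shows "Bmat T m n = Bp (rv T m) (n - m)"
proof -
  have n: "rv T n = rv (rv T m) (n - m)" using rv_add[of T m "n - m"] assms(2) by simp
  note S = good_rv[OF assms(1), of m]
  have "(upt_u (rv T n) (pos_t (rv T n) \<alpha> - 1) + upt_u (rv T n) (pos_t (rv T n) \<alpha>)) / 2 \<in> top_int (rv T n) \<alpha>" for \<alpha>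
    using is_iemD(1)[OF rv_is_iem[OF assms(1)], of n \<alpha>]
    by (simp add: upt_u_left upt_u_right top_int_eq rv_is_iem[OF assms(1)] del: One_nat_def)
  then show ?thesis unfolding Bmat_def Let_def n
    using visits_eq[OF S] by (simp add: vec_eq_iff del: One_nat_def)
qed

subsection \<open>Every letter wins infinitely often\<close>

lemma nxt_pos:
  fixes S :: "'a::finite iem"
  shows "winner S = last_t S \<and> loser S = last_b S \<and> pos_t (nxt S) = pos_t S \<and>
      pos_b (nxt S) = move_last (pos_b S) (winner S) (loser S) \<or>
    winner S = last_b S \<and> loser S = last_t S \<and> pos_b (nxt S) = pos_b S \<and>
      pos_t (nxt S) = move_last (pos_t S) (winner S) (loser S)"
  by (simp add: nxt_def winner_def loser_def)

text \<open>A step changes only the order in which the loser was last, so the winner is still last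
  in the other one and takes part in the next step.\<close>

lemma winner_stays_last:
  fixes T :: "'a::finite iem"
  assumes "good T"
  shows "winner (rv T n) = winner (rv T (Suc n)) \<or> winner (rv T n) = loser (rv T (Suc n))"
proof -
  have "winner (rv T n) = last_t (rv T (Suc n)) \<or> winner (rv T n) = last_b (rv T (Suc n))"
    using nxt_pos[of "rv T n"] unfolding rv_Suc_nxt[OF assms] last_t_def last_b_def by metis
  then show ?thesis using last_winner_loser[of "rv T (Suc n)"] by auto
qed

text \<open>A letter that is not last keeps its place or moves to the right; it keeps both places only
  if the winner is to the right of it in both orders.\<close>

lemma nxt_pos_other:
  fixes S :: "'a::finite iem"
  assumes S: "good S" and a: "\<alpha> \<noteq> winner S" "\<alpha> \<noteq> loser S"
  shows nxt_pos_mono: "pos_t S \<alpha> \<le> pos_t (nxt S) \<alpha>" "pos_b S \<alpha> \<le> pos_b (nxt S) \<alpha>"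
    and nxt_pos_winner: "pos_t (nxt S) \<alpha> = pos_t S \<alpha> \<Longrightarrow> pos_b (nxt S) \<alpha> = pos_b S \<alpha> \<Longrightarrow>
      pos_t S \<alpha> < pos_t S (winner S) \<and> pos_b S \<alpha> < pos_b S (winner S)"
    and nxt_pos_right: "pos_t S \<alpha> < pos_t S (winner S) \<Longrightarrow> pos_b S \<alpha> < pos_b S (winner S) \<Longrightarrow>
      pos_t S \<alpha> < pos_t S \<beta> \<Longrightarrow> pos_b S \<alpha> < pos_b S \<beta> \<Longrightarrow>
      pos_t (nxt S) \<alpha> < pos_t (nxt S) \<beta> \<and> pos_b (nxt S) \<alpha> < pos_b (nxt S) \<beta>"
proof -
  note T = goodD[OF S]
  have i: "pos_t S x = pos_t S y \<longleftrightarrow> x = y" "pos_b S x = pos_b S y \<longleftrightarrow> x = y" for x y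
    using numbering_inj is_iemD[OF T(2)] by blast+
  have le: "pos_t S x \<le> pos_t S (last_t S)" "pos_b S x \<le> pos_b S (last_b S)" for x
    using numbering_range is_iemD[OF T(2)] last_pos[OF T(2)] by metis+
  have lt: "pos_t S \<alpha> < pos_t S (last_t S)" "pos_b S \<alpha> < pos_b S (last_b S)"
    using a i le[of \<alpha>] last_winner_loser[of S] by (metis nat_less_le)+
  show "pos_t S \<alpha> \<le> pos_t (nxt S) \<alpha>" "pos_b S \<alpha> \<le> pos_b (nxt S) \<alpha>"
    using nxt_pos[of S] a by (auto simp: move_last_def)
  show "pos_t S \<alpha> < pos_t S (winner S) \<and> pos_b S \<alpha> < pos_b S (winner S)"
    if "pos_t (nxt S) \<alpha> = pos_t S \<alpha>" "pos_b (nxt S) \<alpha> = pos_b S \<alpha>"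
    using nxt_pos[of S] that a lt i[of \<alpha> "winner S"] by (auto simp: move_last_def split: if_splits)
  show "pos_t (nxt S) \<alpha> < pos_t (nxt S) \<beta> \<and> pos_b (nxt S) \<alpha> < pos_b (nxt S) \<beta>"
    if "pos_t S \<alpha> < pos_t S (winner S)" "pos_b S \<alpha> < pos_b S (winner S)"
      "pos_t S \<alpha> < pos_t S \<beta>" "pos_b S \<alpha> < pos_b S \<beta>"
    using nxt_pos[of S] that a by (auto simp: move_last_def)
qed

lemma eventually_constant_nat:
  fixes f :: "nat \<Rightarrow> nat"
  assumes "\<And>n. N \<le> n \<Longrightarrow> f n \<le> f (Suc n)" "\<And>n. f n \<le> d"
  shows "\<exists>M\<ge>N. \<forall>n\<ge>M. f n = f M"
proof -
  have fin: "finite (f ` {N..})" by (rule finite_subset[of _ "{..d}"]) (use assms(2) in auto)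
  then have "Max (f ` {N..}) \<in> f ` {N..}" by (intro Max_in) auto
  then obtain M where M: "M \<ge> N" "f M = Max (f ` {N..})" by auto
  have "f n = f M" if "n \<ge> M" for n
  proof (rule antisym)
    show "f n \<le> f M" using M fin that by auto
    show "f M \<le> f n" using that
    proof (induction n rule: dec_induct)
      case (step n)
      then show ?case using assms(1)[of n] M by linarith
    qed simp
  qed
  then show ?thesis using M by blast
qed

lemma eventually_all_finite:
  fixes P :: "'a::finite \<Rightarrow> nat \<Rightarrow> bool"
  assumes "\<And>\<alpha>. \<exists>M. \<forall>n\<ge>M. P \<alpha> n"
  shows "\<exists>M\<ge>N. \<forall>n\<ge>M. \<forall>\<alpha>. P \<alpha> n"
proof -
  obtain M where M: "\<And>\<alpha> n. n \<ge> M \<alpha> \<Longrightarrow> P \<alpha> n" using assms by metis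
  show ?thesis
  proof (intro exI[of _ "max N (Max (range M))"] conjI allI impI)
    fix n \<alpha> assume "max N (Max (range M)) \<le> n"
    moreover have "M \<alpha> \<le> Max (range M)" by (intro Max_ge) auto
    ultimately show "P \<alpha> n" using M by auto
  qed auto
qed

lemma rv_len_pos: "good T \<Longrightarrow> len (rv T n) \<alpha> > 0"
  using is_iemD(1)[OF rv_is_iem] .

lemma rv_len_Suc:
  "good T \<Longrightarrow> len (rv T (Suc n)) \<alpha> =
    (if \<alpha> = winner (rv T n) then len (rv T n) \<alpha> - len (rv T n) (loser (rv T n)) else len (rv T n) \<alpha>)"
  unfolding rv_Suc_nxt by (intro step_len goodD good_rv)

lemma rv_left_end: "good T \<Longrightarrow> left_end (rv T n) = left_end T"
proof (induction n)
  case (Suc n)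
  then show ?case unfolding rv_Suc_nxt[OF Suc.prems]
    using nxt_left_end[OF goodD(1,2,4)[OF good_rv[OF Suc.prems]]] by metis
qed simp

lemma rv_right_end_Suc:
  "good T \<Longrightarrow> right_end (rv T (Suc n)) = right_end (rv T n) - len (rv T n) (loser (rv T n))"
  unfolding rv_Suc_nxt by (intro step_right_end goodD good_rv)

text \<open>Let A be the set of letters that win infinitely often. A letter outside A eventually
  keeps its length, so it loses only finitely often; after that its positions can only increase,
  hence stabilise. Stability forces all of A to its right in both orders, so the complement of A is
  a common initial segment, and irreducibility leaves it empty.\<close>

lemma wins_infinitely_often:
  fixes T :: "'a::finite iem"
  assumes T: "good T"
  shows "\<exists>n\<ge>N. winner (rv T n) = \<alpha>"
proof -
  define A where "A = {\<alpha>. \<forall>N. \<exists>n\<ge>N. winner (rv T n) = \<alpha>}"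
  have "\<exists>N1\<ge>0. \<forall>n\<ge>N1. \<forall>\<alpha>. \<alpha> \<notin> A \<longrightarrow> winner (rv T n) \<noteq> \<alpha>"
    by (rule eventually_all_finite) (unfold A_def, blast)
  then obtain N1 where N1: "\<And>n. n \<ge> N1 \<Longrightarrow> winner (rv T n) \<in> A" by blast
  have const: "len (rv T n) \<alpha> = len (rv T N1) \<alpha>" if "\<alpha> \<notin> A" "n \<ge> N1" for n \<alpha>
    using that(2)
  proof (induction n rule: dec_induct)
    case (step n)
    then show ?case using N1[of n] that(1) by (auto simp: rv_len_Suc[OF T])
  qed simp
  \<comment> \<open>Each loss shortens I(n) by the length of the loser, constant from N1 on for a
    letter outside A; the right ends converge, so the amounts cut off tend to zero.\<close>
  have lose: "\<exists>M. \<forall>n\<ge>M. \<alpha> \<notin> A \<longrightarrow> loser (rv T n) \<noteq> \<alpha>" for \<alpha>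
  proof (cases "\<alpha> \<in> A")
    case False
    define c where "c = len (rv T N1) \<alpha>"
    have c: "c > 0" unfolding c_def by (rule rv_len_pos[OF T])
    let ?r = "\<lambda>n. right_end (rv T n)"
    have "decseq ?r"
      using rv_len_pos[OF T] by (intro decseq_SucI) (simp add: rv_right_end_Suc[OF T] less_imp_le)
    moreover have "left_end T \<le> ?r n" for n
      using iem_bounds[OF rv_is_iem[OF T], of n \<alpha>] rv_len_pos[OF T, of n \<alpha>] rv_left_end[OF T, of n] by linarith
    ultimately obtain L where L: "?r \<longlonglongrightarrow> L" using decseq_convergent by blast
    have "(\<lambda>n. ?r n - ?r (Suc n)) \<longlonglongrightarrow> L - L" by (intro tendsto_diff L LIMSEQ_Suc)
    then have "eventually (\<lambda>n. ?r n - ?r (Suc n) < c) sequentially"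
      using c by (intro order_tendstoD) auto
    then obtain M where M: "\<And>n. n \<ge> M \<Longrightarrow> ?r n - ?r (Suc n) < c" by (auto simp: eventually_sequentially)
    have "loser (rv T n) \<noteq> \<alpha>" if "n \<ge> max M N1" for n
    proof
      assume "loser (rv T n) = \<alpha>"
      then show False using M[of n] const[OF False, of n] that by (auto simp: rv_right_end_Suc[OF T] c_def)
    qed
    then show ?thesis by blast
  qed auto
  have "\<exists>M\<ge>N1. \<forall>n\<ge>M. \<forall>\<alpha>. \<alpha> \<notin> A \<longrightarrow> loser (rv T n) \<noteq> \<alpha>"
    by (rule eventually_all_finite) (rule lose)
  then obtain N2 where N2: "N2 \<ge> N1" "\<And>n \<alpha>. n \<ge> N2 \<Longrightarrow> \<alpha> \<notin> A \<Longrightarrow> loser (rv T n) \<noteq> \<alpha>"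
    by blast
  have mono: "pos_t (rv T n) \<alpha> \<le> pos_t (rv T (Suc n)) \<alpha>" "pos_b (rv T n) \<alpha> \<le> pos_b (rv T (Suc n)) \<alpha>"
    if "\<alpha> \<notin> A" "n \<ge> N2" for n \<alpha>
    using nxt_pos_mono[OF good_rv[OF T, of n], of \<alpha>] N1[of n] N2 that unfolding rv_Suc_nxt[OF T]
    by (metis le_trans)+
  have bd: "pos_t (rv T n) \<alpha> \<le> CARD('a)" "pos_b (rv T n) \<alpha> \<le> CARD('a)" for n \<alpha>
    using numbering_range is_iemD[OF rv_is_iem[OF T]] by blast+
  have stab: "\<exists>M. \<forall>n\<ge>M. \<alpha> \<notin> A \<longrightarrow> pos_t (rv T (Suc n)) \<alpha> = pos_t (rv T n) \<alpha> \<and> pos_b (rv T (Suc n)) \<alpha> = pos_b (rv T n) \<alpha>" for \<alpha>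
  proof (cases "\<alpha> \<in> A")
    case False
    obtain M1 where "M1 \<ge> N2" "\<forall>n\<ge>M1. pos_t (rv T n) \<alpha> = pos_t (rv T M1) \<alpha>"
      using eventually_constant_nat[of N2 "\<lambda>n. pos_t (rv T n) \<alpha>" "CARD('a)"] mono[OF False] bd by blast
    moreover obtain M2 where "M2 \<ge> N2" "\<forall>n\<ge>M2. pos_b (rv T n) \<alpha> = pos_b (rv T M2) \<alpha>"
      using eventually_constant_nat[of N2 "\<lambda>n. pos_b (rv T n) \<alpha>" "CARD('a)"] mono[OF False] bd by blast
    ultimately show ?thesis by (intro exI[of _ "max M1 M2"]) (metis le_SucI max.bounded_iff)
  qed auto
  have "\<exists>M\<ge>N2. \<forall>n\<ge>M. \<forall>\<alpha>. \<alpha> \<notin> A \<longrightarrow>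
      pos_t (rv T (Suc n)) \<alpha> = pos_t (rv T n) \<alpha> \<and> pos_b (rv T (Suc n)) \<alpha> = pos_b (rv T n) \<alpha>"
    by (rule eventually_all_finite) (rule stab)
  then obtain N3 where N3: "N3 \<ge> N2"
    and N3a: "\<forall>n\<ge>N3. \<forall>\<alpha>. \<alpha> \<notin> A \<longrightarrow> pos_t (rv T (Suc n)) \<alpha> = pos_t (rv T n) \<alpha> \<and> pos_b (rv T (Suc n)) \<alpha> = pos_b (rv T n) \<alpha>"
    by (elim exE conjE) (rule that)
  have N3': "pos_t (rv T (Suc n)) \<alpha> = pos_t (rv T n) \<alpha>" "pos_b (rv T (Suc n)) \<alpha> = pos_b (rv T n) \<alpha>"
    if "n \<ge> N3" "\<alpha> \<notin> A" for n \<alpha>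
    using N3a[rule_format, OF that] by simp_all
  \<comment> \<open>The current winner has this relation because the letters outside A no longer
    move, and the relation persists; every letter of A acquires it at its next win.\<close>
  define R where "R n \<beta> \<longleftrightarrow> (\<forall>\<alpha>. \<alpha> \<notin> A \<longrightarrow> pos_t (rv T n) \<alpha> < pos_t (rv T n) \<beta> \<and> pos_b (rv T n) \<alpha> < pos_b (rv T n) \<beta>)" for n \<beta>
  have notwl: "\<alpha> \<noteq> winner (rv T n)" "\<alpha> \<noteq> loser (rv T n)" if "\<alpha> \<notin> A" "n \<ge> N3" for n \<alpha>
    using N1[of n] N2(1) N2(2)[of n \<alpha>] N3 that by auto
  have Rw: "R n (winner (rv T n))" if "n \<ge> N3" for n
    unfolding R_def
  proof (intro allI impI)
    fix \<alpha> assume "\<alpha> \<notin> A"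
    note a = this
    show "pos_t (rv T n) \<alpha> < pos_t (rv T n) (winner (rv T n)) \<and> pos_b (rv T n) \<alpha> < pos_b (rv T n) (winner (rv T n))"
      by (rule nxt_pos_winner[OF good_rv[OF T] notwl[OF a that] N3'[OF that a, unfolded rv_Suc_nxt[OF T]]])
  qed
  have RS: "R (Suc n) \<beta>" if "n \<ge> N3" "R n \<beta>" for n \<beta>
    unfolding R_def
  proof (intro allI impI)
    fix \<alpha> assume "\<alpha> \<notin> A"
    note a = this
    show "pos_t (rv T (Suc n)) \<alpha> < pos_t (rv T (Suc n)) \<beta> \<and> pos_b (rv T (Suc n)) \<alpha> < pos_b (rv T (Suc n)) \<beta>"
      unfolding rv_Suc_nxt[OF T]
      by (intro nxt_pos_right[OF good_rv[OF T] notwl[OF a that(1)]])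
         (use Rw[OF that(1)] that(2) a in \<open>unfold R_def, blast\<close>)+
  qed
  have ev: "\<exists>M. \<forall>n\<ge>M. \<beta> \<in> A \<longrightarrow> R n \<beta>" for \<beta>
  proof (cases "\<beta> \<in> A")
    case True
    then obtain k where k: "k \<ge> N3" "winner (rv T k) = \<beta>" by (auto simp: A_def)
    have "R n \<beta>" if "n \<ge> k" for n using that
    proof (induction n rule: dec_induct)
      case base then show ?case using Rw[OF k(1)] k(2) by simp
    next
      case (step n) then show ?case using RS[of n \<beta>] k(1) by simp
    qed
    then show ?thesis by blast
  qed auto
  have "\<exists>M\<ge>0. \<forall>n\<ge>M. \<forall>\<beta>. \<beta> \<in> A \<longrightarrow> R n \<beta>"
    by (rule eventually_all_finite) (rule ev)
  then obtain M where M: "\<And>\<beta>. \<beta> \<in> A \<Longrightarrow> R M \<beta>" by blast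
  have sep: "pos_t (rv T M) x < pos_t (rv T M) y \<and> pos_b (rv T M) x < pos_b (rv T M) y"
    if "x \<in> - A" "y \<notin> - A" for x y
    using M[of y] that unfolding R_def by blast
  have "pos_t (rv T M) -` {1..card (- A)} = - A" "pos_b (rv T M) -` {1..card (- A)} = - A"
    using sep by (intro numbering_initial is_iemD(2,3)[OF rv_is_iem[OF T]]; blast)+
  then have e: "pos_t (rv T M) -` {1..card (- A)} = pos_b (rv T M) -` {1..card (- A)}" by simp
  have "winner (rv T N1) \<in> A" by (rule N1) simp
  then have "- A \<subset> UNIV" by auto
  then have "card (- A) < CARD('a)" by (intro psubset_card_mono) auto
  then have "\<not> 1 \<le> card (- A)"
    using e is_iemD(4)[OF rv_is_iem[OF T, of M]] unfolding irreducible_data_def by blast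
  then have "- A = {}" by (simp add: Suc_le_eq)
  then have "A = UNIV" by blast
  then show ?thesis by (auto simp: A_def)
qed


subsection \<open>Positivity and growth of the cocycle\<close>

lemma Bp_Suc_nth:
  fixes T :: "'a::finite iem"
  shows
  "Bp T (Suc n) $ \<alpha> $ \<beta> = Bp T n $ \<alpha> $ \<beta> + (if \<alpha> = loser (rv T n) then Bp T n $ winner (rv T n) $ \<beta> else 0)"
proof -
  have ax: "M $ \<alpha> $ \<beta> = (M *v axis \<beta> 1) $ \<alpha>" for M :: "real^'a^'a" and \<alpha> \<beta>
    by (simp add: matrix_vector_mul_component inner_axis)
  have "Bp T (Suc n) *v axis \<beta> 1 = step_mat (rv T n) *v (Bp T n *v axis \<beta> 1)"
    by (simp add: matrix_vector_mul_assoc)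
  then show ?thesis
    unfolding ax[of "Bp T (Suc n)"] by (simp only: step_mat_mult) (simp only: ax)
qed

lemma Bp_nat: "Bp T n $ \<alpha> $ \<beta> \<in> \<nat>"
  by (induction n arbitrary: \<alpha>) (auto simp: Bp_Suc_nth mat_def simp del: Bp.simps(2))

lemma Bp_nonneg: "Bp T n $ \<alpha> $ \<beta> \<ge> 0"
  using Bp_nat[of T n \<alpha> \<beta>] by (auto elim!: Nats_cases)

lemma Bp_ge_1: "Bp T n $ \<alpha> $ \<beta> > 0 \<Longrightarrow> Bp T n $ \<alpha> $ \<beta> \<ge> 1"
  using Bp_nat[of T n \<alpha> \<beta>] by (auto elim!: Nats_cases)

lemma Bp_mono: "m \<le> n \<Longrightarrow> Bp T m $ \<alpha> $ \<beta> \<le> Bp T n $ \<alpha> $ \<beta>"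
  by (rule lift_Suc_mono_le[of "\<lambda>n. Bp T n $ \<alpha> $ \<beta>"]) (auto simp: Bp_Suc_nth Bp_nonneg simp del: Bp.simps(2))

text \<open>The support of the column grows, hence stabilises. After a win of a letter outside it,
  consider the next win of a letter in it, which occurs because \<beta> wins again. The winner just
  before, still last, is the loser there, and the addition of rows puts it into the support.\<close>

lemma Bp_pos_column:
  fixes T :: "'a::finite iem"
  assumes T: "good T"
  shows "\<exists>n. \<forall>\<alpha>. Bp T n $ \<alpha> $ \<beta> > 0"
proof (rule ccontr)
  assume no: "\<not> ?thesis"
  define C where "C n = {\<alpha>. Bp T n $ \<alpha> $ \<beta> > 0}" for n
  have Cmono: "C n \<subseteq> C m" if "n \<le> m" for n m
    using Bp_mono[OF that] unfolding C_def by (smt (verit) Collect_mono)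
  obtain M where M: "\<forall>n\<ge>M. card (C n) = card (C M)"
    using eventually_constant_nat[of 0 "\<lambda>n. card (C n)" "CARD('a)"] Cmono
    by (meson card_mono finite le_SucI order_refl top_greatest)
  have C: "C n = C M" if "n \<ge> M" for n
    using card_subset_eq[OF finite Cmono[OF that] M[rule_format, OF that, symmetric]] by (rule sym)
  obtain \<gamma> where g: "\<gamma> \<notin> C M" using no by (auto simp: C_def)
  have "\<beta> \<in> C 0" by (simp add: C_def mat_def)
  then have b: "\<beta> \<in> C M" using Cmono[of 0 M] by auto
  obtain n where n: "n \<ge> M" "winner (rv T n) = \<gamma>" using wins_infinitely_often[OF T] by blast
  obtain n' where n': "n' \<ge> n" "winner (rv T n') = \<beta>" using wins_infinitely_often[OF T] by blast
  define k where "k = (LEAST k. k \<ge> n \<and> winner (rv T k) \<in> C M)"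
  have k: "k \<ge> n" "winner (rv T k) \<in> C M"
    using LeastI[of "\<lambda>k. k \<ge> n \<and> winner (rv T k) \<in> C M" n'] n' b by (auto simp: k_def)
  have "k \<noteq> n" using k n g by auto
  then obtain j where j: "k = Suc j" "j \<ge> n" using k(1) by (cases k) auto
  have jn: "winner (rv T j) \<notin> C M"
    using not_less_Least[of j "\<lambda>k. k \<ge> n \<and> winner (rv T k) \<in> C M"] j by (auto simp: k_def[symmetric])
  then have "winner (rv T j) = loser (rv T k)" using winner_stays_last[OF T, of j] k(2) j by auto
  moreover have "loser (rv T k) \<in> C (Suc k)"
  proof -
    have "winner (rv T k) \<in> C k" using C[of k] k n by simp
    then show ?thesis using Bp_nonneg[of T k "loser (rv T k)" \<beta>] by (auto simp: C_def Bp_Suc_nth simp del: Bp.simps(2))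
  qed
  ultimately show False using jn C[of "Suc k"] k n by simp
qed

lemma Bp_pos:
  fixes T :: "'a::finite iem"
  assumes T: "good T"
  shows "\<exists>n. \<forall>\<alpha> \<beta>. Bp T n $ \<alpha> $ \<beta> > 0"
proof -
  have "\<exists>M. \<forall>n\<ge>M. \<forall>\<alpha>. Bp T n $ \<alpha> $ \<beta> > 0" for \<beta>
    using Bp_pos_column[OF T, of \<beta>] Bp_mono[of _ _ T _ \<beta>] by (meson less_le_trans)
  from eventually_all_finite[OF this, of 0] show ?thesis by (meson order_refl)
qed

text \<open>Positivity of g lets the finitely many early indices be absorbed: their ratios are added
  to the constant. Estimates then hold from n = 0 on.\<close>

lemma bigo_sequence_bound:
  fixes f g :: "nat \<Rightarrow> real"
  assumes "f \<in> O(g)" "\<And>n. g n > 0"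
  shows "\<exists>C>0. \<forall>n. \<bar>f n\<bar> \<le> C * g n"
proof -
  obtain c N where c: "c > 0" "\<And>n. n \<ge> N \<Longrightarrow> \<bar>f n\<bar> \<le> c * g n"
  proof -
    obtain c where "c > 0" "eventually (\<lambda>n. norm (f n) \<le> c * norm (g n)) sequentially"
      using landau_o.bigE[OF assms(1)] by blast
    moreover have "norm (g n) = g n" for n using assms(2)[of n] by simp
    ultimately show ?thesis using that by (auto simp: eventually_sequentially)
  qed
  define C where "C = c + (\<Sum>n<N. \<bar>f n\<bar> / g n)"
  have s: "(\<Sum>n<N. \<bar>f n\<bar> / g n) \<ge> 0" using assms(2) by (intro sum_nonneg divide_nonneg_pos) auto
  have "\<bar>f n\<bar> \<le> C * g n" for n
  proof (cases "n < N")
    case True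
    have "\<bar>f n\<bar> / g n \<le> (\<Sum>n<N. \<bar>f n\<bar> / g n)"
      using True assms(2) by (intro member_le_sum) (auto intro!: divide_nonneg_pos)
    then have "\<bar>f n\<bar> / g n \<le> C" using c(1) by (simp add: C_def)
    then show ?thesis using assms(2)[of n] by (simp add: field_simps)
  next
    case False
    have "c * g n \<le> C * g n" using s assms(2)[of n] by (intro mult_right_mono) (auto simp: C_def)
    then show ?thesis using c(2)[of n] False by simp
  qed
  moreover have "C > 0" using c(1) s by (simp add: C_def)
  ultimately show ?thesis by blast
qed

section \<open>Norms and row sums of the cocycle matrices\<close>

lemma one_le_mult: "1 \<le> x \<Longrightarrow> 1 \<le> y \<Longrightarrow> 1 \<le> x * (y :: real)"
  using mult_mono[of 1 x 1 y] by simp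

lemma row_le_mat_norm: "(\<Sum>\<beta>\<in>UNIV. \<bar>B $ \<alpha> $ \<beta>\<bar>) \<le> mat_norm (B :: real^'a::finite^'a)"
  unfolding mat_norm_def by (intro Max_ge) auto

lemma mat_norm_leI: "(\<And>\<alpha>. (\<Sum>\<beta>\<in>UNIV. \<bar>B $ \<alpha> $ \<beta>\<bar>) \<le> c) \<Longrightarrow> mat_norm (B :: real^'a::finite^'a) \<le> c"
  unfolding mat_norm_def by (subst Max_le_iff) auto

lemma mat_norm_nonneg: "mat_norm (B :: real^'a::finite^'a) \<ge> 0"
  by (rule order_trans[OF sum_nonneg row_le_mat_norm]) simp

lemma infnorm_leI:
  fixes x :: "real^'a::finite"
  assumes "\<And>\<alpha>. \<bar>x $ \<alpha>\<bar> \<le> c"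
  shows "infnorm x \<le> c"
proof -
  have "{\<bar>x $ i\<bar> | i. i \<in> UNIV} \<noteq> {}" by auto
  then show ?thesis unfolding infnorm_cart using assms by (intro cSup_least) auto
qed

lemma infnorm_matrix_mult:
  fixes B :: "real^'a::finite^'a"
  shows "infnorm (B *v x) \<le> mat_norm B * infnorm x"
proof (rule infnorm_leI)
  fix \<alpha>
  have "\<bar>(B *v x) $ \<alpha>\<bar> \<le> (\<Sum>\<beta>\<in>UNIV. \<bar>B $ \<alpha> $ \<beta> * x $ \<beta>\<bar>)"
    unfolding matrix_vector_mult_def by (simp add: sum_abs)
  also have "\<dots> \<le> (\<Sum>\<beta>\<in>UNIV. \<bar>B $ \<alpha> $ \<beta>\<bar> * infnorm x)"
    unfolding abs_mult by (intro sum_mono mult_left_mono component_le_infnorm_cart) auto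
  also have "\<dots> \<le> mat_norm B * infnorm x"
    unfolding sum_distrib_right[symmetric] by (intro mult_right_mono row_le_mat_norm infnorm_pos_le)
  finally show "\<bar>(B *v x) $ \<alpha>\<bar> \<le> mat_norm B * infnorm x" .
qed

text \<open>For \<open>Bp T n\<close> this is the return time to I(n), the height of the tower over
  the interval with label \<alpha>.\<close>

definition rowsum :: "real^'a::finite^'a \<Rightarrow> 'a \<Rightarrow> real" where
  "rowsum B \<alpha> = (\<Sum>\<beta>\<in>UNIV. B $ \<alpha> $ \<beta>)"

definition bnorm :: "'a::finite iem \<Rightarrow> nat \<Rightarrow> real" where
  "bnorm T n = mat_norm (Bp T n)"

lemma rowsum_Bp_Suc:
  "rowsum (Bp T (Suc n)) \<alpha> = rowsum (Bp T n) \<alpha> + (if \<alpha> = loser (rv T n) then rowsum (Bp T n) (winner (rv T n)) else 0)"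
  unfolding rowsum_def Bp_Suc_nth by (auto simp: sum.distrib)

lemma rowsum_mat_1 [simp]: "rowsum (mat 1) \<alpha> = 1"
  by (simp add: rowsum_def mat_def)

lemma rowsum_Bp_mono: "m \<le> n \<Longrightarrow> rowsum (Bp T m) \<alpha> \<le> rowsum (Bp T n) \<alpha>"
  unfolding rowsum_def by (intro sum_mono Bp_mono)

lemma rowsum_Bp_ge_1: "rowsum (Bp T n) \<alpha> \<ge> 1"
  using rowsum_Bp_mono[of 0 n T \<alpha>] by simp

lemma rowsum_le_bnorm: "rowsum (Bp T n) \<alpha> \<le> bnorm T n"
  using row_le_mat_norm[of "Bp T n" \<alpha>] by (simp add: rowsum_def bnorm_def Bp_nonneg)

lemma bnorm_leI: "(\<And>\<alpha>. rowsum (Bp T n) \<alpha> \<le> c) \<Longrightarrow> bnorm T n \<le> c"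
  unfolding bnorm_def rowsum_def by (intro mat_norm_leI) (simp add: Bp_nonneg)

lemma bnorm_ge_1: "bnorm T n \<ge> 1"
  using rowsum_le_bnorm[of T n undefined] rowsum_Bp_ge_1[of T n undefined] by linarith

lemma bnorm_pos: "bnorm T n > 0"
  using bnorm_ge_1[of T n] by linarith

lemma bnorm_0: "bnorm T 0 = 1"
  using bnorm_leI[of T 0 1] bnorm_ge_1[of T 0] by simp

lemma bnorm_mono: "m \<le> n \<Longrightarrow> bnorm T m \<le> bnorm T n"
  by (rule bnorm_leI) (rule order_trans[OF rowsum_Bp_mono rowsum_le_bnorm])

lemma bnorm_Suc: "bnorm T (Suc n) \<le> 2 * bnorm T n"
proof (rule bnorm_leI)
  fix \<alpha>
  show "rowsum (Bp T (Suc n)) \<alpha> \<le> 2 * bnorm T n"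
    using rowsum_le_bnorm[of T n \<alpha>] rowsum_le_bnorm[of T n "winner (rv T n)"] bnorm_pos[of T n]
    unfolding rowsum_Bp_Suc by auto
qed

lemma rowsum_mult: "rowsum (A ** B) \<alpha> = (\<Sum>\<gamma>\<in>UNIV. A $ \<alpha> $ \<gamma> * rowsum B \<gamma>)"
  unfolding rowsum_def matrix_matrix_mult_def
  by (simp add: sum_distrib_left) (rule sum.swap)

lemma rowsum_Bp_add_le: "rowsum (Bp T (m + k)) \<alpha> \<le> rowsum (Bp (rv T m) k) \<alpha> * bnorm T m"
  unfolding Bp_add rowsum_mult rowsum_def[of "Bp (rv T m) k"] sum_distrib_right
  by (intro sum_mono mult_left_mono rowsum_le_bnorm Bp_nonneg)

lemma bnorm_add_le: "bnorm T (m + k) \<le> bnorm (rv T m) k * bnorm T m"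
proof (rule bnorm_leI)
  fix \<alpha>
  have "rowsum (Bp (rv T m) k) \<alpha> * bnorm T m \<le> bnorm (rv T m) k * bnorm T m"
    using bnorm_pos[of T m] by (intro mult_right_mono rowsum_le_bnorm) auto
  then show "rowsum (Bp T (m + k)) \<alpha> \<le> bnorm (rv T m) k * bnorm T m" using rowsum_Bp_add_le[of T m k \<alpha>] by linarith
qed

text \<open>Entries are nonnegative, so nothing cancels in the product, and a lower bound c for all
  return times of the first stretch multiplies the norm of the second. It serves to bound the later
  factor from above.\<close>

lemma bnorm_add_ge:
  assumes "\<And>\<gamma>. c \<le> rowsum (Bp T m) \<gamma>" "c \<ge> 0"
  shows "bnorm (rv T m) k * c \<le> bnorm T (m + k)"
proof (cases "c = 0")
  case False
  have "bnorm (rv T m) k \<le> bnorm T (m + k) / c"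
  proof (rule bnorm_leI)
    fix \<alpha>
    have "rowsum (Bp (rv T m) k) \<alpha> * c \<le> rowsum (Bp T (m + k)) \<alpha>"
      unfolding Bp_add rowsum_mult rowsum_def[of "Bp (rv T m) k"] sum_distrib_right
      by (intro sum_mono mult_left_mono assms Bp_nonneg)
    also have "\<dots> \<le> bnorm T (m + k)" by (rule rowsum_le_bnorm)
    finally show "rowsum (Bp (rv T m) k) \<alpha> \<le> bnorm T (m + k) / c" using False assms(2) by (simp add: field_simps)
  qed
  then show ?thesis using False assms(2) by (simp add: field_simps)
qed (use bnorm_pos[of T "m + k"] in simp)

lemma bnorm_tail_le: "bnorm (rv T m) k \<le> bnorm T (m + k)"
  using bnorm_add_ge[of 1 T m k] rowsum_Bp_ge_1 by auto

text \<open>Each step adds the row sum of the winner, at least one, to the total of the row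
  sums.\<close>

lemma time_le_bnorm:
  fixes T :: "'a::finite iem"
  shows "real n \<le> CARD('a) * bnorm T n"
proof -
  have "real n \<le> (\<Sum>\<alpha>\<in>UNIV. rowsum (Bp T n) \<alpha>)"
  proof (induction n)
    case (Suc n)
    have "(\<Sum>\<alpha>\<in>UNIV. rowsum (Bp T (Suc n)) \<alpha>) = (\<Sum>\<alpha>\<in>UNIV. rowsum (Bp T n) \<alpha>) + rowsum (Bp T n) (winner (rv T n))"
      unfolding rowsum_Bp_Suc sum.distrib by simp
    then show ?case using Suc rowsum_Bp_ge_1[of T n "winner (rv T n)"] by simp
  qed simp
  also have "\<dots> \<le> (\<Sum>\<alpha>\<in>(UNIV::'a set). bnorm T n)" by (intro sum_mono rowsum_le_bnorm)
  finally show ?thesis by simp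
qed


text \<open>Positivity of some later matrix makes the least number in \<open>accel\<close> exist.
  The increase is strict because the identity matrix has a zero off the diagonal, at the two
  distinct last letters.\<close>

lemma accel_Suc:
  fixes T :: "'a::finite iem"
  assumes T: "good T"
  shows accel_less: "accel T k < accel T (Suc k)"
    and accel_pos: "Bp (rv T (accel T k)) (accel T (Suc k) - accel T k) $ \<alpha> $ \<beta> \<ge> 1"
proof -
  let ?m = "accel T k"
  obtain j where j: "\<And>\<alpha> \<beta>. Bp (rv T ?m) j $ \<alpha> $ \<beta> > 0" using Bp_pos[OF good_rv[OF T]] by blast
  have "?m \<le> ?m + j \<and> (\<forall>\<alpha> \<beta>. Bmat T ?m (?m + j) $ \<alpha> $ \<beta> > 0)"
    using j by (simp add: Bmat_eq[OF T])
  then have "?m \<le> accel T (Suc k) \<and> (\<forall>\<alpha> \<beta>. Bmat T ?m (accel T (Suc k)) $ \<alpha> $ \<beta> > 0)"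
    unfolding accel.simps by (rule LeastI)
  then have 1: "?m \<le> accel T (Suc k)" and 2: "Bp (rv T ?m) (accel T (Suc k) - ?m) $ \<alpha> $ \<beta> > 0" for \<alpha> \<beta>
    using Bmat_eq[OF T, of ?m "accel T (Suc k)"] by simp_all
  show "Bp (rv T ?m) (accel T (Suc k) - ?m) $ \<alpha> $ \<beta> \<ge> 1" by (rule Bp_ge_1[OF 2])
  have "?m \<noteq> accel T (Suc k)"
  proof
    assume "?m = accel T (Suc k)"
    then have "Bp (rv T ?m) 0 $ (last_t T) $ (last_b T) > 0" using 2 by (metis diff_self_eq_0)
    then show False using last_neq[OF goodD(1,2)[OF T]] by (simp add: mat_def)
  qed
  then show "?m < accel T (Suc k)" using 1 by simp
qed

lemma accel_between:
  assumes "good T"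
  obtains k where "accel T k \<le> n" "n < accel T (Suc k)"
proof -
  have sm: "strict_mono (accel T)" using accel_less[OF assms] by (rule strict_mono_Suc_iff[THEN iffD2, rule_format])
  have "\<exists>k. accel T k \<le> n \<and> n < accel T (Suc k)"
  proof (induction n)
    case 0 show ?case using accel_less[OF assms, of 0] by (intro exI[of _ 0]) simp
  next
    case (Suc n)
    then obtain k where k: "accel T k \<le> n" "n < accel T (Suc k)" by blast
    show ?case
    proof (cases "Suc n = accel T (Suc k)")
      case True then show ?thesis using accel_less[OF assms, of "Suc k"] by (intro exI[of _ "Suc k"]) simp
    next
      case False then show ?thesis using k by (intro exI[of _ k]) simp
    qed
  qed
  then show ?thesis using that by blast
qed

text \<open>A block with all entries at least one makes every row sum at least the total of the
  previous row sums. This total is at least their maximum, the norm, and at least twice their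
  minimum, as there are two or more letters.\<close>

lemma rowsum_accel:
  fixes T :: "'a::finite iem"
  assumes T: "good T"
  shows "bnorm T (accel T k) \<le> rowsum (Bp T (accel T (Suc k))) \<alpha>" "2 ^ k \<le> rowsum (Bp T (accel T k)) \<alpha>"
proof -
  have ge: "(\<Sum>\<gamma>\<in>UNIV. rowsum (Bp T (accel T k)) \<gamma>) \<le> rowsum (Bp T (accel T (Suc k))) \<alpha>" for k \<alpha>
  proof -
    have "accel T (Suc k) = accel T k + (accel T (Suc k) - accel T k)" using accel_less[OF T, of k] by simp
    then have "rowsum (Bp T (accel T (Suc k))) \<alpha> =
        (\<Sum>\<gamma>\<in>UNIV. Bp (rv T (accel T k)) (accel T (Suc k) - accel T k) $ \<alpha> $ \<gamma> * rowsum (Bp T (accel T k)) \<gamma>)"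
      using rowsum_mult Bp_add by metis
    also have "\<dots> \<ge> (\<Sum>\<gamma>\<in>UNIV. 1 * rowsum (Bp T (accel T k)) \<gamma>)"
      using rowsum_Bp_ge_1[of T "accel T k"] order_trans[OF zero_le_one]
      by (intro sum_mono mult_right_mono accel_pos[OF T]) auto
    finally show ?thesis by simp
  qed
  show "bnorm T (accel T k) \<le> rowsum (Bp T (accel T (Suc k))) \<alpha>"
  proof (rule bnorm_leI)
    fix \<gamma>
    have "rowsum (Bp T (accel T k)) \<gamma> \<le> (\<Sum>\<gamma>\<in>UNIV. rowsum (Bp T (accel T k)) \<gamma>)"
      using rowsum_Bp_ge_1[of T "accel T k"] order_trans[OF zero_le_one] by (intro member_le_sum) auto
    then show "rowsum (Bp T (accel T k)) \<gamma> \<le> rowsum (Bp T (accel T (Suc k))) \<alpha>" using ge[of k \<alpha>] by linarith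
  qed
  show "2 ^ k \<le> rowsum (Bp T (accel T k)) \<alpha>"
  proof (induction k arbitrary: \<alpha>)
    case 0 show ?case by simp
  next
    case (Suc k)
    have "2 ^ Suc k \<le> real CARD('a) * 2 ^ k" using goodD(1)[OF T] by simp
    also have "\<dots> = (\<Sum>\<gamma>\<in>(UNIV::'a set). 2 ^ k)" by simp
    also have "\<dots> \<le> (\<Sum>\<gamma>\<in>UNIV. rowsum (Bp T (accel T k)) \<gamma>)" by (intro sum_mono Suc)
    finally show ?case using ge[of k \<alpha>] by linarith
  qed
qed

section \<open>Return times and number of steps under the growth condition\<close>

context
  fixes T :: "'a::finite iem"
  assumes T: "good T" and mg: "matrix_growth T"
begin

lemma accel_block_norm:
  assumes "\<tau> > 0"
  obtains C where "C \<ge> 1" "\<And>k. bnorm (rv T (accel T k)) (accel T (Suc k) - accel T k) \<le> C * bnorm T (accel T k) powr \<tau>"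
proof -
  have eq: "mat_norm (Bmat T (accel T k) (accel T (Suc k))) = bnorm (rv T (accel T k)) (accel T (Suc k) - accel T k)"
    "mat_norm (Bmat T 0 (accel T k)) = bnorm T (accel T k)" for k
    using Bmat_eq[OF T, of "accel T k" "accel T (Suc k)"] Bmat_eq[OF T, of 0 "accel T k"] accel_less[OF T, of k]
    by (simp_all add: bnorm_def)
  have "(\<lambda>k. bnorm (rv T (accel T k)) (accel T (Suc k) - accel T k)) \<in> O(\<lambda>k. bnorm T (accel T k) powr \<tau>)"
    using mg assms unfolding matrix_growth_def eq by blast
  from bigo_sequence_bound[OF this] bnorm_pos obtain C where
    C: "C > 0" "\<And>k. \<bar>bnorm (rv T (accel T k)) (accel T (Suc k) - accel T k)\<bar> \<le> C * bnorm T (accel T k) powr \<tau>"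
    by (metis powr_gt_zero less_numeral_extra(3))
  show ?thesis
  proof
    fix k
    have "C * bnorm T (accel T k) powr \<tau> \<le> max 1 C * bnorm T (accel T k) powr \<tau>" by (intro mult_right_mono) auto
    then show "bnorm (rv T (accel T k)) (accel T (Suc k) - accel T k) \<le> max 1 C * bnorm T (accel T k) powr \<tau>"
      using C(2)[of k] by linarith
  qed simp
qed

text \<open>Two estimates of exponent s = \<tau> / 2 are multiplied: the number of steps in a block
  is at most a constant times the norm of the block, and the number of blocks is logarithmic in the
  norm because row sums at least double along blocks.\<close>

lemma time_le_powr:
  assumes "\<tau> > 0"
  shows "\<exists>C\<ge>1. \<forall>n. real (Suc n) \<le> C * bnorm T n powr \<tau>"
proof -
  define s where "s = \<tau> / 2"
  have s: "s > 0" using assms by (simp add: s_def)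
  obtain C where C: "C \<ge> 1" "\<And>k. bnorm (rv T (accel T k)) (accel T (Suc k) - accel T k) \<le> C * bnorm T (accel T k) powr s"
    using accel_block_norm[OF s] by blast
  let ?d = "real CARD('a)" and ?a = "\<lambda>k. bnorm T (accel T k)"
  \<comment> \<open>From x \<le> exp x with x = s * ln 2 * k, where exp x is
    \<open>(2 ^ k) powr s\<close>.\<close>
  define D where "D = 1 + 1 / (s * ln 2)"
  have D: "D \<ge> 1" using s by (simp add: D_def)
  have am: "?a j \<le> ?a k" if "j \<le> k" for j k
    by (rule bnorm_mono, rule lift_Suc_mono_le[of "accel T", OF _ that], rule less_imp_le, rule accel_less[OF T])
  have step: "real (accel T (Suc k)) \<le> real (accel T k) + ?d * C * ?a k powr s" for k
  proof -
    have "real (accel T (Suc k) - accel T k) \<le> ?d * bnorm (rv T (accel T k)) (accel T (Suc k) - accel T k)"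
      by (rule time_le_bnorm)
    also have "\<dots> \<le> ?d * (C * ?a k powr s)" by (intro mult_left_mono C(2)) auto
    finally show ?thesis using accel_less[OF T, of k] by (simp add: of_nat_diff)
  qed
  have acc: "real (accel T (Suc k)) \<le> real (Suc k) * (?d * C * ?a k powr s)" for k
  proof (induction k)
    case 0 show ?case using step[of 0] by simp
  next
    case (Suc k)
    have "real (Suc k) * (?d * C * ?a k powr s) \<le> real (Suc k) * (?d * C * ?a (Suc k) powr s)"
      using C(1) s am[of k "Suc k"] bnorm_pos[of T "accel T k"] by (intro mult_left_mono powr_mono2) auto
    then show ?case using step[of "Suc k"] Suc by (simp add: algebra_simps)
  qed
  have kle: "real (Suc k) \<le> D * ?a k powr s" for k
  proof -
    have "real k * (s * ln 2) \<le> s * ln 2 * real k + 1" by simp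
    also have "\<dots> \<le> exp (s * ln 2 * real k)" using exp_ge_add_one_self[of "s * ln 2 * real k"] by linarith
    also have "\<dots> = (2 ^ k) powr s" by (simp add: powr_def ln_realpow mult_ac)
    also have "\<dots> \<le> ?a k powr s"
      using rowsum_accel(2)[OF T, of k undefined] rowsum_le_bnorm[of T "accel T k" undefined] s
      by (intro powr_mono2) auto
    finally have "real k \<le> ?a k powr s * (1 / (s * ln 2))" using s by (simp add: field_simps)
    moreover have "1 \<le> ?a k powr s" using bnorm_ge_1[of T "accel T k"] s by (simp add: ge_one_powr_ge_zero)
    ultimately show ?thesis by (simp add: D_def algebra_simps)
  qed
  show ?thesis
  proof (intro exI[of _ "D * ?d * C"] conjI allI)
    have d1: "?d \<ge> 1" using goodD(1)[OF T] by simp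
    show "1 \<le> D * ?d * C" by (intro one_le_mult D d1 C(1))
    fix n
    obtain k where k: "accel T k \<le> n" "n < accel T (Suc k)" using accel_between[OF T] by blast
    have "real (Suc n) \<le> real (accel T (Suc k))" using k(2) by simp
    also have "\<dots> \<le> real (Suc k) * (?d * C * ?a k powr s)" by (rule acc)
    also have "\<dots> \<le> (D * ?a k powr s) * (?d * C * ?a k powr s)"
      using C(1) kle[of k] by (intro mult_right_mono) auto
    also have "\<dots> = D * ?d * C * ?a k powr \<tau>" by (simp add: s_def powr_add[symmetric])
    also have "\<dots> \<le> D * ?d * C * bnorm T n powr \<tau>"
      using C(1) D assms bnorm_mono[OF k(1), of T] bnorm_pos[of T "accel T k"]
      by (intro mult_left_mono powr_mono2) auto
    finally show "real (Suc n) \<le> D * ?d * C * bnorm T n powr \<tau>" .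
  qed
qed

text \<open>All towers have nearly the same height. For n in the block after n_k every row sum is at
  least the norm at n_{k-1}, and the two blocks from there to n each cost a power s = \<tau> / 2 of
  the norm. In the first block the norm at n_0 is 1.\<close>

lemma rowsum_lower:
  assumes "\<tau> > 0"
  shows "\<exists>C\<ge>1. \<forall>n \<alpha>. bnorm T n \<le> C * bnorm T n powr \<tau> * rowsum (Bp T n) \<alpha>"
proof -
  define s where "s = \<tau> / 2"
  have s: "s > 0" using assms by (simp add: s_def)
  obtain C where C: "C \<ge> 1" "\<And>k. bnorm (rv T (accel T k)) (accel T (Suc k) - accel T k) \<le> C * bnorm T (accel T k) powr s"
    using accel_block_norm[OF s] by blast
  let ?a = "\<lambda>k. bnorm T (accel T k)"
  have nn: "0 \<le> rowsum (Bp T n) \<alpha>" for n \<alpha> using rowsum_Bp_ge_1[of T n \<alpha>] by linarith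
  have blk: "bnorm T n \<le> C * ?a k powr s * ?a k" if "accel T k \<le> n" "n \<le> accel T (Suc k)" for n k
  proof -
    have "bnorm T n \<le> bnorm (rv T (accel T k)) (n - accel T k) * ?a k"
      using bnorm_add_le[of T "accel T k" "n - accel T k"] that by simp
    also have "\<dots> \<le> bnorm (rv T (accel T k)) (accel T (Suc k) - accel T k) * ?a k"
      using that bnorm_pos[of T "accel T k"] by (intro mult_right_mono bnorm_mono) auto
    also have "\<dots> \<le> (C * ?a k powr s) * ?a k" using bnorm_pos[of T "accel T k"] by (intro mult_right_mono C(2)) auto
    finally show ?thesis .
  qed
  have "bnorm T n \<le> (C * C) * bnorm T n powr \<tau> * rowsum (Bp T n) \<alpha>" for n \<alpha>
  proof -
    obtain k where k: "accel T k \<le> n" "n < accel T (Suc k)" using accel_between[OF T] by blast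
    have ps: "?a j powr s \<le> bnorm T n powr s" if "accel T j \<le> n" for j
      using s bnorm_mono[OF that, of T] bnorm_pos[of T "accel T j"] by (intro powr_mono2) auto
    have 1: "bnorm T n \<le> C * bnorm T n powr s * ?a k"
    proof -
      have "bnorm T n \<le> C * ?a k powr s * ?a k" using blk k by simp
      also have "\<dots> \<le> C * bnorm T n powr s * ?a k"
        using C(1) ps[OF k(1)] bnorm_pos[of T "accel T k"] by (intro mult_right_mono mult_left_mono) auto
      finally show ?thesis .
    qed
    have 2: "?a k \<le> C * bnorm T n powr s * rowsum (Bp T n) \<alpha>"
    proof (cases k)
      case 0
      have "1 \<le> C * bnorm T n powr s" using C(1) bnorm_ge_1[of T n] s
        by (intro one_le_mult ge_one_powr_ge_zero) auto
      then have "1 * 1 \<le> C * bnorm T n powr s * rowsum (Bp T n) \<alpha>"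
        using rowsum_Bp_ge_1[of T n \<alpha>] by (intro mult_mono) auto
      then show ?thesis using 0 by (simp add: bnorm_0)
    next
      case (Suc j)
      have jn: "accel T j \<le> n" using accel_less[OF T, of j] k(1) Suc by simp
      have "?a k \<le> C * ?a j powr s * ?a j" using blk[of j "accel T k"] accel_less[OF T, of j] Suc by simp
      also have "\<dots> \<le> C * bnorm T n powr s * ?a j"
        using C(1) ps[OF jn] bnorm_pos[of T "accel T j"] by (intro mult_right_mono mult_left_mono) auto
      also have "\<dots> \<le> C * bnorm T n powr s * rowsum (Bp T n) \<alpha>"
        using rowsum_accel(1)[OF T, of j \<alpha>] rowsum_Bp_mono[OF k(1), of T \<alpha>] Suc C(1)
        by (intro mult_left_mono) auto
      finally show ?thesis .
    qed
    have "bnorm T n \<le> C * bnorm T n powr s * (C * bnorm T n powr s * rowsum (Bp T n) \<alpha>)"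
      using C(1) by (intro order_trans[OF 1] mult_left_mono 2) auto
    also have "\<dots> = (C * C) * bnorm T n powr \<tau> * rowsum (Bp T n) \<alpha>" by (simp add: s_def powr_add[symmetric])
    finally show ?thesis .
  qed
  moreover have "1 \<le> C * C" by (intro one_le_mult C(1))
  ultimately show ?thesis by blast
qed

end

subsection \<open>Antisymmetric matrices\<close>

abbreviation im :: "real^'a^'a \<Rightarrow> (real^'a) set" where
  "im M \<equiv> range ((*v) M)"

lemma matrix_inner: "((M :: real^'a::finite^'a) *v x) \<bullet> y = x \<bullet> (transpose M *v y)"
  by (metis dot_lmul_matrix inner_commute transpose_matrix_vector transpose_transpose)

lemma subspace_im: "subspace (im (M :: real^'a::finite^'a))"
  by (intro linear_subspace_image subspace_UNIV matrix_vector_mul_linear)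

text \<open>The symplectic form on the image of an antisymmetric M, sending M p and y to the inner
  product of p and y. The choice of p is immaterial there, because the kernel of M is orthogonal to
  its image (\<open>sform_eq\<close>).\<close>

definition sform :: "real^'a::finite^'a \<Rightarrow> real^'a \<Rightarrow> real^'a \<Rightarrow> real" where
  "sform M x y = (SOME p. M *v p = x) \<bullet> y"

context
  fixes M :: "real^'a::finite^'a"
  assumes anti: "transpose M = - M"
begin

lemma anti_inner: "(M *v x) \<bullet> y = - (x \<bullet> (M *v y))"
proof -
  have "(- M) *v y = - (M *v y)" by (simp add: vec_eq_iff matrix_vector_mult_def sum_negf)
  then show ?thesis by (simp add: matrix_inner anti)
qed

lemma sform_eq:
  assumes "y \<in> im M"
  shows "sform M (M *v p) y = p \<bullet> y"
proof -
  obtain q where q: "y = M *v q" using assms by auto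
  define p' where "p' = (SOME p'. M *v p' = M *v p)"
  have "M *v p' = M *v p" unfolding p'_def by (rule someI[of _ p]) simp
  then have "(M *v p') \<bullet> q = (M *v p) \<bullet> q" by simp
  then show ?thesis unfolding sform_def p'_def[symmetric] q anti_inner by simp
qed

lemma sform_add_left: "x \<in> im M \<Longrightarrow> x' \<in> im M \<Longrightarrow> y \<in> im M \<Longrightarrow> sform M (x + x') y = sform M x y + sform M x' y"
  by (auto simp: sform_eq inner_add_left simp flip: matrix_vector_right_distrib)

lemma sform_diff_left: "x \<in> im M \<Longrightarrow> x' \<in> im M \<Longrightarrow> y \<in> im M \<Longrightarrow> sform M (x - x') y = sform M x y - sform M x' y"
  by (auto simp: sform_eq inner_diff_left simp flip: matrix_vector_mult_diff_distrib)

lemma sform_add_right: "x \<in> im M \<Longrightarrow> y \<in> im M \<Longrightarrow> y' \<in> im M \<Longrightarrow> sform M x (y + y') = sform M x y + sform M x y'"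
  by (simp add: sform_def inner_add_right)

lemma sform_scale_right: "sform M x (c *\<^sub>R y) = c * sform M x y"
  by (simp add: sform_def)

lemma sform_self: "x \<in> im M \<Longrightarrow> sform M x x = 0"
  using anti_inner by (auto simp: sform_eq) (metis add.inverse_inverse anti_inner inner_commute equal_neg_zero)

lemma sform_antisym: "x \<in> im M \<Longrightarrow> y \<in> im M \<Longrightarrow> sform M x y = - sform M y x"
proof -
  assume "x \<in> im M" "y \<in> im M"
  then obtain p q where "x = M *v p" "y = M *v q" by auto
  then show ?thesis using anti_inner[of q p] by (simp add: sform_eq inner_commute)
qed

text \<open>Lift X to a subspace P of the image of M. As M is injective on its image, the orthogonal
  complement of its kernel, P has the dimension of X. Isotropy says that P and X are orthogonal
  inside the image, so the two dimensions add up to at most the rank.\<close>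

lemma isotropic_dim:
  assumes X: "subspace X" "X \<subseteq> im M" and iso: "\<And>x y. x \<in> X \<Longrightarrow> y \<in> X \<Longrightarrow> sform M x y = 0"
  shows "2 * dim X \<le> rank M"
proof -
  define P where "P = {p \<in> im M. M *v p \<in> X}"
  have lin: "linear ((*v) M)" by (rule matrix_vector_mul_linear)
  have sP: "subspace P"
    unfolding P_def using subspace_im[of M] X(1)
    by (auto simp: subspace_def matrix_vector_right_distrib matrix_vector_mult_scaleR)
  have inj: "x = 0" if x: "x \<in> im M" "M *v x = 0" for x
  proof -
    obtain q where "x = M *v q" using x(1) by auto
    then have "x \<bullet> x = - (q \<bullet> (M *v x))" using anti_inner by simp
    then show ?thesis using x(2) by simp
  qed
  have XP: "X = (*v) M ` P"
  proof (intro equalityI subsetI)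
    fix v assume v: "v \<in> X"
    then obtain p where p: "v = M *v p" using X(2) by auto
    obtain y z where yz: "y \<in> span (im M)" "\<And>w. w \<in> span (im M) \<Longrightarrow> orthogonal z w" "p = y + z"
      using orthogonal_subspace_decomp_exists by blast
    have "(M *v z) \<bullet> w = 0" for w
      using yz(2)[OF span_base[of "M *v w"]] by (simp add: anti_inner orthogonal_def)
    then have "M *v z = 0" by (metis inner_eq_zero_iff)
    then have "v = M *v y" using p yz(3) by (simp add: matrix_vector_right_distrib)
    moreover have "y \<in> im M" using yz(1) span_eq_iff[THEN iffD2, OF subspace_im[of M]] by metis
    ultimately show "v \<in> (*v) M ` P" using v by (auto simp: P_def)
  qed (auto simp: P_def)
  have "inj_on ((*v) M) (span P)"
    unfolding span_eq_iff[THEN iffD2, OF sP]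
  proof (rule inj_onI)
    fix x y assume "x \<in> P" "y \<in> P" and e: "M *v x = M *v y"
    then have "x - y \<in> im M" using subspace_diff[OF subspace_im[of M]] by (auto simp: P_def)
    then show "x = y" using inj[of "x - y"] e by (simp add: matrix_vector_mult_diff_distrib)
  qed
  then have dP: "dim P = dim X" unfolding XP using dim_image_eq[OF lin] by metis
  have "X \<subseteq> {y \<in> im M. \<forall>p\<in>P. orthogonal p y}"
  proof (intro subsetI CollectI conjI ballI)
    fix v assume v: "v \<in> X"
    show "v \<in> im M" using v X(2) by auto
    fix p assume p: "p \<in> P"
    show "orthogonal p v" using iso[of "M *v p" v] v p X(2) by (auto simp: P_def sform_eq orthogonal_def subset_iff)
  qed
  then have "dim X \<le> dim {y \<in> im M. \<forall>p\<in>P. orthogonal p y}" by (rule dim_subset)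
  moreover have "dim {y \<in> im M. \<forall>p\<in>P. orthogonal p y} + dim P = dim (im M)"
    by (rule dim_subspace_orthogonal_to_vectors) (use sP subspace_im in \<open>auto simp: P_def\<close>)
  ultimately show ?thesis using dP by (simp add: rank_dim_range)
qed

text \<open>An isotropic subspace of half the rank cannot be enlarged: x together with X would span
  an isotropic subspace violating \<open>isotropic_dim\<close>.\<close>

lemma lagrangian:
  assumes X: "subspace X" "X \<subseteq> im M" and iso: "\<And>x y. x \<in> X \<Longrightarrow> y \<in> X \<Longrightarrow> sform M x y = 0"
    and dim: "dim X = rank M div 2"
    and x: "x \<in> im M" "\<And>y. y \<in> X \<Longrightarrow> sform M x y = 0"
  shows "x \<in> X"
proof (rule ccontr)
  assume nx: "x \<notin> X"
  have sp: "span X = X" using X(1) by (simp add: span_eq_iff)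
  let ?W = "span (insert x X)"
  have W: "\<exists>a v. v \<in> X \<and> w = a *\<^sub>R x + v" if w: "w \<in> ?W" for w
  proof -
    obtain k where "w - k *\<^sub>R x \<in> X" using w unfolding span_insert sp by blast
    then show ?thesis by (intro exI[of _ k] exI[of _ "w - k *\<^sub>R x"]) simp
  qed
  have Wim: "?W \<subseteq> im M" using X(2) x(1) subspace_im[of M] by (intro span_minimal) auto
  have iso': "sform M w w' = 0" if w: "w \<in> ?W" "w' \<in> ?W" for w w'
  proof -
    obtain a v where v: "v \<in> X" "w = a *\<^sub>R x + v" using W[OF w(1)] by blast
    obtain a' v' where v': "v' \<in> X" "w' = a' *\<^sub>R x + v'" using W[OF w(2)] by blast
    have i: "a *\<^sub>R x \<in> im M" "a' *\<^sub>R x \<in> im M" "v \<in> im M" "v' \<in> im M"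
      using v v' X(2) x(1) subspace_scale[OF subspace_im[of M]] by auto
    have "sform M (a *\<^sub>R x) y = a * sform M x y" if "y \<in> im M" for y
      using sform_antisym[OF i(1) that] sform_antisym[OF x(1) that] by (simp add: sform_scale_right)
    then show ?thesis
      using i v v' x(2) iso[OF v(1) v'(1)] sform_self[OF x(1)] sform_antisym[OF i(3) x(1)] x(2)[OF v(1)]
      by (simp add: sform_add_left sform_add_right subspace_add[OF subspace_im] sform_scale_right x(1))
  qed
  have "2 * dim ?W \<le> rank M" by (rule isotropic_dim[OF subspace_span Wim iso'])
  moreover have "dim ?W = Suc (dim X)" using nx by (simp add: dim_insert sp)
  ultimately show False using dim by linarith
qed

end

lemma im_lift:
  fixes M :: "real^'a::finite^'a"
  shows "\<exists>C\<ge>0. \<forall>x\<in>im M. \<exists>p. M *v p = x \<and> norm p \<le> C * norm x"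
proof -
  obtain g where g: "linear g" "\<And>v. v \<in> im M \<Longrightarrow> M *v (g v) = v"
    using linear_exists_right_inverse_on[of "(*v) M" UNIV] matrix_vector_mul_linear subspace_UNIV by metis
  obtain C where "\<And>x. norm (g x) \<le> C * norm x" using linear_bounded[OF g(1)] by blast
  then have "norm (g x) \<le> max 0 C * norm x" for x by (meson max.cobounded2 mult_right_mono norm_ge_zero order_trans)
  then show ?thesis using g(2) by (intro exI[of _ "max 0 C"] conjI ballI max.cobounded1) (meson exI conjI)
qed

lemma finite_sign_matrices: "finite {M :: real^'a::finite^'a. \<forall>i j. M $ i $ j \<in> {-1, 0, 1}}"
proof -
  let ?f = "\<lambda>(P, N). \<chi> i j. if (i, j) \<in> P then 1 else if (i, j) \<in> N then -1 else (0::real)"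
  have *: "M \<in> range ?f" if "\<forall>i j. M $ i $ j \<in> {-1, 0, 1}" for M :: "real^'a^'a"
  proof (rule range_eqI[of _ _ "({(i, j). M $ i $ j = 1}, {(i, j). M $ i $ j = -1})"])
    show "M = ?f ({(i, j). M $ i $ j = 1}, {(i, j). M $ i $ j = -1})"
      using that by (auto simp: vec_eq_iff)
  qed
  have "finite (range ?f)" by (rule finite_imageI) (rule finite)
  then show ?thesis by (rule rev_finite_subset) (use * in blast)
qed

text \<open>Only finitely many matrices have entries in -1, 0, 1, so the constants of the single
  matrices can be added up. This gives bounds that are uniform along the algorithm, while
  \<open>Omega\<close> varies with n.\<close>

lemma uniform_lift:
  "\<exists>C\<ge>1. \<forall>M :: real^'a::finite^'a. (\<forall>i j. M $ i $ j \<in> {-1, 0, 1}) \<longrightarrow>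
     (\<forall>x\<in>im M. \<exists>p. M *v p = x \<and> norm p \<le> C * norm x) \<and> (\<forall>p. norm (M *v p) \<le> C * norm p)"
proof -
  let ?S = "{M :: real^'a^'a. \<forall>i j. M $ i $ j \<in> {-1, 0, 1}}"
  have "\<exists>C\<ge>0. (\<forall>x\<in>im M. \<exists>p. M *v p = x \<and> norm p \<le> C * norm x) \<and> (\<forall>p. norm (M *v p) \<le> C * norm p)"
    for M :: "real^'a^'a"
  proof -
    obtain C where C: "C \<ge> 0" "\<forall>x\<in>im M. \<exists>p. M *v p = x \<and> norm p \<le> C * norm x" using im_lift by blast
    obtain D where D: "\<And>p. norm (M *v p) \<le> D * norm p" using linear_bounded[OF matrix_vector_mul_linear] by blast
    have "C * norm x \<le> max C D * norm x" "D * norm x \<le> max C D * norm x" for x :: "real^'a"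
      by (intro mult_right_mono; simp)+
    then show ?thesis using C D by (intro exI[of _ "max C D"]) (meson max.coboundedI1 order_trans)
  qed
  then obtain C where C: "\<And>M :: real^'a^'a. C M \<ge> 0" "\<And>M x. x \<in> im M \<Longrightarrow> \<exists>p. M *v p = x \<and> norm p \<le> C M * norm x"
    "\<And>M p. norm (M *v p) \<le> C M * norm p" by metis
  define K where "K = 1 + sum C ?S"
  have K: "C M * norm x \<le> K * norm x" if "M \<in> ?S" for M x
  proof -
    have "C M \<le> sum C ?S" by (rule member_le_sum[OF that C(1) finite_sign_matrices])
    then show ?thesis by (intro mult_right_mono) (auto simp: K_def)
  qed
  have "K \<ge> 1" using C(1) by (simp add: K_def sum_nonneg)
  moreover have "\<exists>p. M *v p = x \<and> norm p \<le> K * norm x" if M: "M \<in> ?S" and x: "x \<in> im M" for M x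
  proof -
    obtain p where "M *v p = x" "norm p \<le> C M * norm x" using C(2)[OF x] by blast
    then show ?thesis using K[OF M, of x] by (intro exI[of _ p]) linarith
  qed
  moreover have "norm (M *v p) \<le> K * norm p" if M: "M \<in> ?S" for M p
    using K[OF M, of p] C(3)[of M p] by linarith
  ultimately show ?thesis by (intro exI[of _ K]) blast
qed

text \<open>The functional is assumed linear and bounded on X only. The vector is assembled from its
  values on an orthonormal basis, and the norm bound comes from evaluating at the vector
  itself.\<close>

lemma riesz_subspace:
  fixes l :: "'a::euclidean_space \<Rightarrow> real"
  assumes X: "subspace X"
    and l: "\<And>x y. x \<in> X \<Longrightarrow> y \<in> X \<Longrightarrow> l (x + y) = l x + l y" "\<And>x c. x \<in> X \<Longrightarrow> l (c *\<^sub>R x) = c * l x"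
    and bd: "\<And>x. x \<in> X \<Longrightarrow> \<bar>l x\<bar> \<le> K * norm x" and K: "K \<ge> 0"
  shows "\<exists>q\<in>X. (\<forall>x\<in>X. l x = q \<bullet> x) \<and> norm q \<le> K"
proof -
  obtain B where B: "B \<subseteq> X" "pairwise orthogonal B" "\<And>x. x \<in> B \<Longrightarrow> norm x = 1" "independent B" "span B = X"
    using orthonormal_basis_subspace[OF X] by metis
  have fB: "finite B" using B(4) by (simp add: independent_imp_finite)
  define q where "q = (\<Sum>e\<in>B. l e *\<^sub>R e)"
  have qV: "q \<in> X" unfolding q_def using B(1) X by (intro subspace_sum subspace_scale) auto
  have qe: "q \<bullet> e = l e" if "e \<in> B" for e
  proof -
    have "q \<bullet> e = (\<Sum>e'\<in>B. l e' * (e' \<bullet> e))" by (simp add: q_def inner_sum_left)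
    also have "\<dots> = (\<Sum>e'\<in>B. if e' = e then l e else 0)"
      using B(2,3) that by (intro sum.cong) (auto simp: pairwise_def orthogonal_def norm_eq_1)
    finally show ?thesis using that fB by simp
  qed
  have eq: "l x = q \<bullet> x" if "x \<in> X" for x
  proof -
    have "x \<in> span B" using that B(5) by simp
    then have "x \<in> X \<and> l x = q \<bullet> x"
    proof (induction rule: span_induct_alt)
      case base then show ?case using l(2)[of 0 0] subspace_0[OF X] by simp
    next
      case (step c e y)
      then have "y \<in> X" "e \<in> X" using B(1) by auto
      then show ?case using step qe l subspace_scale[OF X] subspace_add[OF X] by (simp add: inner_add_right)
    qed
    then show ?thesis by blast
  qed
  have "norm q \<le> K"
  proof (cases "q = 0")
    case True
    then show ?thesis using K by simp
  next
    case False
    have "norm q * norm q = l q" using eq[OF qV] by (simp add: power2_norm_eq_inner[symmetric] power2_eq_square)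
    also have "\<dots> \<le> K * norm q" using bd[OF qV] by simp
    finally show ?thesis using False by simp
  qed
  then show ?thesis using qV eq by blast
qed

subsection \<open>Symplectic cocycles with a stable Lagrangian space\<close>

lemma orthonormal_expansion:
  fixes x :: "'a::euclidean_space"
  assumes E: "finite E" "pairwise orthogonal E" "\<And>e. e \<in> E \<Longrightarrow> norm e = 1" and x: "x \<in> span E"
  shows "(\<Sum>e\<in>E. (x \<bullet> e) *\<^sub>R e) = x"
  using x
proof (induction rule: span_induct_alt)
  case (step c f y)
  have "(\<Sum>e\<in>E. (f \<bullet> e) *\<^sub>R e) = (\<Sum>e\<in>E. if e = f then f else 0)"
    using E(2,3) step.hyps by (intro sum.cong) (auto simp: pairwise_def orthogonal_def norm_eq_1)
  then have "(\<Sum>e\<in>E. (f \<bullet> e) *\<^sub>R e) = f" using E(1) step.hyps by simp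
  moreover have "(\<Sum>e\<in>E. ((c *\<^sub>R f + y) \<bullet> e) *\<^sub>R e) = c *\<^sub>R (\<Sum>e\<in>E. (f \<bullet> e) *\<^sub>R e) + (\<Sum>e\<in>E. (y \<bullet> e) *\<^sub>R e)"
    by (simp add: inner_add_left scaleR_add_left sum.distrib scaleR_sum_right)
  ultimately show ?case using step.IH by simp
qed simp

text \<open>The linear data abstracted from the dynamics. Bounds on stable vectors are phrased
  through B 0 n, so that only the stable space at time zero occurs; \<open>b_time\<close> says that
  b outgrows every power of n.\<close>

locale cocycle =
  fixes Om :: "nat \<Rightarrow> real^'a::finite^'a" and B :: "nat \<Rightarrow> nat \<Rightarrow> real^'a^'a"
    and Gs :: "(real^'a) set" and b :: "nat \<Rightarrow> real"
  assumes B_comp: "\<And>m k n. m \<le> k \<Longrightarrow> k \<le> n \<Longrightarrow> B m n = B k n ** B m k"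
    and B_id: "\<And>m. B m m = mat 1"
    and B_inv: "\<And>m n. m \<le> n \<Longrightarrow> invertible (B m n)"
    and Om_anti: "\<And>n. transpose (Om n) = - Om n"
    and Om_sign: "\<And>n i j. Om n $ i $ j \<in> {-1, 0, 1}"
    and Om_B: "\<And>m n. m \<le> n \<Longrightarrow> Om n = B m n ** Om m ** transpose (B m n)"
    and Gs: "subspace Gs" "Gs \<subseteq> im (Om 0)" "dim Gs = rank (Om 0) div 2"
    and b_0: "b 0 = 1" and b_mono: "\<And>m n. m \<le> n \<Longrightarrow> b m \<le> b n" and b_Suc: "\<And>n. b (Suc n) \<le> 2 * b n"
    and b_time: "\<And>\<tau>. \<tau> > 0 \<Longrightarrow> \<exists>C\<ge>1. \<forall>n. real (Suc n) \<le> C * b n powr \<tau>"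
    and Gs_decay: "\<And>\<xi>. \<xi> \<in> Gs \<Longrightarrow> \<exists>\<sigma>>0. \<exists>C\<ge>0. \<forall>n. norm (B 0 n *v \<xi>) \<le> C * b n powr - \<sigma>"
    and coherent: "\<And>\<tau>. \<tau> > 0 \<Longrightarrow> \<exists>C\<ge>1. \<forall>m n. m \<le> n \<longrightarrow>
      (\<forall>\<xi>\<in>Gs. norm (B 0 n *v \<xi>) \<le> C * b n powr \<tau> * norm (B 0 m *v \<xi>))"
    and B_inv_bound: "\<exists>K\<ge>0. \<exists>C\<ge>1. \<forall>n x. norm x \<le> C * b n powr K * norm (B 0 n *v x)"
    and B_step: "\<exists>C\<ge>1. \<forall>n x. norm (B n (Suc n) *v x) \<le> C * norm x"
begin

lemma b_ge_1: "b n \<ge> 1"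
  using b_mono[of 0 n] b_0 by simp

lemma b_pos: "b n > 0" using b_ge_1[of n] by linarith

lemma b_powr_mono: "m \<le> n \<Longrightarrow> 0 \<le> \<tau> \<Longrightarrow> b m powr \<tau> \<le> b n powr \<tau>"
  using b_mono[of m n] b_pos[of m] by (intro powr_mono2) auto

lemma b_powr_antimono: "m \<le> n \<Longrightarrow> 0 \<le> \<tau> \<Longrightarrow> b n powr - \<tau> \<le> b m powr - \<tau>"
  using b_mono[of m n] b_pos[of m] by (intro powr_mono2') auto

lemma b_powr_le: "\<tau> \<le> \<tau>' \<Longrightarrow> b n powr \<tau> \<le> b n powr \<tau>'"
  using b_ge_1 by (intro powr_mono) auto

lemma B_comp_mult: "m \<le> k \<Longrightarrow> k \<le> n \<Longrightarrow> B k n *v (B m k *v x) = B m n *v x"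
  by (simp add: B_comp[of m k n] matrix_vector_mul_assoc)

text \<open>By \<open>Om_B\<close> the vector B Om m p equals Om n q, with q the image of p under
  the inverse transpose of B. Pairing q with B y gives back p paired with y, so B is
  symplectic.\<close>

lemma B_transfer:
  assumes "m \<le> n" "x \<in> im (Om m)"
  shows B_im: "B m n *v x \<in> im (Om n)"
    and B_sform: "y \<in> im (Om m) \<Longrightarrow> sform (Om n) (B m n *v x) (B m n *v y) = sform (Om m) x y"
proof -
  have im: "\<exists>q. B m n *v (Om m *v p) = Om n *v q \<and> transpose (B m n) *v q = p" for p
  proof -
    obtain C where C: "C ** B m n = mat 1" using B_inv[OF assms(1)] by (auto simp: invertible_def)
    have "transpose (B m n) *v (transpose C *v p) = transpose (C ** B m n) *v p"
      by (simp add: matrix_vector_mul_assoc matrix_transpose_mul del: transpose_matrix_vector)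
    then have q: "transpose (B m n) *v (transpose C *v p) = p" by (simp add: C transpose_mat del: transpose_matrix_vector)
    have "Om n *v (transpose C *v p) = B m n *v (Om m *v (transpose (B m n) *v (transpose C *v p)))"
      by (simp add: Om_B[OF assms(1)] matrix_vector_mul_assoc matrix_mul_assoc del: transpose_matrix_vector)
    then show ?thesis using q by (intro exI[of _ "transpose C *v p"]) simp
  qed
  have i: "B m n *v z \<in> im (Om n)" if z: "z \<in> im (Om m)" for z
  proof -
    obtain p where "z = Om m *v p" using z by blast
    then show ?thesis using im[of p] by auto
  qed
  show "B m n *v x \<in> im (Om n)" using i assms(2) by blast
  assume y: "y \<in> im (Om m)"
  obtain p where p: "x = Om m *v p" using assms(2) by blast
  obtain q where q: "B m n *v (Om m *v p) = Om n *v q" "transpose (B m n) *v q = p" using im by blast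
  have "sform (Om n) (Om n *v q) (B m n *v y) = q \<bullet> (B m n *v y)" by (rule sform_eq[OF Om_anti i[OF y]])
  also have "\<dots> = p \<bullet> y" using matrix_inner[of "B m n" y q] q(2) by (simp add: inner_commute)
  also have "\<dots> = sform (Om m) (Om m *v p) y" by (rule sform_eq[OF Om_anti y, symmetric])
  finally show "sform (Om n) (B m n *v x) (B m n *v y) = sform (Om m) x y" by (simp add: p q(1))
qed

lemma B_im_surj:
  assumes "x \<in> im (Om n)"
  obtains x0 where "x0 \<in> im (Om 0)" "x = B 0 n *v x0"
proof -
  obtain p where "x = Om n *v p" using assms by blast
  then have "x = B 0 n *v (Om 0 *v (transpose (B 0 n) *v p))"
    by (simp add: Om_B[of 0 n] matrix_vector_mul_assoc matrix_mul_assoc del: transpose_matrix_vector)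
  then show ?thesis by (intro that) auto
qed

lemma lift_bounds:
  obtains C where "C \<ge> 1"
    "\<And>n x. x \<in> im (Om n) \<Longrightarrow> \<exists>p. Om n *v p = x \<and> norm p \<le> C * norm x"
    "\<And>n p. norm (Om n *v p) \<le> C * norm p"
    "\<And>n x y. x \<in> im (Om n) \<Longrightarrow> y \<in> im (Om n) \<Longrightarrow> \<bar>sform (Om n) x y\<bar> \<le> C * norm x * norm y"
proof -
  obtain C where C: "C \<ge> 1"
    "\<forall>M :: real^'a^'a. (\<forall>i j. M $ i $ j \<in> {-1, 0, 1}) \<longrightarrow>
     (\<forall>x\<in>im M. \<exists>p. M *v p = x \<and> norm p \<le> C * norm x) \<and> (\<forall>p. norm (M *v p) \<le> C * norm p)"
    using uniform_lift by blast
  have l: "\<exists>p. Om n *v p = x \<and> norm p \<le> C * norm x" if "x \<in> im (Om n)" for n x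
    using C(2) Om_sign that by blast
  have "\<bar>sform (Om n) x y\<bar> \<le> C * norm x * norm y" if x: "x \<in> im (Om n)" and y: "y \<in> im (Om n)" for n x y
  proof -
    obtain p where p: "Om n *v p = x" "norm p \<le> C * norm x" using l[OF x] by blast
    have "\<bar>sform (Om n) x y\<bar> = \<bar>p \<bullet> y\<bar>" using sform_eq[OF Om_anti y, of p] p(1) by simp
    also have "\<dots> \<le> norm p * norm y" by (rule Cauchy_Schwarz_ineq2)
    also have "\<dots> \<le> C * norm x * norm y" using p(2) by (intro mult_right_mono) auto
    finally show ?thesis .
  qed
  then show ?thesis using C l Om_sign by (intro that[of C]) blast+
qed

text \<open>In \<open>Gs_decay\<close> exponent and constant depend on the vector; the smallest
  exponent and the largest constant over an orthonormal basis serve for all.\<close>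

lemma uniform_decay: "\<exists>\<sigma>>0. \<exists>C\<ge>1. \<forall>\<xi>\<in>Gs. \<forall>n. norm (B 0 n *v \<xi>) \<le> C * b n powr - \<sigma> * norm \<xi>"
proof -
  obtain E where E: "E \<subseteq> Gs" "pairwise orthogonal E" "\<And>x. x \<in> E \<Longrightarrow> norm x = 1" "independent E" "span E = Gs"
    using orthonormal_basis_subspace[OF Gs(1)] by metis
  have fE: "finite E" using E(4) by (simp add: independent_imp_finite)
  have "\<exists>\<sigma>>0. \<exists>C\<ge>0. \<forall>e\<in>E. \<forall>n. norm (B 0 n *v e) \<le> C * b n powr - \<sigma>"
    using fE E(1)
  proof (induction E rule: finite_induct)
    case empty show ?case by (rule exI[of _ 1]) auto
  next
    case (insert e F)
    obtain \<sigma>1 C1 where 1: "\<sigma>1 > 0" "C1 \<ge> 0" "\<forall>e\<in>F. \<forall>n. norm (B 0 n *v e) \<le> C1 * b n powr - \<sigma>1"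
      using insert by auto
    obtain \<sigma>2 C2 where 2: "\<sigma>2 > 0" "C2 \<ge> 0" "\<forall>n. norm (B 0 n *v e) \<le> C2 * b n powr - \<sigma>2"
      using Gs_decay[of e] insert by auto
    define \<sigma> C where "\<sigma> = min \<sigma>1 \<sigma>2" and "C = max C1 C2"
    have h: "C1 * b n powr - \<sigma>1 \<le> C * b n powr - \<sigma>" "C2 * b n powr - \<sigma>2 \<le> C * b n powr - \<sigma>" for n
      using 1 2 by (intro mult_mono b_powr_le; simp add: \<sigma>_def C_def)+
    have "norm (B 0 n *v e') \<le> C * b n powr - \<sigma>" if "e' \<in> insert e F" for e' n
      using that order_trans[OF 1(3)[rule_format, of e' n] h(1)[of n]] order_trans[OF 2(3)[rule_format, of n] h(2)[of n]]
      by auto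
    moreover have "\<sigma> > 0" "C \<ge> 0" using 1 2 by (auto simp: \<sigma>_def C_def)
    ultimately show ?case by blast
  qed
  then obtain \<sigma> C where C: "\<sigma> > 0" "C \<ge> 0" "\<And>e n. e \<in> E \<Longrightarrow> norm (B 0 n *v e) \<le> C * b n powr - \<sigma>" by blast
  have "norm (B 0 n *v \<xi>) \<le> (real (card E) * C + 1) * b n powr - \<sigma> * norm \<xi>" if x: "\<xi> \<in> Gs" for \<xi> n
  proof -
    have "\<xi> = (\<Sum>e\<in>E. (\<xi> \<bullet> e) *\<^sub>R e)"
      using orthonormal_expansion[OF fE E(2,3), of \<xi>] x E(5) by simp
    then have "B 0 n *v \<xi> = B 0 n *v (\<Sum>e\<in>E. (\<xi> \<bullet> e) *\<^sub>R e)" by simp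
    also have "\<dots> = (\<Sum>e\<in>E. (\<xi> \<bullet> e) *\<^sub>R (B 0 n *v e))"
      by (simp add: linear_sum[OF matrix_vector_mul_linear] matrix_vector_mult_scaleR)
    finally have "B 0 n *v \<xi> = (\<Sum>e\<in>E. (\<xi> \<bullet> e) *\<^sub>R (B 0 n *v e))" .
    then have "norm (B 0 n *v \<xi>) \<le> (\<Sum>e\<in>E. norm ((\<xi> \<bullet> e) *\<^sub>R (B 0 n *v e)))" by (simp only: norm_sum)
    also have "\<dots> \<le> (\<Sum>e\<in>E. norm \<xi> * (C * b n powr - \<sigma>))"
    proof (rule sum_mono)
      fix e assume e: "e \<in> E"
      have "\<bar>\<xi> \<bullet> e\<bar> \<le> norm \<xi>" using Cauchy_Schwarz_ineq2[of \<xi> e] E(3)[OF e] by simp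
      then show "norm ((\<xi> \<bullet> e) *\<^sub>R (B 0 n *v e)) \<le> norm \<xi> * (C * b n powr - \<sigma>)"
        using C(3)[OF e, of n] by (simp add: mult_mono)
    qed
    also have "\<dots> = real (card E) * C * b n powr - \<sigma> * norm \<xi>" by simp
    also have "\<dots> \<le> (real (card E) * C + 1) * b n powr - \<sigma> * norm \<xi>" by (intro mult_right_mono) auto
    finally show ?thesis .
  qed
  then show ?thesis using C by (intro exI[of _ \<sigma>] conjI exI[of _ "real (card E) * C + 1"]) auto
qed

text \<open>\<open>b_time\<close> at exponent s / 2 makes \<open>b n powr - s\<close> at most a
  constant times 1 / (n + 1)^2.\<close>

lemma summable_b: "s > 0 \<Longrightarrow> summable (\<lambda>n. b n powr - s)"
proof -
  assume s: "s > 0"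
  obtain C where C: "C \<ge> 1" "\<And>n. real (Suc n) \<le> C * b n powr (s / 2)" using b_time[of "s / 2"] s by auto
  have "b n powr - s \<le> C\<^sup>2 * inverse ((real (Suc n))\<^sup>2)" for n
  proof -
    have "(real (Suc n))\<^sup>2 \<le> (C * b n powr (s / 2))\<^sup>2" using C(2)[of n] by (intro power_mono) auto
    also have "\<dots> = C\<^sup>2 * b n powr s" by (simp add: power_mult_distrib power2_eq_square powr_add[symmetric])
    finally have "(real (Suc n))\<^sup>2 * b n powr - s \<le> (C\<^sup>2 * b n powr s) * b n powr - s" by (intro mult_right_mono) auto
    also have "\<dots> = C\<^sup>2" using b_pos[of n] by (simp add: mult.assoc powr_add[symmetric])
    finally show ?thesis by (simp add: field_simps)
  qed
  then have le: "norm (b n powr - s) \<le> C\<^sup>2 * inverse ((real (Suc n))\<^sup>2)" for n by simp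
  have "summable (\<lambda>n. inverse ((real n)\<^sup>2))" by (rule inverse_power_summable) simp
  then have "summable (\<lambda>n. inverse ((real (Suc n))\<^sup>2))" by (subst summable_Suc_iff)
  then have "summable (\<lambda>n. C\<^sup>2 * inverse ((real (Suc n))\<^sup>2))" by (rule summable_mult)
  then show "summable (\<lambda>n. b n powr - s)" by (rule summable_comparison_test') (rule le)
qed

lemma sum_b_bound: "s > 0 \<Longrightarrow> \<exists>C\<ge>1. \<forall>A. finite A \<longrightarrow> (\<Sum>n\<in>A. b n powr - s) \<le> C"
proof (intro exI[of _ "1 + (\<Sum>n. b n powr - s)"] conjI allI impI)
  assume s: "s > 0"
  show "1 \<le> 1 + (\<Sum>n. b n powr - s)" using suminf_nonneg[OF summable_b[OF s]] by simp
  fix A :: "nat set" assume "finite A"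
  then show "(\<Sum>n\<in>A. b n powr - s) \<le> 1 + (\<Sum>n. b n powr - s)" using sum_le_suminf[OF summable_b[OF s], of A] by simp
qed

lemma powr_decay_tendsto: "s > 0 \<Longrightarrow> (\<lambda>n. b n powr - s) \<longlonglongrightarrow> 0"
  by (rule summable_LIMSEQ_zero[OF summable_b])

lemma Gs_im: "\<xi> \<in> Gs \<Longrightarrow> \<xi> \<in> im (Om 0)" using Gs(2) by blast

text \<open>By invariance the pairing can be evaluated at any time n, and there it is at most a
  constant times b n to the power \<sigma> / 2 - \<sigma>.\<close>

lemma sform_small:
  assumes x: "x \<in> im (Om 0)" and xi: "\<xi> \<in> Gs"
    and g: "\<And>\<tau>. \<tau> > 0 \<Longrightarrow> \<exists>C. \<forall>n. norm (B 0 n *v x) \<le> C * b n powr \<tau>"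
  shows "sform (Om 0) x \<xi> = 0"
proof -
  obtain \<sigma> D where D: "\<sigma> > 0" "D \<ge> 1" "\<And>\<xi> n. \<xi> \<in> Gs \<Longrightarrow> norm (B 0 n *v \<xi>) \<le> D * b n powr - \<sigma> * norm \<xi>"
    using uniform_decay by blast
  obtain C0 where C0: "\<And>n. norm (B 0 n *v x) \<le> C0 * b n powr (\<sigma> / 2)" using g[of "\<sigma> / 2"] D(1) by auto
  define C where "C = \<bar>C0\<bar>"
  have C: "norm (B 0 n *v x) \<le> C * b n powr (\<sigma> / 2)" "C \<ge> 0" for n
    using order_trans[OF C0[of n] mult_right_mono[OF abs_ge_self[of C0], of "b n powr (\<sigma> / 2)"]] by (auto simp: C_def)
  obtain L where L: "L \<ge> 1" "\<And>n x y. x \<in> im (Om n) \<Longrightarrow> y \<in> im (Om n) \<Longrightarrow> \<bar>sform (Om n) x y\<bar> \<le> L * norm x * norm y"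
    using lift_bounds by metis
  have "\<bar>sform (Om 0) x \<xi>\<bar> \<le> L * C * D * norm \<xi> * b n powr - (\<sigma> / 2)" for n
  proof -
    have "\<bar>sform (Om 0) x \<xi>\<bar> = \<bar>sform (Om n) (B 0 n *v x) (B 0 n *v \<xi>)\<bar>"
      using B_sform[OF le0 x Gs_im[OF xi]] by simp
    also have "\<dots> \<le> L * norm (B 0 n *v x) * norm (B 0 n *v \<xi>)"
      by (intro L(2) B_im x Gs_im[OF xi]) auto
    also have "\<dots> \<le> L * (C * b n powr (\<sigma> / 2)) * (D * b n powr - \<sigma> * norm \<xi>)"
      using L(1) C(1)[of n] C(2) D(3)[OF xi, of n] by (intro mult_mono mult_nonneg_nonneg) auto
    also have "\<dots> = L * C * D * norm \<xi> * (b n powr (\<sigma> / 2) * b n powr - \<sigma>)" by simp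
    also have "b n powr (\<sigma> / 2) * b n powr - \<sigma> = b n powr - (\<sigma> / 2)" by (simp add: powr_add[symmetric])
    finally show ?thesis .
  qed
  moreover have "(\<lambda>n. L * C * D * norm \<xi> * b n powr - (\<sigma> / 2)) \<longlonglongrightarrow> L * C * D * norm \<xi> * 0"
    using D(1) by (intro tendsto_mult tendsto_const powr_decay_tendsto) auto
  ultimately have "\<bar>sform (Om 0) x \<xi>\<bar> \<le> 0" by (intro LIMSEQ_le_const[where X = "\<lambda>n. L * C * D * norm \<xi> * b n powr - (\<sigma> / 2)"]) auto
  then show ?thesis by simp
qed

lemma Gs_growth: "\<xi> \<in> Gs \<Longrightarrow> \<tau> > 0 \<Longrightarrow> \<exists>C. \<forall>n. norm (B 0 n *v \<xi>) \<le> C * b n powr \<tau>"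
proof -
  assume xi: "\<xi> \<in> Gs" and t: "\<tau> > 0"
  obtain C where "\<And>m n. m \<le> n \<Longrightarrow> norm (B 0 n *v \<xi>) \<le> C * b n powr \<tau> * norm (B 0 m *v \<xi>)"
    using coherent[OF t] xi by blast
  from this[of 0] show ?thesis by (intro exI[of _ "C * norm \<xi>"]) (simp add: B_id mult_ac)
qed

lemma isotropic: "\<xi> \<in> Gs \<Longrightarrow> \<eta> \<in> Gs \<Longrightarrow> sform (Om 0) \<xi> \<eta> = 0"
  by (rule sform_small[OF Gs_im _ Gs_growth])

lemma in_Gs: "x \<in> im (Om 0) \<Longrightarrow> (\<And>\<xi>. \<xi> \<in> Gs \<Longrightarrow> sform (Om 0) x \<xi> = 0) \<Longrightarrow> x \<in> Gs"
  using lagrangian[OF Om_anti Gs(1,2) isotropic Gs(3), of x] by blast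

text \<open>The symplectic form pairs the growth of an element outside the stable space against the decay
  of the stable space.\<close>

lemma slow_growth_in_Gs:
  assumes "x \<in> im (Om 0)" "\<And>\<tau>. \<tau> > 0 \<Longrightarrow> \<exists>C. \<forall>n. norm (B 0 n *v x) \<le> C * b n powr \<tau>"
  shows "x \<in> Gs"
  by (rule in_Gs[OF assms(1)]) (rule sform_small[OF assms(1) _ assms(2)])

text \<open>Interpolation between coherence and the decay of the stable space.\<close>

lemma interpolated_decay:
  assumes "\<tau> > 0"
  shows "\<exists>s>0. \<exists>C\<ge>1. \<forall>n m. n \<le> m \<longrightarrow> (\<forall>\<xi>\<in>Gs.
    norm (B 0 m *v \<xi>) \<le> C * b m powr - s * b n powr \<tau> * norm (B 0 n *v \<xi>))"
proof -
  obtain \<sigma> D where D: "\<sigma> > 0" "D \<ge> 1" "\<And>\<xi> n. \<xi> \<in> Gs \<Longrightarrow> norm (B 0 n *v \<xi>) \<le> D * b n powr - \<sigma> * norm \<xi>"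
    using uniform_decay by blast
  obtain K E where K: "K \<ge> 0" "E \<ge> 1" "\<And>n x. norm x \<le> E * b n powr K * norm (B 0 n *v x)"
    using B_inv_bound by blast
  \<comment> \<open>\<theta> is the weight of the decay bound, 1 - \<theta> that of coherence. The
    decay bound refers to time zero, and going back there from time n costs b n to the power K; the
    \<theta>-th power of this cost must stay below the allowed \<tau>.\<close>
  define \<theta> where "\<theta> = min (1 / 2) (\<tau> / (K + 1))"
  have th: "\<theta> > 0" "\<theta> < 1" using assms K(1) by (auto simp: \<theta>_def)
  have "\<theta> * (K + 1) \<le> \<tau> / (K + 1) * (K + 1)" using K(1) by (intro mult_right_mono) (auto simp: \<theta>_def)
  also have "\<dots> = \<tau>" using K(1) by simp
  finally have Kt: "K * \<theta> \<le> \<tau>" using th by (simp add: algebra_simps)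
  \<comment> \<open>Half of the gain \<sigma> * \<theta> pays for coherence at exponent s, the other
    half remains as decay.\<close>
  define s where "s = \<sigma> * \<theta> / 2"
  have s: "s > 0" using D(1) th by (simp add: s_def)
  obtain C where C: "C \<ge> 1" "\<And>m n \<xi>. m \<le> n \<Longrightarrow> \<xi> \<in> Gs \<Longrightarrow> norm (B 0 n *v \<xi>) \<le> C * b n powr s * norm (B 0 m *v \<xi>)"
    using coherent[OF s] by blast
  let ?F = "C powr (1 - \<theta>) * (D * E) powr \<theta>"
  have "norm (B 0 m *v \<xi>) \<le> ?F * b m powr - s * b n powr \<tau> * norm (B 0 n *v \<xi>)" if nm: "n \<le> m" and xi: "\<xi> \<in> Gs" for n m \<xi>
  proof (cases "norm (B 0 m *v \<xi>) = 0")
    case False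
    define y z where "y = norm (B 0 m *v \<xi>)" and "z = norm (B 0 n *v \<xi>)"
    have y: "y > 0" using False by (simp add: y_def)
    have 1: "y \<le> C * b m powr s * z" using C(2)[OF nm xi] by (simp add: y_def z_def)
    have 2: "y \<le> D * b m powr - \<sigma> * (E * b n powr K * z)"
    proof -
      have "y \<le> D * b m powr - \<sigma> * norm \<xi>" using D(3)[OF xi] by (simp add: y_def)
      also have "\<dots> \<le> D * b m powr - \<sigma> * (E * b n powr K * z)"
        using D(2) K(3)[of \<xi> n] by (intro mult_left_mono) (auto simp: z_def)
      finally show ?thesis .
    qed
    have z: "z > 0"
    proof (rule ccontr)
      assume "\<not> z > 0"
      then have "z = 0" by (simp add: z_def)
      then show False using 1 y by simp
    qed
    have "y = y powr (1 - \<theta>) * y powr \<theta>" using y by (simp add: powr_add[symmetric])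
    also have "\<dots> \<le> (C * b m powr s * z) powr (1 - \<theta>) * (D * b m powr - \<sigma> * (E * b n powr K * z)) powr \<theta>"
      using 1 2 y th by (intro mult_mono powr_mono2) auto
    also have "(C * b m powr s * z) powr (1 - \<theta>) = C powr (1 - \<theta>) * b m powr (s * (1 - \<theta>)) * z powr (1 - \<theta>)"
      using C(1) z by (simp add: powr_mult powr_powr)
    also have "(D * b m powr - \<sigma> * (E * b n powr K * z)) powr \<theta> =
        (D * E) powr \<theta> * b m powr (- \<sigma> * \<theta>) * b n powr (K * \<theta>) * z powr \<theta>"
      using D(2) K(2) z by (simp add: powr_mult powr_powr)
    also have "C powr (1 - \<theta>) * b m powr (s * (1 - \<theta>)) * z powr (1 - \<theta>) *
        ((D * E) powr \<theta> * b m powr (- \<sigma> * \<theta>) * b n powr (K * \<theta>) * z powr \<theta>) =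
        ?F * (b m powr (s * (1 - \<theta>)) * b m powr (- \<sigma> * \<theta>)) * b n powr (K * \<theta>) * (z powr (1 - \<theta>) * z powr \<theta>)"
      by (simp only: mult_ac)
    also have "b m powr (s * (1 - \<theta>)) * b m powr (- \<sigma> * \<theta>) = b m powr (s * (1 - \<theta>) - \<sigma> * \<theta>)"
      by (simp add: powr_add[symmetric])
    also have "z powr (1 - \<theta>) * z powr \<theta> = z" using z by (simp add: powr_add[symmetric])
    also have "?F * b m powr (s * (1 - \<theta>) - \<sigma> * \<theta>) * b n powr (K * \<theta>) * z \<le> ?F * b m powr - s * b n powr \<tau> * z"
    proof -
      have "s * (1 - \<theta>) - \<sigma> * \<theta> \<le> - s" using s th mult_nonneg_nonneg[of s \<theta>] by (simp add: s_def field_simps)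
      then show ?thesis using z Kt by (intro mult_mono b_powr_le mult_nonneg_nonneg) auto
    qed
    finally show ?thesis by (simp add: y_def z_def)
  qed simp
  moreover have "?F \<ge> 1" using C(1) D(2) K(2) th by (intro one_le_mult ge_one_powr_ge_zero) auto
  ultimately show ?thesis using s by blast
qed

end

section \<open>Shadowing of approximate orbits\<close>

context cocycle
begin

text \<open>Pseudo-orbits of the cocycle with errors of size A times b n to the power -\<delta>. The
  case \<delta> = 0 serves functions of class C^1, the case \<delta> > 0 functions of class C^r with
  r > 1 under the spectral gap.\<close>

definition approx :: "(nat \<Rightarrow> real^'a) \<Rightarrow> real \<Rightarrow> real \<Rightarrow> bool" where
  "approx x A \<delta> \<longleftrightarrow> (\<forall>n. x n \<in> im (Om n)) \<and> norm (x 0) \<le> A \<and>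
     (\<forall>n. norm (x (Suc n) - B n (Suc n) *v x n) \<le> A * b n powr - \<delta>)"

text \<open>c follows the pseudo-orbit as far as stable vectors can see. Since Gs is Lagrangian this
  determines c modulo Gs; no bound on x n - B 0 n c is asked for yet.\<close>

definition asymptotic :: "real^'a \<Rightarrow> (nat \<Rightarrow> real^'a) \<Rightarrow> bool" where
  "asymptotic c x \<longleftrightarrow> c \<in> im (Om 0) \<and>
     (\<forall>\<xi>\<in>Gs. (\<lambda>n. sform (Om n) (x n) (B 0 n *v \<xi>)) \<longlonglongrightarrow> sform (Om 0) c \<xi>)"

lemma approxD:
  assumes "approx x A \<delta>"
  shows "x n \<in> im (Om n)" "norm (x 0) \<le> A" "norm (x (Suc n) - B n (Suc n) *v x n) \<le> A * b n powr - \<delta>" "A \<ge> 0"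
proof -
  show "x n \<in> im (Om n)" "norm (x 0) \<le> A" "norm (x (Suc n) - B n (Suc n) *v x n) \<le> A * b n powr - \<delta>"
    using assms unfolding approx_def by blast+
  then show "A \<ge> 0" using norm_ge_zero[of "x 0"] by linarith
qed

text \<open>The true orbit contributes nothing by invariance of the form, so the increment of the
  pairing is the pairing of the error alone.\<close>

lemma form_increment:
  assumes L: "L \<ge> 1" "\<And>n x y. x \<in> im (Om n) \<Longrightarrow> y \<in> im (Om n) \<Longrightarrow> \<bar>sform (Om n) x y\<bar> \<le> L * norm x * norm y"
    and x: "approx x A \<delta>" and xi: "\<xi> \<in> Gs"
  shows "\<bar>sform (Om (Suc n)) (x (Suc n)) (B 0 (Suc n) *v \<xi>) - sform (Om n) (x n) (B 0 n *v \<xi>)\<bar>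
    \<le> L * (A * b n powr - \<delta>) * norm (B 0 (Suc n) *v \<xi>)"
proof -
  note im = approxD(1)[OF x]
  have nS: "n \<le> Suc n" by simp
  have xin: "B 0 n *v \<xi> \<in> im (Om n)" for n by (intro B_im Gs_im[OF xi]) simp
  have Bx: "B n (Suc n) *v x n \<in> im (Om (Suc n))" by (intro B_im im) simp
  have "sform (Om n) (x n) (B 0 n *v \<xi>) = sform (Om (Suc n)) (B n (Suc n) *v x n) (B n (Suc n) *v (B 0 n *v \<xi>))"
    by (rule B_sform[OF nS im xin, symmetric])
  also have "B n (Suc n) *v (B 0 n *v \<xi>) = B 0 (Suc n) *v \<xi>" by (rule B_comp_mult) auto
  finally have "sform (Om (Suc n)) (x (Suc n)) (B 0 (Suc n) *v \<xi>) - sform (Om n) (x n) (B 0 n *v \<xi>) =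
      sform (Om (Suc n)) (x (Suc n) - B n (Suc n) *v x n) (B 0 (Suc n) *v \<xi>)"
    using sform_diff_left[OF Om_anti im Bx xin] by simp
  also have "\<bar>\<dots>\<bar> \<le> L * norm (x (Suc n) - B n (Suc n) *v x n) * norm (B 0 (Suc n) *v \<xi>)"
    by (intro L(2) subspace_diff[OF subspace_im] im Bx xin)
  also have "\<dots> \<le> L * (A * b n powr - \<delta>) * norm (B 0 (Suc n) *v \<xi>)"
    using L(1) approxD(3)[OF x, of n] by (intro mult_right_mono mult_left_mono) auto
  finally show ?thesis .
qed

text \<open>Pairings with a fixed stable vector have summable increments by
  \<open>uniform_decay\<close>. Their limit is a linear functional on Gs bounded by a multiple of A;
  if q in Gs represents it, Om 0 q is the vector sought.\<close>

lemma asymptotic_exists: "\<exists>K\<ge>1. \<forall>x A. approx x A 0 \<longrightarrow> (\<exists>c. asymptotic c x \<and> norm c \<le> K * A)"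
proof -
  obtain L where L: "L \<ge> 1" "\<And>n p. norm (Om n *v p) \<le> L * norm p"
    "\<And>n x y. x \<in> im (Om n) \<Longrightarrow> y \<in> im (Om n) \<Longrightarrow> \<bar>sform (Om n) x y\<bar> \<le> L * norm x * norm y"
    using lift_bounds by metis
  obtain \<sigma> D where D: "\<sigma> > 0" "D \<ge> 1" "\<And>\<xi> n. \<xi> \<in> Gs \<Longrightarrow> norm (B 0 n *v \<xi>) \<le> D * b n powr - \<sigma> * norm \<xi>"
    using uniform_decay by blast
  obtain S where S: "S \<ge> 1" "\<And>A. finite A \<Longrightarrow> (\<Sum>n\<in>A. b n powr - \<sigma>) \<le> S" using sum_b_bound[OF D(1)] by blast
  define K where "K = L + L * D * S"
  have K: "K \<ge> 1" using L(1) D(2) S(1) by (simp add: K_def add_increasing2)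
  have "\<exists>c. asymptotic c x \<and> norm c \<le> (L * K) * A" if x: "approx x A 0" for x A
  proof -
    note im = approxD(1)[OF x] and A = approxD(4)[OF x]
    define a where "a \<xi> n = sform (Om n) (x n) (B 0 n *v \<xi>)" for \<xi> n
    define l where "l \<xi> = lim (a \<xi>)" for \<xi>
    have xin: "B 0 n *v \<xi> \<in> im (Om n)" if "\<xi> \<in> Gs" for n \<xi> by (intro B_im Gs_im[OF that]) simp
    have inc: "\<bar>a \<xi> (Suc n) - a \<xi> n\<bar> \<le> L * A * D * norm \<xi> * b (Suc n) powr - \<sigma>" if xi: "\<xi> \<in> Gs" for \<xi> n
    proof -
      have "\<bar>a \<xi> (Suc n) - a \<xi> n\<bar> \<le> L * (A * b n powr - 0) * norm (B 0 (Suc n) *v \<xi>)"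
        unfolding a_def by (rule form_increment[OF L(1,3) x xi])
      also have "\<dots> \<le> L * A * (D * b (Suc n) powr - \<sigma> * norm \<xi>)"
        using b_pos[of n] L(1) A D(3)[OF xi, of "Suc n"] by (simp add: mult_left_mono)
      finally show ?thesis by (simp add: mult_ac)
    qed
    have tel: "a \<xi> n = a \<xi> 0 + (\<Sum>i<n. a \<xi> (Suc i) - a \<xi> i)" for \<xi> n
      using sum_lessThan_telescope[of "a \<xi>" n] by simp
    have conv: "a \<xi> \<longlonglongrightarrow> l \<xi>" if xi: "\<xi> \<in> Gs" for \<xi>
    proof -
      have "summable (\<lambda>n. b (Suc n) powr - \<sigma>)" using summable_b[OF D(1)] by (subst summable_Suc_iff)
      then have "summable (\<lambda>n. L * A * D * norm \<xi> * b (Suc n) powr - \<sigma>)" by (rule summable_mult)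
      then have "summable (\<lambda>n. a \<xi> (Suc n) - a \<xi> n)"
        by (rule summable_comparison_test') (use inc[OF xi] in simp)
      then have "(\<lambda>n. a \<xi> 0 + (\<Sum>i<n. a \<xi> (Suc i) - a \<xi> i)) \<longlonglongrightarrow> a \<xi> 0 + (\<Sum>i. a \<xi> (Suc i) - a \<xi> i)"
        by (intro tendsto_add tendsto_const summable_LIMSEQ)
      then have "convergent (a \<xi>)" unfolding tel[symmetric] convergent_def by blast
      then show ?thesis unfolding l_def by (rule convergent_LIMSEQ_iff[THEN iffD1])
    qed
    have bd: "\<bar>a \<xi> n\<bar> \<le> K * A * norm \<xi>" if xi: "\<xi> \<in> Gs" for \<xi> n
    proof -
      have "\<bar>a \<xi> 0\<bar> \<le> L * norm (x 0) * norm \<xi>"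
        using L(3)[OF im[of 0] xin[OF xi, of 0]] by (simp add: a_def B_id)
      also have "\<dots> \<le> L * A * norm \<xi>" using L(1) approxD(2)[OF x] by (intro mult_right_mono mult_left_mono) auto
      finally have 1: "\<bar>a \<xi> 0\<bar> \<le> L * A * norm \<xi>" .
      have "\<bar>\<Sum>i<n. a \<xi> (Suc i) - a \<xi> i\<bar> \<le> (\<Sum>i<n. L * A * D * norm \<xi> * b (Suc i) powr - \<sigma>)"
        by (intro order_trans[OF sum_abs] sum_mono inc xi)
      also have "\<dots> = L * A * D * norm \<xi> * (\<Sum>i<n. b (Suc i) powr - \<sigma>)" by (simp add: sum_distrib_left)
      also have "(\<Sum>i<n. b (Suc i) powr - \<sigma>) = (\<Sum>i\<in>Suc ` {..<n}. b i powr - \<sigma>)" by (simp add: sum.reindex)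
      also have "L * A * D * norm \<xi> * \<dots> \<le> L * A * D * norm \<xi> * S"
        using L(1) A D(2) by (intro mult_left_mono S(2)) auto
      finally have "\<bar>a \<xi> n\<bar> \<le> L * A * norm \<xi> + L * A * D * norm \<xi> * S" using 1 tel[of \<xi> n] by linarith
      also have "\<dots> = K * A * norm \<xi>" by (simp add: K_def algebra_simps)
      finally show ?thesis .
    qed
    have "\<exists>q\<in>Gs. (\<forall>\<xi>\<in>Gs. l \<xi> = q \<bullet> \<xi>) \<and> norm q \<le> K * A"
    proof (rule riesz_subspace[OF Gs(1)])
      fix \<xi> \<eta> assume h: "\<xi> \<in> Gs" "\<eta> \<in> Gs"
      have "a (\<xi> + \<eta>) n = a \<xi> n + a \<eta> n" for n
        unfolding a_def matrix_vector_right_distrib by (rule sform_add_right[OF Om_anti im xin[OF h(1)] xin[OF h(2)]])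
      then have "a (\<xi> + \<eta>) \<longlonglongrightarrow> l \<xi> + l \<eta>" using tendsto_add[OF conv[OF h(1)] conv[OF h(2)]] by (simp add: tendsto_def)
      then show "l (\<xi> + \<eta>) = l \<xi> + l \<eta>" using conv[OF subspace_add[OF Gs(1) h]] LIMSEQ_unique by blast
    next
      fix \<xi> k assume h: "\<xi> \<in> Gs"
      have "a (k *\<^sub>R \<xi>) n = k * a \<xi> n" for n
        unfolding a_def matrix_vector_mult_scaleR by (rule sform_scale_right[OF Om_anti])
      then have "a (k *\<^sub>R \<xi>) \<longlonglongrightarrow> k * l \<xi>" using tendsto_mult[OF tendsto_const conv[OF h], of k] by (simp add: tendsto_def)
      then show "l (k *\<^sub>R \<xi>) = k * l \<xi>" using conv[OF subspace_scale[OF Gs(1) h]] LIMSEQ_unique by blast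
    next
      fix \<xi> assume h: "\<xi> \<in> Gs"
      show "\<bar>l \<xi>\<bar> \<le> K * A * norm \<xi>"
        by (rule LIMSEQ_le_const2[OF tendsto_rabs[OF conv[OF h]]]) (use bd[OF h] in blast)
    qed (use A K in auto)
    then obtain q where q: "\<And>\<xi>. \<xi> \<in> Gs \<Longrightarrow> l \<xi> = q \<bullet> \<xi>" "norm q \<le> K * A" by blast
    have "asymptotic (Om 0 *v q) x"
      unfolding asymptotic_def
    proof (intro conjI ballI)
      fix \<xi> assume xi: "\<xi> \<in> Gs"
      have "sform (Om 0) (Om 0 *v q) \<xi> = l \<xi>" using sform_eq[OF Om_anti Gs_im[OF xi], of q] q(1)[OF xi] by simp
      then show "(\<lambda>n. sform (Om n) (x n) (B 0 n *v \<xi>)) \<longlonglongrightarrow> sform (Om 0) (Om 0 *v q) \<xi>"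
        using conv[OF xi] by (simp add: a_def[abs_def])
    qed simp
    moreover have "norm (Om 0 *v q) \<le> (L * K) * A"
      using order_trans[OF L(2)[of 0 q] mult_left_mono[OF q(2), of L]] L(1) by (simp add: mult_ac)
    ultimately show ?thesis by blast
  qed
  moreover have "L * K \<ge> 1" by (intro one_le_mult L(1) K)
  ultimately show ?thesis by blast
qed

text \<open>The pairing of x n - B 0 n c with a stable vector is the tail of a convergent series,
  which \<open>interpolated_decay\<close> makes small relative to that vector at time n. If q
  represents this functional on the image of Gs, then y = Om n q has the same pairings, so the
  difference pairs to zero with a Lagrangian space and is itself stable.\<close>

lemma tracking_mod_Gs:
  assumes "\<delta> \<ge> 0" "\<tau> > 0"
  shows "\<exists>C\<ge>1. \<forall>x A c n. approx x A \<delta> \<longrightarrow> asymptotic c x \<longrightarrow>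
    (\<exists>\<xi>\<in>Gs. \<exists>y. x n - B 0 n *v c = B 0 n *v \<xi> + y \<and> norm y \<le> C * A * b n powr (\<tau> - \<delta>))"
proof -
  obtain L where L: "L \<ge> 1" "\<And>n p. norm (Om n *v p) \<le> L * norm p"
    "\<And>n x y. x \<in> im (Om n) \<Longrightarrow> y \<in> im (Om n) \<Longrightarrow> \<bar>sform (Om n) x y\<bar> \<le> L * norm x * norm y"
    using lift_bounds by metis
  obtain s D where D: "s > 0" "D \<ge> 1"
    "\<And>n m \<xi>. n \<le> m \<Longrightarrow> \<xi> \<in> Gs \<Longrightarrow> norm (B 0 m *v \<xi>) \<le> D * b m powr - s * b n powr \<tau> * norm (B 0 n *v \<xi>)"
    using interpolated_decay[OF assms(2)] by blast
  obtain S where S: "S \<ge> 1" "\<And>A. finite A \<Longrightarrow> (\<Sum>n\<in>A. b n powr - s) \<le> S" using sum_b_bound[OF D(1)] by blast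
  define K where "K = L * D * S"
  have K: "K \<ge> 1" unfolding K_def by (intro one_le_mult L(1) D(2) S(1))
  have "\<exists>\<xi>\<in>Gs. \<exists>y. x n - B 0 n *v c = B 0 n *v \<xi> + y \<and> norm y \<le> (L * K) * A * b n powr (\<tau> - \<delta>)"
    if x: "approx x A \<delta>" and c: "asymptotic c x" for x A c n
  proof -
    note im = approxD(1)[OF x] and A = approxD(4)[OF x]
    have c0: "c \<in> im (Om 0)" using c by (simp add: asymptotic_def)
    define z where "z = x n - B 0 n *v c"
    have cn: "B 0 n *v c \<in> im (Om n)" for n by (intro B_im c0) simp
    have zim: "z \<in> im (Om n)" unfolding z_def by (rule subspace_diff[OF subspace_im im cn])
    have xin: "B 0 n *v \<xi> \<in> im (Om n)" if "\<xi> \<in> Gs" for n \<xi> by (intro B_im Gs_im[OF that]) simp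
    have small: "\<bar>sform (Om n) z (B 0 n *v \<xi>)\<bar> \<le> K * A * b n powr (\<tau> - \<delta>) * norm (B 0 n *v \<xi>)" if xi: "\<xi> \<in> Gs" for \<xi>
    proof -
      define a where "a n = sform (Om n) (x n) (B 0 n *v \<xi>)" for n
      let ?H = "K * A * b n powr (\<tau> - \<delta>) * norm (B 0 n *v \<xi>)"
      have "\<bar>a N - a n\<bar> \<le> ?H" if N: "n \<le> N" for N
      proof -
        have inc: "\<bar>a (Suc m) - a m\<bar> \<le> L * A * b n powr - \<delta> * D * b n powr \<tau> * norm (B 0 n *v \<xi>) * b (Suc m) powr - s"
          if m: "n \<le> m" for m
        proof -
          have "\<bar>a (Suc m) - a m\<bar> \<le> L * (A * b m powr - \<delta>) * norm (B 0 (Suc m) *v \<xi>)"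
            unfolding a_def by (rule form_increment[OF L(1,3) x xi])
          also have "\<dots> \<le> L * (A * b n powr - \<delta>) * (D * b (Suc m) powr - s * b n powr \<tau> * norm (B 0 n *v \<xi>))"
            using L(1) A b_powr_antimono[OF m assms(1)] D(3)[OF le_SucI[OF m] xi]
            by (intro mult_mono mult_left_mono) auto
          finally show ?thesis by (simp add: mult_ac)
        qed
        have "\<bar>a N - a n\<bar> = \<bar>\<Sum>m=n..<N. a (Suc m) - a m\<bar>" using N by (simp add: sum_Suc_diff')
        also have "\<dots> \<le> (\<Sum>m=n..<N. L * A * b n powr - \<delta> * D * b n powr \<tau> * norm (B 0 n *v \<xi>) * b (Suc m) powr - s)"
          by (intro order_trans[OF sum_abs] sum_mono inc) auto
        also have "\<dots> = L * A * b n powr - \<delta> * D * b n powr \<tau> * norm (B 0 n *v \<xi>) * (\<Sum>m\<in>Suc ` {n..<N}. b m powr - s)"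
          by (simp add: sum_distrib_left sum.reindex del: image_Suc_atLeastLessThan)
        also have "\<dots> \<le> L * A * b n powr - \<delta> * D * b n powr \<tau> * norm (B 0 n *v \<xi>) * S"
          using L(1) A D(2) by (intro mult_left_mono S(2)) auto
        also have "\<dots> = K * A * (b n powr \<tau> * b n powr - \<delta>) * norm (B 0 n *v \<xi>)" by (simp add: K_def)
        also have "b n powr \<tau> * b n powr - \<delta> = b n powr (\<tau> - \<delta>)" by (simp add: powr_add[symmetric])
        finally show ?thesis .
      qed
      moreover have "(\<lambda>N. \<bar>a N - a n\<bar>) \<longlonglongrightarrow> \<bar>sform (Om 0) c \<xi> - a n\<bar>"
        using c xi by (intro tendsto_intros) (simp add: asymptotic_def a_def)
      ultimately have "\<bar>sform (Om 0) c \<xi> - a n\<bar> \<le> ?H" by (intro LIMSEQ_le_const2) auto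
      moreover have "sform (Om n) z (B 0 n *v \<xi>) = a n - sform (Om 0) c \<xi>"
        unfolding z_def a_def using sform_diff_left[OF Om_anti im cn xin[OF xi]] B_sform[OF le0 c0 Gs_im[OF xi]] by simp
      ultimately show ?thesis by linarith
    qed
    let ?W = "(*v) (B 0 n) ` Gs"
    have "\<exists>q\<in>?W. (\<forall>y\<in>?W. sform (Om n) z y = q \<bullet> y) \<and> norm q \<le> K * A * b n powr (\<tau> - \<delta>)"
    proof (rule riesz_subspace)
      show "subspace ?W" by (rule linear_subspace_image[OF matrix_vector_mul_linear Gs(1)])
      fix y y' assume "y \<in> ?W" "y' \<in> ?W"
      then have "y \<in> im (Om n)" "y' \<in> im (Om n)" using xin by (metis imageE)+
      then show "sform (Om n) z (y + y') = sform (Om n) z y + sform (Om n) z y'"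
        by (rule sform_add_right[OF Om_anti zim])
    next
      fix y and k :: real show "sform (Om n) z (k *\<^sub>R y) = k * sform (Om n) z y" by (rule sform_scale_right[OF Om_anti])
    next
      fix y assume "y \<in> ?W" then show "\<bar>sform (Om n) z y\<bar> \<le> K * A * b n powr (\<tau> - \<delta>) * norm y" using small by blast
    qed (use A K in auto)
    then obtain q where q: "\<And>\<xi>. \<xi> \<in> Gs \<Longrightarrow> sform (Om n) z (B 0 n *v \<xi>) = q \<bullet> (B 0 n *v \<xi>)"
      "norm q \<le> K * A * b n powr (\<tau> - \<delta>)" by blast
    define y where "y = Om n *v q"
    have yim: "y \<in> im (Om n)" by (simp add: y_def)
    have "z - y \<in> im (Om n)" by (rule subspace_diff[OF subspace_im zim yim])
    then obtain \<xi>0 where x0: "\<xi>0 \<in> im (Om 0)" "z - y = B 0 n *v \<xi>0" by (rule B_im_surj)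
    have "\<xi>0 \<in> Gs"
    proof (rule in_Gs[OF x0(1)])
      fix \<xi> assume xi: "\<xi> \<in> Gs"
      have "sform (Om 0) \<xi>0 \<xi> = sform (Om n) (z - y) (B 0 n *v \<xi>)"
        using B_sform[OF le0 x0(1) Gs_im[OF xi]] x0(2) by simp
      also have "\<dots> = sform (Om n) z (B 0 n *v \<xi>) - q \<bullet> (B 0 n *v \<xi>)"
        using sform_diff_left[OF Om_anti zim yim xin[OF xi]] sform_eq[OF Om_anti xin[OF xi, of n], of q] by (simp add: y_def)
      finally show "sform (Om 0) \<xi>0 \<xi> = 0" using q(1)[OF xi] by simp
    qed
    moreover have "x n - B 0 n *v c = B 0 n *v \<xi>0 + y" using x0(2) by (simp add: z_def algebra_simps)
    moreover have "norm y \<le> (L * K) * A * b n powr (\<tau> - \<delta>)"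
      using order_trans[OF L(2)[of n q] mult_left_mono[OF q(2), of L]] L(1) by (simp add: y_def mult_ac)
    ultimately show ?thesis by blast
  qed
  moreover have "L * K \<ge> 1" by (intro one_le_mult L(1) K)
  ultimately show ?thesis by blast
qed

text \<open>\<open>tracking_mod_Gs\<close> leaves a stable vector \<xi> n that depends on n.
  Consecutive ones differ little when measured at their own time, and each difference is carried
  from time m + 1 to time n inside Gs by \<open>interpolated_decay\<close>, at a cost of b (m + 1)
  to the power \<tau> and with a gain of b n to the power -s. Telescoping gives the sum.\<close>

lemma tracking:
  assumes de: "\<delta> \<ge> 0" and ta: "\<tau> > 0" and K: "K \<ge> 0"
  shows "\<exists>s>0. \<exists>C\<ge>1. \<forall>x A c n. approx x A \<delta> \<longrightarrow> asymptotic c x \<longrightarrow> norm c \<le> K * A \<longrightarrow>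
    norm (x n - B 0 n *v c) \<le> C * A * (b n powr (\<tau> - \<delta>) + b n powr - s * (\<Sum>m\<le>n. b m powr (2 * \<tau> - \<delta>)))"
proof -
  obtain C1 where C1: "C1 \<ge> 1" "\<And>x A c n. approx x A \<delta> \<Longrightarrow> asymptotic c x \<Longrightarrow>
    (\<exists>\<xi>\<in>Gs. \<exists>y. x n - B 0 n *v c = B 0 n *v \<xi> + y \<and> norm y \<le> C1 * A * b n powr (\<tau> - \<delta>))"
    using tracking_mod_Gs[OF de ta] by blast
  obtain s D where D: "s > 0" "D \<ge> 1"
    "\<And>n m \<xi>. n \<le> m \<Longrightarrow> \<xi> \<in> Gs \<Longrightarrow> norm (B 0 m *v \<xi>) \<le> D * b m powr - s * b n powr \<tau> * norm (B 0 n *v \<xi>)"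
    using interpolated_decay[OF ta] by blast
  obtain S1 where S1: "S1 \<ge> 1" "\<And>n x. norm (B n (Suc n) *v x) \<le> S1 * norm x" using B_step by blast
  \<comment> \<open>Three contributions to one increment of \<xi>: the error of the pseudo-orbit, y
    at time m + 1, and y at time m carried one step. The factor \<open>2 powr \<delta>\<close> pays
    for comparing b m with b (m + 1), which is at most twice as large.\<close>
  define Q where "Q = 2 powr \<delta> * (1 + C1 + S1 * C1)"
  \<comment> \<open>1 + K + C1 bounds \<xi> 0 through x 0, c and y 0; Q bounds the later
    differences.\<close>
  define G where "G = D * (1 + K + C1 + Q)"
  define C where "C = C1 + G"
  have SC: "S1 * C1 \<ge> 0" using S1(1) C1(1) by simp
  have Q: "Q \<ge> 0" using C1(1) SC by (simp add: Q_def)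
  have G: "D * (1 + K + C1) \<le> G" "D * Q \<le> G"
    unfolding G_def using D(2) K Q C1(1) by (intro mult_left_mono; simp)+
  have "0 \<le> D * Q" using D(2) Q by simp
  then have GC: "G \<le> C" "C1 \<le> C" using C1(1) G(2) by (auto simp: C_def)
  then have C: "C \<ge> 1" using C1(1) by simp
  have "norm (x n - B 0 n *v c) \<le> C * A * (b n powr (\<tau> - \<delta>) + b n powr - s * (\<Sum>m\<le>n. b m powr (2 * \<tau> - \<delta>)))"
    if x: "approx x A \<delta>" and c: "asymptotic c x" and cK: "norm c \<le> K * A" for x A c n
  proof -
    note A = approxD(4)[OF x]
    have "\<exists>\<xi> y. \<xi> \<in> Gs \<and> x n - B 0 n *v c = B 0 n *v \<xi> + y \<and> norm y \<le> C1 * A * b n powr (\<tau> - \<delta>)" for n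
      using C1(2)[OF x c, of n] by blast
    then obtain \<xi> y where xy: "\<And>n. \<xi> n \<in> Gs" "\<And>n. x n - B 0 n *v c = B 0 n *v \<xi> n + y n"
      "\<And>n. norm (y n) \<le> C1 * A * b n powr (\<tau> - \<delta>)" by metis
    have half: "b m powr - \<delta> \<le> 2 powr \<delta> * b (Suc m) powr - \<delta>" for m
    proof -
      have "b m powr - \<delta> \<le> (b (Suc m) / 2) powr - \<delta>" using b_Suc[of m] b_pos[of "Suc m"] de by (intro powr_mono2') auto
      also have "\<dots> = 2 powr \<delta> * b (Suc m) powr - \<delta>" using b_pos[of "Suc m"] by (simp add: powr_divide powr_minus divide_simps)
      finally show ?thesis .
    qed
    have mono: "b m powr (\<tau> - \<delta>) \<le> 2 powr \<delta> * b (Suc m) powr (\<tau> - \<delta>)" "b m powr - \<delta> \<le> 2 powr \<delta> * b (Suc m) powr (\<tau> - \<delta>)"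
      "b (Suc m) powr (\<tau> - \<delta>) \<le> 2 powr \<delta> * b (Suc m) powr (\<tau> - \<delta>)" for m
    proof -
      have e: "b k powr (\<tau> - \<delta>) = b k powr \<tau> * b k powr - \<delta>" for k by (simp add: powr_add[symmetric])
      show "b m powr (\<tau> - \<delta>) \<le> 2 powr \<delta> * b (Suc m) powr (\<tau> - \<delta>)"
      proof -
        have "b m powr \<tau> * b m powr - \<delta> \<le> b (Suc m) powr \<tau> * (2 powr \<delta> * b (Suc m) powr - \<delta>)"
          using ta by (intro mult_mono half b_powr_mono) auto
        then show ?thesis by (simp add: e mult_ac)
      qed
      have "b (Suc m) powr - \<delta> \<le> b (Suc m) powr (\<tau> - \<delta>)" using ta by (intro b_powr_le) auto
      then have "2 powr \<delta> * b (Suc m) powr - \<delta> \<le> 2 powr \<delta> * b (Suc m) powr (\<tau> - \<delta>)" by (intro mult_left_mono) auto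
      then show "b m powr - \<delta> \<le> 2 powr \<delta> * b (Suc m) powr (\<tau> - \<delta>)" using half[of m] by linarith
      show "b (Suc m) powr (\<tau> - \<delta>) \<le> 2 powr \<delta> * b (Suc m) powr (\<tau> - \<delta>)"
        using mult_right_mono[OF ge_one_powr_ge_zero[of 2 \<delta>], of "b (Suc m) powr (\<tau> - \<delta>)"] de by simp
    qed
    have dxi: "\<xi> (Suc m) - \<xi> m \<in> Gs" for m by (rule subspace_diff[OF Gs(1) xy(1) xy(1)])
    have dif: "norm (B 0 (Suc m) *v (\<xi> (Suc m) - \<xi> m)) \<le> Q * A * b (Suc m) powr (\<tau> - \<delta>)" for m
    proof -
      have Bc: "B m (Suc m) *v (B 0 m *v v) = B 0 (Suc m) *v v" for v by (rule B_comp_mult) auto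
      have "B 0 m *v \<xi> m = x m - B 0 m *v c - y m" for m using xy(2)[of m] by (simp add: algebra_simps)
      then have "B 0 (Suc m) *v (\<xi> (Suc m) - \<xi> m) = (x (Suc m) - B 0 (Suc m) *v c - y (Suc m)) - B m (Suc m) *v (x m - B 0 m *v c - y m)"
        by (metis Bc matrix_vector_mult_diff_distrib)
      also have "\<dots> = (x (Suc m) - B m (Suc m) *v x m) - y (Suc m) + B m (Suc m) *v y m"
        by (simp add: matrix_vector_mult_diff_distrib Bc)
      finally have "norm (B 0 (Suc m) *v (\<xi> (Suc m) - \<xi> m)) \<le>
          norm (x (Suc m) - B m (Suc m) *v x m) + norm (y (Suc m)) + norm (B m (Suc m) *v y m)"
        using norm_triangle_ineq[of "x (Suc m) - B m (Suc m) *v x m - y (Suc m)" "B m (Suc m) *v y m"]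
          norm_triangle_ineq4[of "x (Suc m) - B m (Suc m) *v x m" "y (Suc m)"] by simp
      also have "\<dots> \<le> A * b m powr - \<delta> + C1 * A * b (Suc m) powr (\<tau> - \<delta>) + S1 * (C1 * A * b m powr (\<tau> - \<delta>))"
        using approxD(3)[OF x, of m] xy(3)[of "Suc m"] S1(2)[of m "y m"] mult_left_mono[OF xy(3)[of m], of S1] S1(1)
        by linarith
      also have "\<dots> \<le> A * (2 powr \<delta> * b (Suc m) powr (\<tau> - \<delta>)) + C1 * A * (2 powr \<delta> * b (Suc m) powr (\<tau> - \<delta>))
          + S1 * (C1 * A * (2 powr \<delta> * b (Suc m) powr (\<tau> - \<delta>)))"
        using A C1(1) S1(1) by (intro add_mono mult_left_mono mono) auto
      also have "\<dots> = Q * A * b (Suc m) powr (\<tau> - \<delta>)" by (simp add: Q_def algebra_simps)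
      finally show ?thesis .
    qed
    have far: "norm (B 0 n *v (\<xi> (Suc m) - \<xi> m)) \<le> D * Q * A * b n powr - s * b (Suc m) powr (2 * \<tau> - \<delta>)" if "m < n" for m
    proof -
      have "norm (B 0 n *v (\<xi> (Suc m) - \<xi> m)) \<le> D * b n powr - s * b (Suc m) powr \<tau> * norm (B 0 (Suc m) *v (\<xi> (Suc m) - \<xi> m))"
        using that by (intro D(3) dxi) auto
      also have "\<dots> \<le> D * b n powr - s * b (Suc m) powr \<tau> * (Q * A * b (Suc m) powr (\<tau> - \<delta>))"
        using D(2) by (intro mult_left_mono dif) auto
      also have "\<dots> = D * Q * A * b n powr - s * (b (Suc m) powr \<tau> * b (Suc m) powr (\<tau> - \<delta>))" by (simp add: mult_ac)
      also have "b (Suc m) powr \<tau> * b (Suc m) powr (\<tau> - \<delta>) = b (Suc m) powr (2 * \<tau> - \<delta>)" by (simp add: powr_add[symmetric])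
      finally show ?thesis .
    qed
    have x0: "norm (B 0 n *v \<xi> 0) \<le> D * (1 + K + C1) * A * b n powr - s * b 0 powr (2 * \<tau> - \<delta>)"
    proof -
      have "\<xi> 0 = x 0 - c - y 0" using xy(2)[of 0] by (simp add: B_id algebra_simps)
      then have "norm (\<xi> 0) \<le> norm (x 0) + norm c + norm (y 0)"
        using norm_triangle_ineq4[of "x 0 - c" "y 0"] norm_triangle_ineq4[of "x 0" c] by simp
      also have "\<dots> \<le> (1 + K + C1) * A" using approxD(2)[OF x] cK xy(3)[of 0] by (simp add: b_0 algebra_simps)
      finally have n0: "norm (\<xi> 0) \<le> (1 + K + C1) * A" .
      have "norm (B 0 n *v \<xi> 0) \<le> D * b n powr - s * b 0 powr \<tau> * norm (B 0 0 *v \<xi> 0)" by (intro D(3) xy(1)) auto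
      also have "\<dots> \<le> D * b n powr - s * ((1 + K + C1) * A)" using D(2) n0 by (simp add: b_0 B_id mult_left_mono)
      finally show ?thesis by (simp add: b_0 mult_ac)
    qed
    have "B 0 n *v \<xi> n = B 0 n *v \<xi> 0 + (\<Sum>m<n. B 0 n *v (\<xi> (Suc m) - \<xi> m))"
      using sum_lessThan_telescope[of "\<lambda>m. B 0 n *v \<xi> m" n] by (simp add: matrix_vector_mult_diff_distrib)
    then have "norm (B 0 n *v \<xi> n) \<le> norm (B 0 n *v \<xi> 0) + (\<Sum>m<n. norm (B 0 n *v (\<xi> (Suc m) - \<xi> m)))"
      using norm_triangle_ineq[of "B 0 n *v \<xi> 0" "\<Sum>m<n. B 0 n *v (\<xi> (Suc m) - \<xi> m)"]
        norm_sum[of "\<lambda>m. B 0 n *v (\<xi> (Suc m) - \<xi> m)" "{..<n}"] by simp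
    also have "\<dots> \<le> D * (1 + K + C1) * A * b n powr - s * b 0 powr (2 * \<tau> - \<delta>) +
        (\<Sum>m<n. D * Q * A * b n powr - s * b (Suc m) powr (2 * \<tau> - \<delta>))"
      by (intro add_mono x0 sum_mono far) auto
    also have "\<dots> \<le> G * A * b n powr - s * b 0 powr (2 * \<tau> - \<delta>) +
        (\<Sum>m<n. G * A * b n powr - s * b (Suc m) powr (2 * \<tau> - \<delta>))"
      using A by (intro add_mono sum_mono mult_right_mono G) auto
    also have "\<dots> = G * A * b n powr - s * (b 0 powr (2 * \<tau> - \<delta>) + (\<Sum>m<n. b (Suc m) powr (2 * \<tau> - \<delta>)))"
      by (simp add: sum_distrib_left distrib_left)
    also have "b 0 powr (2 * \<tau> - \<delta>) + (\<Sum>m<n. b (Suc m) powr (2 * \<tau> - \<delta>)) = (\<Sum>m\<le>n. b m powr (2 * \<tau> - \<delta>))"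
      using sum.lessThan_Suc_shift[of "\<lambda>m. b m powr (2 * \<tau> - \<delta>)" n] by (simp only: lessThan_Suc_atMost)
    finally have w: "norm (B 0 n *v \<xi> n) \<le> G * A * b n powr - s * (\<Sum>m\<le>n. b m powr (2 * \<tau> - \<delta>))" .
    have "norm (x n - B 0 n *v c) \<le> norm (B 0 n *v \<xi> n) + norm (y n)" unfolding xy(2) by (rule norm_triangle_ineq)
    also have "\<dots> \<le> G * A * (b n powr - s * (\<Sum>m\<le>n. b m powr (2 * \<tau> - \<delta>))) + C1 * A * b n powr (\<tau> - \<delta>)"
      using w xy(3)[of n] by (simp add: mult_ac)
    also have "\<dots> \<le> C * A * (b n powr - s * (\<Sum>m\<le>n. b m powr (2 * \<tau> - \<delta>))) + C * A * b n powr (\<tau> - \<delta>)"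
      using A GC by (intro add_mono mult_right_mono mult_nonneg_nonneg sum_nonneg) auto
    finally show ?thesis by (simp add: algebra_simps)
  qed
  then show ?thesis using C D(1) by blast
qed

text \<open>With exponent \<tau> / 3 the sum has n + 1 terms of size at most b n to the power 2
  \<tau> / 3, and by \<open>b_time\<close> their number costs the last third.\<close>

lemma tracking_growth:
  assumes "\<tau> > 0" "K \<ge> 0"
  shows "\<exists>C\<ge>1. \<forall>x A c n. approx x A 0 \<longrightarrow> asymptotic c x \<longrightarrow> norm c \<le> K * A \<longrightarrow>
    norm (x n - B 0 n *v c) \<le> C * A * b n powr \<tau>"
proof -
  define t where "t = \<tau> / 3"
  have t: "t > 0" using assms by (simp add: t_def)
  obtain s C where C: "s > 0" "C \<ge> 1" "\<And>x A c n. approx x A 0 \<Longrightarrow> asymptotic c x \<Longrightarrow> norm c \<le> K * A \<Longrightarrow>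
    norm (x n - B 0 n *v c) \<le> C * A * (b n powr (t - 0) + b n powr - s * (\<Sum>m\<le>n. b m powr (2 * t - 0)))"
    using tracking[OF _ t assms(2), of 0] by auto
  obtain E where E: "E \<ge> 1" "\<And>n. real (Suc n) \<le> E * b n powr t" using b_time[OF t] by blast
  have "norm (x n - B 0 n *v c) \<le> (C * (1 + E)) * A * b n powr \<tau>"
    if x: "approx x A 0" "asymptotic c x" "norm c \<le> K * A" for x A c n
  proof -
    have "(\<Sum>m\<le>n. b m powr (2 * t)) \<le> (\<Sum>m\<le>n. b n powr (2 * t))" using t by (intro sum_mono b_powr_mono) auto
    also have "\<dots> = real (Suc n) * b n powr (2 * t)" by simp
    also have "\<dots> \<le> E * b n powr t * b n powr (2 * t)" using E(2)[of n] by (intro mult_right_mono) auto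
    also have "\<dots> = E * b n powr \<tau>" by (simp add: mult.assoc powr_add[symmetric] t_def)
    finally have 1: "(\<Sum>m\<le>n. b m powr (2 * t)) \<le> E * b n powr \<tau>" .
    have "b n powr - s \<le> 1" using b_powr_le[of "- s" 0 n] C(1) b_pos[of n] by simp
    then have "b n powr - s * (\<Sum>m\<le>n. b m powr (2 * t)) \<le> 1 * (E * b n powr \<tau>)"
      using 1 by (intro mult_mono sum_nonneg) auto
    moreover have "b n powr t \<le> b n powr \<tau>" using t by (intro b_powr_le) (simp add: t_def)
    ultimately have "b n powr (t - 0) + b n powr - s * (\<Sum>m\<le>n. b m powr (2 * t - 0)) \<le> (1 + E) * b n powr \<tau>"
      by (simp add: algebra_simps)
    then have "C * A * (b n powr (t - 0) + b n powr - s * (\<Sum>m\<le>n. b m powr (2 * t - 0))) \<le> C * A * ((1 + E) * b n powr \<tau>)"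
      using C(2) approxD(4)[OF x(1)] by (intro mult_left_mono) auto
    then show ?thesis using C(3)[OF x, of n] by (simp add: mult_ac)
  qed
  moreover have "C * (1 + E) \<ge> 1" using C(2) E(1) by (intro one_le_mult) auto
  ultimately show ?thesis by blast
qed

text \<open>The choice t = \<delta> / 4 turns the exponent in the sum into -\<delta> / 2, which is
  summable, so the factor \<open>b n powr - s\<close> survives.\<close>

lemma tracking_decay:
  assumes "\<delta> > 0" "K \<ge> 0"
  shows "\<exists>s>0. \<exists>C\<ge>1. \<forall>x A c n. approx x A \<delta> \<longrightarrow> asymptotic c x \<longrightarrow> norm c \<le> K * A \<longrightarrow>
    norm (x n - B 0 n *v c) \<le> C * A * b n powr - s"
proof -
  define t where "t = \<delta> / 4"
  have t: "t > 0" using assms by (simp add: t_def)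
  obtain s C where C: "s > 0" "C \<ge> 1" "\<And>x A c n. approx x A \<delta> \<Longrightarrow> asymptotic c x \<Longrightarrow> norm c \<le> K * A \<Longrightarrow>
    norm (x n - B 0 n *v c) \<le> C * A * (b n powr (t - \<delta>) + b n powr - s * (\<Sum>m\<le>n. b m powr (2 * t - \<delta>)))"
    using tracking[OF _ t assms(2), of \<delta>] assms(1) by auto
  have "\<delta> / 2 > 0" using assms by simp
  from sum_b_bound[OF this] obtain S where S: "S \<ge> 1" "\<And>n. (\<Sum>m\<le>n. b m powr - (\<delta> / 2)) \<le> S" by blast
  define s' where "s' = min s (3 * t)"
  have "norm (x n - B 0 n *v c) \<le> (C * (1 + S)) * A * b n powr - s'"
    if x: "approx x A \<delta>" "asymptotic c x" "norm c \<le> K * A" for x A c n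
  proof -
    have e: "2 * t - \<delta> = - (\<delta> / 2)" by (simp add: t_def)
    have "b n powr - s * (\<Sum>m\<le>n. b m powr (2 * t - \<delta>)) \<le> b n powr - s' * S"
      unfolding e using S(2) by (intro mult_mono sum_nonneg b_powr_le) (auto simp: s'_def)
    moreover have "b n powr (t - \<delta>) \<le> b n powr - s'" by (intro b_powr_le) (auto simp: s'_def t_def)
    ultimately have "b n powr (t - \<delta>) + b n powr - s * (\<Sum>m\<le>n. b m powr (2 * t - \<delta>)) \<le> (1 + S) * b n powr - s'"
      by (simp add: algebra_simps)
    then have "C * A * (b n powr (t - \<delta>) + b n powr - s * (\<Sum>m\<le>n. b m powr (2 * t - \<delta>))) \<le> C * A * ((1 + S) * b n powr - s')"
      using C(2) approxD(4)[OF x(1)] by (intro mult_left_mono) auto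
    then show ?thesis using C(3)[OF x, of n] by (simp add: mult_ac)
  qed
  moreover have "C * (1 + S) \<ge> 1" using C(2) S(1) by (intro one_le_mult) auto
  moreover have "s' > 0" using C(1) t by (simp add: s'_def)
  ultimately show ?thesis by blast
qed

end

subsection \<open>The matrix Omega along the algorithm\<close>

text \<open>\<open>Omega\<close> compares the two orders: applied to the lengths it gives the
  translation lengths. Kernel vectors are those whose partial sums agree in both orders.\<close>

lemma Omega_mult:
  fixes T :: "'a::finite iem"
  assumes T: "is_iem T"
  shows "(Omega T *v c) $ \<alpha> = psum (pos_b T) (($) c) \<alpha> - psum (pos_t T) (($) c) \<alpha>"
proof -
  let ?p = "pos_t T" and ?q = "pos_b T"
  have "psum ?q (($) c) \<alpha> - psum ?p (($) c) \<alpha> =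
      (\<Sum>\<beta>\<in>UNIV. (if ?q \<beta> < ?q \<alpha> then c $ \<beta> else 0) - (if ?p \<beta> < ?p \<alpha> then c $ \<beta> else 0))"
    by (simp add: psum_def sum_subtractf sum.If_cases)
  also have "\<dots> = (\<Sum>\<beta>\<in>UNIV. Omega T $ \<alpha> $ \<beta> * c $ \<beta>)"
  proof (rule sum.cong[OF refl])
    fix \<beta>
    show "(if ?q \<beta> < ?q \<alpha> then c $ \<beta> else 0) - (if ?p \<beta> < ?p \<alpha> then c $ \<beta> else 0) = Omega T $ \<alpha> $ \<beta> * c $ \<beta>"
    proof (cases "\<beta> = \<alpha>")
      case False
      then have "?p \<beta> \<noteq> ?p \<alpha>" "?q \<beta> \<noteq> ?q \<alpha>" using numbering_inj is_iemD[OF T] by blast+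
      then show ?thesis by (auto simp: Omega_def neq_iff)
    qed (simp add: Omega_def)
  qed
  finally show ?thesis by (simp add: matrix_vector_mult_def)
qed

lemma Omega_anti: "transpose (Omega T) = - Omega T"
  by (auto simp: Omega_def transpose_def vec_eq_iff)

lemma Omega_sign: "Omega T $ i $ j \<in> {-1, 0, 1}"
  by (simp add: Omega_def)

lemma winner_neq_loser': "good T \<Longrightarrow> winner (rv T n) \<noteq> loser (rv T n)"
  by (intro winner_neq_loser goodD good_rv)

lemma step_mat_det:
  fixes T :: "'a::finite iem"
  assumes "winner T \<noteq> loser T"
  shows "det (step_mat T) = 1"
proof -
  have "step_mat T = (\<chi> k. if k = loser T then row (loser T) (mat 1) + 1 *s row (winner T) (mat 1) else row k (mat 1 :: real^'a^'a))"
    using assms by (auto simp: step_mat_def vec_eq_iff row_def mat_def)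
  also have "det \<dots> = det (mat 1 :: real^'a^'a)" using assms by (intro det_row_operation) auto
  finally show ?thesis by simp
qed

lemma Bp_det: "good T \<Longrightarrow> det (Bp T n) = 1"
  by (induction n) (auto simp: det_mul step_mat_det winner_neq_loser')

text \<open>After a step the partial sums of c are those of the pushed vector before it, except at
  the loser. There the right ends of \<open>last_b\<close> and \<open>last_t\<close> enter, and the
  two totals cancel.\<close>

lemma Omega_nxt_mult:
  fixes T :: "'a::finite iem"
  assumes T: "good T"
  shows "Omega (nxt T) *v c = step_mat T *v (Omega T *v (transpose (step_mat T) *v c))"
proof -
  note g = goodD(1,2,4)[OF T]
  note q = is_iemD[OF g(2)]
  let ?P = "push (winner T) (loser T) (($) c)"
  have P: "($) (transpose (step_mat T) *v c) = ?P" by (rule ext) (rule step_mat_transpose_mult)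
  have l: "psum (pos_t T) ?P (last_t T) + ?P (last_t T) = sum ?P UNIV" "psum (pos_b T) ?P (last_b T) + ?P (last_b T) = sum ?P UNIV"
    using psum_last[OF q(2), of "last_t T" ?P] psum_last[OF q(3), of "last_b T" ?P] last_pos[OF g(2)] by auto
  have "(Omega (nxt T) *v c) $ \<alpha> = (step_mat T *v (Omega T *v (transpose (step_mat T) *v c))) $ \<alpha>" for \<alpha>
    unfolding Omega_mult[OF nxt_is_iem[OF g]] step_mat_mult Omega_mult[OF g(2)] P nxt_psum_t[OF g] nxt_psum_b[OF g]
    using l last_winner_loser[of T] by auto
  then show ?thesis unfolding vec_eq_iff by blast
qed

lemma Omega_Bp:
  fixes T :: "'a::finite iem"
  assumes T: "good T"
  shows "Omega (rv T n) = Bp T n ** Omega T ** transpose (Bp T n)"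
proof (induction n)
  case 0 show ?case by (simp add: transpose_mat)
next
  case (Suc n)
  have "Omega (rv T (Suc n)) *v c = (step_mat (rv T n) ** Omega (rv T n) ** transpose (step_mat (rv T n))) *v c" for c
    unfolding rv_Suc_nxt[OF T] Omega_nxt_mult[OF good_rv[OF T]] by (simp only: matrix_vector_mul_assoc matrix_mul_assoc)
  then have "Omega (rv T (Suc n)) = step_mat (rv T n) ** Omega (rv T n) ** transpose (step_mat (rv T n))"
    using matrix_eq by blast
  then show ?case unfolding Suc.IH by (simp add: matrix_transpose_mul matrix_mul_assoc)
qed

text \<open>The image of an antisymmetric matrix is the orthogonal complement of its kernel. The
  component z of v in the kernel satisfies v . z = |z|^2, so the bound on the kernel bounds
  |z|.\<close>

lemma in_im_approx:
  fixes M :: "real^'a::finite^'a"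
  assumes anti: "transpose M = - M" and K: "\<And>z. M *v z = 0 \<Longrightarrow> v \<bullet> z \<le> K * norm z" and K0: "K \<ge> 0"
  shows "\<exists>y\<in>im M. norm (v - y) \<le> K"
proof -
  obtain y z where yz: "y \<in> span (im M)" "\<And>w. w \<in> span (im M) \<Longrightarrow> orthogonal z w" "v = y + z"
    using orthogonal_subspace_decomp_exists by blast
  have y: "y \<in> im M" using yz(1) span_eq_iff[THEN iffD2, OF subspace_im[of M]] by metis
  have "(M *v z) \<bullet> w = 0" for w
    using yz(2)[OF span_base[of "M *v w"]] by (simp add: anti_inner[OF anti] orthogonal_def)
  then have "M *v z = 0" by (metis inner_eq_zero_iff)
  then have "v \<bullet> z \<le> K * norm z" by (rule K)
  moreover have "v \<bullet> z = norm z * norm z"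
    using yz(2)[OF yz(1)] by (simp add: yz(3) inner_add_left orthogonal_def inner_commute[of y z] norm_eq_sqrt_inner)
  ultimately have "norm z \<le> K" using K0 by (cases "norm z = 0") auto
  then show ?thesis using y yz(3) by (intro bexI[of _ y]) auto
qed


subsection \<open>Pairing functions with the kernel of Omega\<close>

text \<open>
  For the lengths and the left endpoint in place of \<open>c\<close> and \<open>s\<close> the coefficients are the endpoints
  of the intervals; elements of the kernel of Omega are lengths of formal interval exchanges that
  are the identity.
\<close>

definition pairing :: "'a::finite iem \<Rightarrow> real^'a \<Rightarrow> real \<Rightarrow> 'a pfun \<Rightarrow> real" where
  "pairing T c s \<phi> = (\<Sum>\<alpha>\<in>UNIV. (s + psum (pos_t T) (($) c) \<alpha> + c $ \<alpha>) * \<phi> \<alpha> (topl T \<alpha> + len T \<alpha>)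
      - (s + psum (pos_t T) (($) c) \<alpha>) * \<phi> \<alpha> (topl T \<alpha>))"

definition step_sum :: "'a::finite iem \<Rightarrow> 'a pfun \<Rightarrow> 'a pfun" where
  "step_sum T \<phi> = (\<lambda>\<alpha> x. if \<alpha> = loser T then \<phi> (last_b T) x + \<phi> (last_t T) (x + shift T (last_b T)) else \<phi> \<alpha> x)"

lemma Sb_Suc: "Sb T (Suc n) \<phi> = step_sum (rv T n) (Sb T n \<phi>)"
  by (simp add: step_sum_def)

text \<open>For a kernel vector the formal exchange is the identity, so corresponding points of
  \<open>last_b\<close> and \<open>last_t\<close> carry the same coefficient and the two summands at
  the loser keep their outer endpoint terms. The new cut point of the winner's interval occurs as
  left end for the loser and as right end for the winner, and cancels.\<close>

lemma pairing_step:
  fixes T :: "'a::finite iem"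
  assumes T: "good T" and ker: "Omega T *v (transpose (step_mat T) *v c) = 0"
  shows "pairing (nxt T) c s (step_sum T \<phi>) = pairing T (transpose (step_mat T) *v c) s \<phi>"
proof -
  note g = goodD(1,2,4)[OF T]
  note q = is_iemD[OF g(2)]
  let ?a = "last_b T" and ?t = "last_t T" and ?l = "loser T" and ?w = "winner T"
  let ?P = "push ?w ?l (($) c)"
  define d where "d = transpose (step_mat T) *v c"
  have P: "($) d = ?P" unfolding d_def by (rule ext) (rule step_mat_transpose_mult)
  have dl: "d $ \<alpha> = ?P \<alpha>" for \<alpha> using P by metis
  have wl: "?w \<noteq> ?l" by (rule winner_neq_loser[OF g])
  have k: "psum (pos_b T) ?P \<alpha> = psum (pos_t T) ?P \<alpha>" for \<alpha>
    using arg_cong[OF ker, of "\<lambda>v. v $ \<alpha>"] unfolding Omega_mult[OF g(2)] d_def[symmetric] P by simp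
  \<comment> \<open>Both sides are the formal right end: \<open>last_t\<close> is last on top and
    \<open>last_b\<close> on the bottom, where k replaces bottom partial sums by top ones.\<close>
  have tot: "psum (pos_t T) ?P ?a + ?P ?a = psum (pos_t T) ?P ?t + ?P ?t"
    using psum_last[OF q(2), of ?t ?P] psum_last[OF q(3), of ?a ?P] last_pos[OF g(2)] k[of ?a] by simp
  define X where "X \<alpha> = (s + psum (pos_t T) (($) d) \<alpha> + d $ \<alpha>) * \<phi> \<alpha> (topl T \<alpha> + len T \<alpha>)
      - (s + psum (pos_t T) (($) d) \<alpha>) * \<phi> \<alpha> (topl T \<alpha>)" for \<alpha>
  define Y where "Y \<alpha> = (s + psum (pos_t (nxt T)) (($) c) \<alpha> + c $ \<alpha>) * step_sum T \<phi> \<alpha> (topl (nxt T) \<alpha> + len (nxt T) \<alpha>)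
      - (s + psum (pos_t (nxt T)) (($) c) \<alpha>) * step_sum T \<phi> \<alpha> (topl (nxt T) \<alpha>)" for \<alpha>
  have other: "Y \<alpha> = X \<alpha>" if "\<alpha> \<noteq> ?l" "\<alpha> \<noteq> ?w" for \<alpha>
    using that unfolding X_def Y_def P dl
    by (simp add: nxt_psum_t[OF g] step_sum_def step_topl[OF g] step_len[OF g] push_def[of _ _ "($) c" , THEN fun_cong, of _ _ \<alpha>])
  have sh: "topl T ?a + len T ?a + shift T ?a = topl T ?t + len T ?t"
    using last_endpoints[OF g(2)] by (simp add: shift_def)
  have sh': "topl T ?a + len T ?a - len T ?l + shift T ?a = topl T ?t + len T ?t - len T ?l"
    using sh by simp
  have cl: "c $ ?l = ?P ?l" "c $ ?w = ?P ?w - ?P ?l" using wl by (auto simp: push_def)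
  have Yl: "Y ?l = (s + psum (pos_t T) ?P ?a + ?P ?a) * (\<phi> ?a (topl T ?a + len T ?a) + \<phi> ?t (topl T ?t + len T ?t))
      - (s + psum (pos_t T) ?P ?a + ?P ?a - ?P ?l) * (\<phi> ?a (topl T ?a + len T ?a - len T ?l) + \<phi> ?t (topl T ?t + len T ?t - len T ?l))"
  proof -
    have 1: "topl (nxt T) ?l + len (nxt T) ?l = topl T ?a + len T ?a" "topl (nxt T) ?l = topl T ?a + len T ?a - len T ?l"
      using wl by (simp_all add: step_topl[OF g] step_len[OF g])
    have 2: "s + psum (pos_t (nxt T)) (($) c) ?l + c $ ?l = s + psum (pos_t T) ?P ?a + ?P ?a"
      "s + psum (pos_t (nxt T)) (($) c) ?l = s + psum (pos_t T) ?P ?a + ?P ?a - ?P ?l"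
      using cl(1) by (simp_all add: nxt_psum_t[OF g])
    have 3: "step_sum T \<phi> ?l x = \<phi> ?a x + \<phi> ?t (x + shift T ?a)" for x by (simp add: step_sum_def)
    show ?thesis unfolding Y_def 2(1) 3 1(1) unfolding 1(2) 2(2) sh sh' ..
  qed
  have Yw: "Y ?w = (s + psum (pos_t T) ?P ?w + (?P ?w - ?P ?l)) * \<phi> ?w (topl T ?w + (len T ?w - len T ?l))
      - (s + psum (pos_t T) ?P ?w) * \<phi> ?w (topl T ?w)"
    unfolding Y_def cl(2) using wl by (simp add: nxt_psum_t[OF g] step_sum_def step_topl[OF g] step_len[OF g])
  have alg: "K * (A + A') - (K - p) * (D + D') + ((s + m' + (p' - p)) * D' - (s + m') * E) =
      ((s + m + p) * A - (s + m) * D) + ((s + m' + p') * A' - (s + m') * E)"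
    if "K = s + m + p" "K = s + m' + p'" for K A A' D D' E m m' p p' :: real
  proof -
    have m: "m = K - p - s" "m' = K - p' - s" using that by auto
    show ?thesis unfolding m by (simp add: algebra_simps)
  qed
  have alg': "K * (A' + A) - (K - p) * (D' + D) + ((s + m' + (p' - p)) * D' - (s + m') * E) =
      ((s + m + p) * A - (s + m) * D) + ((s + m' + p') * A' - (s + m') * E)"
    if "K = s + m + p" "K = s + m' + p'" for K A A' D D' E m m' p p' :: real
    using alg[OF that, of A A' D D' E] by (simp only: add.commute)
  have r: "topl T ?w + (len T ?w - len T ?l) = topl T ?w + len T ?w - len T ?l"
    "topl T ?l + len T ?l - len T ?l = topl T ?l" by simp_all
  have "Y ?l + Y ?w = X ?l + X ?w"
    using last_winner_loser[of T]
  proof (elim disjE conjE)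
    assume e: "?a = ?l" "?t = ?w"
    have t: "s + psum (pos_t T) ?P ?l + ?P ?l = s + psum (pos_t T) ?P ?w + ?P ?w" using tot unfolding e by simp
    show ?thesis unfolding Yl Yw X_def P dl e r by (rule alg[OF refl t])
  next
    assume e: "?a = ?w" "?t = ?l"
    have t: "s + psum (pos_t T) ?P ?w + ?P ?w = s + psum (pos_t T) ?P ?l + ?P ?l" using tot unfolding e by simp
    show ?thesis unfolding Yl Yw X_def P dl e r by (rule alg'[OF t refl])
  qed
  moreover have "sum Y (UNIV - {?l} - {?w}) = sum X (UNIV - {?l} - {?w})" using other by (intro sum.cong) auto
  ultimately have "sum Y UNIV = sum X UNIV"
    using wl by (simp add: sum.remove[of UNIV ?l] sum.remove[of "UNIV - {?l}" ?w])
  then show ?thesis unfolding pairing_def X_def Y_def d_def[symmetric] .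
qed

text \<open>As the step matrix is invertible, its transpose turns a kernel vector after the step
  into a kernel vector before it; so the vanishing of pairings passes from level to level.\<close>

lemma pairing_iterate:
  fixes T :: "'a::finite iem"
  assumes T: "good T" and z: "\<And>c s. Omega T *v c = 0 \<Longrightarrow> pairing T c s \<phi> = 0"
    and "Omega (rv T n) *v c = 0"
  shows "pairing (rv T n) c s (Sb T n \<phi>) = 0"
  using assms(3)
proof (induction n arbitrary: c)
  case 0 then show ?case using z by simp
next
  case (Suc n)
  let ?S = "rv T n"
  have "step_mat ?S *v (Omega ?S *v (transpose (step_mat ?S) *v c)) = 0"
    using Suc.prems unfolding rv_Suc_nxt[OF T] Omega_nxt_mult[OF good_rv[OF T]] .
  moreover have "invertible (step_mat ?S)"
    by (simp add: invertible_det_nz step_mat_det winner_neq_loser'[OF T])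
  ultimately have 1: "Omega ?S *v (transpose (step_mat ?S) *v c) = 0"
    by (metis invertible_def matrix_left_invertible_ker)
  show ?case unfolding rv_Suc_nxt[OF T] Sb_Suc pairing_step[OF good_rv[OF T] 1] by (rule Suc.IH[OF 1])
qed


subsection \<open>The boundary operator\<close>

text \<open>What is checked by hand is that the finite symbol set is mapped onto itself; injectivity
  then follows by counting.\<close>

lemma sigma_perm_permutes:
  fixes T :: "'a::finite iem"
  assumes T: "is_iem T"
  shows "sigma_perm T permutes bsyms CARD('a)"
proof -
  let ?d = "CARD('a)" and ?p = "pos_t T" and ?q = "pos_b T"
  note p = is_iemD(2)[OF T] and q = is_iemD(3)[OF T]
  have d: "1 \<le> ?d" by (simp add: Suc_leI)
  have S: "bsyms ?d = U ` {0..?d} \<union> V ` {0<..<?d}"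
    by (auto simp: bsyms_def Vsym_def)
  define r where "r k = ?p (inv ?q k)" for k
  have r: "1 \<le> r k" "r k \<le> ?d" for k using numbering_range[OF p] by (auto simp: r_def)
  have rsurj: "\<exists>j. 1 \<le> j \<and> j \<le> ?d \<and> r j = k" if k: "1 \<le> k" "k \<le> ?d" for k
  proof (intro exI conjI)
    show "r (?q (inv ?p k)) = k" by (simp add: r_def numbering_inv'[OF q] numbering_inv[OF p k])
  qed (rule numbering_range[OF q])+
  define h where "h i = ?q (inv ?p (i + 1)) - 1" for i
  have hsurj: "\<exists>i<?d. h i = j" if j: "j < ?d" for j
  proof -
    have j': "1 \<le> j + 1" "j + 1 \<le> ?d" using j by auto
    let ?\<alpha> = "inv ?q (j + 1)"
    have "1 \<le> ?p ?\<alpha>" "?p ?\<alpha> \<le> ?d" by (rule numbering_range[OF p])+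
    moreover from this have "h (?p ?\<alpha> - 1) = j" by (simp add: h_def numbering_inv'[OF p] numbering_inv[OF q j', simplified])
    ultimately show ?thesis by (intro exI[of _ "?p ?\<alpha> - 1"]) auto
  qed
  have hd: "h i < ?d" for i
    using numbering_range[OF q, of "inv ?p (i + 1)"] by (auto simp: h_def)
  have sU: "sigma_perm T (U i) = (if h i = 0 then U 0 else V (h i))" if "i < ?d" for i
    using that hd[of i] by (simp add: h_def Vsym_def)
  have sUd: "sigma_perm T (U ?d) = U (r ?d)" by (simp add: r_def)
  have sV: "sigma_perm T (V k) = U (r k)" if "0 < k" "k < ?d" for k using that by (simp add: r_def)
  have sur: "bsyms ?d \<subseteq> sigma_perm T ` bsyms ?d"
  proof
    fix y assume "y \<in> bsyms ?d"
    then have "(\<exists>k\<le>?d. y = U k) \<or> (\<exists>k. 0 < k \<and> k < ?d \<and> y = V k)" unfolding S by auto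
    then have "y = U 0 \<or> (\<exists>k. 1 \<le> k \<and> k \<le> ?d \<and> y = U k) \<or> (\<exists>k. 0 < k \<and> k < ?d \<and> y = V k)"
      by (metis One_nat_def Suc_leI neq0_conv)
    then consider "y = U 0" | k where "1 \<le> k" "k \<le> ?d" "y = U k" | k where "0 < k" "k < ?d" "y = V k"
      by blast
    then show "y \<in> sigma_perm T ` bsyms ?d"
    proof cases
      case 1
      obtain i where i: "i < ?d" "h i = 0" using hsurj[of 0] by auto
      show ?thesis by (rule image_eqI[of _ _ "U i"]) (use 1 i sU[of i] in \<open>auto simp: S simp del: sigma_perm.simps\<close>)
    next
      case (2 k)
      obtain j where j: "1 \<le> j" "j \<le> ?d" "r j = k" using rsurj[OF 2(1,2)] by blast
      show ?thesis
      proof (cases "j = ?d")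
        case True
        show ?thesis by (rule image_eqI[of _ _ "U ?d"]) (use 2(3) j(3) sUd True in \<open>auto simp: S simp del: sigma_perm.simps\<close>)
      next
        case False
        then have "0 < j" "j < ?d" using j by auto
        then show ?thesis
          by (intro image_eqI[of _ _ "V j"]) (use 2(3) j(3) sV[of j] in \<open>auto simp: S simp del: sigma_perm.simps\<close>)
      qed
    next
      case (3 k)
      obtain i where i: "i < ?d" "h i = k" using hsurj[OF 3(2)] by auto
      show ?thesis by (rule image_eqI[of _ _ "U i"]) (use 3 i sU[of i] in \<open>auto simp: S simp del: sigma_perm.simps\<close>)
    qed
  qed
  have sub: "sigma_perm T ` bsyms ?d \<subseteq> bsyms ?d"
  proof
    fix y assume "y \<in> sigma_perm T ` bsyms ?d"
    then obtain x where x: "x \<in> bsyms ?d" "y = sigma_perm T x" by blast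
    then consider i where "i < ?d" "x = U i" | "x = U ?d" | k where "0 < k" "k < ?d" "x = V k"
      unfolding S by (auto simp: le_less)
    then show "y \<in> bsyms ?d"
      unfolding S x(2) using r(2) hd by cases (auto simp: sU sUd sV simp del: sigma_perm.simps)
  qed
  have fin: "finite (bsyms ?d)" by (simp add: S)
  have "bij_betw (sigma_perm T) (bsyms ?d) (bsyms ?d)"
    using finite_surj_inj[OF fin sur] sub sur by (simp add: bij_betw_def subset_antisym)
  moreover have "sigma_perm T x = x" if "x \<notin> bsyms ?d" for x
    using that unfolding S by (cases x) (auto simp: image_iff)
  ultimately show ?thesis by (rule bij_imp_permutes)
qed

text \<open>A regrouping by endpoints instead of intervals. The convention that the outer values at
  both ends of I are zero extends the sums over letters to all d + 1 endpoints.\<close>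

lemma endpoint_sum:
  fixes T :: "'a::finite iem"
  assumes T: "is_iem T"
  shows "(\<Sum>\<alpha>\<in>UNIV. u (pos_t T \<alpha>) * \<phi> \<alpha> (topl T \<alpha> + len T \<alpha>) - u (pos_t T \<alpha> - 1) * \<phi> \<alpha> (topl T \<alpha>)) =
    (\<Sum>i\<le>CARD('a). u i * (val_left T \<phi> i - val_right T \<phi> i))"
proof -
  let ?d = "CARD('a)" and ?p = "pos_t T"
  note p = is_iemD(2)[OF T]
  have bij: "bij_betw ?p UNIV {1..?d}" using p by (simp add: is_numbering_def)
  have L: "(\<Sum>\<alpha>\<in>UNIV. u (?p \<alpha>) * \<phi> \<alpha> (topl T \<alpha> + len T \<alpha>)) = (\<Sum>i\<le>?d. u i * val_left T \<phi> i)"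
  proof -
    have "(\<Sum>\<alpha>\<in>UNIV. u (?p \<alpha>) * \<phi> \<alpha> (topl T \<alpha> + len T \<alpha>)) = (\<Sum>\<alpha>\<in>UNIV. u (?p \<alpha>) * val_left T \<phi> (?p \<alpha>))"
    proof (rule sum.cong[OF refl])
      fix \<alpha>
      show "u (?p \<alpha>) * \<phi> \<alpha> (topl T \<alpha> + len T \<alpha>) = u (?p \<alpha>) * val_left T \<phi> (?p \<alpha>)"
        using numbering_range(1)[OF p, of \<alpha>] by (simp add: val_left_def numbering_inv'[OF p] upt_u_right[OF T])
    qed
    also have "\<dots> = (\<Sum>i\<in>{1..?d}. u i * val_left T \<phi> i)" by (rule sum.reindex_bij_betw[OF bij])
    also have "\<dots> = (\<Sum>i\<le>?d. u i * val_left T \<phi> i)"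
      by (rule sum.mono_neutral_left) (auto simp: val_left_def not_le)
    finally show ?thesis .
  qed
  have R: "(\<Sum>\<alpha>\<in>UNIV. u (?p \<alpha> - 1) * \<phi> \<alpha> (topl T \<alpha>)) = (\<Sum>i\<le>?d. u i * val_right T \<phi> i)"
  proof -
    have "(\<Sum>\<alpha>\<in>UNIV. u (?p \<alpha> - 1) * \<phi> \<alpha> (topl T \<alpha>)) = (\<Sum>\<alpha>\<in>UNIV. u (?p \<alpha> - 1) * val_right T \<phi> (?p \<alpha> - 1))"
    proof (rule sum.cong[OF refl])
      fix \<alpha>
      have "1 \<le> ?p \<alpha>" "?p \<alpha> \<le> ?d" using numbering_range[OF p] by auto
      then have "val_right T \<phi> (?p \<alpha> - 1) = \<phi> \<alpha> (topl T \<alpha>)"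
        using upt_u_left[OF T, of \<alpha>] by (simp add: val_right_def numbering_inv'[OF p])
      then show "u (?p \<alpha> - 1) * \<phi> \<alpha> (topl T \<alpha>) = u (?p \<alpha> - 1) * val_right T \<phi> (?p \<alpha> - 1)" by simp
    qed
    also have "\<dots> = (\<Sum>i\<in>{1..?d}. u (i - 1) * val_right T \<phi> (i - 1))" by (rule sum.reindex_bij_betw[OF bij])
    also have "\<dots> = (\<Sum>i<?d. u i * val_right T \<phi> i)"
      by (rule sum.reindex_bij_witness[of _ Suc "\<lambda>i. i - 1"]) auto
    also have "\<dots> = (\<Sum>i\<le>?d. u i * val_right T \<phi> i)"
      by (rule sum.mono_neutral_left) (auto simp: val_right_def not_less)
    finally show ?thesis .
  qed
  show ?thesis using L R by (simp add: sum_subtractf right_diff_distrib)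
qed

text \<open>For a kernel vector the formal endpoints u and v of the two partitions match along the
  letters, so they form one function F on the symbols that is invariant under \<sigma>. The pairing
  is then the sum over cycles of the value of F times the boundary at the cycle.\<close>

lemma pairing_boundary:
  fixes T :: "'a::finite iem"
  assumes T: "is_iem T" and b: "\<And>C. C \<in> sigma_cycles T \<Longrightarrow> boundary T \<phi> C = 0"
    and ker: "Omega T *v c = 0"
  shows "pairing T c s \<phi> = 0"
proof -
  let ?d = "CARD('a)" and ?p = "pos_t T" and ?q = "pos_b T"
  note p = is_iemD(2)[OF T] and q = is_iemD(3)[OF T]
  define u where "u i = s + (\<Sum>\<beta> | ?p \<beta> \<le> i. c $ \<beta>)" for i
  define v where "v j = s + (\<Sum>\<beta> | ?q \<beta> \<le> j. c $ \<beta>)" for j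
  have k: "psum ?q (($) c) \<alpha> = psum ?p (($) c) \<alpha>" for \<alpha>
    using arg_cong[OF ker, of "\<lambda>v. v $ \<alpha>"] unfolding Omega_mult[OF T] by simp
  have low: "{\<beta>. r \<beta> \<le> r \<alpha> - 1} = {\<beta>. r \<beta> < r \<alpha>}" if "is_numbering r" for r :: "'a \<Rightarrow> nat" and \<alpha>
    using numbering_range(1)[OF that, of \<alpha>] by (intro Collect_cong) linarith
  have ur: "u (?p \<alpha>) = s + psum ?p (($) c) \<alpha> + c $ \<alpha>" "u (?p \<alpha> - 1) = s + psum ?p (($) c) \<alpha>" for \<alpha>
    unfolding u_def using psum_incl[OF p, of "($) c" \<alpha>] low[OF p, of \<alpha>] by (simp_all add: psum_def)
  have vr: "v (?q \<alpha>) = s + psum ?q (($) c) \<alpha> + c $ \<alpha>" "v (?q \<alpha> - 1) = s + psum ?q (($) c) \<alpha>" for \<alpha>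
    unfolding v_def using psum_incl[OF q, of "($) c" \<alpha>] low[OF q, of \<alpha>] by (simp_all add: psum_def)
  have vu: "v (?q \<alpha>) = u (?p \<alpha>)" "v (?q \<alpha> - 1) = u (?p \<alpha> - 1)" for \<alpha> using ur[of \<alpha>] vr[of \<alpha>] k[of \<alpha>] by simp_all
  have e0: "u 0 = s" "v 0 = s"
  proof -
    have "{\<beta>. r \<beta> \<le> 0} = {}" if "is_numbering r" for r :: "'a \<Rightarrow> nat"
      using numbering_range(1)[OF that] by (auto simp: Suc_le_eq)
    then show "u 0 = s" "v 0 = s" using p q unfolding u_def v_def by (simp_all only: sum.empty)
  qed
  have ed: "u ?d = v ?d" using numbering_range(2)[OF p] numbering_range(2)[OF q] by (simp add: u_def v_def)
  define F where "F x = (case x of U i \<Rightarrow> u i | V j \<Rightarrow> v j)" for x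
  have FV: "F (Vsym ?d j) = v j" for j using e0 ed by (simp add: F_def Vsym_def)
  have Fs: "F (sigma_perm T x) = F x" for x
  proof (cases x)
    case (U i)
    show ?thesis
    proof (cases "i < ?d")
      case True
      have "F (sigma_perm T x) = v (?q (inv ?p (i + 1)) - 1)" using U True FV by simp
      also have "\<dots> = u (?p (inv ?p (i + 1)) - 1)" by (rule vu)
      also have "?p (inv ?p (i + 1)) = i + 1" using True by (intro numbering_inv[OF p]) auto
      finally show ?thesis using U by (simp add: F_def)
    next
      case False
      have "?q (inv ?q ?d) = ?d" by (intro numbering_inv[OF q]) (auto simp: Suc_leI)
      then have "u (?p (inv ?q ?d)) = u ?d" using vu(1)[of "inv ?q ?d"] ed by simp
      then show ?thesis using U False by (simp add: F_def)
    qed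
  next
    case (V j)
    show ?thesis
    proof (cases "0 < j \<and> j < ?d")
      case True
      then have "?q (inv ?q j) = j" by (intro numbering_inv[OF q]) auto
      then show ?thesis using V True vu(1)[of "inv ?q j"] by (simp add: F_def)
    qed (use V in auto)
  qed
  have Fo: "F y = F x" if "y \<in> orbit (sigma_perm T) x" for x y
    using that by induction (auto simp: Fs)
  have perm: "permutation (sigma_perm T)"
    using sigma_perm_permutes[OF T] unfolding permutation_permutes by (metis bsyms_def finite_Un finite_imageI finite_atLeastAtMost)
  define D where "D i = val_left T \<phi> i - val_right T \<phi> i" for i
  define orb where "orb i = orbit (sigma_perm T) (U i)" for i
  have sO: "U i \<in> orb i" for i unfolding orb_def by (rule permutation_self_in_orbit[OF perm])
  have eqO: "orb j = orb i" if "U j \<in> orb i" for i j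
    using that orbit_cyclic_eq3[OF cyclic_on_orbit'[OF perm]] unfolding orb_def by blast
  have "(\<Sum>i\<le>?d. u i * D i) = (\<Sum>C\<in>orb ` {..?d}. \<Sum>i | i \<in> {..?d} \<and> orb i = C. u i * D i)"
    by (rule sum.image_gen) simp
  also have "\<dots> = (\<Sum>C\<in>orb ` {..?d}. 0)"
  proof (rule sum.cong[OF refl])
    fix C assume "C \<in> orb ` {..?d}"
    then obtain i where i: "i \<le> ?d" "C = orb i" by auto
    have set: "{j. j \<in> {..?d} \<and> orb j = C} = {j. j \<le> ?d \<and> U j \<in> C}" using sO eqO i(2) by auto
    have "(\<Sum>j | j \<in> {..?d} \<and> orb j = C. u j * D j) = (\<Sum>j | j \<le> ?d \<and> U j \<in> C. u i * D j)"
      unfolding set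
    proof (rule sum.cong[OF refl])
      fix j assume "j \<in> {j. j \<le> ?d \<and> U j \<in> C}"
      then have "F (U j) = F (U i)" using Fo i(2) unfolding orb_def by blast
      then show "u j * D j = u i * D j" by (simp add: F_def)
    qed
    also have "\<dots> = u i * boundary T \<phi> C" by (simp add: boundary_def D_def sum_distrib_left)
    also have "C \<in> sigma_cycles T" using i unfolding sigma_cycles_def orb_def bsyms_def by auto
    then have "boundary T \<phi> C = 0" by (rule b)
    finally show "(\<Sum>j | j \<in> {..?d} \<and> orb j = C. u j * D j) = 0" by simp
  qed
  finally have zero: "(\<Sum>i\<le>?d. u i * D i) = 0" by simp
  have "pairing T c s \<phi> = (\<Sum>\<alpha>\<in>UNIV. u (?p \<alpha>) * \<phi> \<alpha> (topl T \<alpha> + len T \<alpha>) - u (?p \<alpha> - 1) * \<phi> \<alpha> (topl T \<alpha>))"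
    unfolding pairing_def ur ..
  also have "\<dots> = (\<Sum>i\<le>?d. u i * D i)" unfolding D_def by (rule endpoint_sum[OF T])
  finally show ?thesis using zero by simp
qed

lemma pairing_gamma: "pairing T c s (gamma_fun e) = c \<bullet> e"
  unfolding pairing_def gamma_fun_def inner_vec_def by (intro sum.cong) (auto simp: algebra_simps)

text \<open>With a piecewise constant function the pairing is an inner product, so a vanishing
  boundary makes e orthogonal to the kernel of \<open>Omega\<close>.\<close>

lemma Gamma_bd_im:
  assumes T: "is_iem T"
  shows "Gamma_bd T \<subseteq> im (Omega T)"
proof
  fix e assume e: "e \<in> Gamma_bd T"
  have "e \<bullet> z \<le> 0 * norm z" if "Omega T *v z = 0" for z
    using pairing_boundary[OF T _ that, of "gamma_fun e" 0] e by (simp add: Gamma_bd_def pairing_gamma inner_commute)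
  then obtain y where "y \<in> im (Omega T)" "norm (e - y) \<le> 0"
    using in_im_approx[OF Omega_anti, of T e 0] by auto
  then show "e \<in> im (Omega T)" by simp
qed


lemma psum_telescope:
  fixes r :: "'a::finite \<Rightarrow> nat"
  assumes r: "is_numbering r" and f: "\<And>\<beta>. f \<beta> = h (r \<beta>) - h (r \<beta> - 1)"
  shows "psum r f \<alpha> = h (r \<alpha> - 1) - h 0"
proof (induction "r \<alpha>" arbitrary: \<alpha> rule: less_induct)
  case less
  note b = numbering_range[OF r, of \<alpha>]
  show ?case
  proof (cases "r \<alpha> = 1")
    case True then show ?thesis by (simp add: psum_first[OF r True])
  next
    case False
    then have "1 \<le> r \<alpha> - 1" "r \<alpha> - 1 \<le> CARD('a)" using b by auto
    then obtain \<beta> where \<beta>: "r \<beta> = r \<alpha> - 1" by (rule numbering_surj[OF r])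
    then have S: "r \<alpha> = Suc (r \<beta>)" using b by simp
    show ?thesis using psum_succ[OF r S, of f] less[of \<beta>] f[of \<beta>] S by simp
  qed
qed

text \<open>The indicator function of a cycle is invariant on the symbols, so its increments along
  the top and the bottom partition agree and define a kernel vector z. The boundary of e at the
  cycle is the inner product of z with e, which vanishes for e in the image.\<close>

lemma im_Gamma_bd:
  fixes T :: "'a::finite iem"
  assumes T: "is_iem T"
  shows "im (Omega T) \<subseteq> Gamma_bd T"
proof
  fix e assume "e \<in> im (Omega T)"
  then obtain y where y: "e = Omega T *v y" by auto
  let ?d = "CARD('a)" and ?p = "pos_t T" and ?q = "pos_b T"
  note p = is_iemD(2)[OF T] and q = is_iemD(3)[OF T]
  have perm: "permutation (sigma_perm T)"
    using sigma_perm_permutes[OF T] unfolding permutation_permutes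
    by (metis bsyms_def finite_Un finite_imageI finite_atLeastAtMost)
  have "boundary T (gamma_fun e) C = 0" if C: "C \<in> sigma_cycles T" for C
  proof -
    obtain x0 where x0: "C = orbit (sigma_perm T) x0" using C by (auto simp: sigma_cycles_def)
    have inv: "sigma_perm T x \<in> C \<longleftrightarrow> x \<in> C" for x
    proof
      assume "sigma_perm T x \<in> C"
      then have 1: "orbit (sigma_perm T) (sigma_perm T x) = C"
        using orbit_cyclic_eq3[OF cyclic_on_orbit'[OF perm]] unfolding x0 by blast
      have "sigma_perm T x \<in> orbit (sigma_perm T) x" by (rule orbit.base)
      then have "orbit (sigma_perm T) (sigma_perm T x) = orbit (sigma_perm T) x"
        using orbit_cyclic_eq3[OF cyclic_on_orbit'[OF perm]] by blast
      then show "x \<in> C" using 1 permutation_self_in_orbit[OF perm, of x] by simp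
    next
      assume "x \<in> C" then show "sigma_perm T x \<in> C" unfolding x0 by (rule orbit.step)
    qed
    define F where "F x = (if x \<in> C then 1 else 0 :: real)" for x
    have Fs: "F (sigma_perm T x) = F x" for x by (simp add: F_def inv del: sigma_perm.simps)
    define u where "u i = F (U i)" for i
    define v where "v j = F (Vsym ?d j)" for j
    have vu: "v (?q \<alpha>) = u (?p \<alpha>)" "v (?q \<alpha> - 1) = u (?p \<alpha> - 1)" for \<alpha>
    proof -
      note b = numbering_range[OF p, of \<alpha>] numbering_range[OF q, of \<alpha>]
      have "?p \<alpha> - 1 < ?d" "?p \<alpha> - 1 + 1 = ?p \<alpha>" using b by auto
      then have "sigma_perm T (U (?p \<alpha> - 1)) = Vsym ?d (?q \<alpha> - 1)"
        by (simp only: sigma_perm.simps if_True numbering_inv'[OF p])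
      then show "v (?q \<alpha> - 1) = u (?p \<alpha> - 1)" using Fs[of "U (?p \<alpha> - 1)"] by (simp add: u_def v_def)
      have "sigma_perm T (Vsym ?d (?q \<alpha>)) = U (?p \<alpha>)"
      proof (cases "?q \<alpha> = ?d")
        case True
        then have "inv ?q ?d = \<alpha>" using numbering_inv'[OF q, of \<alpha>] by simp
        then show ?thesis using True by (simp add: Vsym_def)
      next
        case False
        then show ?thesis using b by (simp add: Vsym_def numbering_inv'[OF q])
      qed
      then show "v (?q \<alpha>) = u (?p \<alpha>)" using Fs[of "Vsym ?d (?q \<alpha>)"] by (simp add: u_def v_def)
    qed
    define z where "z = (\<chi> \<alpha>. u (?p \<alpha>) - u (?p \<alpha> - 1))"
    have "psum ?q (($) z) \<alpha> - psum ?p (($) z) \<alpha> = 0" for \<alpha>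
    proof -
      have "psum ?p (($) z) \<alpha> = u (?p \<alpha> - 1) - u 0" by (rule psum_telescope[OF p]) (simp add: z_def)
      moreover have "psum ?q (($) z) \<alpha> = v (?q \<alpha> - 1) - v 0"
        by (rule psum_telescope[OF q]) (simp add: z_def vu[simplified])
      moreover have "v 0 = u 0" by (simp add: u_def v_def Vsym_def)
      ultimately show ?thesis using vu(2)[of \<alpha>] by simp
    qed
    then have ker: "Omega T *v z = 0" by (simp add: vec_eq_iff Omega_mult[OF T])
    have "boundary T (gamma_fun e) C = (\<Sum>i\<le>?d. u i * (val_left T (gamma_fun e) i - val_right T (gamma_fun e) i))"
      unfolding boundary_def by (rule sum.mono_neutral_cong_left) (auto simp: u_def F_def)
    also have "\<dots> = (\<Sum>\<alpha>\<in>UNIV. u (?p \<alpha>) * gamma_fun e \<alpha> (topl T \<alpha> + len T \<alpha>) - u (?p \<alpha> - 1) * gamma_fun e \<alpha> (topl T \<alpha>))"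
      by (rule endpoint_sum[OF T, symmetric])
    also have "\<dots> = z \<bullet> e" by (simp add: gamma_fun_def inner_vec_def z_def left_diff_distrib)
    also have "\<dots> = 0" using anti_inner[OF Omega_anti, of T y z] ker by (simp add: y inner_commute)
    finally show ?thesis .
  qed
  then show "e \<in> Gamma_bd T" by (simp add: Gamma_bd_def)
qed

subsection \<open>The cocycle of an interval exchange map\<close>

lemma norm_le_card_infnorm: "norm (x :: real^'a::finite) \<le> real CARD('a) * infnorm x"
proof -
  have "norm x \<le> sqrt (real CARD('a)) * infnorm x" using norm_le_infnorm[of x] by simp
  also have "sqrt (real CARD('a)) \<le> real CARD('a)"
    by (rule real_le_lsqrt) (auto simp: Suc_leI power2_eq_square)
  then have "sqrt (real CARD('a)) * infnorm x \<le> real CARD('a) * infnorm x"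
    by (intro mult_right_mono infnorm_pos_le)
  finally show ?thesis .
qed

lemma abs_det_le:
  fixes A :: "real^'a::finite^'a"
  assumes "\<And>i j. \<bar>A $ i $ j\<bar> \<le> c j"
  shows "\<bar>det A\<bar> \<le> fact CARD('a) * (\<Prod>j\<in>UNIV. c j)"
proof -
  have "\<bar>det A\<bar> \<le> (\<Sum>p | p permutes (UNIV :: 'a set). \<bar>of_int (sign p) * (\<Prod>i\<in>UNIV. A $ i $ p i)\<bar>)"
    unfolding det_def by (rule sum_abs)
  also have "\<dots> \<le> (\<Sum>p | p permutes (UNIV :: 'a set). \<Prod>j\<in>UNIV. c j)"
  proof (rule sum_mono)
    fix p assume "p \<in> {p. p permutes (UNIV :: 'a set)}"
    then have p: "p permutes UNIV" by simp
    have "\<bar>of_int (sign p) * (\<Prod>i\<in>UNIV. A $ i $ p i)\<bar> = (\<Prod>i\<in>UNIV. \<bar>A $ i $ p i\<bar>)"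
      by (simp add: abs_mult abs_prod sign_def)
    also have "\<dots> \<le> (\<Prod>i\<in>UNIV. c (p i))" using assms by (intro prod_mono) auto
    also have "\<dots> = (\<Prod>j\<in>UNIV. c j)" using prod.permute[OF p, of c] by (simp add: o_def)
    finally show "\<bar>of_int (sign p) * (\<Prod>i\<in>UNIV. A $ i $ p i)\<bar> \<le> (\<Prod>j\<in>UNIV. c j)" .
  qed
  also have "\<dots> = fact CARD('a) * (\<Prod>j\<in>UNIV. c j)" by (simp add: card_permutations)
  finally show ?thesis .
qed

text \<open>Cramer's rule with determinant one: each numerator has d - 1 columns bounded by the norm
  and one column equal to the image vector.\<close>

lemma Bp_inverse_bound:
  fixes T :: "'a::finite iem"
  assumes T: "good T"
  shows "infnorm (x :: real^'a) \<le> fact CARD('a) * bnorm T n powr real (CARD('a) - 1) * infnorm (Bp T n *v x)"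
proof (rule infnorm_leI)
  fix k :: 'a
  let ?B = "Bp T n" and ?y = "Bp T n *v x"
  let ?c = "\<lambda>j. if j = k then infnorm ?y else bnorm T n"
  have "x = (\<chi> k. det (\<chi> i j. if j = k then ?y $ i else ?B $ i $ j) / det ?B)"
    using cramer[of ?B x ?y] Bp_det[OF T, of n] by simp
  from arg_cong[OF this, of "\<lambda>v. v $ k"]
  have "x $ k = det (\<chi> i j. if j = k then ?y $ i else ?B $ i $ j) / det ?B" by (simp only: vec_lambda_beta)
  then have "\<bar>x $ k\<bar> = \<bar>det (\<chi> i j. if j = k then ?y $ i else ?B $ i $ j)\<bar>" by (simp add: Bp_det[OF T])
  also have "\<dots> \<le> fact CARD('a) * (\<Prod>j\<in>UNIV. ?c j)"
  proof (rule abs_det_le)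
    fix i j
    have "\<bar>?B $ i $ j\<bar> \<le> (\<Sum>\<beta>\<in>UNIV. \<bar>?B $ i $ \<beta>\<bar>)" by (intro member_le_sum) auto
    also have "\<dots> \<le> bnorm T n" unfolding bnorm_def by (rule row_le_mat_norm)
    finally show "\<bar>(\<chi> i j. if j = k then ?y $ i else ?B $ i $ j) $ i $ j\<bar> \<le> ?c j"
      using component_le_infnorm_cart[of ?y i] by simp
  qed
  also have "(\<Prod>j\<in>UNIV. ?c j) = infnorm ?y * bnorm T n ^ (CARD('a) - 1)"
    by (subst prod.remove[of UNIV k]) (auto simp: prod_constant)
  also have "bnorm T n ^ (CARD('a) - 1) = bnorm T n powr real (CARD('a) - 1)"
    by (rule powr_realpow[OF bnorm_pos, symmetric])
  finally show "\<bar>x $ k\<bar> \<le> fact CARD('a) * bnorm T n powr real (CARD('a) - 1) * infnorm ?y" by (simp add: mult_ac)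
qed

lemma infnorm_Bp: "infnorm (Bp T n *v x) \<le> bnorm T n * infnorm x"
  unfolding bnorm_def by (rule infnorm_matrix_mult)

lemma Gamma_s_iff:
  assumes T: "good T"
  shows "c \<in> Gamma_s T \<longleftrightarrow> (\<exists>\<sigma>>0. \<exists>C\<ge>0. \<forall>n. infnorm (Bp T n *v c) \<le> C * bnorm T n powr - \<sigma>)"
proof -
  have e: "Bmat T 0 n = Bp T n" "mat_norm (Bmat T 0 n) = bnorm T n" for n
    using Bmat_eq[OF T, of 0 n] by (simp_all add: bnorm_def)
  have pos: "bnorm T n powr - \<sigma> > 0" for n \<sigma> using bnorm_pos[of T n] by simp
  have "(\<lambda>n. infnorm (Bp T n *v c)) \<in> O(\<lambda>n. bnorm T n powr - \<sigma>) \<longleftrightarrow>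
      (\<exists>C\<ge>0. \<forall>n. infnorm (Bp T n *v c) \<le> C * bnorm T n powr - \<sigma>)" for \<sigma>
  proof
    assume "(\<lambda>n. infnorm (Bp T n *v c)) \<in> O(\<lambda>n. bnorm T n powr - \<sigma>)"
    from bigo_sequence_bound[OF this pos] obtain C where
      "C > 0" "\<forall>n. \<bar>infnorm (Bp T n *v c)\<bar> \<le> C * bnorm T n powr - \<sigma>" by blast
    then show "\<exists>C\<ge>0. \<forall>n. infnorm (Bp T n *v c) \<le> C * bnorm T n powr - \<sigma>"
      unfolding real_abs_infnorm by (intro exI[of _ C] conjI less_imp_le)
  next
    assume "\<exists>C\<ge>0. \<forall>n. infnorm (Bp T n *v c) \<le> C * bnorm T n powr - \<sigma>"
    then obtain C where "\<forall>n. infnorm (Bp T n *v c) \<le> C * bnorm T n powr - \<sigma>" by blast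
    then show "(\<lambda>n. infnorm (Bp T n *v c)) \<in> O(\<lambda>n. bnorm T n powr - \<sigma>)"
      by (intro bigoI[of _ C]) (auto simp: real_abs_infnorm)
  qed
  then show ?thesis unfolding Gamma_s_def e(1) bnorm_def[symmetric] mem_Collect_eq by (simp only:)
qed

lemma subspace_Gamma_s:
  assumes T: "good T"
  shows "subspace (Gamma_s T)"
  unfolding subspace_def
proof (intro conjI ballI allI)
  show "0 \<in> Gamma_s T" unfolding Gamma_s_iff[OF T]
    by (intro exI[of _ 1] conjI exI[of _ 0]) (auto simp: infnorm_0)
next
  fix x y assume "x \<in> Gamma_s T" "y \<in> Gamma_s T"
  then obtain \<sigma>1 C1 \<sigma>2 C2 where
    1: "\<sigma>1 > 0" "C1 \<ge> 0" "\<And>n. infnorm (Bp T n *v x) \<le> C1 * bnorm T n powr - \<sigma>1" and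
    2: "\<sigma>2 > 0" "C2 \<ge> 0" "\<And>n. infnorm (Bp T n *v y) \<le> C2 * bnorm T n powr - \<sigma>2"
    unfolding Gamma_s_iff[OF T] by blast
  define \<sigma> where "\<sigma> = min \<sigma>1 \<sigma>2"
  have le: "bnorm T n powr - \<sigma>1 \<le> bnorm T n powr - \<sigma>" "bnorm T n powr - \<sigma>2 \<le> bnorm T n powr - \<sigma>" for n
    using bnorm_ge_1[of T n] by (intro powr_mono; simp add: \<sigma>_def)+
  have "infnorm (Bp T n *v (x + y)) \<le> (C1 + C2) * bnorm T n powr - \<sigma>" for n
  proof -
    have "infnorm (Bp T n *v (x + y)) \<le> infnorm (Bp T n *v x) + infnorm (Bp T n *v y)"
      unfolding matrix_vector_right_distrib by (rule infnorm_triangle)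
    also have "\<dots> \<le> C1 * bnorm T n powr - \<sigma> + C2 * bnorm T n powr - \<sigma>"
      using order_trans[OF 1(3) mult_left_mono[OF le(1) 1(2)]] order_trans[OF 2(3) mult_left_mono[OF le(2) 2(2)]]
      by (intro add_mono)
    finally show ?thesis by (simp add: algebra_simps)
  qed
  then show "x + y \<in> Gamma_s T" unfolding Gamma_s_iff[OF T]
    using 1 2 by (intro exI[of _ \<sigma>] conjI exI[of _ "C1 + C2"]) (auto simp: \<sigma>_def)
next
  fix k :: real and x assume "x \<in> Gamma_s T"
  then obtain \<sigma> C where 1: "\<sigma> > 0" "C \<ge> 0" "\<And>n. infnorm (Bp T n *v x) \<le> C * bnorm T n powr - \<sigma>"
    unfolding Gamma_s_iff[OF T] by blast
  have "infnorm (Bp T n *v (k *\<^sub>R x)) \<le> (\<bar>k\<bar> * C) * bnorm T n powr - \<sigma>" for n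
    using mult_left_mono[OF 1(3), of "\<bar>k\<bar>" n] by (simp add: matrix_vector_mult_scaleR infnorm_mul mult.assoc)
  then show "k *\<^sub>R x \<in> Gamma_s T" unfolding Gamma_s_iff[OF T]
    using 1 by (intro exI[of _ \<sigma>] conjI exI[of _ "\<bar>k\<bar> * C"]) auto
qed

lemma Bp_split: "m \<le> n \<Longrightarrow> Bp (rv T m) (n - m) *v (Bp T m *v x) = Bp T n *v x"
  using Bp_add[of T m "n - m"] by (simp add: matrix_vector_mul_assoc)

text \<open>The norm of the later factor is at most that of the whole product, so decay measured by
  the latter is at least as good when measured by the former.\<close>

lemma Gamma_s_image:
  assumes T: "good T" and c: "c \<in> Gamma_s T"
  shows "Bp T m *v c \<in> Gamma_s (rv T m)"
proof -
  obtain \<sigma> C where 1: "\<sigma> > 0" "C \<ge> 0" "\<And>n. infnorm (Bp T n *v c) \<le> C * bnorm T n powr - \<sigma>"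
    using c unfolding Gamma_s_iff[OF T] by blast
  have "infnorm (Bp (rv T m) k *v (Bp T m *v c)) \<le> C * bnorm (rv T m) k powr - \<sigma>" for k
  proof -
    have "infnorm (Bp (rv T m) k *v (Bp T m *v c)) = infnorm (Bp T (m + k) *v c)"
      using Bp_split[of m "m + k" T c] by simp
    also have "\<dots> \<le> C * bnorm T (m + k) powr - \<sigma>" by (rule 1)
    also have "\<dots> \<le> C * bnorm (rv T m) k powr - \<sigma>"
      using 1(1,2) bnorm_tail_le[of T m k] bnorm_pos[of "rv T m" k] by (intro mult_left_mono powr_mono2') auto
    finally show ?thesis .
  qed
  then show ?thesis unfolding Gamma_s_iff[OF good_rv[OF T]] using 1 by blast
qed

text \<open>\<open>op_norm_on\<close> is a supremum of reals, so it bounds the members of its set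
  only once that set is known to be bounded; \<open>mat_norm M\<close> provides the bound.\<close>

lemma op_norm_bound:
  fixes M :: "real^'a::finite^'a"
  assumes W: "subspace W" and x: "x \<in> W"
  shows "infnorm (M *v x) \<le> op_norm_on W M * infnorm x"
proof (cases "x = 0")
  case False
  then have p: "infnorm x > 0" by (simp add: infnorm_pos_lt)
  let ?y = "(1 / infnorm x) *\<^sub>R x"
  have y: "?y \<in> W" "infnorm ?y \<le> 1" using subspace_scale[OF W x] p by (auto simp: infnorm_mul)
  have "bdd_above {infnorm (M *v c) | c. c \<in> W \<and> infnorm c \<le> 1}"
  proof (rule bdd_aboveI)
    fix r assume "r \<in> {infnorm (M *v c) | c. c \<in> W \<and> infnorm c \<le> 1}"
    then obtain c where "r = infnorm (M *v c)" "infnorm c \<le> 1" by blast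
    then show "r \<le> mat_norm M" using order_trans[OF infnorm_matrix_mult[of M c] mult_left_mono[OF _ mat_norm_nonneg]] by fastforce
  qed
  then have "infnorm (M *v ?y) \<le> op_norm_on W M"
    unfolding op_norm_on_def using y by (intro cSup_upper) blast+
  moreover have "infnorm (M *v ?y) = infnorm (M *v x) / infnorm x"
    using p by (simp add: matrix_vector_mult_scaleR infnorm_mul)
  ultimately show ?thesis using p by (simp add: field_simps)
qed (simp add: infnorm_0)

text \<open>The locale uses the Euclidean norm, the diophantine conditions the supremum norm; each
  comparison costs a factor \<open>CARD('a)\<close>. The bound on inverses comes from determinant
  one, that on single steps from doubling.\<close>

lemma cocycle_iem:
  fixes T :: "'a::finite iem"
  assumes T: "good T" and mg: "matrix_growth T" and coh: "coherence T" and hyp: "hyperbolic T"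
    and sub: "Gamma_s T \<subseteq> Gamma_bd T"
  shows "cocycle (\<lambda>n. Omega (rv T n)) (\<lambda>m n. Bp (rv T m) (n - m)) (Gamma_s T) (bnorm T)"
proof
  let ?d = "real CARD('a)"
  have d: "?d \<ge> 1" using goodD(1)[OF T] by simp
  note nd = norm_le_card_infnorm[where ?'a = 'a]
  show "Bp (rv T m) (n - m) = Bp (rv T k) (n - k) ** Bp (rv T m) (k - m)" if "m \<le> k" "k \<le> n" for m k n
    using Bp_add[of "rv T m" "k - m" "n - k"] that rv_add[of T m "k - m"] by simp
  show "Bp (rv T m) (m - m) = mat 1" for m by simp
  show "invertible (Bp (rv T m) (n - m))" for m n
    by (simp add: invertible_det_nz Bp_det[OF good_rv[OF T]])
  show "transpose (Omega (rv T n)) = - Omega (rv T n)" for n by (rule Omega_anti)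
  show "Omega (rv T n) $ i $ j \<in> {- 1, 0, 1}" for n i j by (rule Omega_sign)
  show "Omega (rv T n) = Bp (rv T m) (n - m) ** Omega (rv T m) ** transpose (Bp (rv T m) (n - m))" if "m \<le> n" for m n
    using Omega_Bp[OF good_rv[OF T, of m], of "n - m"] rv_add[of T m "n - m"] that by simp
  show "subspace (Gamma_s T)" by (rule subspace_Gamma_s[OF T])
  show "Gamma_s T \<subseteq> im (Omega (rv T 0))" using sub Gamma_bd_im[OF goodD(2)[OF T]] by simp
  show "dim (Gamma_s T) = rank (Omega (rv T 0)) div 2" using hyp by (simp add: hyperbolic_def genus_def)
  show "bnorm T 0 = 1" by (rule bnorm_0)
  show "bnorm T m \<le> bnorm T n" if "m \<le> n" for m n using that by (rule bnorm_mono)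
  show "bnorm T (Suc n) \<le> 2 * bnorm T n" for n by (rule bnorm_Suc)
  show "\<exists>C\<ge>1. \<forall>n. real (Suc n) \<le> C * bnorm T n powr \<tau>" if "\<tau> > 0" for \<tau> by (rule time_le_powr[OF T mg that])
  show "\<exists>\<sigma>>0. \<exists>C\<ge>0. \<forall>n. norm (Bp (rv T 0) (n - 0) *v \<xi>) \<le> C * bnorm T n powr - \<sigma>" if xi: "\<xi> \<in> Gamma_s T" for \<xi>
  proof -
    obtain \<sigma> C where 1: "\<sigma> > 0" "C \<ge> 0" "\<And>n. infnorm (Bp T n *v \<xi>) \<le> C * bnorm T n powr - \<sigma>"
      using xi unfolding Gamma_s_iff[OF T] by blast
    have "norm (Bp T n *v \<xi>) \<le> ?d * C * bnorm T n powr - \<sigma>" for n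
      using order_trans[OF nd mult_left_mono[OF 1(3)]] by (simp add: mult.assoc)
    then show ?thesis using 1 by (intro exI[of _ \<sigma>] conjI exI[of _ "?d * C"]) auto
  qed
  show "\<exists>C\<ge>1. \<forall>m n. m \<le> n \<longrightarrow> (\<forall>\<xi>\<in>Gamma_s T. norm (Bp (rv T 0) (n - 0) *v \<xi>)
      \<le> C * bnorm T n powr \<tau> * norm (Bp (rv T 0) (m - 0) *v \<xi>))" if tau: "\<tau> > 0" for \<tau>
  proof -
    have e: "mat_norm (Bmat T 0 n) = bnorm T n" for n
      using Bmat_eq[OF T, of 0 n] by (simp add: bnorm_def)
    obtain C where C: "\<And>m n. m \<le> n \<Longrightarrow> B_s_norm T m n \<le> C * bnorm T n powr \<tau>"
      using coh tau unfolding coherence_def e by blast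
    have "norm (Bp T n *v \<xi>) \<le> (?d * max 1 C) * bnorm T n powr \<tau> * norm (Bp T m *v \<xi>)"
      if mn: "m \<le> n" and xi: "\<xi> \<in> Gamma_s T" for m n \<xi>
    proof -
      let ?y = "Bp T m *v \<xi>"
      have "infnorm (Bp T n *v \<xi>) \<le> B_s_norm T m n * infnorm ?y"
        using op_norm_bound[OF subspace_Gamma_s[OF good_rv[OF T]] Gamma_s_image[OF T xi], of "Bmat T m n" m]
        by (simp add: B_s_norm_def Bmat_eq[OF T mn] Bp_split[OF mn])
      also have "\<dots> \<le> (max 1 C * bnorm T n powr \<tau>) * norm ?y"
      proof (intro mult_mono infnorm_le_norm infnorm_pos_le)
        show "B_s_norm T m n \<le> max 1 C * bnorm T n powr \<tau>"
          using order_trans[OF C[OF mn] mult_right_mono[of C "max 1 C"]] by simp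
      qed simp
      finally have "?d * infnorm (Bp T n *v \<xi>) \<le> ?d * (max 1 C * bnorm T n powr \<tau> * norm ?y)" by (intro mult_left_mono) auto
      then show ?thesis using order_trans[OF nd] by (simp add: mult.assoc)
    qed
    moreover have "1 \<le> ?d * max 1 C" using d by (intro one_le_mult) auto
    ultimately show ?thesis by (intro exI[of _ "?d * max 1 C"]) auto
  qed
  show "\<exists>K\<ge>0. \<exists>C\<ge>1. \<forall>n x. norm x \<le> C * bnorm T n powr K * norm (Bp (rv T 0) (n - 0) *v x)"
  proof (intro exI conjI allI)
    show "0 \<le> real (CARD('a) - 1)" by simp
    show "1 \<le> ?d * fact CARD('a)" using d by (intro one_le_mult) auto
    fix n and x :: "real^'a"
    have "norm x \<le> ?d * infnorm x" by (rule nd)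
    also have "\<dots> \<le> ?d * (fact CARD('a) * bnorm T n powr real (CARD('a) - 1) * infnorm (Bp T n *v x))"
      by (intro mult_left_mono Bp_inverse_bound[OF T]) auto
    also have "\<dots> \<le> ?d * (fact CARD('a) * bnorm T n powr real (CARD('a) - 1) * norm (Bp T n *v x))"
      by (intro mult_left_mono infnorm_le_norm) auto
    finally show "norm x \<le> ?d * fact CARD('a) * bnorm T n powr real (CARD('a) - 1) * norm (Bp (rv T 0) (n - 0) *v x)"
      by (simp add: mult.assoc)
  qed
  show "\<exists>C\<ge>1. \<forall>n x. norm (Bp (rv T n) (Suc n - n) *v x) \<le> C * norm x"
  proof (intro exI conjI allI)
    show "1 \<le> ?d * 2" by (intro one_le_mult d) simp
    fix n and x :: "real^'a"
    have "infnorm (Bp (rv T n) 1 *v x) \<le> bnorm (rv T n) 1 * infnorm x" by (rule infnorm_Bp)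
    also have "\<dots> \<le> 2 * norm x"
      using bnorm_Suc[of "rv T n" 0] by (intro mult_mono infnorm_le_norm infnorm_pos_le) (auto simp: bnorm_0)
    finally have "?d * infnorm (Bp (rv T n) 1 *v x) \<le> ?d * (2 * norm x)" by (intro mult_left_mono) auto
    then show "norm (Bp (rv T n) (Suc n - n) *v x) \<le> ?d * 2 * norm x"
      using order_trans[OF nd] by (simp add: mult.assoc del: Bp.simps)
  qed
qed


subsection \<open>Special Birkhoff sums on closed intervals\<close>

abbreviation cint :: "'a::finite iem \<Rightarrow> nat \<Rightarrow> 'a \<Rightarrow> real set" where
  "cint T n \<alpha> \<equiv> top_cint (rv T n) \<alpha>"

lemma cint_eq: "good T \<Longrightarrow> cint T n \<alpha> = {topl (rv T n) \<alpha> .. topl (rv T n) \<alpha> + len (rv T n) \<alpha>}"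
  by (simp add: top_cint_eq rv_is_iem)

lemma cint_Suc:
  fixes T :: "'a::finite iem"
  assumes T: "good T" and x: "x \<in> cint T (Suc n) \<alpha>"
  shows "\<alpha> \<noteq> loser (rv T n) \<Longrightarrow> x \<in> cint T n \<alpha>"
    and "\<alpha> = loser (rv T n) \<Longrightarrow> x \<in> cint T n (last_b (rv T n))"
    and "\<alpha> = loser (rv T n) \<Longrightarrow> x + shift (rv T n) (last_b (rv T n)) \<in> cint T n (last_t (rv T n))"
proof -
  let ?S = "rv T n"
  note g = goodD(1,2,4)[OF good_rv[OF T, of n]]
  have x': "topl (nxt ?S) \<alpha> \<le> x" "x \<le> topl (nxt ?S) \<alpha> + len (nxt ?S) \<alpha>"
    using x[unfolded cint_eq[OF T]] unfolding rv_Suc_nxt[OF T] by auto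
  show "\<alpha> \<noteq> loser ?S \<Longrightarrow> x \<in> cint T n \<alpha>"
    using x' step_len_le[OF g, of \<alpha>] by (auto simp: cint_eq[OF T] step_topl[OF g])
  show "\<alpha> = loser ?S \<Longrightarrow> x \<in> cint T n (last_b ?S)"
    using x' len_loser_le_last[OF g] winner_neq_loser[OF g] by (auto simp: cint_eq[OF T] step_topl[OF g] step_len[OF g])
  show "\<alpha> = loser ?S \<Longrightarrow> x + shift ?S (last_b ?S) \<in> cint T n (last_t ?S)"
    using x' len_loser_le_last[OF g] winner_neq_loser[OF g] last_endpoints[OF g(2)]
    by (auto simp: cint_eq[OF T] step_topl[OF g] step_len[OF g] shift_def)
qed

lemma rowsum_loser:
  "rowsum (Bp T (Suc n)) (loser (rv T n)) = rowsum (Bp T n) (last_b (rv T n)) + rowsum (Bp T n) (last_t (rv T n))"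
  using last_winner_loser[of "rv T n"] unfolding rowsum_Bp_Suc by auto

lemma rowsum_not_loser: "\<alpha> \<noteq> loser (rv T n) \<Longrightarrow> rowsum (Bp T (Suc n)) \<alpha> = rowsum (Bp T n) \<alpha>"
  unfolding rowsum_Bp_Suc by simp

text \<open>The sum along a fibre has \<open>rowsum (Bp T n) \<alpha>\<close> terms, and
  translations keep the distance of the two points. With w linear or a power this covers Lipschitz
  and Hoelder functions alike.\<close>

lemma Sb_modulus:
  assumes T: "good T" and w: "\<And>\<alpha> x y. x \<in> cint T 0 \<alpha> \<Longrightarrow> y \<in> cint T 0 \<alpha> \<Longrightarrow> \<bar>\<phi> \<alpha> x - \<phi> \<alpha> y\<bar> \<le> w \<bar>x - y\<bar>"
    and "x \<in> cint T n \<alpha>" "y \<in> cint T n \<alpha>"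
  shows "\<bar>Sb T n \<phi> \<alpha> x - Sb T n \<phi> \<alpha> y\<bar> \<le> rowsum (Bp T n) \<alpha> * w \<bar>x - y\<bar>"
  using assms(3,4)
proof (induction n arbitrary: \<alpha> x y)
  case 0 then show ?case using w by simp
next
  case (Suc n)
  let ?S = "rv T n"
  show ?case
  proof (cases "\<alpha> = loser ?S")
    case False
    then show ?thesis using Suc.IH cint_Suc(1)[OF T] Suc.prems by (simp add: rowsum_not_loser del: Bp.simps)
  next
    case True
    have "\<bar>(x + shift ?S (last_b ?S)) - (y + shift ?S (last_b ?S))\<bar> = \<bar>x - y\<bar>" by simp
    then have "\<bar>Sb T n \<phi> (last_b ?S) x - Sb T n \<phi> (last_b ?S) y\<bar> \<le> rowsum (Bp T n) (last_b ?S) * w \<bar>x - y\<bar>"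
      "\<bar>Sb T n \<phi> (last_t ?S) (x + shift ?S (last_b ?S)) - Sb T n \<phi> (last_t ?S) (y + shift ?S (last_b ?S))\<bar>
        \<le> rowsum (Bp T n) (last_t ?S) * w \<bar>x - y\<bar>"
      using Suc.IH[OF cint_Suc(2)[OF T Suc.prems(1) True] cint_Suc(2)[OF T Suc.prems(2) True]]
        Suc.IH[OF cint_Suc(3)[OF T Suc.prems(1) True] cint_Suc(3)[OF T Suc.prems(2) True]] by metis+
    then show ?thesis unfolding True rowsum_loser by (simp add: distrib_right del: Bp.simps)
  qed
qed

lemma Sb_bound:
  assumes T: "good T" and w: "\<And>\<alpha> x. x \<in> cint T 0 \<alpha> \<Longrightarrow> \<bar>\<phi> \<alpha> x\<bar> \<le> M" and "x \<in> cint T n \<alpha>"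
  shows "\<bar>Sb T n \<phi> \<alpha> x\<bar> \<le> rowsum (Bp T n) \<alpha> * M"
  using assms(3)
proof (induction n arbitrary: \<alpha> x)
  case 0 then show ?case using w by simp
next
  case (Suc n)
  let ?S = "rv T n"
  show ?case
  proof (cases "\<alpha> = loser ?S")
    case False
    then show ?thesis using Suc.IH cint_Suc(1)[OF T] Suc.prems by (simp add: rowsum_not_loser del: Bp.simps)
  next
    case True
    show ?thesis
      using Suc.IH[OF cint_Suc(2)[OF T Suc.prems True]] Suc.IH[OF cint_Suc(3)[OF T Suc.prems True]]
      unfolding True rowsum_loser by (simp add: distrib_right del: Bp.simps)
  qed
qed

text \<open>All branches are translations, so the chain rule produces no factors.\<close>

lemma Sb_derivative:
  assumes T: "good T" and f: "\<And>\<alpha> x. x \<in> cint T 0 \<alpha> \<Longrightarrow> (\<phi> \<alpha> has_real_derivative \<phi>' \<alpha> x) (at x within cint T 0 \<alpha>)"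
    and "x \<in> cint T n \<alpha>"
  shows "(Sb T n \<phi> \<alpha> has_real_derivative Sb T n \<phi>' \<alpha> x) (at x within cint T n \<alpha>)"
  using assms(3)
proof (induction n arbitrary: \<alpha> x)
  case 0 then show ?case using f by simp
next
  case (Suc n)
  let ?S = "rv T n" and ?c = "cint T (Suc n) \<alpha>"
  let ?k = "shift ?S (last_b ?S)"
  show ?case
  proof (cases "\<alpha> = loser ?S")
    case False
    have "(Sb T n \<phi> \<alpha> has_real_derivative Sb T n \<phi>' \<alpha> x) (at x within ?c)"
      by (rule DERIV_subset[OF Suc.IH]) (use cint_Suc(1)[OF T _ False] Suc.prems in auto)
    then show ?thesis using False by simp
  next
    case True
    have 1: "(Sb T n \<phi> (last_b ?S) has_real_derivative Sb T n \<phi>' (last_b ?S) x) (at x within ?c)"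
      by (rule DERIV_subset[OF Suc.IH]) (use cint_Suc(2)[OF T _ True] Suc.prems in auto)
    have "(Sb T n \<phi> (last_t ?S) has_real_derivative Sb T n \<phi>' (last_t ?S) (x + ?k)) (at (x + ?k) within (\<lambda>x. x + ?k) ` ?c)"
      by (rule DERIV_subset[OF Suc.IH]) (use cint_Suc(3)[OF T _ True] Suc.prems in auto)
    then have "((\<lambda>x. Sb T n \<phi> (last_t ?S) (x + ?k)) has_real_derivative Sb T n \<phi>' (last_t ?S) (x + ?k) * (1 + 0)) (at x within ?c)"
      by (intro DERIV_image_chain[of "Sb T n \<phi> (last_t ?S)" _ "\<lambda>x. x + ?k", unfolded o_def] derivative_intros) auto
    from DERIV_add[OF 1 this] True show ?thesis by simp
  qed
qed

lemma Sb_continuous: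
  assumes T: "good T" and f: "\<And>\<alpha>. continuous_on (cint T 0 \<alpha>) (\<phi> \<alpha>)"
  shows "continuous_on (cint T n \<alpha>) (Sb T n \<phi> \<alpha>)"
proof (induction n arbitrary: \<alpha>)
  case 0 then show ?case using f by simp
next
  case (Suc n)
  let ?S = "rv T n" and ?c = "cint T (Suc n) \<alpha>"
  show ?case
  proof (cases "\<alpha> = loser ?S")
    case False
    have "continuous_on ?c (Sb T n \<phi> \<alpha>)"
      by (rule continuous_on_subset[OF Suc.IH]) (use cint_Suc(1)[OF T _ False] in auto)
    then show ?thesis using False by simp
  next
    case True
    have "continuous_on ?c (Sb T n \<phi> (last_b ?S))"
      by (rule continuous_on_subset[OF Suc.IH]) (use cint_Suc(2)[OF T _ True] in auto)
    moreover have "continuous_on ?c (\<lambda>x. Sb T n \<phi> (last_t ?S) (x + shift ?S (last_b ?S)))"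
      by (rule continuous_on_compose2[OF Suc.IH]) (use cint_Suc(3)[OF T _ True] in \<open>auto intro!: continuous_intros\<close>)
    ultimately show ?thesis using True by (simp add: continuous_on_add)
  qed
qed

text \<open>The towers over the intervals of T(n) fill I, so their total area is conserved. In one
  step the loser's row sum gains that of the winner, while the winner's length drops by that of the
  loser.\<close>

lemma rowsum_len:
  fixes T :: "'a::finite iem"
  assumes T: "good T"
  shows "(\<Sum>\<alpha>\<in>UNIV. rowsum (Bp T n) \<alpha> * len (rv T n) \<alpha>) = sum (len T) UNIV"
proof (induction n)
  case (Suc n)
  let ?S = "rv T n"
  let ?f = "\<lambda>\<alpha>. rowsum (Bp T (Suc n)) \<alpha> * len (rv T (Suc n)) \<alpha>"
  let ?h = "\<lambda>\<alpha>. rowsum (Bp T n) \<alpha> * len ?S \<alpha>"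
  have wl: "winner ?S \<noteq> loser ?S" by (rule winner_neq_loser'[OF T])
  have "sum ?f (UNIV - {loser ?S} - {winner ?S}) = sum ?h (UNIV - {loser ?S} - {winner ?S})"
    by (intro sum.cong) (auto simp: rowsum_not_loser rv_len_Suc[OF T] simp del: Bp.simps)
  moreover have "?f (loser ?S) + ?f (winner ?S) = ?h (loser ?S) + ?h (winner ?S)"
    using wl unfolding rowsum_Bp_Suc by (simp add: rv_len_Suc[OF T] algebra_simps)
  ultimately have "sum ?f UNIV = sum ?h UNIV"
    using wl by (simp add: sum.remove[of UNIV "loser ?S"] sum.remove[of "UNIV - {loser ?S}" "winner ?S"] del: Bp.simps)
  then show ?case using Suc by simp
qed simp

lemma rowsum_len_le: "good T \<Longrightarrow> rowsum (Bp T n) \<alpha> * len (rv T n) \<alpha> \<le> sum (len T) UNIV"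
proof -
  assume T: "good T"
  have nn: "0 \<le> rowsum (Bp T n) \<beta> * len (rv T n) \<beta>" for \<beta>
    using rowsum_Bp_ge_1[of T n \<beta>] rv_len_pos[OF T, of n \<beta>] by simp
  have "rowsum (Bp T n) \<alpha> * len (rv T n) \<alpha> \<le> (\<Sum>\<alpha>\<in>UNIV. rowsum (Bp T n) \<alpha> * len (rv T n) \<alpha>)"
    by (rule member_le_sum) (use nn in auto)
  then show ?thesis by (simp add: rowsum_len[OF T])
qed

text \<open>At an endpoint the definition takes a limit from inside the open interval, which
  continuity of \<open>Sb\<close> on the closed interval evaluates.\<close>

lemma special_birkhoff_eq:
  assumes T: "good T" and f: "\<And>\<alpha>. continuous_on (cint T 0 \<alpha>) (\<phi> \<alpha>)" and x: "x \<in> cint T n \<alpha>"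
  shows "special_birkhoff T 0 n \<phi> \<alpha> x = Sb T n \<phi> \<alpha> x"
proof (cases "x \<in> top_int (rv T n) \<alpha>")
  case True then show ?thesis by (simp add: special_birkhoff_def birkhoff_open_eq[OF T])
next
  case False
  let ?I = "top_int (rv T n) \<alpha>" and ?a = "topl (rv T n) \<alpha>" and ?b = "topl (rv T n) \<alpha> + len (rv T n) \<alpha>"
  have I: "?I = {?a<..<?b}" by (rule top_int_eq[OF rv_is_iem[OF T]])
  have lt: "?a < ?b" using rv_len_pos[OF T] by simp
  have "(Sb T n \<phi> \<alpha> \<longlongrightarrow> Sb T n \<phi> \<alpha> x) (at x within cint T n \<alpha>)"
    using Sb_continuous[OF T f, of n \<alpha>] x by (simp add: continuous_on_def)
  then have "(Sb T n \<phi> \<alpha> \<longlongrightarrow> Sb T n \<phi> \<alpha> x) (at x within ?I)"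
    by (rule tendsto_within_subset) (auto simp: I cint_eq[OF T])
  then have "(birkhoff_open T 0 n \<phi> \<longlongrightarrow> Sb T n \<phi> \<alpha> x) (at x within ?I)"
    by (rule Lim_transform_within[of _ _ _ _ 1]) (auto simp: birkhoff_open_eq[OF T])
  moreover have "at x within ?I \<noteq> bot"
  proof -
    have "x \<in> closure ?I" using x lt by (simp add: I cint_eq[OF T])
    then show ?thesis using False by (simp add: trivial_limit_within islimpt_in_closure)
  qed
  ultimately show ?thesis using False by (simp add: special_birkhoff_def tendsto_Lim)
qed

lemma Cr_norm_0_le_iff:
  assumes S: "is_iem S" and f: "\<And>\<alpha>. continuous_on (top_cint S \<alpha>) (\<phi> \<alpha>)"
  shows "Cr_norm 0 S \<phi> \<le> c \<longleftrightarrow> (\<forall>\<alpha>. \<forall>x\<in>top_cint S \<alpha>. \<bar>\<phi> \<alpha> x\<bar> \<le> c)"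
proof -
  have ne: "top_cint S \<alpha> \<noteq> {}" for \<alpha> using is_iemD(1)[OF S, of \<alpha>] by (simp add: top_cint_eq[OF S] less_imp_le)
  have bdd: "bdd_above ((\<lambda>x. \<bar>\<phi> \<alpha> x\<bar>) ` top_cint S \<alpha>)" for \<alpha>
    by (intro compact_imp_bounded[THEN bounded_imp_bdd_above] compact_continuous_image continuous_intros f)
       (simp add: top_cint_eq[OF S])
  have "Cr_norm_on 0 (top_cint S \<alpha>) (\<phi> \<alpha>) = (SUP x\<in>top_cint S \<alpha>. \<bar>\<phi> \<alpha> x\<bar>)" for \<alpha>
    by (simp add: Cr_norm_on_def)
  then show ?thesis unfolding Cr_norm_def
    by (simp add: cSUP_le_iff[OF ne bdd])
qed

subsection \<open>Correction by piecewise constant functions\<close>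

text \<open>By compactness the distance to S has a positive minimum m on the unit sphere of W, and 1
  / m is the constant. The zero space W has an empty sphere and is treated apart.\<close>

lemma complement_norm_bound:
  fixes W S :: "(real^'a::finite) set"
  assumes W: "subspace W" and S: "subspace S" and d: "W \<inter> S = {0}"
  shows "\<exists>K\<ge>0. \<forall>w\<in>W. \<forall>s\<in>S. norm w \<le> K * norm (w + s)"
proof (cases "W \<inter> sphere 0 1 = {}")
  case True
  have "w = 0" if w: "w \<in> W" for w
  proof (rule ccontr)
    assume "w \<noteq> 0"
    then have "(1 / norm w) *\<^sub>R w \<in> W \<inter> sphere 0 1" using subspace_scale[OF W w] by auto
    then show False using True by blast
  qed
  then show ?thesis by (intro exI[of _ 0]) auto
next
  case False
  have K: "compact (W \<inter> sphere 0 1)" by (intro closed_Int_compact closed_subspace W compact_sphere)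
  have "continuous_on (W \<inter> sphere 0 1) (\<lambda>y. infdist y S)" by (intro continuous_intros)
  from continuous_attains_inf[OF K False this] obtain x where
    x: "x \<in> W \<inter> sphere 0 1" "\<And>y. y \<in> W \<inter> sphere 0 1 \<Longrightarrow> infdist x S \<le> infdist y S" by blast
  define m where "m = infdist x S"
  have ne: "S \<noteq> {}" using subspace_0[OF S] by blast
  have "x \<notin> S"
  proof
    assume "x \<in> S"
    then have "x \<in> {0}" using x(1) unfolding d[symmetric] by blast
    then show False using x(1) by simp
  qed
  then have "m \<noteq> 0" using in_closed_iff_infdist_zero[OF closed_subspace[OF S] ne, of x] by (simp add: m_def)
  then have m: "m > 0" using infdist_nonneg[of x S] by (simp add: m_def)
  have "norm w \<le> (1 / m) * norm (w + s)" if w: "w \<in> W" and s: "s \<in> S" for w s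
  proof (cases "w = 0")
    case False
    let ?k = "1 / norm w"
    have k: "?k > 0" using False by simp
    have "?k *\<^sub>R w \<in> W \<inter> sphere 0 1" using subspace_scale[OF W w] False by auto
    then have "m \<le> infdist (?k *\<^sub>R w) S" unfolding m_def by (rule x(2))
    also have "\<dots> \<le> dist (?k *\<^sub>R w) (- ?k *\<^sub>R s)" by (rule infdist_le) (rule subspace_scale[OF S s])
    also have "\<dots> = norm (?k *\<^sub>R (w + s))" by (simp add: dist_norm scaleR_add_right)
    also have "\<dots> = norm (w + s) / norm w" using k by simp
    finally show ?thesis using m False by (simp add: field_simps)
  qed (use m in simp)
  then show ?thesis using m by (intro exI[of _ "1 / m"]) auto
qed

text \<open>The pairing with the kernel of Omega is invariant under special Birkhoff sums, hence functions in
  the kernel of the boundary operator are close to the image of Omega once they oscillate little.\<close>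

lemma near_im_Omega:
  fixes T :: "'a::finite iem"
  assumes T: "good T" and bd: "\<And>C. C \<in> sigma_cycles T \<Longrightarrow> boundary T \<phi> C = 0"
    and osc: "\<And>\<alpha> x. x \<in> cint T n \<alpha> \<Longrightarrow> \<bar>Sb T n \<phi> \<alpha> x - Sb T n \<phi> \<alpha> (topl (rv T n) \<alpha>)\<bar> \<le> W"
  shows "\<exists>y\<in>im (Omega (rv T n)). \<forall>\<alpha>. \<forall>x\<in>cint T n \<alpha>. \<bar>Sb T n \<phi> \<alpha> x - y $ \<alpha>\<bar> \<le> (1 + (real CARD('a))\<^sup>2) * W"
proof -
  let ?S = "rv T n" and ?d = "real CARD('a)"
  let ?g = "Sb T n \<phi>"
  define v where "v = (\<chi> \<alpha>. ?g \<alpha> (topl ?S \<alpha>))"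
  have ends: "topl ?S \<alpha> \<in> cint T n \<alpha>" "topl ?S \<alpha> + len ?S \<alpha> \<in> cint T n \<alpha>" for \<alpha>
    using rv_len_pos[OF T, of n \<alpha>] by (auto simp: cint_eq[OF T] less_imp_le)
  have W: "W \<ge> 0" using osc[OF ends(1)] by simp
  note num = is_iemD(2)[OF rv_is_iem[OF T, of n]]
  have "v \<bullet> z \<le> (?d\<^sup>2 * W) * norm z" if z: "Omega ?S *v z = 0" for z
  proof -
    have "pairing ?S z 0 ?g = 0"
      by (rule pairing_iterate[OF T _ z]) (rule pairing_boundary[OF goodD(2)[OF T] bd])
    \<comment> \<open>Subtracting the vanishing pairing leaves only differences between the values
      at the two ends of each interval, which the oscillation bounds.\<close>
    then have "v \<bullet> z = v \<bullet> z - pairing ?S z 0 ?g" by simp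
    also have "\<dots> = (\<Sum>\<alpha>\<in>UNIV. (psum (pos_t ?S) (($) z) \<alpha> + z $ \<alpha>) * (v $ \<alpha> - ?g \<alpha> (topl ?S \<alpha> + len ?S \<alpha>)))"
      unfolding pairing_def inner_vec_def sum_subtractf[symmetric]
      by (intro sum.cong) (auto simp: v_def algebra_simps)
    also have "\<dots> \<le> (\<Sum>\<alpha>\<in>(UNIV :: 'a set). (?d * norm z) * W)"
    proof (rule sum_mono)
      fix \<alpha>
      have "\<bar>psum (pos_t ?S) (($) z) \<alpha> + z $ \<alpha>\<bar> \<le> (\<Sum>\<beta> | pos_t ?S \<beta> \<le> pos_t ?S \<alpha>. \<bar>z $ \<beta>\<bar>)"
        unfolding psum_incl[OF num] by (rule sum_abs)
      also have "\<dots> \<le> (\<Sum>\<beta>\<in>UNIV. \<bar>z $ \<beta>\<bar>)" by (intro sum_mono2) auto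
      also have "\<dots> \<le> (\<Sum>\<beta>\<in>(UNIV :: 'a set). norm z)" by (intro sum_mono component_le_norm_cart)
      finally have 1: "\<bar>psum (pos_t ?S) (($) z) \<alpha> + z $ \<alpha>\<bar> \<le> ?d * norm z" by simp
      have 2: "\<bar>v $ \<alpha> - ?g \<alpha> (topl ?S \<alpha> + len ?S \<alpha>)\<bar> \<le> W"
        using osc[OF ends(2), of \<alpha>] by (simp add: v_def abs_minus_commute)
      have "(psum (pos_t ?S) (($) z) \<alpha> + z $ \<alpha>) * (v $ \<alpha> - ?g \<alpha> (topl ?S \<alpha> + len ?S \<alpha>)) \<le>
          \<bar>psum (pos_t ?S) (($) z) \<alpha> + z $ \<alpha>\<bar> * \<bar>v $ \<alpha> - ?g \<alpha> (topl ?S \<alpha> + len ?S \<alpha>)\<bar>"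
        unfolding abs_mult[symmetric] by (rule abs_ge_self)
      also have "\<dots> \<le> (?d * norm z) * W" using 1 2 by (intro mult_mono) auto
      finally show "(psum (pos_t ?S) (($) z) \<alpha> + z $ \<alpha>) * (v $ \<alpha> - ?g \<alpha> (topl ?S \<alpha> + len ?S \<alpha>)) \<le> (?d * norm z) * W" .
    qed
    also have "\<dots> = (?d\<^sup>2 * W) * norm z" by (simp add: power2_eq_square)
    finally show ?thesis .
  qed
  then obtain y where y: "y \<in> im (Omega ?S)" "norm (v - y) \<le> ?d\<^sup>2 * W"
    using in_im_approx[OF Omega_anti, of ?S v "?d\<^sup>2 * W"] W by auto
  have "\<bar>?g \<alpha> x - y $ \<alpha>\<bar> \<le> (1 + ?d\<^sup>2) * W" if x: "x \<in> cint T n \<alpha>" for \<alpha> x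
  proof -
    have "\<bar>?g \<alpha> x - v $ \<alpha>\<bar> \<le> W" using osc[OF x] by (simp add: v_def)
    moreover have "\<bar>v $ \<alpha> - y $ \<alpha>\<bar> \<le> ?d\<^sup>2 * W" using component_le_norm_cart[of "v - y" \<alpha>] y(2) by simp
    ultimately show ?thesis unfolding distrib_right by linarith
  qed
  then show ?thesis using y(1) by blast
qed

text \<open>Exact special Birkhoff sums satisfy the step relation of the cocycle, so vectors close
  to them satisfy it up to the approximation errors. D is chosen before \<phi>, which keeps the
  later operator bounds uniform.\<close>

lemma approximating_sequence:
  fixes T :: "'a::finite iem"
  assumes T: "good T"
  shows "\<exists>D\<ge>1. \<forall>\<phi> M \<delta>. 0 \<le> \<delta> \<longrightarrow> (\<forall>C\<in>sigma_cycles T. boundary T \<phi> C = 0) \<longrightarrow>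
    (\<forall>\<alpha>. \<forall>x\<in>cint T 0 \<alpha>. \<bar>\<phi> \<alpha> x\<bar> \<le> M) \<longrightarrow>
    (\<forall>n \<alpha>. \<forall>x\<in>cint T n \<alpha>. \<bar>Sb T n \<phi> \<alpha> x - Sb T n \<phi> \<alpha> (topl (rv T n) \<alpha>)\<bar> \<le> M * bnorm T n powr - \<delta>) \<longrightarrow>
    (\<exists>x. (\<forall>n. x n \<in> im (Omega (rv T n))) \<and> norm (x 0) \<le> D * M \<and>
      (\<forall>n. norm (x (Suc n) - Bp (rv T n) (Suc n - n) *v x n) \<le> D * M * bnorm T n powr - \<delta>) \<and>
      (\<forall>n \<alpha>. \<forall>p\<in>cint T n \<alpha>. \<bar>Sb T n \<phi> \<alpha> p - x n $ \<alpha>\<bar> \<le> D * M * bnorm T n powr - \<delta>))"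
proof -
  let ?d = "real CARD('a)"
  define k where "k = 1 + ?d\<^sup>2"
  \<comment> \<open>k comes from \<open>near_im_Omega\<close>, the factor 3 from the loser, where
    one new and two old approximations meet, and the cardinality from passing to the Euclidean
    norm.\<close>
  define D where "D = 3 * ?d * k"
  have d: "?d \<ge> 1" using goodD(1)[OF T] by simp
  have k: "k \<ge> 1" by (simp add: k_def)
  have dk: "1 \<le> ?d * k" by (intro one_le_mult d k)
  have D: "D \<ge> 1" "k \<le> D" "?d * (1 + k) \<le> D"
  proof -
    have "1 * k \<le> ?d * k" using d k by (intro mult_right_mono) auto
    moreover have "?d * 1 \<le> ?d * k" using k d by (intro mult_left_mono) auto
    moreover have "D = 3 * (?d * k)" "?d * (1 + k) = ?d + ?d * k" by (simp_all add: D_def distrib_left)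
    ultimately show "D \<ge> 1" "k \<le> D" "?d * (1 + k) \<le> D" using dk by linarith+
  qed
  have "\<exists>x. (\<forall>n. x n \<in> im (Omega (rv T n))) \<and> norm (x 0) \<le> D * M \<and>
      (\<forall>n. norm (x (Suc n) - Bp (rv T n) (Suc n - n) *v x n) \<le> D * M * bnorm T n powr - \<delta>) \<and>
      (\<forall>n \<alpha>. \<forall>p\<in>cint T n \<alpha>. \<bar>Sb T n \<phi> \<alpha> p - x n $ \<alpha>\<bar> \<le> D * M * bnorm T n powr - \<delta>)"
    if de: "0 \<le> \<delta>" and bd: "\<forall>C\<in>sigma_cycles T. boundary T \<phi> C = 0"
      and Mb: "\<forall>\<alpha>. \<forall>x\<in>cint T 0 \<alpha>. \<bar>\<phi> \<alpha> x\<bar> \<le> M"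
      and osc: "\<forall>n \<alpha>. \<forall>x\<in>cint T n \<alpha>. \<bar>Sb T n \<phi> \<alpha> x - Sb T n \<phi> \<alpha> (topl (rv T n) \<alpha>)\<bar> \<le> M * bnorm T n powr - \<delta>"
    for \<phi> M \<delta>
  proof -
    have left: "topl (rv T n) \<alpha> \<in> cint T n \<alpha>" for n \<alpha>
      using rv_len_pos[OF T, of n \<alpha>] by (auto simp: cint_eq[OF T] less_imp_le)
    have M: "M \<ge> 0" using Mb left[of 0] abs_ge_zero order_trans by (metis rv_0)
    have "\<exists>y. y \<in> im (Omega (rv T n)) \<and> (\<forall>\<alpha>. \<forall>x\<in>cint T n \<alpha>. \<bar>Sb T n \<phi> \<alpha> x - y $ \<alpha>\<bar> \<le> k * (M * bnorm T n powr - \<delta>))" for n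
      using near_im_Omega[OF T, of \<phi> n "M * bnorm T n powr - \<delta>"] bd osc unfolding k_def by blast
    then obtain x where x: "\<And>n. x n \<in> im (Omega (rv T n))"
      "\<And>n \<alpha> p. p \<in> cint T n \<alpha> \<Longrightarrow> \<bar>Sb T n \<phi> \<alpha> p - x n $ \<alpha>\<bar> \<le> k * (M * bnorm T n powr - \<delta>)" by metis
    have inc: "norm (x (Suc n) - Bp (rv T n) (Suc n - n) *v x n) \<le> D * M * bnorm T n powr - \<delta>" for n
    proof -
      let ?w = "M * bnorm T n powr - \<delta>"
      have w: "?w \<ge> 0" using M by simp
      have "M * bnorm T (Suc n) powr - \<delta> \<le> ?w"
        using M de bnorm_mono[of n "Suc n" T] bnorm_pos[of T n] by (intro mult_left_mono powr_mono2') auto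
      from mult_left_mono[OF this, of k] have 1: "k * (M * bnorm T (Suc n) powr - \<delta>) \<le> k * ?w" using k by simp
      have "infnorm (x (Suc n) - step_mat (rv T n) *v x n) \<le> 3 * k * ?w"
      proof (rule infnorm_leI)
        fix \<alpha>
        define p where "p = topl (rv T (Suc n)) \<alpha>"
        have p: "p \<in> cint T (Suc n) \<alpha>" unfolding p_def by (rule left)
        have a: "\<bar>Sb T (Suc n) \<phi> \<alpha> p - x (Suc n) $ \<alpha>\<bar> \<le> k * ?w" using x(2)[OF p] 1 by linarith
        have kw: "0 \<le> k * ?w" using k w by simp
        show "\<bar>(x (Suc n) - step_mat (rv T n) *v x n) $ \<alpha>\<bar> \<le> 3 * k * ?w"
        proof (cases "\<alpha> = loser (rv T n)")
          case False
          have "\<bar>Sb T n \<phi> \<alpha> p - x n $ \<alpha>\<bar> \<le> k * ?w" by (rule x(2)[OF cint_Suc(1)[OF T p False]])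
          then show ?thesis using a False kw by (simp add: step_mat_mult)
        next
          case True
          let ?a = "last_b (rv T n)" and ?t = "last_t (rv T n)"
          have "\<bar>Sb T n \<phi> ?a p - x n $ ?a\<bar> \<le> k * ?w" by (rule x(2)[OF cint_Suc(2)[OF T p True]])
          moreover have "\<bar>Sb T n \<phi> ?t (p + shift (rv T n) ?a) - x n $ ?t\<bar> \<le> k * ?w" by (rule x(2)[OF cint_Suc(3)[OF T p True]])
          moreover have "(step_mat (rv T n) *v x n) $ \<alpha> = x n $ ?a + x n $ ?t"
            using True last_winner_loser[of "rv T n"] by (auto simp: step_mat_mult)
          ultimately show ?thesis using a True by simp
        qed
      qed
      then have "?d * infnorm (x (Suc n) - step_mat (rv T n) *v x n) \<le> ?d * (3 * k * ?w)" by (intro mult_left_mono) auto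
      from order_trans[OF norm_le_card_infnorm this] show ?thesis by (simp add: D_def mult_ac)
    qed
    have "infnorm (x 0) \<le> (1 + k) * M"
    proof (rule infnorm_leI)
      fix \<alpha>
      have "\<bar>\<phi> \<alpha> (topl (rv T 0) \<alpha>)\<bar> \<le> M" using Mb left[of 0 \<alpha>] by blast
      moreover have "\<bar>\<phi> \<alpha> (topl (rv T 0) \<alpha>) - x 0 $ \<alpha>\<bar> \<le> k * M" using x(2)[OF left[of 0 \<alpha>]] by (simp add: bnorm_0)
      ultimately show "\<bar>x 0 $ \<alpha>\<bar> \<le> (1 + k) * M" unfolding distrib_right by linarith
    qed
    then have "?d * infnorm (x 0) \<le> ?d * ((1 + k) * M)" by (intro mult_left_mono) auto
    also have "\<dots> \<le> D * M" using D(3) M by (simp only: mult.assoc[symmetric] mult_right_mono)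
    finally have x0: "norm (x 0) \<le> D * M" using order_trans[OF norm_le_card_infnorm] by blast
    have "\<bar>Sb T n \<phi> \<alpha> p - x n $ \<alpha>\<bar> \<le> D * M * bnorm T n powr - \<delta>" if "p \<in> cint T n \<alpha>" for n \<alpha> p
    proof -
      have "k * (M * bnorm T n powr - \<delta>) \<le> D * (M * bnorm T n powr - \<delta>)" using D(2) M by (intro mult_right_mono) auto
      then show ?thesis using x(2)[OF that] by (simp add: mult.assoc)
    qed
    then show ?thesis using x(1) inc x0 by blast
  qed
  then show ?thesis using D(1) by blast
qed

context
  fixes T :: "'a::finite iem" and Gamma_u :: "(real^'a) set"
  assumes T: "good T" and mg: "matrix_growth T" and coh: "coherence T" and hyp: "hyperbolic T"
    and sup: "supplements Gamma_u (Gamma_s T) (Gamma_bd T)"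
begin

lemma supplementsD:
  "subspace Gamma_u" "Gamma_u \<inter> Gamma_s T = {0}" "Gamma_s T \<subseteq> Gamma_bd T" "Gamma_u \<subseteq> Gamma_bd T"
  "\<And>c. c \<in> Gamma_bd T \<Longrightarrow> \<exists>w\<in>Gamma_u. \<exists>s\<in>Gamma_s T. c = w + s"
proof -
  have e: "subspace Gamma_u" "Gamma_u \<inter> Gamma_s T = {0}" "{w + s | w s. w \<in> Gamma_u \<and> s \<in> Gamma_s T} = Gamma_bd T"
    using sup unfolding supplements_def by auto
  then show "subspace Gamma_u" "Gamma_u \<inter> Gamma_s T = {0}" by auto
  have z: "0 \<in> Gamma_u" "0 \<in> Gamma_s T" using e(2) by auto
  show "Gamma_s T \<subseteq> Gamma_bd T"
  proof
    fix x assume "x \<in> Gamma_s T"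
    then have "0 + x \<in> {w + s | w s. w \<in> Gamma_u \<and> s \<in> Gamma_s T}" using z by blast
    then show "x \<in> Gamma_bd T" using e(3) by simp
  qed
  show "Gamma_u \<subseteq> Gamma_bd T"
  proof
    fix x assume "x \<in> Gamma_u"
    then have "x + 0 \<in> {w + s | w s. w \<in> Gamma_u \<and> s \<in> Gamma_s T}" using z by blast
    then show "x \<in> Gamma_bd T" using e(3) by simp
  qed
  show "\<exists>w\<in>Gamma_u. \<exists>s\<in>Gamma_s T. c = w + s" if "c \<in> Gamma_bd T" for c
    using that e(3) by blast
qed

interpretation c: cocycle "\<lambda>n. Omega (rv T n)" "\<lambda>m n. Bp (rv T m) (n - m)" "Gamma_s T" "bnorm T"
  by (rule cocycle_iem[OF T mg coh hyp supplementsD(3)])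

text \<open>Changing c by a stable vector leaves its pairings with the isotropic stable space
  unchanged; so the component in \<open>Gamma_u\<close> may be taken, with norm controlled by
  \<open>complement_norm_bound\<close>.\<close>

lemma asymptotic_in_Gamma_u:
  "\<exists>K\<ge>1. \<forall>x A. c.approx x A 0 \<longrightarrow> (\<exists>w\<in>Gamma_u. c.asymptotic w x \<and> norm w \<le> K * A)"
proof -
  obtain K where K: "K \<ge> 1" "\<And>x A. c.approx x A 0 \<Longrightarrow> \<exists>c. c.asymptotic c x \<and> norm c \<le> K * A"
    using c.asymptotic_exists by blast
  obtain L where L: "L \<ge> 0" "\<And>w s. w \<in> Gamma_u \<Longrightarrow> s \<in> Gamma_s T \<Longrightarrow> norm w \<le> L * norm (w + s)"
    using complement_norm_bound[OF supplementsD(1) c.Gs(1) supplementsD(2)] by blast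
  have imeq: "im (Omega T) = Gamma_bd T"
    using im_Gamma_bd Gamma_bd_im goodD(2)[OF T] by blast
  have "\<exists>w\<in>Gamma_u. c.asymptotic w x \<and> norm w \<le> (max 1 L * K) * A" if x: "c.approx x A 0" for x A
  proof -
    obtain e where e: "c.asymptotic e x" "norm e \<le> K * A" using K(2)[OF x] by blast
    have "e \<in> im (Omega T)" using e(1) by (simp add: c.asymptotic_def)
    then have "e \<in> Gamma_bd T" using imeq by blast
    then obtain w s where ws: "w \<in> Gamma_u" "s \<in> Gamma_s T" "e = w + s" using supplementsD(5) by blast
    have wim: "w \<in> im (Omega (rv T 0))" using supplementsD(4) ws(1) imeq by auto
    have "sform (Omega (rv T 0)) w \<xi> = sform (Omega (rv T 0)) e \<xi>" if xi: "\<xi> \<in> Gamma_s T" for \<xi>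
      using sform_add_left[OF Omega_anti wim c.Gs_im[OF ws(2)] c.Gs_im[OF xi]] c.isotropic[OF ws(2) xi] by (simp add: ws(3))
    then have "c.asymptotic w x" using e(1) wim unfolding c.asymptotic_def by auto
    moreover have "norm w \<le> (max 1 L * K) * A"
    proof -
      have "norm w \<le> L * norm e" using L(2)[OF ws(1,2)] by (simp add: ws(3))
      also have "\<dots> \<le> max 1 L * (K * A)" using e(2) L(1) by (intro mult_mono) auto
      finally show ?thesis by (simp add: mult.assoc)
    qed
    ultimately show ?thesis using ws(1) by blast
  qed
  moreover have "max 1 L * K \<ge> 1" using K(1) by (intro one_le_mult) auto
  ultimately show ?thesis by blast
qed

text \<open>K and \<open>Cf\<close> are fixed before \<phi> and M: this gives boundedness of the
  operator and the constants C(\<tau>). One w has to serve every \<tau>, so it is taken from the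
  limits of pairings, before any growth rate is chosen.\<close>

lemma correction_growth:
  "\<exists>K\<ge>0. \<exists>Cf. \<forall>\<phi> M. (\<forall>C\<in>sigma_cycles T. boundary T \<phi> C = 0) \<longrightarrow>
    (\<forall>\<alpha>. \<forall>x\<in>cint T 0 \<alpha>. \<bar>\<phi> \<alpha> x\<bar> \<le> M) \<longrightarrow>
    (\<forall>n \<alpha>. \<forall>x\<in>cint T n \<alpha>. \<bar>Sb T n \<phi> \<alpha> x - Sb T n \<phi> \<alpha> (topl (rv T n) \<alpha>)\<bar> \<le> M) \<longrightarrow>
    (\<exists>w\<in>Gamma_u. norm w \<le> K * M \<and>
      (\<forall>\<tau>>0. \<forall>n \<alpha>. \<forall>p\<in>cint T n \<alpha>. \<bar>Sb T n \<phi> \<alpha> p - (Bp T n *v w) $ \<alpha>\<bar> \<le> Cf \<tau> * M * bnorm T n powr \<tau>))"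
proof -
  obtain D where D: "D \<ge> 1" "\<And>\<phi> M \<delta>. 0 \<le> \<delta> \<Longrightarrow> (\<forall>C\<in>sigma_cycles T. boundary T \<phi> C = 0) \<Longrightarrow>
    (\<forall>\<alpha>. \<forall>x\<in>cint T 0 \<alpha>. \<bar>\<phi> \<alpha> x\<bar> \<le> M) \<Longrightarrow>
    (\<forall>n \<alpha>. \<forall>x\<in>cint T n \<alpha>. \<bar>Sb T n \<phi> \<alpha> x - Sb T n \<phi> \<alpha> (topl (rv T n) \<alpha>)\<bar> \<le> M * bnorm T n powr - \<delta>) \<Longrightarrow>
    (\<exists>x. (\<forall>n. x n \<in> im (Omega (rv T n))) \<and> norm (x 0) \<le> D * M \<and>
      (\<forall>n. norm (x (Suc n) - Bp (rv T n) (Suc n - n) *v x n) \<le> D * M * bnorm T n powr - \<delta>) \<and>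
      (\<forall>n \<alpha>. \<forall>p\<in>cint T n \<alpha>. \<bar>Sb T n \<phi> \<alpha> p - x n $ \<alpha>\<bar> \<le> D * M * bnorm T n powr - \<delta>))"
    using approximating_sequence[OF T] by blast
  obtain K where K: "K \<ge> 1" "\<And>x A. c.approx x A 0 \<Longrightarrow> \<exists>w\<in>Gamma_u. c.asymptotic w x \<and> norm w \<le> K * A"
    using asymptotic_in_Gamma_u by blast
  \<comment> \<open>The value at nonpositive \<tau> is a dummy that lets \<open>choice\<close> run
    over all reals.\<close>
  have "\<forall>\<tau>. \<exists>C\<ge>1. \<tau> > 0 \<longrightarrow> (\<forall>x A c n. c.approx x A 0 \<longrightarrow> c.asymptotic c x \<longrightarrow> norm c \<le> K * A \<longrightarrow>
    norm (x n - Bp (rv T 0) (n - 0) *v c) \<le> C * A * bnorm T n powr \<tau>)"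
  proof
    fix \<tau> :: real
    show "\<exists>C\<ge>1. \<tau> > 0 \<longrightarrow> (\<forall>x A c n. c.approx x A 0 \<longrightarrow> c.asymptotic c x \<longrightarrow> norm c \<le> K * A \<longrightarrow>
      norm (x n - Bp (rv T 0) (n - 0) *v c) \<le> C * A * bnorm T n powr \<tau>)"
    proof (cases "\<tau> > 0")
      case True
      have "0 \<le> K" using K(1) by simp
      from c.tracking_growth[OF True this] show ?thesis by blast
    qed (auto intro: exI[of _ 1])
  qed
  from choice[OF this] obtain Cf where Cf0: "\<forall>\<tau>. Cf \<tau> \<ge> 1 \<and> (\<tau> > 0 \<longrightarrow> (\<forall>x A c n. c.approx x A 0 \<longrightarrow> c.asymptotic c x \<longrightarrow>
    norm c \<le> K * A \<longrightarrow> norm (x n - Bp (rv T 0) (n - 0) *v c) \<le> Cf \<tau> * A * bnorm T n powr \<tau>))" ..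
  have Cf: "norm (x n - Bp (rv T 0) (n - 0) *v c) \<le> Cf \<tau> * A * bnorm T n powr \<tau>"
    if "\<tau> > 0" "c.approx x A 0" "c.asymptotic c x" "norm c \<le> K * A" for \<tau> x A c n
    using Cf0 that by blast
  have "\<exists>w\<in>Gamma_u. norm w \<le> (K * D) * M \<and>
      (\<forall>\<tau>>0. \<forall>n \<alpha>. \<forall>p\<in>cint T n \<alpha>. \<bar>Sb T n \<phi> \<alpha> p - (Bp T n *v w) $ \<alpha>\<bar> \<le> ((1 + Cf \<tau>) * D) * M * bnorm T n powr \<tau>)"
    if bd: "\<forall>C\<in>sigma_cycles T. boundary T \<phi> C = 0" and Mb: "\<forall>\<alpha>. \<forall>x\<in>cint T 0 \<alpha>. \<bar>\<phi> \<alpha> x\<bar> \<le> M"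
      and osc: "\<forall>n \<alpha>. \<forall>x\<in>cint T n \<alpha>. \<bar>Sb T n \<phi> \<alpha> x - Sb T n \<phi> \<alpha> (topl (rv T n) \<alpha>)\<bar> \<le> M" for \<phi> M
  proof -
    have b0: "bnorm T n powr - 0 = 1" for n using bnorm_pos[of T n] by simp
    obtain x where x: "\<forall>n. x n \<in> im (Omega (rv T n))" "norm (x 0) \<le> D * M"
      "\<forall>n. norm (x (Suc n) - Bp (rv T n) (Suc n - n) *v x n) \<le> D * M * bnorm T n powr - 0"
      "\<forall>n \<alpha>. \<forall>p\<in>cint T n \<alpha>. \<bar>Sb T n \<phi> \<alpha> p - x n $ \<alpha>\<bar> \<le> D * M * bnorm T n powr - 0"
      using D(2)[OF order_refl bd Mb] osc unfolding b0 by auto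
    have ap: "c.approx x (D * M) 0" unfolding c.approx_def using x(1-3) by blast
    obtain w where w: "w \<in> Gamma_u" "c.asymptotic w x" "norm w \<le> K * (D * M)" using K(2)[OF ap] by blast
    have "\<bar>Sb T n \<phi> \<alpha> p - (Bp T n *v w) $ \<alpha>\<bar> \<le> ((1 + Cf \<tau>) * D) * M * bnorm T n powr \<tau>"
      if t: "\<tau> > 0" and p: "p \<in> cint T n \<alpha>" for \<tau> n \<alpha> p
    proof -
      have 1: "\<bar>Sb T n \<phi> \<alpha> p - x n $ \<alpha>\<bar> \<le> D * M" using x(4) p unfolding b0 by auto
      have "1 \<le> bnorm T n powr \<tau>" using bnorm_ge_1[of T n] t by (simp add: ge_one_powr_ge_zero)
      then have "D * M * 1 \<le> D * M * bnorm T n powr \<tau>" using c.approxD(4)[OF ap] by (intro mult_left_mono)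
      moreover have "\<bar>x n $ \<alpha> - (Bp T n *v w) $ \<alpha>\<bar> \<le> Cf \<tau> * (D * M) * bnorm T n powr \<tau>"
        using component_le_norm_cart[of "x n - Bp T n *v w" \<alpha>] Cf[OF t ap w(2,3), of n] by simp
      ultimately have "\<bar>Sb T n \<phi> \<alpha> p - (Bp T n *v w) $ \<alpha>\<bar> \<le> D * M * bnorm T n powr \<tau> + Cf \<tau> * (D * M) * bnorm T n powr \<tau>"
        using 1 by linarith
      then show ?thesis by (simp add: algebra_simps)
    qed
    then show ?thesis using w(1,3) by (intro bexI[of _ w]) (auto simp: mult.assoc)
  qed
  moreover have "0 \<le> K * D" using K(1) D(1) by simp
  ultimately show ?thesis by (intro exI[of _ "K * D"] conjI exI[of _ "\<lambda>\<tau>. (1 + Cf \<tau>) * D"]) blast+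
qed

text \<open>A pseudo-orbit whose errors decay is in particular one with bounded errors, so w is
  obtained as for bounded errors; only the tracking estimate is replaced by the stronger
  one.\<close>

lemma correction_decay:
  assumes "\<delta> > 0"
    and bd: "\<forall>C\<in>sigma_cycles T. boundary T \<phi> C = 0" and Mb: "\<forall>\<alpha>. \<forall>x\<in>cint T 0 \<alpha>. \<bar>\<phi> \<alpha> x\<bar> \<le> M"
    and osc: "\<forall>n \<alpha>. \<forall>x\<in>cint T n \<alpha>. \<bar>Sb T n \<phi> \<alpha> x - Sb T n \<phi> \<alpha> (topl (rv T n) \<alpha>)\<bar> \<le> M * bnorm T n powr - \<delta>"
  shows "\<exists>w\<in>Gamma_u. \<exists>s>0. \<exists>C\<ge>0. \<forall>n \<alpha>. \<forall>p\<in>cint T n \<alpha>.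
    \<bar>Sb T n \<phi> \<alpha> p - (Bp T n *v w) $ \<alpha>\<bar> \<le> C * bnorm T n powr - s"
proof -
  have "0 \<le> \<delta>" using assms(1) by simp
  then obtain D x where D: "D \<ge> 1" and x: "\<forall>n. x n \<in> im (Omega (rv T n))" "norm (x 0) \<le> D * M"
      "\<forall>n. norm (x (Suc n) - Bp (rv T n) (Suc n - n) *v x n) \<le> D * M * bnorm T n powr - \<delta>"
      "\<forall>n \<alpha>. \<forall>p\<in>cint T n \<alpha>. \<bar>Sb T n \<phi> \<alpha> p - x n $ \<alpha>\<bar> \<le> D * M * bnorm T n powr - \<delta>"
    using approximating_sequence[OF T] bd Mb osc by blast
  have ap: "c.approx x (D * M) \<delta>" unfolding c.approx_def using x(1-3) by blast
  note A = c.approxD(4)[OF ap]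
  have ap0: "c.approx x (D * M) 0"
  proof -
    have "D * M * bnorm T n powr - \<delta> \<le> D * M * bnorm T n powr - 0" for n
      using A assms(1) bnorm_ge_1[of T n] by (intro mult_left_mono powr_mono) auto
    then show ?thesis unfolding c.approx_def using x(1-3) order_trans by blast
  qed
  obtain K where K: "K \<ge> 1" "\<And>x A. c.approx x A 0 \<Longrightarrow> \<exists>w\<in>Gamma_u. c.asymptotic w x \<and> norm w \<le> K * A"
    using asymptotic_in_Gamma_u by blast
  obtain w where w: "w \<in> Gamma_u" "c.asymptotic w x" "norm w \<le> K * (D * M)" using K(2)[OF ap0] by blast
  have "0 \<le> K" using K(1) by simp
  from c.tracking_decay[OF assms(1) this] obtain s C where C: "s > 0" "C \<ge> 1"
    and C0: "\<forall>x A c n. c.approx x A \<delta> \<longrightarrow> c.asymptotic c x \<longrightarrow> norm c \<le> K * A \<longrightarrow>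
      norm (x n - Bp (rv T 0) (n - 0) *v c) \<le> C * A * bnorm T n powr - s"
    by (elim exE conjE) (rule that)
  have Cw: "norm (x n - Bp (rv T 0) (n - 0) *v w) \<le> C * (D * M) * bnorm T n powr - s" for n
    using C0[rule_format, OF ap w(2,3)] .
  define s' where "s' = min s \<delta>"
  have "\<bar>Sb T n \<phi> \<alpha> p - (Bp T n *v w) $ \<alpha>\<bar> \<le> ((1 + C) * (D * M)) * bnorm T n powr - s'"
    if p: "p \<in> cint T n \<alpha>" for n \<alpha> p
  proof -
    have "\<bar>Sb T n \<phi> \<alpha> p - x n $ \<alpha>\<bar> \<le> D * M * bnorm T n powr - \<delta>" using x(4) p by blast
    also have "\<dots> \<le> D * M * bnorm T n powr - s'"
      using A bnorm_ge_1[of T n] by (intro mult_left_mono powr_mono) (auto simp: s'_def)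
    finally have 1: "\<bar>Sb T n \<phi> \<alpha> p - x n $ \<alpha>\<bar> \<le> D * M * bnorm T n powr - s'" .
    have "\<bar>x n $ \<alpha> - (Bp T n *v w) $ \<alpha>\<bar> \<le> C * (D * M) * bnorm T n powr - s"
      using component_le_norm_cart[of "x n - Bp T n *v w" \<alpha>] Cw[of n] by simp
    also have "\<dots> \<le> C * (D * M) * bnorm T n powr - s'"
      using mult_nonneg_nonneg[OF _ A, of C] C(2) bnorm_ge_1[of T n]
      by (intro mult_left_mono powr_mono) (auto simp: s'_def)
    finally have "\<bar>Sb T n \<phi> \<alpha> p - (Bp T n *v w) $ \<alpha>\<bar> \<le> D * M * bnorm T n powr - s' + C * (D * M) * bnorm T n powr - s'"
      using 1 by linarith
    then show ?thesis by (simp add: algebra_simps)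
  qed
  moreover have "s' > 0" using C(1) assms(1) by (simp add: s'_def)
  moreover have "(1 + C) * (D * M) \<ge> 0" using A C(2) by simp
  ultimately show ?thesis using w(1) by blast
qed

text \<open>Comparing both bounds at one point of each interval, w - w' grows at most like every
  positive power of the norm. It is then stable by \<open>slow_growth_in_Gs\<close>, and zero
  because it lies in the complement.\<close>

lemma correction_unique:
  assumes w: "w \<in> Gamma_u" "w' \<in> Gamma_u"
    and g: "\<And>\<tau>. \<tau> > 0 \<Longrightarrow> \<exists>C. \<forall>n \<alpha>. \<forall>p\<in>cint T n \<alpha>. \<bar>Sb T n \<phi> \<alpha> p - (Bp T n *v w) $ \<alpha>\<bar> \<le> C * bnorm T n powr \<tau>"
      "\<And>\<tau>. \<tau> > 0 \<Longrightarrow> \<exists>C. \<forall>n \<alpha>. \<forall>p\<in>cint T n \<alpha>. \<bar>Sb T n \<phi> \<alpha> p - (Bp T n *v w') $ \<alpha>\<bar> \<le> C * bnorm T n powr \<tau>"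
  shows "w = w'"
proof -
  let ?d = "real CARD('a)"
  have wu: "w - w' \<in> Gamma_u" by (rule subspace_diff[OF supplementsD(1) w])
  then have im: "w - w' \<in> im (Omega (rv T 0))"
    using supplementsD(4) Gamma_bd_im[OF goodD(2)[OF T]] by auto
  have "\<exists>C. \<forall>n. norm (Bp (rv T 0) (n - 0) *v (w - w')) \<le> C * bnorm T n powr \<tau>" if t: "\<tau> > 0" for \<tau>
  proof -
    obtain C where C: "\<And>n \<alpha> p. p \<in> cint T n \<alpha> \<Longrightarrow> \<bar>Sb T n \<phi> \<alpha> p - (Bp T n *v w) $ \<alpha>\<bar> \<le> C * bnorm T n powr \<tau>"
      using g(1)[OF t] by blast
    obtain C' where C': "\<And>n \<alpha> p. p \<in> cint T n \<alpha> \<Longrightarrow> \<bar>Sb T n \<phi> \<alpha> p - (Bp T n *v w') $ \<alpha>\<bar> \<le> C' * bnorm T n powr \<tau>"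
      using g(2)[OF t] by blast
    have "norm (Bp T n *v (w - w')) \<le> (?d * (C + C')) * bnorm T n powr \<tau>" for n
    proof -
      have "infnorm (Bp T n *v (w - w')) \<le> (C + C') * bnorm T n powr \<tau>"
      proof (rule infnorm_leI)
        fix \<alpha>
        have "topl (rv T n) \<alpha> \<in> cint T n \<alpha>" using rv_len_pos[OF T, of n \<alpha>] by (simp add: cint_eq[OF T] less_imp_le)
        from C[OF this] C'[OF this] show "\<bar>(Bp T n *v (w - w')) $ \<alpha>\<bar> \<le> (C + C') * bnorm T n powr \<tau>"
          by (simp add: matrix_vector_mult_diff_distrib distrib_right)
      qed
      then have "?d * infnorm (Bp T n *v (w - w')) \<le> ?d * ((C + C') * bnorm T n powr \<tau>)" by (intro mult_left_mono) auto
      from order_trans[OF norm_le_card_infnorm this] show ?thesis by (simp add: mult.assoc)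
    qed
    then show ?thesis by auto
  qed
  then have "w - w' \<in> Gamma_s T" by (rule c.slow_growth_in_Gs[OF im])
  then have "w - w' = 0" using wu supplementsD(2) by blast
  then show ?thesis by simp
qed

end

subsection \<open>Transfer functions from decaying special Birkhoff sums\<close>

text \<open>
  A point lies in a tower over the interval of \<open>T(n)\<close>; \<open>base\<close> is the foot of its fibre and
  \<open>height_sum\<close> the Birkhoff sum from the foot to the point. Intervals are half-open here, closed on
  the left, so that every point has a fibre.
\<close>

primrec base :: "'a::finite iem \<Rightarrow> nat \<Rightarrow> real \<Rightarrow> real" where
  "base T 0 x = x"
| "base T (Suc n) x = (if base T n x < right_end (rv T (Suc n)) then base T n x
     else base T n x - shift (rv T n) (last_b (rv T n)))"

text \<open>When the foot at level n lies in the part cut off by the step, the new foot is its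
  preimage under T(n) in the interval of \<open>last_b\<close>, and the increment is the special
  Birkhoff sum that leads from there to the old foot.\<close>

definition height_inc :: "'a::finite iem \<Rightarrow> 'a pfun \<Rightarrow> nat \<Rightarrow> real \<Rightarrow> real" where
  "height_inc T f n x = (if base T n x < right_end (rv T (Suc n)) then 0
     else Sb T n f (last_b (rv T n)) (base T n x - shift (rv T n) (last_b (rv T n))))"

definition height_sum :: "'a::finite iem \<Rightarrow> 'a pfun \<Rightarrow> nat \<Rightarrow> real \<Rightarrow> real" where
  "height_sum T f n x = (\<Sum>m<n. height_inc T f m x)"

definition top_half :: "'a::finite iem \<Rightarrow> 'a \<Rightarrow> real set" where
  "top_half T \<alpha> = {topl T \<alpha> ..< topl T \<alpha> + len T \<alpha>}"

lemma top_half_unique: "is_iem T \<Longrightarrow> x \<in> top_half T \<alpha> \<Longrightarrow> x \<in> top_half T \<beta> \<Longrightarrow> \<alpha> = \<beta>"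
  using topl_unique[of T \<alpha> x \<beta>] by (auto simp: top_half_def)

lemma top_half_cover: "is_iem T \<Longrightarrow> x \<in> {left_end T ..< right_end T} \<Longrightarrow> \<exists>\<alpha>. x \<in> top_half T \<alpha>"
  using topl_cover[of T x] by (auto simp: top_half_def)

lemma top_half_shift: "is_iem T \<Longrightarrow> x \<in> top_half T \<alpha> \<Longrightarrow> x + shift T \<alpha> \<in> {left_end T ..< right_end T}"
  using iem_bounds[of T \<alpha>] by (auto simp: top_half_def shift_def)

lemma top_half_cint: "good T \<Longrightarrow> x \<in> top_half (rv T n) \<alpha> \<Longrightarrow> x \<in> cint T n \<alpha>"
  by (auto simp: top_half_def cint_eq)

lemma top_half_Suc:
  fixes T :: "'a::finite iem"
  assumes T: "good T" and x: "x \<in> top_half (rv T (Suc n)) \<alpha>"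
  shows "\<alpha> \<noteq> loser (rv T n) \<Longrightarrow> x \<in> top_half (rv T n) \<alpha>"
    and "\<alpha> = loser (rv T n) \<Longrightarrow> x \<in> top_half (rv T n) (last_b (rv T n))"
    and "\<alpha> = loser (rv T n) \<Longrightarrow> x + shift (rv T n) (last_b (rv T n)) \<in> top_half (rv T n) (last_t (rv T n))"
    and "\<alpha> = loser (rv T n) \<Longrightarrow> right_end (rv T (Suc n)) \<le> x + shift (rv T n) (last_b (rv T n))"
proof -
  let ?S = "rv T n"
  note g = goodD(1,2,4)[OF good_rv[OF T, of n]]
  have x': "topl (nxt ?S) \<alpha> \<le> x" "x < topl (nxt ?S) \<alpha> + len (nxt ?S) \<alpha>"
    using x unfolding top_half_def rv_Suc_nxt[OF T] by auto
  show "\<alpha> \<noteq> loser ?S \<Longrightarrow> x \<in> top_half ?S \<alpha>"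
    using x' step_len_le[OF g, of \<alpha>] by (auto simp: top_half_def step_topl[OF g])
  show "\<alpha> = loser ?S \<Longrightarrow> x \<in> top_half ?S (last_b ?S)"
    using x' len_loser_le_last[OF g] winner_neq_loser[OF g] by (auto simp: top_half_def step_topl[OF g] step_len[OF g])
  show "\<alpha> = loser ?S \<Longrightarrow> x + shift ?S (last_b ?S) \<in> top_half ?S (last_t ?S)"
    using x' len_loser_le_last[OF g] winner_neq_loser[OF g] last_endpoints[OF g(2)]
    by (auto simp: top_half_def step_topl[OF g] step_len[OF g] shift_def)
  show "\<alpha> = loser ?S \<Longrightarrow> right_end (rv T (Suc n)) \<le> x + shift ?S (last_b ?S)"
    using x' last_endpoints[OF g(2)] unfolding rv_Suc_nxt[OF T]
    by (auto simp: step_topl[OF g] step_right_end[OF g] shift_def)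
qed

text \<open>The part of I(n) cut off by the step is the first image of the new interval of the
  loser, so translating back with \<open>last_b\<close> lands in that interval.\<close>

lemma top_half_pull:
  fixes T :: "'a::finite iem"
  assumes T: "good T" and x: "right_end (rv T (Suc n)) \<le> x" "x < right_end (rv T n)"
  shows "x - shift (rv T n) (last_b (rv T n)) \<in> top_half (rv T (Suc n)) (loser (rv T n))"
proof -
  let ?S = "rv T n"
  note g = goodD(1,2,4)[OF good_rv[OF T, of n]]
  show ?thesis
    using x last_endpoints[OF g(2)] winner_neq_loser[OF g] unfolding rv_Suc_nxt[OF T]
    by (auto simp: top_half_def step_topl[OF g] step_right_end[OF g] step_len[OF g] shift_def)
qed

lemma base_range:
  assumes T: "good T" and x: "x \<in> {left_end T ..< right_end T}"
  shows "base T n x \<in> {left_end T ..< right_end (rv T n)}"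
proof (induction n)
  case 0 then show ?case using x by simp
next
  case (Suc n)
  show ?case
  proof (cases "base T n x < right_end (rv T (Suc n))")
    case False
    then have "base T n x - shift (rv T n) (last_b (rv T n)) \<in> top_half (rv T (Suc n)) (loser (rv T n))"
      using Suc by (intro top_half_pull[OF T]) auto
    then show ?thesis
      using False iem_bounds[OF rv_is_iem[OF T, of "Suc n"], of "loser (rv T n)"] rv_left_end[OF T, of "Suc n"]
      by (auto simp: top_half_def)
  qed (use Suc in auto)
qed

lemma height_inc_bound:
  assumes T: "good T" and x: "x \<in> {left_end T ..< right_end T}"
    and E: "\<And>\<alpha> y. y \<in> cint T n \<alpha> \<Longrightarrow> \<bar>Sb T n f \<alpha> y\<bar> \<le> E"
  shows "\<bar>height_inc T f n x\<bar> \<le> E"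
proof (cases "base T n x < right_end (rv T (Suc n))")
  case True
  have "topl (rv T n) \<alpha> \<in> cint T n \<alpha>" for \<alpha>
    using rv_len_pos[OF T, of n \<alpha>] by (simp add: cint_eq[OF T] less_imp_le)
  from order_trans[OF abs_ge_zero E[OF this]] show ?thesis using True by (simp add: height_inc_def)
next
  case False
  then have "base T n x - shift (rv T n) (last_b (rv T n)) \<in> top_half (rv T (Suc n)) (loser (rv T n))"
    using base_range[OF T x, of n] by (intro top_half_pull[OF T]) auto
  then have "base T n x - shift (rv T n) (last_b (rv T n)) \<in> cint T n (last_b (rv T n))"
    by (intro top_half_cint[OF T] top_half_Suc(2)[OF T]) auto
  from E[OF this] show ?thesis using False by (simp add: height_inc_def)
qed

text \<open>Moving one step up a tower adds \<open>f\<close>; from the top floor one lands in the interval of \<open>T(n)\<close>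
  and a special Birkhoff sum is lost.\<close>

lemma height_sum_shift:
  fixes T :: "'a::finite iem"
  assumes T: "good T" and x: "x \<in> top_half T \<alpha>"
  defines "y \<equiv> x + shift T \<alpha>"
  shows "base T n y = base T n x \<and> height_sum T f n y = height_sum T f n x + f \<alpha> x \<or>
    (\<exists>\<beta>. base T n x \<in> top_half (rv T n) \<beta> \<and> base T n y = base T n x + shift (rv T n) \<beta> \<and> y < right_end (rv T n) \<and>
      base T n y = y \<and> height_sum T f n y = height_sum T f n x + f \<alpha> x - Sb T n f \<beta> (base T n x))"
proof (induction n)
  case 0
  then show ?case using x top_half_shift[OF goodD(2)[OF T] x] by (auto simp: height_sum_def y_def)
next
  case (Suc n)
  let ?S = "rv T n" and ?S' = "rv T (Suc n)"
  let ?e = "right_end ?S'" and ?a = "last_b ?S" and ?t = "last_t ?S" and ?l = "loser ?S"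
  note g = goodD(1,2,4)[OF good_rv[OF T, of n]]
  have xI: "x \<in> {left_end T ..< right_end T}"
    using x iem_bounds[OF goodD(2)[OF T], of \<alpha>] by (auto simp: top_half_def)
  have hs: "height_sum T f (Suc n) z = height_sum T f n z + height_inc T f n z" for z by (simp add: height_sum_def)
  have sh: "shift ?S' \<gamma> = (if \<gamma> = ?l then shift ?S ?a + shift ?S ?t else shift ?S \<gamma>)" for \<gamma>
    unfolding rv_Suc_nxt[OF T] by (rule step_shift[OF g])
  from Suc show ?case
  proof (elim disjE exE conjE)
    assume "base T n y = base T n x" "height_sum T f n y = height_sum T f n x + f \<alpha> x"
    then show ?thesis by (simp add: hs height_inc_def)
  next
    fix \<beta> assume b: "base T n x \<in> top_half ?S \<beta>" "base T n y = base T n x + shift ?S \<beta>" "base T n y = y"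
      "height_sum T f n y = height_sum T f n x + f \<alpha> x - Sb T n f \<beta> (base T n x)"
    let ?b = "base T n x"
    show ?thesis
    proof (cases "?b < ?e")
      case True
      then have "?b \<in> {left_end ?S' ..< right_end ?S'}" using base_range[OF T xI, of n] rv_left_end[OF T, of "Suc n"] by simp
      then obtain \<gamma> where c: "?b \<in> top_half ?S' \<gamma>" using top_half_cover[OF rv_is_iem[OF T]] by blast
      show ?thesis
      \<comment> \<open>The foot is still in I(n+1). If its letter is not the loser, the point stays
        on a top floor; for the loser it only passes from the lower tower to the one stacked on it,
        the landing point being in the cut-off part.\<close>
      proof (cases "\<gamma> = ?l")
        case False
        have "\<gamma> = \<beta>" by (rule top_half_unique[OF g(2) top_half_Suc(1)[OF T c False] b(1)])
        then have "?b + shift ?S \<beta> < ?e" using top_half_shift[OF rv_is_iem[OF T] c] False by (simp add: sh)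
        then have "base T (Suc n) y = base T n y" "base T (Suc n) x = ?b" "height_sum T f (Suc n) y = height_sum T f n y"
            "height_sum T f (Suc n) x = height_sum T f n x" "y < ?e"
          using b True by (simp_all add: hs height_inc_def)
        then show ?thesis using b c False \<open>\<gamma> = \<beta>\<close> by (intro disjI2 exI[of _ \<gamma>]) (simp add: sh del: base.simps)
      next
        case True': True
        have "\<beta> = ?a" by (rule top_half_unique[OF g(2) b(1) top_half_Suc(2)[OF T c True']])
        then have ge: "\<not> ?b + shift ?S ?a < ?e" using top_half_Suc(4)[OF T c True'] by simp
        then have "base T (Suc n) y = ?b" "base T (Suc n) x = ?b"
            "height_sum T f (Suc n) y = height_sum T f n y + Sb T n f ?a ?b" "height_sum T f (Suc n) x = height_sum T f n x"
          using b(2) True \<open>\<beta> = ?a\<close> by (simp_all add: hs height_inc_def)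
        then show ?thesis using b(4) \<open>\<beta> = ?a\<close> by (intro disjI1) (simp del: base.simps)
      qed
    next
      case False
      \<comment> \<open>The foot is in the cut-off part, hence in the interval of
        \<open>last_t\<close>: the point is on the top floor of the upper tower over the loser, and
        its image lies in I(n+1).\<close>
      define z where "z = ?b - shift ?S ?a"
      have z: "z \<in> top_half ?S' ?l"
        unfolding z_def using False base_range[OF T xI, of n] by (intro top_half_pull[OF T]) auto
      have bz: "?b = z + shift ?S ?a" by (simp add: z_def)
      have "\<beta> = ?t" using top_half_Suc(3)[OF T z refl] b(1) unfolding bz by (intro top_half_unique[OF g(2)]) auto
      then have yz: "base T n y = z + shift ?S' ?l" using b(2) by (simp add: sh bz)
      then have lt: "base T n y < ?e" using top_half_shift[OF rv_is_iem[OF T] z] by simp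
      have "base T (Suc n) y = base T n y" "base T (Suc n) x = z" "height_sum T f (Suc n) y = height_sum T f n y"
          "height_sum T f (Suc n) x = height_sum T f n x + Sb T n f ?a z"
        using lt False by (simp_all add: hs height_inc_def z_def)
      moreover have "Sb T (Suc n) f ?l z = Sb T n f ?a z + Sb T n f ?t ?b" by (simp add: bz)
      ultimately show ?thesis using b z yz lt \<open>\<beta> = ?t\<close> by (intro disjI2 exI[of _ ?l]) (simp del: base.simps Sb.simps)
    qed
  qed
qed

text \<open>The towers have constant total area and, at the accelerated times, height at least 2^k,
  so their bases shrink.\<close>

lemma right_end_tendsto:
  fixes T :: "'a::finite iem"
  assumes T: "good T" and e: "e > 0"
  shows "\<exists>n. right_end (rv T n) < left_end T + e"
proof -
  let ?L = "sum (len T) UNIV"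
  obtain k :: nat where k: "?L / e < 2 ^ k" using real_arch_pow[of 2 "?L / e"] by auto
  let ?n = "accel T k"
  have "2 ^ k * sum (len (rv T ?n)) UNIV = (\<Sum>\<alpha>\<in>UNIV. 2 ^ k * len (rv T ?n) \<alpha>)" by (simp add: sum_distrib_left)
  also have "\<dots> \<le> (\<Sum>\<alpha>\<in>UNIV. rowsum (Bp T ?n) \<alpha> * len (rv T ?n) \<alpha>)"
    using rv_len_pos[OF T] by (intro sum_mono mult_right_mono rowsum_accel(2)[OF T]) (auto intro: less_imp_le)
  also have "\<dots> = ?L" by (rule rowsum_len[OF T])
  also have "\<dots> < 2 ^ k * e" using k e by (simp add: field_simps)
  finally have "sum (len (rv T ?n)) UNIV < e" by simp
  then show ?thesis using rv_left_end[OF T, of ?n] by (intro exI[of _ ?n]) (simp add: right_end_def)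
qed

text \<open>For the constant function 1, \<open>height_sum\<close> counts floors. With n so large
  that the whole orbit lies to the right of I(n), each step climbs exactly one floor, and a periodic
  orbit would return strictly higher.\<close>

lemma no_periodic_point:
  fixes T :: "'a::finite iem"
  assumes T: "good T" and p: "p > 0" "(iem_map T ^^ p) z = z" and dom: "\<And>l. l < p \<Longrightarrow> (iem_map T ^^ l) z \<in> iem_dom T"
  shows False
proof -
  note iT = goodD(2)[OF T]
  let ?z = "\<lambda>l. (iem_map T ^^ l) z"
  define m where "m = Min (?z ` {..<p})"
  have "m \<in> ?z ` {..<p}" unfolding m_def using p(1) by (intro Min_in) auto
  then have "m \<in> iem_dom T" using dom by auto
  then obtain \<alpha> where "m \<in> top_int T \<alpha>" by (auto simp: iem_dom_def)
  then have "m - left_end T > 0" using iem_bounds(1)[OF iT, of \<alpha>] by (simp add: top_int_eq[OF iT])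
  from right_end_tendsto[OF T this] obtain n where n: "right_end (rv T n) < m" by auto
  have ge: "m \<le> ?z l" if "l \<le> p" for l
  proof (cases "l = p")
    case True
    have "m \<le> ?z 0" unfolding m_def using p(1) by (intro Min_le) blast+
    then show ?thesis using p(2) True by simp
  next
    case False then show ?thesis unfolding m_def using that by (intro Min_le) auto
  qed
  let ?one = "\<lambda>_ _. 1 :: real"
  have "height_sum T ?one n (?z l) = height_sum T ?one n z + real l" if "l \<le> p" for l
    using that
  proof (induction l)
    case (Suc l)
    then obtain \<alpha> where a: "?z l \<in> top_int T \<alpha>" using dom[of l] by (auto simp: iem_dom_def)
    then have h: "?z l \<in> top_half T \<alpha>" by (auto simp: top_int_eq[OF iT] top_half_def)
    have e: "?z l + shift T \<alpha> = ?z (Suc l)" using iem_map_eq[OF iT a] by simp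
    have "\<not> ?z (Suc l) < right_end (rv T n)" using ge[OF Suc.prems] n by linarith
    then have "height_sum T ?one n (?z (Suc l)) = height_sum T ?one n (?z l) + 1"
      using height_sum_shift[OF T h, of n ?one] unfolding e by blast
    then show ?case using Suc by simp
  qed simp
  from this[of p] p show False by simp
qed

text \<open>Going one level deeper breaks the local form only where the foot meets the new cut
  point; with finitely many translations c this adds finitely many points. The ends of I are never
  bad, since nearby points of X lie on one side of them.\<close>

lemma base_local:
  fixes T :: "'a::finite iem"
  assumes T: "good T" and f: "\<And>\<alpha>. continuous_on (cint T 0 \<alpha>) (f \<alpha>)"
  defines "X \<equiv> {left_end T ..< right_end T}"
  shows "\<exists>C F. finite C \<and> finite F \<and> (\<forall>x\<in>{left_end T .. right_end T}. x \<in> F \<and> x \<in> {left_end T <..< right_end T} \<or>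
    (\<exists>\<eta>>0. \<exists>c\<in>C. \<forall>y\<in>X. \<bar>y - x\<bar> < \<eta> \<longrightarrow> base T n y = y - c) \<and>
    (\<forall>\<epsilon>>0. \<exists>\<eta>>0. \<forall>y\<in>X. \<forall>z\<in>X. \<bar>y - x\<bar> < \<eta> \<longrightarrow> \<bar>z - x\<bar> < \<eta> \<longrightarrow> \<bar>height_sum T f n y - height_sum T f n z\<bar> < \<epsilon>))"
proof (induction n)
  case 0
  show ?case by (rule exI[of _ "{0}"], rule exI[of _ "{}"]) (auto simp: height_sum_def intro: exI[of _ 1])
next
  case (Suc n)
  from Suc obtain C F where CF: "finite C" "finite F" and loc: "\<forall>x\<in>{left_end T .. right_end T}. x \<in> F \<and> x \<in> {left_end T <..< right_end T} \<or>
    (\<exists>\<eta>>0. \<exists>c\<in>C. \<forall>y\<in>X. \<bar>y - x\<bar> < \<eta> \<longrightarrow> base T n y = y - c) \<and>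
    (\<forall>\<epsilon>>0. \<exists>\<eta>>0. \<forall>y\<in>X. \<forall>z\<in>X. \<bar>y - x\<bar> < \<eta> \<longrightarrow> \<bar>z - x\<bar> < \<eta> \<longrightarrow> \<bar>height_sum T f n y - height_sum T f n z\<bar> < \<epsilon>)"
    by (elim exE conjE) (rule that)
  let ?e = "right_end (rv T (Suc n))" and ?a = "last_b (rv T n)"
  let ?k = "shift (rv T n) ?a" and ?g = "Sb T n f (last_b (rv T n))"
  define C' where "C' = C \<union> (\<lambda>c. c + ?k) ` C"
  define F' where "F' = F \<union> (\<lambda>c. c + ?e) ` C"
  have hs: "height_sum T f (Suc n) z = height_sum T f n z + height_inc T f n z" for z by (simp add: height_sum_def)
  have main: "x \<in> F' \<and> x \<in> {left_end T <..< right_end T} \<or>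
    (\<exists>\<eta>>0. \<exists>c\<in>C'. \<forall>y\<in>X. \<bar>y - x\<bar> < \<eta> \<longrightarrow> base T (Suc n) y = y - c) \<and>
    (\<forall>\<epsilon>>0. \<exists>\<eta>>0. \<forall>y\<in>X. \<forall>z\<in>X. \<bar>y - x\<bar> < \<eta> \<longrightarrow> \<bar>z - x\<bar> < \<eta> \<longrightarrow> \<bar>height_sum T f (Suc n) y - height_sum T f (Suc n) z\<bar> < \<epsilon>)"
    if x: "x \<in> {left_end T .. right_end T}" for x
  proof (cases "x \<in> F' \<and> x \<in> {left_end T <..< right_end T}")
    case False
    then have "\<not> (x \<in> F \<and> x \<in> {left_end T <..< right_end T})" by (auto simp: F'_def)
    then obtain \<eta> c where c: "\<eta> > 0" "c \<in> C" "\<And>y. y \<in> X \<Longrightarrow> \<bar>y - x\<bar> < \<eta> \<Longrightarrow> base T n y = y - c"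
      and osc: "\<And>\<epsilon>. \<epsilon> > 0 \<Longrightarrow> \<exists>\<eta>>0. \<forall>y\<in>X. \<forall>z\<in>X. \<bar>y - x\<bar> < \<eta> \<longrightarrow> \<bar>z - x\<bar> < \<eta> \<longrightarrow> \<bar>height_sum T f n y - height_sum T f n z\<bar> < \<epsilon>"
      using bspec[OF loc x] by blast
    have "\<exists>\<eta>'>0. \<eta>' \<le> \<eta> \<and> ((\<forall>y\<in>X. \<bar>y - x\<bar> < \<eta>' \<longrightarrow> y - c < ?e) \<or> (\<forall>y\<in>X. \<bar>y - x\<bar> < \<eta>' \<longrightarrow> \<not> y - c < ?e))"
    proof (cases "x = c + ?e")
      case True
      then have "x = left_end T \<or> x = right_end T" using False x c(2) by (auto simp: F'_def)
      then show ?thesis using True c(1) by (intro exI[of _ \<eta>]) (auto simp: X_def)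
    next
      case False
      then show ?thesis using c(1) by (intro exI[of _ "min \<eta> \<bar>x - c - ?e\<bar>"]) auto
    qed
    then obtain \<eta>' where h: "\<eta>' > 0" "\<eta>' \<le> \<eta>"
      "(\<forall>y\<in>X. \<bar>y - x\<bar> < \<eta>' \<longrightarrow> y - c < ?e) \<or> (\<forall>y\<in>X. \<bar>y - x\<bar> < \<eta>' \<longrightarrow> \<not> y - c < ?e)" by blast
    have bc: "base T n y = y - c" if "y \<in> X" "\<bar>y - x\<bar> < \<eta>'" for y using c(3) that h(2) by auto
    from h(3) show ?thesis
    proof
      assume lt: "\<forall>y\<in>X. \<bar>y - x\<bar> < \<eta>' \<longrightarrow> y - c < ?e"
      have 1: "base T (Suc n) y = y - c" "height_inc T f n y = 0" if "y \<in> X" "\<bar>y - x\<bar> < \<eta>'" for y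
        using lt bc[OF that] that by (auto simp: height_inc_def)
      have "\<exists>\<eta>>0. \<forall>y\<in>X. \<forall>z\<in>X. \<bar>y - x\<bar> < \<eta> \<longrightarrow> \<bar>z - x\<bar> < \<eta> \<longrightarrow> \<bar>height_sum T f (Suc n) y - height_sum T f (Suc n) z\<bar> < \<epsilon>"
        if ep: "\<epsilon> > 0" for \<epsilon>
      proof -
        obtain \<zeta> where z: "\<zeta> > 0" "\<And>y z. y \<in> X \<Longrightarrow> z \<in> X \<Longrightarrow> \<bar>y - x\<bar> < \<zeta> \<Longrightarrow> \<bar>z - x\<bar> < \<zeta> \<Longrightarrow> \<bar>height_sum T f n y - height_sum T f n z\<bar> < \<epsilon>"
          using osc[OF ep] by blast
        then show ?thesis using h(1) 1(2) by (intro exI[of _ "min \<zeta> \<eta>'"]) (auto simp: hs)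
      qed
      moreover have "c \<in> C'" using c(2) by (simp add: C'_def)
      ultimately show ?thesis using h(1) 1(1) by blast
    next
      assume ge: "\<forall>y\<in>X. \<bar>y - x\<bar> < \<eta>' \<longrightarrow> \<not> y - c < ?e"
      have 1: "base T (Suc n) y = y - (c + ?k)" "height_inc T f n y = ?g (y - (c + ?k))" "y - (c + ?k) \<in> cint T n ?a"
        if y: "y \<in> X" "\<bar>y - x\<bar> < \<eta>'" for y
      proof -
        have e: "base T n y - ?k = y - (c + ?k)" using bc[OF y] by simp
        have n: "\<not> base T n y < ?e" using ge bc[OF y] y by simp
        show "base T (Suc n) y = y - (c + ?k)" "height_inc T f n y = ?g (y - (c + ?k))" using n unfolding height_inc_def base.simps e by simp_all
        have "base T n y - ?k \<in> top_half (rv T (Suc n)) (loser (rv T n))"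
          using n base_range[OF T, of y n] y(1) by (intro top_half_pull[OF T]) (auto simp: X_def)
        then show "y - (c + ?k) \<in> cint T n ?a" unfolding e by (intro top_half_cint[OF T] top_half_Suc(2)[OF T]) auto
      qed
      have "compact (cint T n ?a)" by (simp add: cint_eq[OF T])
      then have uc: "uniformly_continuous_on (cint T n ?a) ?g" by (intro compact_uniformly_continuous Sb_continuous[OF T f])
      have "\<exists>\<eta>>0. \<forall>y\<in>X. \<forall>z\<in>X. \<bar>y - x\<bar> < \<eta> \<longrightarrow> \<bar>z - x\<bar> < \<eta> \<longrightarrow> \<bar>height_sum T f (Suc n) y - height_sum T f (Suc n) z\<bar> < \<epsilon>"
        if ep: "\<epsilon> > 0" for \<epsilon>
      proof -
        have ep2: "\<epsilon> / 2 > 0" using ep by simp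
        obtain \<zeta> where z: "\<zeta> > 0" "\<And>y z. y \<in> X \<Longrightarrow> z \<in> X \<Longrightarrow> \<bar>y - x\<bar> < \<zeta> \<Longrightarrow> \<bar>z - x\<bar> < \<zeta> \<Longrightarrow> \<bar>height_sum T f n y - height_sum T f n z\<bar> < \<epsilon> / 2"
          using osc[OF ep2] by blast
        obtain d where d: "d > 0" "\<And>u v. u \<in> cint T n ?a \<Longrightarrow> v \<in> cint T n ?a \<Longrightarrow> dist v u < d \<Longrightarrow> dist (?g v) (?g u) < \<epsilon> / 2"
          using uc ep2 unfolding uniformly_continuous_on_def by metis
        define \<kappa> where "\<kappa> = min (min \<zeta> \<eta>') (d / 2)"
        have "\<bar>height_sum T f (Suc n) y - height_sum T f (Suc n) w\<bar> < \<epsilon>"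
          if y: "y \<in> X" "\<bar>y - x\<bar> < \<kappa>" and w: "w \<in> X" "\<bar>w - x\<bar> < \<kappa>" for y w
        proof -
          have k: "\<kappa> \<le> \<zeta>" "\<kappa> \<le> \<eta>'" "\<kappa> \<le> d / 2" by (auto simp: \<kappa>_def)
          have y': "\<bar>y - x\<bar> < \<zeta>" "\<bar>y - x\<bar> < \<eta>'" "\<bar>w - x\<bar> < \<zeta>" "\<bar>w - x\<bar> < \<eta>'" "\<bar>y - w\<bar> < d"
            using y(2) w(2) k by linarith+
          have "dist (?g (y - (c + ?k))) (?g (w - (c + ?k))) < \<epsilon> / 2"
            using y'(5) by (intro d(2) 1(3) y w y') (simp add: dist_real_def)
          moreover have "\<bar>height_sum T f n y - height_sum T f n w\<bar> < \<epsilon> / 2" by (intro z(2) y w y')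
          ultimately show ?thesis
            using 1(2)[OF y(1) y'(2)] 1(2)[OF w(1) y'(4)] unfolding hs dist_real_def by linarith
        qed
        moreover have "\<kappa> > 0" using z(1) h(1) d(1) by (simp add: \<kappa>_def)
        ultimately show ?thesis by blast
      qed
      moreover have "c + ?k \<in> C'" using c(2) by (simp add: C'_def)
      ultimately show ?thesis using h(1) 1(1) by blast
    qed
  qed blast
  have fin: "finite C'" "finite F'" using CF by (auto simp: C'_def F'_def)
  show ?case by (intro exI[of _ C'] exI[of _ F'] conjI ballI fin) (rule main)
qed

text \<open>Dependent choice with a prescribed first term; the condition at k = 0 is carried in the
  invariant.\<close>

lemma dependent_nat_choice':
  assumes "\<exists>y. y = y0 \<and> Q y" "\<And>y (k :: nat). Q y \<Longrightarrow> \<exists>y'. Q y' \<and> R y' y"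
  shows "\<exists>y. y 0 = y0 \<and> (\<forall>k. Q (y k) \<and> R (y (Suc k)) (y k))"
proof -
  have "\<exists>y. \<forall>k. (Q (y k) \<and> (k = 0 \<longrightarrow> y k = y0)) \<and> R (y (Suc k)) (y k)"
    by (rule dependent_nat_choice) (use assms in auto)
  then show ?thesis by blast
qed

text \<open>An interior point has an infinite forward orbit or, if that runs into a singularity, an
  infinite backward orbit, since otherwise there would be a connection. Without periodic points such
  an orbit has infinitely many points, and an invariant property failing at one of them fails at
  all.\<close>

lemma infinite_orbit:
  fixes T :: "'a::finite iem"
  assumes T: "good T" and inv: "\<And>x. x \<in> iem_dom T \<Longrightarrow> P x \<longleftrightarrow> P (iem_map T x)"
    and fin: "finite {x \<in> {left_end T <..< right_end T}. \<not> P x}" and x: "x \<in> {left_end T <..< right_end T}"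
  shows "P x"
proof (rule ccontr)
  assume nP: "\<not> P x"
  note iT = goodD(2)[OF T]
  have w: "iem_map T y \<in> {left_end T <..< right_end T}" if "y \<in> iem_dom T" for y
    using iem_map_whole[OF iT that] by (simp add: whole_int_eq[OF iT])
  have dI: "y \<in> {left_end T <..< right_end T}" if d: "y \<in> iem_dom T" for y
  proof -
    obtain \<alpha> where "y \<in> top_int T \<alpha>" using d by (auto simp: iem_dom_def)
    then show ?thesis using iem_bounds[OF iT, of \<alpha>] by (auto simp: top_int_eq[OF iT])
  qed
  show False
  proof (cases "\<forall>m. (iem_map T ^^ m) x \<in> iem_dom T")
    case True
    have "\<not> P ((iem_map T ^^ m) x)" for m
    proof (induction m)
      case (Suc m)
      then show ?case using inv[of "(iem_map T ^^ m) x"] True by simp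
    qed (use nP in simp)
    then have "range (\<lambda>m. (iem_map T ^^ m) x) \<subseteq> {x \<in> {left_end T <..< right_end T}. \<not> P x}" using dI True by blast
    then have "finite (range (\<lambda>m. (iem_map T ^^ m) x))" using fin finite_subset by blast
    then have "\<not> inj (\<lambda>m. (iem_map T ^^ m) x)" using finite_imageD infinite_UNIV_nat by blast
    then obtain i j where ij: "i \<noteq> j" "(iem_map T ^^ i) x = (iem_map T ^^ j) x" by (auto simp: inj_def)
    have per: False if "i < j" "(iem_map T ^^ i) x = (iem_map T ^^ j) x" for i j
    proof (rule no_periodic_point[OF T])
      show "j - i > 0" using that by simp
      have "(iem_map T ^^ (j - i)) ((iem_map T ^^ i) x) = (iem_map T ^^ (j - i + i)) x" by (simp only: funpow_add comp_apply)
      then show "(iem_map T ^^ (j - i)) ((iem_map T ^^ i) x) = (iem_map T ^^ i) x" using that by simp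
      have "(iem_map T ^^ l) ((iem_map T ^^ i) x) = (iem_map T ^^ (l + i)) x" for l by (simp only: funpow_add comp_apply)
      then show "(iem_map T ^^ l) ((iem_map T ^^ i) x) \<in> iem_dom T" for l using True by metis
    qed
    from ij(1) show False
    proof (rule nat_neq_iff[THEN iffD1, THEN disjE])
      assume "i < j" then show False by (rule per) (rule ij(2))
    next
      assume "j < i" then show False by (rule per) (rule ij(2)[symmetric])
    qed
  next
    case False
    define m where "m = (LEAST m. (iem_map T ^^ m) x \<notin> iem_dom T)"
    have "\<exists>m. (iem_map T ^^ m) x \<notin> iem_dom T" using False by simp
    from LeastI_ex[OF this] have m: "(iem_map T ^^ m) x \<notin> iem_dom T" unfolding m_def .
    have lm: "(iem_map T ^^ l) x \<in> iem_dom T" if "l < m" for l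
      using not_less_Least[of l "\<lambda>m. (iem_map T ^^ m) x \<notin> iem_dom T"] that unfolding m_def[symmetric] by simp
    define y0 where "y0 = (iem_map T ^^ m) x"
    have "(iem_map T ^^ l) x \<in> {left_end T <..< right_end T} \<and> \<not> P ((iem_map T ^^ l) x)" if "l \<le> m" for l
      using that
    proof (induction l)
      case (Suc l) then show ?case using inv[OF lm[of l]] w[OF lm[of l]] by simp
    qed (use nP x in simp)
    then have y0: "y0 \<in> {left_end T <..< right_end T}" "\<not> P y0" unfolding y0_def by blast+
    obtain \<alpha> where a: "topl T \<alpha> \<le> y0" "y0 < topl T \<alpha> + len T \<alpha>" using topl_cover[OF iT, of y0] y0(1) by auto
    have "y0 \<notin> top_int T \<alpha>" using m by (auto simp: y0_def iem_dom_def)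
    \<comment> \<open>The first orbit point outside the domain is a left endpoint, and a singularity
      of T because it is interior to I.\<close>
    then have ya: "y0 = topl T \<alpha>" using a by (auto simp: top_int_eq[OF iT])
    have "\<exists>y. y 0 = y0 \<and> (\<forall>k. (connects T (y k) y0 \<and> y k \<in> {left_end T <..< right_end T} \<and> \<not> P (y k)) \<and>
        (y (Suc k) \<in> iem_dom T \<and> iem_map T (y (Suc k)) = y k))"
    proof (rule dependent_nat_choice')
      show "\<exists>y. y = y0 \<and> connects T y y0 \<and> y \<in> {left_end T <..< right_end T} \<and> \<not> P y" using y0 connects_refl by blast
      fix y :: real and k :: nat
      assume y: "connects T y y0 \<and> y \<in> {left_end T <..< right_end T} \<and> \<not> P y"
      obtain \<beta> where b: "botl T \<beta> \<le> y" "y < botl T \<beta> + len T \<beta>" using botl_cover[OF iT, of y] y by auto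
      \<comment> \<open>A singularity of the inverse on the backward orbit would be connected to the
        singularity y0.\<close>
      have "y \<noteq> botl T \<beta>"
      proof
        assume e: "y = botl T \<beta>"
        then have "connects T (botl T \<beta>) (topl T \<alpha>)" "botl T \<beta> \<noteq> left_end T" "topl T \<alpha> \<noteq> left_end T"
          using y y0 ya by auto
        then show False using goodD(3)[OF T] unfolding keane_def by blast
      qed
      then have t: "y - shift T \<beta> \<in> top_int T \<beta>" using b by (auto simp: top_int_eq[OF iT] shift_def)
      then have d: "y - shift T \<beta> \<in> iem_dom T" "iem_map T (y - shift T \<beta>) = y" using iem_map_eq[OF iT t] by (auto simp: iem_dom_def)
      then show "\<exists>y'. (connects T y' y0 \<and> y' \<in> {left_end T <..< right_end T} \<and> \<not> P y') \<and> y' \<in> iem_dom T \<and> iem_map T y' = y"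
        using y inv[OF d(1)] dI[OF d(1)] connects_step[OF d(1)] by (intro exI[of _ "y - shift T \<beta>"]) auto
    qed
    then obtain y where y: "y 0 = y0" "\<And>k. y k \<in> {left_end T <..< right_end T}" "\<And>k. \<not> P (y k)"
      "\<And>k. y (Suc k) \<in> iem_dom T" "\<And>k. iem_map T (y (Suc k)) = y k" by blast
    have it: "(iem_map T ^^ l) (y (l + k)) = y k" for l k
    proof (induction l)
      case (Suc l) then show ?case using y(5)[of "l + k"] by (simp add: funpow_swap1)
    qed simp
    have "range y \<subseteq> {x \<in> {left_end T <..< right_end T}. \<not> P x}" using y by blast
    then have "finite (range y)" using fin finite_subset by blast
    then have "\<not> inj y" using finite_imageD infinite_UNIV_nat by blast
    then obtain i j where ij: "i \<noteq> j" "y i = y j" by (auto simp: inj_def)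
    have per: False if "i < j" "y i = y j" for i j
    proof (rule no_periodic_point[OF T])
      show "j - i > 0" using that by simp
      show "(iem_map T ^^ (j - i)) (y j) = y j" using it[of "j - i" i] that by simp
      fix l assume "l < j - i"
      then have "l + (j - l) = j" "j - l = Suc (j - l - 1)" by auto
      then show "(iem_map T ^^ l) (y j) \<in> iem_dom T" using it[of l "j - l"] y(4)[of "j - l - 1"] by metis
    qed
    from ij(1) show False
    proof (rule nat_neq_iff[THEN iffD1, THEN disjE])
      assume "i < j" then show False by (rule per) (rule ij(2))
    next
      assume "j < i" then show False by (rule per) (rule ij(2)[symmetric])
    qed
  qed
qed

lemma cohomological_solution:
  fixes T :: "'a::finite iem"
  assumes T: "good T" and f: "\<And>\<alpha>. continuous_on (cint T 0 \<alpha>) (f \<alpha>)"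
    and sE: "summable E" and E: "\<And>n \<alpha> y. y \<in> cint T n \<alpha> \<Longrightarrow> \<bar>Sb T n f \<alpha> y\<bar> \<le> E n"
  shows "\<exists>\<psi>. continuous_on {left_end T .. right_end T} \<psi> \<and>
    (\<forall>\<alpha>. \<forall>x\<in>top_int T \<alpha>. f \<alpha> x = \<psi> (iem_map T x) - \<psi> x)"
proof -
  note iT = goodD(2)[OF T]
  define X where "X = {left_end T ..< right_end T}"
  define P where "P x = (\<Sum>m. height_inc T f m x)" for x
  have lr: "left_end T < right_end T"
    using is_iemD(1)[OF iT] by (auto simp: right_end_def intro!: sum_pos)
  have "uniform_limit X (\<lambda>n x. \<Sum>m<n. height_inc T f m x) (\<lambda>x. \<Sum>m. height_inc T f m x) sequentially"
  proof (rule Weierstrass_m_test[OF _ sE])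
    fix n x assume "x \<in> X"
    then show "norm (height_inc T f n x) \<le> E n" using height_inc_bound[OF T _ E] by (simp add: X_def)
  qed
  then have ul: "uniform_limit X (height_sum T f) P sequentially"
    by (simp add: P_def[abs_def] height_sum_def[abs_def])
  have lim: "(\<lambda>n. height_sum T f n x) \<longlonglongrightarrow> P x" if "x \<in> X" for x
    by (rule tendsto_uniform_limitI[OF ul that])
  have En: "E n \<ge> 0" for n
  proof -
    have "topl (rv T n) \<alpha> \<in> cint T n \<alpha>" for \<alpha>
      using rv_len_pos[OF T, of n \<alpha>] by (simp add: cint_eq[OF T] less_imp_le)
    from order_trans[OF abs_ge_zero E[OF this]] show ?thesis .
  qed
  have E0: "E \<longlonglongrightarrow> 0" by (rule summable_LIMSEQ_zero[OF sE])
  have topX: "x \<in> X" if "x \<in> top_half T \<alpha>" for x \<alpha>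
    using that iem_bounds[OF iT, of \<alpha>] by (auto simp: top_half_def X_def)
  \<comment> \<open>The finite sums satisfy the equation exactly, or up to one special Birkhoff sum
    at the foot when the point is on a top floor; that error is at most E n.\<close>
  have eq: "P (x + shift T \<alpha>) = P x + f \<alpha> x" if x: "x \<in> top_half T \<alpha>" for x \<alpha>
  proof -
    let ?y = "x + shift T \<alpha>"
    have yX: "?y \<in> X" using top_half_shift[OF iT x] by (simp add: X_def)
    have "\<bar>height_sum T f n ?y - height_sum T f n x - f \<alpha> x\<bar> \<le> E n" for n
      using height_sum_shift[OF T x, of n f]
    proof (elim disjE exE conjE)
      fix \<beta> assume b: "base T n x \<in> top_half (rv T n) \<beta>"
        and h: "height_sum T f n ?y = height_sum T f n x + f \<alpha> x - Sb T n f \<beta> (base T n x)"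
      show ?thesis using E[OF top_half_cint[OF T b]] unfolding h by simp
    qed (use En in simp)
    then have "(\<lambda>n. height_sum T f n ?y - height_sum T f n x - f \<alpha> x) \<longlonglongrightarrow> 0"
      by (intro Lim_null_comparison[OF _ E0]) auto
    moreover have "(\<lambda>n. height_sum T f n ?y - height_sum T f n x - f \<alpha> x) \<longlonglongrightarrow> P ?y - P x - f \<alpha> x"
      by (intro tendsto_intros lim yX topX[OF x])
    ultimately have "P ?y - P x - f \<alpha> x = 0" by (rule LIMSEQ_unique[symmetric])
    then show ?thesis by simp
  qed
  \<comment> \<open>The centre may be any point of the closed interval while the test points come
    from X, so the right end, which is not in X, is covered as well.\<close>
  define osc where "osc \<epsilon> x \<longleftrightarrow> (\<exists>\<eta>>0. \<forall>y\<in>X. \<forall>z\<in>X. \<bar>y - x\<bar> < \<eta> \<longrightarrow> \<bar>z - x\<bar> < \<eta> \<longrightarrow> \<bar>P y - P z\<bar> \<le> \<epsilon>)" for \<epsilon> x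
  have oscD: "\<exists>\<eta>>0. \<forall>y\<in>X. \<forall>z\<in>X. \<bar>y - x\<bar> < \<eta> \<longrightarrow> \<bar>z - x\<bar> < \<eta> \<longrightarrow> \<bar>P y - P z\<bar> \<le> \<epsilon>" if "osc \<epsilon> x" for \<epsilon> x
    using that unfolding osc_def .
  have oscI: "osc \<epsilon> x" if "\<eta> > 0" "\<And>y z. y \<in> X \<Longrightarrow> z \<in> X \<Longrightarrow> \<bar>y - x\<bar> < \<eta> \<Longrightarrow> \<bar>z - x\<bar> < \<eta> \<Longrightarrow> \<bar>P y - P z\<bar> \<le> \<epsilon>" for \<epsilon> x \<eta>
    unfolding osc_def using that by blast
  have osc_mono: "osc \<epsilon>' x" if "osc \<epsilon> x" "\<epsilon> \<le> \<epsilon>'" for \<epsilon> \<epsilon>' x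
    using that unfolding osc_def by (meson order_trans)
  \<comment> \<open>A uniformly close finite sum has small oscillation off a finite set by
    \<open>base_local\<close>; approximating at both test points accounts for the three parts
    \<epsilon> / 3.\<close>
  have most: "\<exists>F. finite F \<and> (\<forall>x\<in>{left_end T .. right_end T}. x \<in> F \<and> x \<in> {left_end T <..< right_end T} \<or> osc \<epsilon> x)"
    if ep: "\<epsilon> > 0" for \<epsilon>
  proof -
    have "\<forall>\<^sub>F n in sequentially. \<forall>x\<in>X. dist (height_sum T f n x) (P x) < \<epsilon> / 3"
      using ul ep unfolding uniform_limit_iff by (meson divide_pos_pos zero_less_numeral)
    then obtain n where n: "\<And>x. x \<in> X \<Longrightarrow> \<bar>height_sum T f n x - P x\<bar> < \<epsilon> / 3"
      by (auto simp: eventually_sequentially dist_real_def)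
    have "\<exists>C F. finite C \<and> finite F \<and> (\<forall>x\<in>{left_end T .. right_end T}. x \<in> F \<and> x \<in> {left_end T <..< right_end T} \<or>
      (\<exists>\<eta>>0. \<exists>c\<in>C. \<forall>y\<in>X. \<bar>y - x\<bar> < \<eta> \<longrightarrow> base T n y = y - c) \<and>
      (\<forall>\<epsilon>>0. \<exists>\<eta>>0. \<forall>y\<in>X. \<forall>z\<in>X. \<bar>y - x\<bar> < \<eta> \<longrightarrow> \<bar>z - x\<bar> < \<eta> \<longrightarrow> \<bar>height_sum T f n y - height_sum T f n z\<bar> < \<epsilon>))"
      unfolding X_def by (rule base_local[OF T f])
    then obtain C F where F: "finite F" "\<forall>x\<in>{left_end T .. right_end T}. x \<in> F \<and> x \<in> {left_end T <..< right_end T} \<or>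
      (\<exists>\<eta>>0. \<exists>c\<in>C. \<forall>y\<in>X. \<bar>y - x\<bar> < \<eta> \<longrightarrow> base T n y = y - c) \<and>
      (\<forall>\<epsilon>>0. \<exists>\<eta>>0. \<forall>y\<in>X. \<forall>z\<in>X. \<bar>y - x\<bar> < \<eta> \<longrightarrow> \<bar>z - x\<bar> < \<eta> \<longrightarrow> \<bar>height_sum T f n y - height_sum T f n z\<bar> < \<epsilon>)"
      by (elim exE conjE) (rule that)
    have "osc \<epsilon> x" if x: "x \<in> {left_end T .. right_end T}" "\<not> (x \<in> F \<and> x \<in> {left_end T <..< right_end T})" for x
    proof -
      have e3: "\<epsilon> / 3 > 0" using ep by simp
      have "\<forall>\<epsilon>>0. \<exists>\<eta>>0. \<forall>y\<in>X. \<forall>z\<in>X. \<bar>y - x\<bar> < \<eta> \<longrightarrow> \<bar>z - x\<bar> < \<eta> \<longrightarrow> \<bar>height_sum T f n y - height_sum T f n z\<bar> < \<epsilon>"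
        using bspec[OF F(2) x(1)] by (elim disjE) (erule notE[OF x(2)], erule conjunct2)
      from this[rule_format, OF e3] obtain \<eta> where e: "\<eta> > 0"
        "\<forall>y\<in>X. \<forall>z\<in>X. \<bar>y - x\<bar> < \<eta> \<longrightarrow> \<bar>z - x\<bar> < \<eta> \<longrightarrow> \<bar>height_sum T f n y - height_sum T f n z\<bar> < \<epsilon> / 3"
        by (elim exE conjE) (rule that)
      show ?thesis
      proof (rule oscI[OF e(1)])
        fix y z assume yz: "y \<in> X" "z \<in> X" "\<bar>y - x\<bar> < \<eta>" "\<bar>z - x\<bar> < \<eta>"
        show "\<bar>P y - P z\<bar> \<le> \<epsilon>" using e(2)[rule_format, OF yz] n[OF yz(1)] n[OF yz(2)] by linarith
      qed
    qed
    then show ?thesis using F(1) by (intro exI[of _ F] conjI ballI) blast+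
  qed
  have near: "\<exists>\<eta>>0. \<forall>y. \<bar>y - x\<bar> < \<eta> \<longrightarrow> y \<in> top_half T \<alpha> \<and> \<bar>f \<alpha> y - f \<alpha> x\<bar> < \<epsilon>"
    if x: "x \<in> top_int T \<alpha>" and ep: "\<epsilon> > 0" for x \<alpha> \<epsilon>
  proof -
    have o: "open (top_int T \<alpha>)" by (simp add: top_int_eq[OF iT])
    have "continuous_on (top_int T \<alpha>) (f \<alpha>)"
      by (rule continuous_on_subset[OF f]) (auto simp: top_cint_eq[OF iT] top_int_eq[OF iT])
    then have "isCont (f \<alpha>) x" using o x by (simp add: continuous_on_eq_continuous_at)
    then obtain d where d: "d > 0" "\<And>y. \<bar>y - x\<bar> < d \<Longrightarrow> \<bar>f \<alpha> y - f \<alpha> x\<bar> < \<epsilon>"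
      using ep unfolding continuous_at_eps_delta dist_real_def by blast
    obtain e where e: "e > 0" "ball x e \<subseteq> top_int T \<alpha>" using o x by (meson openE)
    have "y \<in> top_half T \<alpha>" if "\<bar>y - x\<bar> < e" for y
    proof -
      have "y \<in> ball x e" using that by (simp add: dist_real_def abs_minus_commute)
      then show ?thesis using e(2) by (auto simp: top_int_eq[OF iT] top_half_def)
    qed
    then show ?thesis using d e(1) by (intro exI[of _ "min d e"]) auto
  qed
  have fwd: "osc \<epsilon>' (iem_map T x)" if x: "x \<in> top_int T \<alpha>" and o: "osc \<epsilon> x" and lt: "\<epsilon> < \<epsilon>'" for x \<alpha> \<epsilon> \<epsilon>'
  proof -
    have "(\<epsilon>' - \<epsilon>) / 2 > 0" using lt by simp
    from near[OF x this] obtain d where d: "d > 0"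
      "\<And>y. \<bar>y - x\<bar> < d \<Longrightarrow> y \<in> top_half T \<alpha> \<and> \<bar>f \<alpha> y - f \<alpha> x\<bar> < (\<epsilon>' - \<epsilon>) / 2" by blast
    obtain \<eta> where e: "\<eta> > 0" "\<And>y z. y \<in> X \<Longrightarrow> z \<in> X \<Longrightarrow> \<bar>y - x\<bar> < \<eta> \<Longrightarrow> \<bar>z - x\<bar> < \<eta> \<Longrightarrow> \<bar>P y - P z\<bar> \<le> \<epsilon>"
      using oscD[OF o] by blast
    have Tx: "iem_map T x = x + shift T \<alpha>" by (rule iem_map_eq[OF iT x])
    show ?thesis
    proof (rule oscI[of "min d \<eta>"])
      fix y z assume h: "\<bar>y - iem_map T x\<bar> < min d \<eta>" "\<bar>z - iem_map T x\<bar> < min d \<eta>"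
      let ?y = "y - shift T \<alpha>" and ?z = "z - shift T \<alpha>"
      have n: "\<bar>?y - x\<bar> < d" "\<bar>?y - x\<bar> < \<eta>" "\<bar>?z - x\<bar> < d" "\<bar>?z - x\<bar> < \<eta>" using h unfolding Tx by auto
      have "P y = P ?y + f \<alpha> ?y" "P z = P ?z + f \<alpha> ?z" using eq[of ?y \<alpha>] eq[of ?z \<alpha>] d(2) n by auto
      moreover have "\<bar>P ?y - P ?z\<bar> \<le> \<epsilon>" using d(2) n topX by (intro e(2)) blast+
      moreover have "\<bar>f \<alpha> ?y - f \<alpha> x\<bar> < (\<epsilon>' - \<epsilon>) / 2" "\<bar>f \<alpha> ?z - f \<alpha> x\<bar> < (\<epsilon>' - \<epsilon>) / 2" using d(2) n by blast+
      ultimately show "\<bar>P y - P z\<bar> \<le> \<epsilon>'" by argo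
    qed (use d(1) e(1) in simp)
  qed
  have bwd: "osc \<epsilon>' x" if x: "x \<in> top_int T \<alpha>" and o: "osc \<epsilon> (iem_map T x)" and lt: "\<epsilon> < \<epsilon>'" for x \<alpha> \<epsilon> \<epsilon>'
  proof -
    have "(\<epsilon>' - \<epsilon>) / 2 > 0" using lt by simp
    from near[OF x this] obtain d where d: "d > 0"
      "\<And>y. \<bar>y - x\<bar> < d \<Longrightarrow> y \<in> top_half T \<alpha> \<and> \<bar>f \<alpha> y - f \<alpha> x\<bar> < (\<epsilon>' - \<epsilon>) / 2" by blast
    have Tx: "iem_map T x = x + shift T \<alpha>" by (rule iem_map_eq[OF iT x])
    obtain \<eta> where e: "\<eta> > 0" "\<And>y z. y \<in> X \<Longrightarrow> z \<in> X \<Longrightarrow> \<bar>y - (x + shift T \<alpha>)\<bar> < \<eta> \<Longrightarrow> \<bar>z - (x + shift T \<alpha>)\<bar> < \<eta> \<Longrightarrow> \<bar>P y - P z\<bar> \<le> \<epsilon>"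
      using oscD[OF o] unfolding Tx by blast
    show ?thesis
    proof (rule oscI[of "min d \<eta>"])
      fix y z assume h: "\<bar>y - x\<bar> < min d \<eta>" "\<bar>z - x\<bar> < min d \<eta>"
      let ?y = "y + shift T \<alpha>" and ?z = "z + shift T \<alpha>"
      have yz: "y \<in> top_half T \<alpha>" "z \<in> top_half T \<alpha>" using d(2) h by auto
      have "P ?y = P y + f \<alpha> y" "P ?z = P z + f \<alpha> z" using eq yz by auto
      moreover have "\<bar>P ?y - P ?z\<bar> \<le> \<epsilon>"
        using h top_half_shift[OF iT yz(1)] top_half_shift[OF iT yz(2)] by (intro e(2)) (auto simp: X_def)
      moreover have "\<bar>f \<alpha> y - f \<alpha> x\<bar> < (\<epsilon>' - \<epsilon>) / 2" "\<bar>f \<alpha> z - f \<alpha> x\<bar> < (\<epsilon>' - \<epsilon>) / 2" using d(2) h by auto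
      ultimately show "\<bar>P y - P z\<bar> \<le> \<epsilon>'" by argo
    qed (use d(1) e(1) in simp)
  qed
  have all_osc: "osc \<epsilon> x" if x: "x \<in> {left_end T .. right_end T}" and ep: "\<epsilon> > 0" for x \<epsilon>
  proof (cases "x \<in> {left_end T <..< right_end T}")
    case False
    then show ?thesis using most[OF ep] x by blast
  next
    case True
    have e2: "\<epsilon> / 2 > 0" using ep by simp
    obtain F where F: "finite F" "\<And>x. x \<in> {left_end T .. right_end T} \<Longrightarrow> x \<in> F \<or> osc (\<epsilon> / 2) x" using most[OF e2] by blast
    \<comment> \<open>Transport by T in either direction worsens the oscillation by an arbitrarily
      small amount, due to continuity of f. Asking for every bound above \<epsilon> / 2 makes the
      property exactly invariant.\<close>
    define Q where "Q x \<longleftrightarrow> (\<forall>\<epsilon>'>\<epsilon> / 2. osc \<epsilon>' x)" for x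
    have "Q x"
    proof (rule infinite_orbit[OF T _ _ True])
      fix y assume "y \<in> iem_dom T"
      then obtain \<alpha> where a: "y \<in> top_int T \<alpha>" by (auto simp: iem_dom_def)
      have mid: "\<exists>\<epsilon>1. \<epsilon> / 2 < \<epsilon>1 \<and> \<epsilon>1 < \<epsilon>'" if "\<epsilon>' > \<epsilon> / 2" for \<epsilon>' using that by (rule dense)
      show "Q y \<longleftrightarrow> Q (iem_map T y)"
      proof
        assume q: "Q y"
        show "Q (iem_map T y)" unfolding Q_def
        proof (intro allI impI)
          fix \<epsilon>' assume "\<epsilon> / 2 < \<epsilon>'"
          then obtain \<epsilon>1 where "\<epsilon> / 2 < \<epsilon>1" "\<epsilon>1 < \<epsilon>'" using mid by blast
          then show "osc \<epsilon>' (iem_map T y)" using q fwd[OF a] unfolding Q_def by blast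
        qed
      next
        assume q: "Q (iem_map T y)"
        show "Q y" unfolding Q_def
        proof (intro allI impI)
          fix \<epsilon>' assume "\<epsilon> / 2 < \<epsilon>'"
          then obtain \<epsilon>1 where "\<epsilon> / 2 < \<epsilon>1" "\<epsilon>1 < \<epsilon>'" using mid by blast
          then show "osc \<epsilon>' y" using q bwd[OF a] unfolding Q_def by blast
        qed
      qed
    next
      have "{x \<in> {left_end T<..<right_end T}. \<not> Q x} \<subseteq> F"
      proof
        fix y assume y: "y \<in> {x \<in> {left_end T<..<right_end T}. \<not> Q x}"
        then have "\<not> osc (\<epsilon> / 2) y" using osc_mono unfolding Q_def by (auto intro: less_imp_le)
        moreover have "y \<in> {left_end T .. right_end T}" using y by auto
        ultimately show "y \<in> F" using F(2) by blast
      qed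
      then show "finite {x \<in> {left_end T<..<right_end T}. \<not> Q x}" using F(1) finite_subset by blast
    qed
    moreover have "\<epsilon> / 2 < \<epsilon>" using ep by simp
    ultimately show ?thesis unfolding Q_def by blast
  qed
  \<comment> \<open>Small oscillation at all points of the compact interval and a Lebesgue number
    give uniform continuity, which is what extends P to the right end.\<close>
  have "uniformly_continuous_on X P"
    unfolding uniformly_continuous_on_def
  proof (intro allI impI)
    fix \<epsilon> :: real assume ep: "\<epsilon> > 0"
    then have e2: "\<epsilon> / 2 > 0" by simp
    have "\<forall>x. \<exists>\<eta>. x \<in> {left_end T .. right_end T} \<longrightarrow> \<eta> > 0 \<and> (\<forall>y\<in>X. \<forall>z\<in>X. \<bar>y - x\<bar> < \<eta> \<longrightarrow> \<bar>z - x\<bar> < \<eta> \<longrightarrow> \<bar>P y - P z\<bar> \<le> \<epsilon> / 2)"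
      using oscD[OF all_osc[OF _ e2]] by blast
    from choice[OF this] obtain \<eta> where \<eta>: "\<forall>x. x \<in> {left_end T .. right_end T} \<longrightarrow> \<eta> x > 0 \<and>
      (\<forall>y\<in>X. \<forall>z\<in>X. \<bar>y - x\<bar> < \<eta> x \<longrightarrow> \<bar>z - x\<bar> < \<eta> x \<longrightarrow> \<bar>P y - P z\<bar> \<le> \<epsilon> / 2)" ..
    let ?G = "(\<lambda>x. ball x (\<eta> x)) ` {left_end T .. right_end T}"
    have sub: "{left_end T .. right_end T} \<subseteq> \<Union> ?G" using \<eta> by fastforce
    have op: "\<And>G. G \<in> ?G \<Longrightarrow> open G" by auto
    obtain d where d: "d > 0" "\<And>x. x \<in> {left_end T .. right_end T} \<Longrightarrow> \<exists>G\<in>?G. ball x d \<subseteq> G"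
      by (rule Heine_Borel_lemma[OF compact_Icc sub op]) (assumption, rule that)
    show "\<exists>d>0. \<forall>x\<in>X. \<forall>x'\<in>X. dist x' x < d \<longrightarrow> dist (P x') (P x) < \<epsilon>"
    proof (intro exI[of _ d] conjI ballI impI d(1))
      fix y z assume yz: "y \<in> X" "z \<in> X" "dist z y < d"
      have "y \<in> {left_end T .. right_end T}" using yz(1) by (auto simp: X_def)
      then obtain x where x: "x \<in> {left_end T .. right_end T}" "ball y d \<subseteq> ball x (\<eta> x)" using d(2) by blast
      have "y \<in> ball y d" "z \<in> ball y d" using d(1) yz(3) by (auto simp: dist_commute)
      then have "y \<in> ball x (\<eta> x)" "z \<in> ball x (\<eta> x)" using x(2) by blast+
      then have "\<bar>y - x\<bar> < \<eta> x" "\<bar>z - x\<bar> < \<eta> x" by (auto simp: dist_real_def abs_minus_commute)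
      then have "\<bar>P z - P y\<bar> \<le> \<epsilon> / 2" using \<eta> x(1) yz(1,2) by blast
      then show "dist (P z) (P y) < \<epsilon>" using ep by (simp add: dist_real_def)
    qed
  qed
  then obtain \<psi> where psi: "uniformly_continuous_on (closure X) \<psi>" "\<And>x. x \<in> X \<Longrightarrow> P x = \<psi> x"
    by (rule uniformly_continuous_on_extension_on_closure) blast
  have "closure X = {left_end T .. right_end T}" using lr by (simp add: X_def)
  then have "continuous_on {left_end T .. right_end T} \<psi>" using uniformly_continuous_imp_continuous[OF psi(1)] by simp
  moreover have "f \<alpha> x = \<psi> (iem_map T x) - \<psi> x" if x: "x \<in> top_int T \<alpha>" for \<alpha> x
  proof -
    have h: "x \<in> top_half T \<alpha>" using x by (auto simp: top_int_eq[OF iT] top_half_def)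
    have "x + shift T \<alpha> \<in> X" using top_half_shift[OF iT h] by (simp add: X_def)
    then show ?thesis using eq[OF h] psi(2) topX[OF h] iem_map_eq[OF iT x] by simp
  qed
  ultimately show ?thesis by blast
qed

subsection \<open>Decay of oscillations under the spectral gap\<close>

lemma Sb_comp: "Sb T (m + k) \<phi> = Sb (rv T m) k (Sb T m \<phi>)"
  by (induction k) (simp_all add: rv_add cong: if_cong)

lemma len_transpose:
  fixes T :: "'a::finite iem"
  assumes T: "good T"
  shows "transpose (Bp T n) *v (\<chi> \<alpha>. len (rv T n) \<alpha>) = (\<chi> \<alpha>. len T \<alpha>)"
proof (induction n)
  case 0 then show ?case by (simp add: rv_0)
next
  case (Suc n)
  let ?S = "rv T n"
  note g = goodD[OF good_rv[OF T, of n]]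
  have e: "($) (\<chi> \<alpha>. f \<alpha>) = f" for f :: "'a \<Rightarrow> real" by (rule ext) simp
  have "transpose (step_mat ?S) *v (\<chi> \<alpha>. len (rv T (Suc n)) \<alpha>) = (\<chi> \<alpha>. len ?S \<alpha>)"
    unfolding vec_eq_iff step_mat_transpose_mult e rv_Suc_nxt[OF T] nxt_len[OF g(1,2,4), symmetric] by simp
  then show ?case using Suc
    by (simp add: matrix_transpose_mul matrix_vector_mul_assoc[symmetric])
qed

text \<open>Conservation of the integral under special Birkhoff sums: the transposed matrix carries
  the lengths of T(n) back to those of T.\<close>

lemma sum_Bp_len:
  fixes T :: "'a::finite iem"
  assumes T: "good T"
  shows "(\<Sum>\<alpha>\<in>UNIV. (Bp T n *v c) $ \<alpha> * len (rv T n) \<alpha>) = (\<Sum>\<alpha>\<in>UNIV. c $ \<alpha> * len T \<alpha>)"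
proof -
  have "(\<chi> \<alpha>. len (rv T n) \<alpha>) \<bullet> (Bp T n *v c) = (\<chi> \<alpha>. len T \<alpha>) \<bullet> c"
    unfolding dot_lmul_matrix[symmetric] transpose_matrix_vector[symmetric] len_transpose[OF T] ..
  then show ?thesis by (simp add: inner_vec_def mult.commute)
qed

lemma Gamma_0_iff:
  assumes "is_iem T"
  shows "c \<in> Gamma_0 T \<longleftrightarrow> (\<Sum>\<alpha>\<in>UNIV. c $ \<alpha> * len T \<alpha>) = 0"
  using is_iemD(1)[OF assms]
  by (simp add: Gamma_0_def pintegral_def gamma_fun_def top_cint_eq[OF assms] less_imp_le mult.commute)

lemma spectral_gap_bound:
  fixes T :: "'a::finite iem"
  assumes T: "good T" and gap: "spectral_gap T"
  shows "\<exists>\<theta>>0. \<exists>G\<ge>0. \<forall>c n. (\<Sum>\<alpha>\<in>UNIV. c $ \<alpha> * len T \<alpha>) = 0 \<longrightarrow>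
    infnorm (Bp T n *v c) \<le> G * bnorm T n powr (1 - \<theta>) * infnorm c"
proof -
  have e: "Bmat T 0 n = Bp T n" "mat_norm (Bp T n) = bnorm T n" for n
    using Bmat_eq[OF T, of 0 n] by (simp_all add: bnorm_def rv_0)
  obtain \<theta> where th: "\<theta> > 0" "(\<lambda>n. op_norm_on (Gamma_0 T) (Bp T n)) \<in> O(\<lambda>n. bnorm T n powr (1 - \<theta>))"
    using gap unfolding spectral_gap_def e by blast
  have "bnorm T n powr (1 - \<theta>) > 0" for n using bnorm_pos[of T n] by simp
  from bigo_sequence_bound[OF th(2) this] obtain G where G: "G > 0"
    "\<And>n. \<bar>op_norm_on (Gamma_0 T) (Bp T n)\<bar> \<le> G * bnorm T n powr (1 - \<theta>)" by blast
  have sub: "subspace (Gamma_0 T)"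
    by (rule subspaceI)
      (auto simp: Gamma_0_iff[OF goodD(2)[OF T]] distrib_right sum.distrib mult.assoc sum_distrib_left[symmetric])
  have "infnorm (Bp T n *v c) \<le> G * bnorm T n powr (1 - \<theta>) * infnorm c" if "(\<Sum>\<alpha>\<in>UNIV. c $ \<alpha> * len T \<alpha>) = 0" for c n
  proof -
    have "c \<in> Gamma_0 T" using that by (simp add: Gamma_0_iff[OF goodD(2)[OF T]])
    from op_norm_bound[OF sub this, of "Bp T n"]
    have "infnorm (Bp T n *v c) \<le> op_norm_on (Gamma_0 T) (Bp T n) * infnorm c" .
    also have "\<dots> \<le> G * bnorm T n powr (1 - \<theta>) * infnorm c"
      by (intro mult_right_mono order_trans[OF abs_ge_self G(2)] infnorm_pos_le)
    finally show ?thesis .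
  qed
  then show ?thesis using th(1) G(1) by (meson less_imp_le)
qed

text \<open>Norms start at 1 and at most double in a step, so the last level up to n that does not
  exceed the prescribed power is within a factor two of it.\<close>

lemma intermediate_level:
  fixes \<kappa> :: real
  assumes k: "0 < \<kappa>" "\<kappa> \<le> 1"
  shows "\<exists>m\<le>n. bnorm T m \<le> bnorm T n powr \<kappa> \<and> bnorm T n powr \<kappa> \<le> 2 * bnorm T m"
proof -
  define A where "A = {m. m \<le> n \<and> bnorm T m \<le> bnorm T n powr \<kappa>}"
  have "0 \<in> A" using ge_one_powr_ge_zero[OF bnorm_ge_1, of \<kappa>] k by (auto simp: A_def bnorm_0)
  then have A: "finite A" "A \<noteq> {}" by (auto simp: A_def)
  define m where "m = Max A"
  have m: "m \<le> n" "bnorm T m \<le> bnorm T n powr \<kappa>" using Max_in[OF A] by (auto simp: A_def m_def)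
  have "bnorm T n powr \<kappa> \<le> 2 * bnorm T m"
  proof (cases "m = n")
    case True
    have "bnorm T n powr \<kappa> \<le> bnorm T n powr 1" by (rule powr_mono[OF k(2) bnorm_ge_1])
    then show ?thesis using True bnorm_pos[of T n] by simp
  next
    case False
    have "Suc m \<notin> A" using Max_ge[OF A(1), of "Suc m"] by (auto simp: m_def)
    then have "bnorm T n powr \<kappa> < bnorm T (Suc m)" using False m(1) by (auto simp: A_def)
    then show ?thesis using bnorm_Suc[of T m] by linarith
  qed
  then show ?thesis using m by blast
qed

text \<open>The area of one tower is at most |I|, and by \<open>rowsum_lower\<close> its height is
  nearly the norm.\<close>

lemma len_upper:
  fixes T :: "'a::finite iem"
  assumes T: "good T" and mg: "matrix_growth T" and "\<tau> > 0"
  shows "\<exists>R\<ge>1. \<forall>n \<alpha>. len (rv T n) \<alpha> \<le> sum (len T) UNIV * R * bnorm T n powr (\<tau> - 1)"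
proof -
  obtain R where R: "R \<ge> 1" "\<And>n \<alpha>. bnorm T n \<le> R * bnorm T n powr \<tau> * rowsum (Bp T n) \<alpha>"
    using rowsum_lower[OF T mg assms(3)] by blast
  have "len (rv T n) \<alpha> \<le> sum (len T) UNIV * R * bnorm T n powr (\<tau> - 1)" for n \<alpha>
  proof -
    have "bnorm T n * len (rv T n) \<alpha> \<le> R * bnorm T n powr \<tau> * rowsum (Bp T n) \<alpha> * len (rv T n) \<alpha>"
      by (rule mult_right_mono[OF R(2)]) (use rv_len_pos[OF T, of n \<alpha>] in simp)
    also have "\<dots> = R * bnorm T n powr \<tau> * (rowsum (Bp T n) \<alpha> * len (rv T n) \<alpha>)" by simp
    also have "\<dots> \<le> R * bnorm T n powr \<tau> * sum (len T) UNIV"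
      by (rule mult_left_mono[OF rowsum_len_le[OF T]]) (use R(1) in simp)
    finally show ?thesis using bnorm_pos[of T n] by (simp add: powr_diff field_simps)
  qed
  then show ?thesis using R(1) by blast
qed

text \<open>The level m must be high enough for Hoelder continuity on its short intervals to yield a
  gain, and low enough that pulling the means back to time zero does not eat up the spectral gap.
  Hence the norm at m is taken near a small power \<kappa> of the norm at n.\<close>

lemma derivative_sum_decay:
  fixes T :: "'a::finite iem"
  assumes T: "good T" and mg: "matrix_growth T" and gap: "spectral_gap T"
    and d: "\<And>\<alpha> x. x \<in> cint T 0 \<alpha> \<Longrightarrow> (\<phi> \<alpha> has_real_derivative \<phi>' \<alpha> x) (at x within cint T 0 \<alpha>)"
    and M: "\<And>\<alpha> x. x \<in> cint T 0 \<alpha> \<Longrightarrow> \<bar>\<phi>' \<alpha> x\<bar> \<le> M"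
    and h: "0 < h" "h \<le> 1" and H0: "H \<ge> 0"
    and H: "\<And>\<alpha> x y. x \<in> cint T 0 \<alpha> \<Longrightarrow> y \<in> cint T 0 \<alpha> \<Longrightarrow> \<bar>\<phi>' \<alpha> x - \<phi>' \<alpha> y\<bar> \<le> H * \<bar>x - y\<bar> powr h"
    and p: "\<And>n. pairing (rv T n) 0 1 (Sb T n \<phi>) = 0"
  shows "\<exists>\<epsilon>>0. \<exists>C\<ge>0. \<forall>n \<alpha>. \<forall>x\<in>cint T n \<alpha>. \<bar>Sb T n \<phi>' \<alpha> x\<bar> \<le> C * bnorm T n powr (1 - \<epsilon>)"
proof -
  define \<Lambda> where "\<Lambda> = sum (len T) UNIV"
  define K where "K = real (CARD('a) - 1)"
  have L0: "\<Lambda> \<ge> 0" unfolding \<Lambda>_def using is_iemD(1)[OF goodD(2)[OF T]] by (simp add: sum_nonneg less_imp_le)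
  have t: "h / 4 > 0" using h by simp
  have b: "bnorm T n \<ge> 1" "bnorm T n > 0" for n using bnorm_ge_1 bnorm_pos by blast+
  obtain R1 where R1: "R1 \<ge> 1" "\<And>n \<alpha>. len (rv T n) \<alpha> \<le> \<Lambda> * R1 * bnorm T n powr (h / 4 - 1)"
    using len_upper[OF T mg t] unfolding \<Lambda>_def by blast
  obtain R where R: "R \<ge> 1" "\<And>n \<alpha>. bnorm T n \<le> R * bnorm T n powr (h / 4) * rowsum (Bp T n) \<alpha>"
    using rowsum_lower[OF T mg t] by blast
  obtain \<theta> G where G: "\<theta> > 0" "G \<ge> 0" "\<And>c n. (\<Sum>\<alpha>\<in>UNIV. c $ \<alpha> * len T \<alpha>) = 0 \<Longrightarrow>
      infnorm (Bp T n *v c) \<le> G * bnorm T n powr (1 - \<theta>) * infnorm c"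
    using spectral_gap_bound[OF T gap] by blast
  have M0: "M \<ge> 0"
  proof -
    have "topl (rv T 0) \<alpha> \<in> cint T 0 \<alpha>" for \<alpha>
      using rv_len_pos[OF T, of 0 \<alpha>] by (simp add: cint_eq[OF T] less_imp_le del: rv_0)
    from order_trans[OF abs_ge_zero M[OF this]] show ?thesis .
  qed
  define Q where "Q = H * (\<Lambda> * R1) powr h"
  have Q0: "Q \<ge> 0" using H0 by (simp add: Q_def)
  have level: "\<exists>a :: real^'a. (\<forall>\<alpha>. \<forall>x\<in>cint T m \<alpha>. \<bar>Sb T m \<phi>' \<alpha> x - a $ \<alpha>\<bar> \<le> Q * bnorm T m powr (1 - h / 2)) \<and>
      (\<Sum>\<alpha>\<in>UNIV. a $ \<alpha> * len (rv T m) \<alpha>) = 0 \<and> infnorm a \<le> bnorm T m * M" for m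
  proof -
    let ?S = "rv T m"
    define a :: "real^'a" where
      "a = (\<chi> \<alpha>. (Sb T m \<phi> \<alpha> (topl ?S \<alpha> + len ?S \<alpha>) - Sb T m \<phi> \<alpha> (topl ?S \<alpha>)) / len ?S \<alpha>)"
    have lp: "len ?S \<alpha> > 0" for \<alpha> by (rule rv_len_pos[OF T])
    have mv: "\<exists>\<xi>\<in>cint T m \<alpha>. a $ \<alpha> = Sb T m \<phi>' \<alpha> \<xi>" for \<alpha>
    proof -
      let ?l = "topl ?S \<alpha>" and ?r = "topl ?S \<alpha> + len ?S \<alpha>"
      have lr: "?l < ?r" using lp by simp
      have "(Sb T m \<phi> \<alpha> has_derivative (\<lambda>u. Sb T m \<phi>' \<alpha> x * u)) (at x within {?l..?r})" if "?l \<le> x" "x \<le> ?r" for x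
        using Sb_derivative[OF T d, of x m \<alpha>] that
        by (simp add: cint_eq[OF T] has_field_derivative_def)
      from mvt_simple[OF lr this] obtain \<xi> where x: "\<xi> \<in> {?l<..<?r}" "Sb T m \<phi> \<alpha> ?r - Sb T m \<phi> \<alpha> ?l = Sb T m \<phi>' \<alpha> \<xi> * (?r - ?l)"
        by blast
      then have "a $ \<alpha> = Sb T m \<phi>' \<alpha> \<xi>" using lp[of \<alpha>] by (simp add: a_def)
      moreover have "\<xi> \<in> cint T m \<alpha>" using x(1) by (simp add: cint_eq[OF T])
      ultimately show ?thesis by blast
    qed
    have "\<bar>Sb T m \<phi>' \<alpha> x - a $ \<alpha>\<bar> \<le> Q * bnorm T m powr (1 - h / 2)" if x: "x \<in> cint T m \<alpha>" for \<alpha> x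
    proof -
      obtain \<xi> where xi: "\<xi> \<in> cint T m \<alpha>" "a $ \<alpha> = Sb T m \<phi>' \<alpha> \<xi>" using mv by blast
      have "\<bar>Sb T m \<phi>' \<alpha> x - Sb T m \<phi>' \<alpha> \<xi>\<bar> \<le> rowsum (Bp T m) \<alpha> * (H * \<bar>x - \<xi>\<bar> powr h)"
        by (rule Sb_modulus[where w = "\<lambda>d. H * d powr h", OF T H x xi(1)])
      also have "\<dots> \<le> bnorm T m * (H * (\<Lambda> * R1 * bnorm T m powr (h / 4 - 1)) powr h)"
      proof (intro mult_mono rowsum_le_bnorm order_refl powr_mono2)
        show "\<bar>x - \<xi>\<bar> \<le> \<Lambda> * R1 * bnorm T m powr (h / 4 - 1)"
          using R1(2)[of m \<alpha>] x xi(1) by (auto simp: cint_eq[OF T])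
      qed (use h H0 b[of m] in auto)
      also have "\<dots> = Q * (bnorm T m powr 1 * bnorm T m powr ((h / 4 - 1) * h))"
        using b[of m] L0 R1(1) by (simp add: Q_def powr_mult powr_powr)
      also have "\<dots> \<le> Q * bnorm T m powr (1 - h / 2)"
        unfolding powr_add[symmetric]
      proof (intro mult_left_mono powr_mono)
        have "h * h \<le> 1 * h" using h by (intro mult_right_mono) auto
        then show "1 + (h / 4 - 1) * h \<le> 1 - h / 2" using h by (simp add: algebra_simps)
      qed (use Q0 b in auto)
      finally show ?thesis unfolding xi(2) .
    qed
    \<comment> \<open>With c = 0 and s = 1 the pairing is the sum over all intervals of right minus
      left endpoint value, that is, the integral of the derivative.\<close>
    moreover have "(\<Sum>\<alpha>\<in>UNIV. a $ \<alpha> * len ?S \<alpha>) = 0"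
    proof -
      have "a $ \<alpha> * len ?S \<alpha> = Sb T m \<phi> \<alpha> (topl ?S \<alpha> + len ?S \<alpha>) - Sb T m \<phi> \<alpha> (topl ?S \<alpha>)" for \<alpha>
        using lp[of \<alpha>] by (simp add: a_def)
      then show ?thesis using p[of m] by (simp add: pairing_def psum_def)
    qed
    moreover have "infnorm a \<le> bnorm T m * M"
    proof (rule infnorm_leI)
      fix \<alpha>
      obtain \<xi> where xi: "\<xi> \<in> cint T m \<alpha>" "a $ \<alpha> = Sb T m \<phi>' \<alpha> \<xi>" using mv by blast
      have "\<bar>Sb T m \<phi>' \<alpha> \<xi>\<bar> \<le> rowsum (Bp T m) \<alpha> * M" by (rule Sb_bound[OF T M xi(1)])
      also have "\<dots> \<le> bnorm T m * M" by (rule mult_right_mono[OF rowsum_le_bnorm M0])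
      finally show "\<bar>a $ \<alpha>\<bar> \<le> bnorm T m * M" unfolding xi(2) .
    qed
    ultimately show ?thesis by blast
  qed
  \<comment> \<open>Inverting the cocycle up to level m costs the power K of the norm there, the
    size of the means one more; bounding \<kappa> (K + 1) by \<theta> / 2 keeps half of the
    gap.\<close>
  define \<kappa> where "\<kappa> = min 1 (\<theta> / (2 * (K + 1)))"
  have K0: "K \<ge> 0" by (simp add: K_def)
  have kap: "0 < \<kappa>" "\<kappa> \<le> 1" "\<kappa> * (K + 1) \<le> \<theta> / 2"
  proof -
    have "\<kappa> * (K + 1) \<le> \<theta> / (2 * (K + 1)) * (K + 1)" using K0 by (intro mult_right_mono) (auto simp: \<kappa>_def)
    also have "\<dots> = \<theta> / 2" using K0 by (simp add: field_simps)
    finally show "\<kappa> * (K + 1) \<le> \<theta> / 2" .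
  qed (use G(1) K0 in \<open>auto simp: \<kappa>_def\<close>)
  define F where "F = (fact CARD('a) :: real)"
  define \<epsilon> where "\<epsilon> = min (\<kappa> * h / 4) (\<theta> / 2)"
  have ep: "\<epsilon> > 0" "\<epsilon> \<le> \<kappa> * h / 4" "\<epsilon> \<le> \<theta> / 2" using kap(1) h G(1) by (auto simp: \<epsilon>_def)
  define C where "C = R * Q * 2 powr (h / 4) + G * F * M"
  have C0: "R * Q * 2 powr (h / 4) \<ge> 0" "G * F * M \<ge> 0" using R(1) Q0 G(2) M0 by (auto simp: F_def)
  have "\<bar>Sb T n \<phi>' \<alpha> x\<bar> \<le> C * bnorm T n powr (1 - \<epsilon>)" if x: "x \<in> cint T n \<alpha>" for n \<alpha> x
  proof -
    obtain m where m: "m \<le> n" "bnorm T m \<le> bnorm T n powr \<kappa>" "bnorm T n powr \<kappa> \<le> 2 * bnorm T m"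
      using intermediate_level[OF kap(1,2)] by blast
    let ?S = "rv T m"
    define k where "k = n - m"
    have n: "n = m + k" using m(1) by (simp add: k_def)
    obtain a :: "real^'a" where a: "\<forall>\<alpha>. \<forall>x\<in>cint T m \<alpha>. \<bar>Sb T m \<phi>' \<alpha> x - a $ \<alpha>\<bar> \<le> Q * bnorm T m powr (1 - h / 2)"
        "(\<Sum>\<alpha>\<in>UNIV. a $ \<alpha> * len ?S \<alpha>) = 0" "infnorm a \<le> bnorm T m * M"
      using level by blast
    let ?g = "Sb T m \<phi>'"
    let ?d = "\<lambda>\<alpha> x. 1 * ?g \<alpha> x + (-1) * gamma_fun a \<alpha> x"
    have split: "Sb T n \<phi>' \<alpha> x = Sb ?S k ?d \<alpha> x + (Bp ?S k *v a) $ \<alpha>"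
      unfolding n Sb_comp Sb_add Sb_gamma by simp
    have "\<bar>Sb ?S k ?d \<alpha> x\<bar> \<le> rowsum (Bp ?S k) \<alpha> * (Q * bnorm T m powr (1 - h / 2))"
    proof (rule Sb_bound[OF good_rv[OF T]])
      fix \<alpha> x assume "x \<in> cint ?S 0 \<alpha>"
      then have "x \<in> cint T m \<alpha>" by (simp add: rv_0)
      then show "\<bar>?d \<alpha> x\<bar> \<le> Q * bnorm T m powr (1 - h / 2)" using a(1) by (simp add: gamma_fun_def)
    qed (use x in \<open>simp add: n rv_add\<close>)
    also have "\<dots> \<le> (R * bnorm T n * bnorm T m powr (h / 4 - 1)) * (Q * bnorm T m powr (1 - h / 2))"
    proof (rule mult_right_mono)
      have pd: "bnorm T m powr (1 - h / 4) = bnorm T m / bnorm T m powr (h / 4)"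
          "bnorm T m powr (h / 4 - 1) = bnorm T m powr (h / 4) / bnorm T m"
        using powr_diff[of "bnorm T m" 1 "h / 4"] powr_diff[of "bnorm T m" "h / 4" 1] b[of m] by simp_all
      have pp: "bnorm T m powr (h / 4) > 0" using b[of m] by simp
      \<comment> \<open>The remaining factor of the cocycle has norm not much above the quotient of
        the norms at n and m, because all towers at level m are nearly as high as the norm
        there.\<close>
      have "bnorm ?S k * (bnorm T m powr (1 - h / 4) / R) \<le> bnorm T (m + k)"
      proof (rule bnorm_add_ge)
        show "bnorm T m powr (1 - h / 4) / R \<le> rowsum (Bp T m) \<gamma>" for \<gamma>
          using R(2)[of m \<gamma>] R(1) pp unfolding pd by (simp add: field_simps)
      qed (use R(1) in simp)
      then have "bnorm ?S k \<le> R * bnorm T n * bnorm T m powr (h / 4 - 1)"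
        using R(1) b[of m] pp unfolding pd n by (simp add: field_simps)
      then show "rowsum (Bp ?S k) \<alpha> \<le> R * bnorm T n * bnorm T m powr (h / 4 - 1)"
        using rowsum_le_bnorm[of ?S k \<alpha>] by linarith
    qed (use Q0 in simp)
    also have "\<dots> = R * Q * bnorm T n * (bnorm T m powr (h / 4 - 1) * bnorm T m powr (1 - h / 2))" by simp
    also have "bnorm T m powr (h / 4 - 1) * bnorm T m powr (1 - h / 2) = bnorm T m powr - (h / 4)"
      unfolding powr_add[symmetric] by (simp add: algebra_simps)
    also have "bnorm T m powr - (h / 4) \<le> (bnorm T n powr \<kappa> / 2) powr - (h / 4)"
      by (rule powr_mono2') (use h m(3) b[of n] in auto)
    also have "(bnorm T n powr \<kappa> / 2) powr - (h / 4) = 2 powr (h / 4) * bnorm T n powr - (\<kappa> * h / 4)"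
      using b[of n] by (simp add: powr_divide powr_powr powr_minus field_simps)
    finally have 1: "\<bar>Sb ?S k ?d \<alpha> x\<bar> \<le> R * Q * bnorm T n * (2 powr (h / 4) * bnorm T n powr - (\<kappa> * h / 4))"
      using R(1) Q0 b[of n] by (simp add: mult_left_mono)
    have "R * Q * bnorm T n * (2 powr (h / 4) * bnorm T n powr - (\<kappa> * h / 4)) =
        R * Q * 2 powr (h / 4) * (bnorm T n powr 1 * bnorm T n powr - (\<kappa> * h / 4))"
      using b[of n] by simp
    also have "\<dots> \<le> R * Q * 2 powr (h / 4) * bnorm T n powr (1 - \<epsilon>)"
      unfolding powr_add[symmetric] by (intro mult_left_mono powr_mono C0 b) (use ep in simp)
    finally have 1: "\<bar>Sb ?S k ?d \<alpha> x\<bar> \<le> R * Q * 2 powr (h / 4) * bnorm T n powr (1 - \<epsilon>)" using 1 by linarith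
    have "invertible (Bp T m)" by (simp add: invertible_det_nz Bp_det[OF T])
    then obtain A where A: "Bp T m ** A = mat 1" unfolding invertible_def by blast
    \<comment> \<open>The means are written as the image of a vector at time zero, since the
      spectral gap controls only products starting there.\<close>
    define c where "c = A *v a"
    have c: "Bp T m *v c = a" by (simp add: c_def matrix_vector_mul_assoc A)
    have "(\<Sum>\<alpha>\<in>UNIV. c $ \<alpha> * len T \<alpha>) = 0" using sum_Bp_len[OF T, of m c] a(2) unfolding c by simp
    from G(3)[OF this] have "infnorm (Bp T n *v c) \<le> G * bnorm T n powr (1 - \<theta>) * infnorm c" .
    also have "infnorm c \<le> F * bnorm T m powr K * infnorm a"
      using Bp_inverse_bound[OF T, of c m] unfolding c F_def K_def .
    also have "F * bnorm T m powr K * infnorm a \<le> F * bnorm T m powr K * (bnorm T m powr 1 * M)"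
      using a(3) b[of m] by (intro mult_left_mono) (auto simp: F_def)
    also have "\<dots> = F * M * bnorm T m powr (K + 1)" by (simp add: powr_add)
    also have "\<dots> \<le> F * M * (bnorm T n powr \<kappa>) powr (K + 1)"
      using m(2) b[of m] K0 M0 by (intro mult_left_mono powr_mono2) (auto simp: F_def)
    also have "(bnorm T n powr \<kappa>) powr (K + 1) \<le> bnorm T n powr (\<theta> / 2)"
      unfolding powr_powr by (intro powr_mono kap(3) b)
    finally have "infnorm (Bp T n *v c) \<le> G * bnorm T n powr (1 - \<theta>) * (F * M * bnorm T n powr (\<theta> / 2))"
      using G(2) M0 by (simp add: mult_left_mono F_def)
    also have "\<dots> = G * F * M * bnorm T n powr (1 - \<theta> + \<theta> / 2)" unfolding powr_add by simp
    also have "\<dots> \<le> G * F * M * bnorm T n powr (1 - \<epsilon>)"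
      by (intro mult_left_mono powr_mono C0 b) (use ep in simp)
    finally have "infnorm (Bp T n *v c) \<le> G * F * M * bnorm T n powr (1 - \<epsilon>)" .
    moreover have "Bp ?S k *v a = Bp T n *v c" using Bp_split[OF m(1), of T c] unfolding c k_def .
    ultimately have 2: "\<bar>(Bp ?S k *v a) $ \<alpha>\<bar> \<le> G * F * M * bnorm T n powr (1 - \<epsilon>)"
      using component_le_infnorm_cart[of "Bp T n *v c" \<alpha>] by simp
    have "C * bnorm T n powr (1 - \<epsilon>) = R * Q * 2 powr (h / 4) * bnorm T n powr (1 - \<epsilon>) + G * F * M * bnorm T n powr (1 - \<epsilon>)"
      by (simp add: C_def distrib_right)
    then show ?thesis using 1 2 unfolding split by linarith
  qed
  moreover have "C \<ge> 0" using C0 by (simp add: C_def)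
  ultimately show ?thesis using ep(1) by blast
qed

text \<open>Up to constants, derivative sums are at most the norm to the power 1 - \<epsilon> and
  lengths at most the norm to the power \<epsilon> / 2 - 1; the product has exponent -\<epsilon> /
  2.\<close>

lemma oscillation_decay:
  fixes T :: "'a::finite iem"
  assumes T: "good T" and mg: "matrix_growth T" and gap: "spectral_gap T"
    and d: "\<And>\<alpha> x. x \<in> cint T 0 \<alpha> \<Longrightarrow> (\<phi> \<alpha> has_real_derivative \<phi>' \<alpha> x) (at x within cint T 0 \<alpha>)"
    and M: "\<And>\<alpha> x. x \<in> cint T 0 \<alpha> \<Longrightarrow> \<bar>\<phi>' \<alpha> x\<bar> \<le> M"
    and h: "0 < h" "h \<le> 1" and H0: "H \<ge> 0"
    and H: "\<And>\<alpha> x y. x \<in> cint T 0 \<alpha> \<Longrightarrow> y \<in> cint T 0 \<alpha> \<Longrightarrow> \<bar>\<phi>' \<alpha> x - \<phi>' \<alpha> y\<bar> \<le> H * \<bar>x - y\<bar> powr h"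
    and p: "\<And>n. pairing (rv T n) 0 1 (Sb T n \<phi>) = 0"
  shows "\<exists>\<delta>>0. \<exists>C\<ge>0. \<forall>n \<alpha>. \<forall>x\<in>cint T n \<alpha>.
    \<bar>Sb T n \<phi> \<alpha> x - Sb T n \<phi> \<alpha> (topl (rv T n) \<alpha>)\<bar> \<le> C * bnorm T n powr - \<delta>"
proof -
  obtain \<epsilon> C where C: "\<epsilon> > 0" "C \<ge> 0" "\<And>n \<alpha> x. x \<in> cint T n \<alpha> \<Longrightarrow> \<bar>Sb T n \<phi>' \<alpha> x\<bar> \<le> C * bnorm T n powr (1 - \<epsilon>)"
    using derivative_sum_decay[OF T mg gap d M h H0 H p] by blast
  have e2: "\<epsilon> / 2 > 0" using C(1) by simp
  obtain R where R: "R \<ge> 1" "\<And>n \<alpha>. len (rv T n) \<alpha> \<le> sum (len T) UNIV * R * bnorm T n powr (\<epsilon> / 2 - 1)"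
    using len_upper[OF T mg e2] by blast
  have L0: "sum (len T) UNIV \<ge> 0" using is_iemD(1)[OF goodD(2)[OF T]] by (simp add: sum_nonneg less_imp_le)
  have "\<bar>Sb T n \<phi> \<alpha> x - Sb T n \<phi> \<alpha> (topl (rv T n) \<alpha>)\<bar> \<le> (C * (sum (len T) UNIV * R)) * bnorm T n powr - (\<epsilon> / 2)"
    if x: "x \<in> cint T n \<alpha>" for n \<alpha> x
  proof -
    let ?l = "topl (rv T n) \<alpha>"
    have l: "?l \<in> cint T n \<alpha>" using rv_len_pos[OF T, of n \<alpha>] by (simp add: cint_eq[OF T] less_imp_le)
    have "norm (Sb T n \<phi> \<alpha> x - Sb T n \<phi> \<alpha> ?l) \<le> C * bnorm T n powr (1 - \<epsilon>) * norm (x - ?l)"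
      by (rule field_differentiable_bound[OF _ Sb_derivative[OF T d] _ x l])
        (use C(3) in \<open>auto simp: cint_eq[OF T]\<close>)
    also have "\<dots> \<le> C * bnorm T n powr (1 - \<epsilon>) * (sum (len T) UNIV * R * bnorm T n powr (\<epsilon> / 2 - 1))"
      using R(2)[of n \<alpha>] x C(2) by (intro mult_left_mono) (auto simp: cint_eq[OF T])
    also have "\<dots> = C * (sum (len T) UNIV * R) * (bnorm T n powr (1 - \<epsilon>) * bnorm T n powr (\<epsilon> / 2 - 1))" by simp
    also have "bnorm T n powr (1 - \<epsilon>) * bnorm T n powr (\<epsilon> / 2 - 1) = bnorm T n powr - (\<epsilon> / 2)"
      unfolding powr_add[symmetric] by (simp add: field_simps)
    finally show ?thesis by simp
  qed
  moreover have "C * (sum (len T) UNIV * R) \<ge> 0" using C(2) L0 R(1) by simp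
  ultimately show ?thesis using e2 by blast
qed

subsection \<open>Functions of class C^r\<close>

lemma Cr_on_derivative:
  assumes "1 \<le> r" "Cr_on r S f" "x \<in> S"
  shows "(f has_real_derivative nderiv_within S 1 f x) (at x within S)"
proof -
  have "0 < nat \<lfloor>r\<rfloor>" using assms(1) by linarith
  then have "nderiv_within S 0 f differentiable_on S" using assms(2) unfolding Cr_on_def Let_def by blast
  then have "f differentiable (at x within S)" using assms(3) by (simp add: differentiable_on_def)
  then show ?thesis by (simp add: has_real_derivative_iff_has_vector_derivative vector_derivative_works)
qed

lemma Cr_on_nderiv_continuous:
  assumes "Cr_on r S f" "j \<le> nat \<lfloor>r\<rfloor>"
  shows "continuous_on S (nderiv_within S j f)"
proof (cases "j = nat \<lfloor>r\<rfloor>")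
  case True
  then show ?thesis using assms(1) unfolding Cr_on_def Let_def by blast
next
  case False
  then have "nderiv_within S j f differentiable_on S" using assms unfolding Cr_on_def Let_def by (meson le_neq_implies_less)
  then show ?thesis by (rule differentiable_imp_continuous_on)
qed

lemma Cr_on_imp_C1:
  assumes "1 \<le> r" "Cr_on r S f"
  shows "Cr_on 1 S f"
proof -
  have k: "1 \<le> nat \<lfloor>r\<rfloor>" using assms(1) by linarith
  have "f differentiable_on S"
    unfolding differentiable_on_def using Cr_on_derivative[OF assms] real_differentiable_def by blast
  then show ?thesis using Cr_on_nderiv_continuous[OF assms(2) k] by (simp add: Cr_on_def)
qed

lemma Cr_on_nderiv_bdd:
  assumes "Cr_on r {a..b::real} f" "j \<le> nat \<lfloor>r\<rfloor>"
  shows "bdd_above ((\<lambda>x. \<bar>nderiv_within {a..b} j f x\<bar>) ` {a..b})"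
  by (intro compact_imp_bounded[THEN bounded_imp_bdd_above] compact_continuous_image continuous_intros
      Cr_on_nderiv_continuous[OF assms]) auto

lemma Cr_norm_on_1: "Cr_norm_on 1 S f = (SUP x\<in>S. \<bar>f x\<bar>) + (SUP x\<in>S. \<bar>nderiv_within S 1 f x\<bar>)"
proof -
  have "{..1::nat} = {0, 1}" by auto
  then show ?thesis by (simp add: Cr_norm_on_def)
qed

lemma nderiv_sup_nonneg:
  assumes "a \<le> (b::real)" "Cr_on r {a..b} f" "j \<le> nat \<lfloor>r\<rfloor>"
  shows "0 \<le> (SUP x\<in>{a..b}. \<bar>nderiv_within {a..b} j f x\<bar>)"
  by (rule cSUP_upper2[OF Cr_on_nderiv_bdd[OF assms(2,3)], of a]) (use assms(1) in auto)

lemma Cr_norm_on_1_bounds: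
  assumes "a \<le> (b::real)" "Cr_on 1 {a..b} f" "x \<in> {a..b}"
  shows "\<bar>f x\<bar> \<le> Cr_norm_on 1 {a..b} f" "\<bar>nderiv_within {a..b} 1 f x\<bar> \<le> Cr_norm_on 1 {a..b} f"
proof -
  have "\<bar>nderiv_within {a..b} j f x\<bar> \<le> (SUP x\<in>{a..b}. \<bar>nderiv_within {a..b} j f x\<bar>)" if "j \<le> 1" for j
    by (rule cSUP_upper[OF assms(3) Cr_on_nderiv_bdd[OF assms(2)]]) (use that in simp)
  from this[of 0] this[of 1] nderiv_sup_nonneg[OF assms(1,2), of 0] nderiv_sup_nonneg[OF assms(1,2), of 1]
  show "\<bar>f x\<bar> \<le> Cr_norm_on 1 {a..b} f" "\<bar>nderiv_within {a..b} 1 f x\<bar> \<le> Cr_norm_on 1 {a..b} f"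
    unfolding Cr_norm_on_1 by simp_all
qed

text \<open>The additional terms are suprema, whose sign is known only for bounded nonempty sets; a
  < b supplies a pair of distinct points for the Hoelder quotient.\<close>

lemma Cr_norm_on_mono:
  assumes ab: "a < (b::real)" and r: "1 \<le> r" and f: "Cr_on r {a..b} f"
  shows "Cr_norm_on 1 {a..b} f \<le> Cr_norm_on r {a..b} f"
proof -
  define k where "k = nat \<lfloor>r\<rfloor>"
  define g where "g = nderiv_within {a..b} k f"
  let ?s = "\<lambda>j. SUP x\<in>{a..b}. \<bar>nderiv_within {a..b} j f x\<bar>"
  have k: "1 \<le> k" using r unfolding k_def by linarith
  have "sum ?s {..1} \<le> sum ?s {..k}"
    by (rule sum_mono2) (use k nderiv_sup_nonneg[OF less_imp_le[OF ab] f] in \<open>auto simp: k_def\<close>)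
  moreover have "0 \<le> (if r = real k then 0
      else Sup {\<bar>g x - g y\<bar> / \<bar>x - y\<bar> powr (r - real k) | x y. x \<in> {a..b} \<and> y \<in> {a..b} \<and> x \<noteq> y})"
  proof (cases "r = real k")
    case False
    then obtain C where C: "\<And>x y. x \<in> {a..b} \<Longrightarrow> y \<in> {a..b} \<Longrightarrow> \<bar>g x - g y\<bar> \<le> C * \<bar>x - y\<bar> powr (r - real k)"
      using f unfolding Cr_on_def Let_def k_def g_def by blast
    let ?A = "{\<bar>g x - g y\<bar> / \<bar>x - y\<bar> powr (r - real k) | x y. x \<in> {a..b} \<and> y \<in> {a..b} \<and> x \<noteq> y}"
    have "bdd_above ?A"
    proof (rule bdd_aboveI)
      fix u assume "u \<in> ?A"
      then obtain x y where u: "u = \<bar>g x - g y\<bar> / \<bar>x - y\<bar> powr (r - real k)" "x \<in> {a..b}" "y \<in> {a..b}" "x \<noteq> y" by blast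
      then have "\<bar>x - y\<bar> powr (r - real k) > 0" by simp
      then show "u \<le> C" using C[OF u(2,3)] unfolding u(1) by (simp add: divide_le_eq)
    qed
    moreover have "\<bar>g a - g b\<bar> / \<bar>a - b\<bar> powr (r - real k) \<in> ?A"
      using ab by (intro CollectI exI[of _ a] exI[of _ b]) auto
    ultimately have "\<bar>g a - g b\<bar> / \<bar>a - b\<bar> powr (r - real k) \<le> Sup ?A" by (intro cSup_upper)
    moreover have "0 \<le> \<bar>g a - g b\<bar> / \<bar>a - b\<bar> powr (r - real k)" by simp
    ultimately show ?thesis unfolding if_not_P[OF False] by (rule order_trans[rotated])
  qed simp
  moreover have "Cr_norm_on 1 {a..b} f = sum ?s {..1}" by (simp add: Cr_norm_on_def)
  moreover have "Cr_norm_on r {a..b} f = sum ?s {..k} + (if r = real k then 0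
      else Sup {\<bar>g x - g y\<bar> / \<bar>x - y\<bar> powr (r - real k) | x y. x \<in> {a..b} \<and> y \<in> {a..b} \<and> x \<noteq> y})"
    unfolding Cr_norm_on_def Let_def k_def g_def ..
  ultimately show ?thesis by linarith
qed

text \<open>For r < 2 the Hoelder condition is part of the definition, with exponent r - 1. For r
  \<ge> 2 the second derivative is continuous on a compact interval, so the first one is
  Lipschitz.\<close>

lemma Cr_on_derivative_holder:
  assumes r: "1 < r" and f: "Cr_on r {a..b::real} f"
  shows "\<exists>H\<ge>0. \<forall>x\<in>{a..b}. \<forall>y\<in>{a..b}.
    \<bar>nderiv_within {a..b} 1 f x - nderiv_within {a..b} 1 f y\<bar> \<le> H * \<bar>x - y\<bar> powr min 1 (r - 1)"
proof (cases "nat \<lfloor>r\<rfloor> = 1")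
  case True
  let ?g = "nderiv_within {a..b} 1 f"
  have fl: "\<lfloor>r\<rfloor> = 1" using True r by linarith
  then have "r < 2" by linarith
  then have m: "min 1 (r - 1) = r - 1" by simp
  obtain C where C: "\<forall>x\<in>{a..b}. \<forall>y\<in>{a..b}. \<bar>?g x - ?g y\<bar> \<le> C * \<bar>x - y\<bar> powr (r - 1)"
    using f r unfolding Cr_on_def Let_def True by auto
  have "\<bar>?g x - ?g y\<bar> \<le> \<bar>C\<bar> * \<bar>x - y\<bar> powr (r - 1)" if "x \<in> {a..b}" "y \<in> {a..b}" for x y
    by (rule order_trans[OF C[rule_format, OF that]]) (simp add: mult_right_mono)
  then show ?thesis unfolding m by (intro exI[of _ "\<bar>C\<bar>"]) auto
next
  case False
  then have k: "2 \<le> nat \<lfloor>r\<rfloor>" using r by linarith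
  then have "2 \<le> \<lfloor>r\<rfloor>" by linarith
  then have "2 \<le> r" by (simp add: le_floor_iff)
  then have m: "min 1 (r - 1) = 1" by linarith
  let ?g = "nderiv_within {a..b} 1 f" and ?h = "nderiv_within {a..b} 2 f"
  have "1 < nat \<lfloor>r\<rfloor>" using k by linarith
  then have "?g differentiable_on {a..b}" using f unfolding Cr_on_def Let_def by blast
  then have d: "(?g has_field_derivative ?h x) (at x within {a..b})" if "x \<in> {a..b}" for x
    using that unfolding has_real_derivative_iff_has_vector_derivative numeral_2_eq_2
    by (simp add: differentiable_on_def vector_derivative_works)
  obtain B where B: "\<And>x. x \<in> {a..b} \<Longrightarrow> \<bar>?h x\<bar> \<le> B"
    using Cr_on_nderiv_bdd[OF f k] unfolding bdd_above_def ball_simps by blast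
  have "\<bar>?g x - ?g y\<bar> \<le> \<bar>B\<bar> * \<bar>x - y\<bar> powr 1" if xy: "x \<in> {a..b}" "y \<in> {a..b}" for x y
  proof -
    have "norm (?g x - ?g y) \<le> \<bar>B\<bar> * norm (x - y)"
    proof (rule field_differentiable_bound[OF _ d _ xy])
      show "norm (?h z) \<le> \<bar>B\<bar>" if "z \<in> {a..b}" for z using B[OF that] by simp
    qed auto
    then show ?thesis by simp
  qed
  then show ?thesis unfolding m by (intro exI[of _ "\<bar>B\<bar>"]) auto
qed

section \<open>Special Birkhoff sums of coboundaries\<close>

lemma Sb_coboundary:
  fixes T :: "'a::finite iem"
  assumes T: "good T" and e: "\<And>\<alpha> x. x \<in> top_int T \<alpha> \<Longrightarrow> f \<alpha> x = \<psi> (iem_map T x) - \<psi> x"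
    and x: "x \<in> top_int (rv T n) \<alpha>"
  shows "Sb T n f \<alpha> x = \<psi> (iem_map (rv T n) x) - \<psi> x"
proof -
  let ?y = "\<lambda>j. (iem_map T ^^ j) x"
  obtain N where N: "(iem_map T ^^ N) x = iem_map (rv T n) x" "\<forall>i<N. ?y i \<in> iem_dom T"
      "\<forall>\<phi>. (\<Sum>j<N. \<phi> (label_of T (?y j)) (?y j)) = Sb T n \<phi> \<alpha> x"
    using return_structure[OF T x] by (elim exE conjE) (rule that)
  have "f (label_of T (?y j)) (?y j) = \<psi> (?y (Suc j)) - \<psi> (?y j)" if "j < N" for j
  proof -
    have "?y j \<in> iem_dom T" using N(2) that by blast
    then obtain \<beta> where b: "?y j \<in> top_int T \<beta>" unfolding iem_dom_def by blast
    then show ?thesis using e[OF b] label_of_eq[OF goodD(2)[OF T] b] by simp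
  qed
  then have "(\<Sum>j<N. f (label_of T (?y j)) (?y j)) = (\<Sum>j<N. \<psi> (?y (Suc j)) - \<psi> (?y j))" by simp
  also have "\<dots> = \<psi> (?y N) - \<psi> (?y 0)" by (rule sum_lessThan_telescope)
  finally show ?thesis using N(1,3) by simp
qed

text \<open>On open intervals the sum telescopes to a difference of two values of \<psi>, bounded by
  compactness; density carries the bound to the endpoints.\<close>

lemma Sb_coboundary_bound:
  fixes T :: "'a::finite iem"
  assumes T: "good T" and f: "\<And>\<alpha>. continuous_on (cint T 0 \<alpha>) (f \<alpha>)"
    and e: "\<And>\<alpha> x. x \<in> top_int T \<alpha> \<Longrightarrow> f \<alpha> x = \<psi> (iem_map T x) - \<psi> x"
    and psi: "continuous_on {left_end T .. right_end T} \<psi>"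
  shows "\<exists>C. \<forall>n \<alpha>. \<forall>x\<in>cint T n \<alpha>. \<bar>Sb T n f \<alpha> x\<bar> \<le> C"
proof -
  have "compact (\<psi> ` {left_end T .. right_end T})" by (intro compact_continuous_image psi) simp
  then obtain C where C: "\<And>x. x \<in> {left_end T .. right_end T} \<Longrightarrow> \<bar>\<psi> x\<bar> \<le> C"
    using compact_imp_bounded bounded_iff by (metis imageI real_norm_def)
  have "\<bar>Sb T n f \<alpha> x\<bar> \<le> 2 * C" if x: "x \<in> cint T n \<alpha>" for n \<alpha> x
  proof -
    let ?S = "rv T n" and ?I = "top_int (rv T n) \<alpha>"
    note iS = rv_is_iem[OF T, of n]
    have sub: "whole_int ?S \<subseteq> {left_end T .. right_end T}" "?I \<subseteq> whole_int ?S"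
    proof -
      show "whole_int ?S \<subseteq> {left_end T .. right_end T}"
      proof (induction n)
        case 0 then show ?case by (auto simp: rv_0 whole_int_eq[OF goodD(2)[OF T]])
      next
        case (Suc n)
        note g = goodD[OF good_rv[OF T, of n]]
        show ?case using step_whole_subset[OF g(1,2,4)] Suc unfolding rv_Suc_nxt[OF T] by blast
      qed
      show "?I \<subseteq> whole_int ?S" using iem_bounds[OF iS, of \<alpha>] by (auto simp: top_int_eq[OF iS] whole_int_eq[OF iS])
    qed
    have b: "\<bar>Sb T n f \<alpha> y\<bar> \<le> 2 * C" if y: "y \<in> ?I" for y
    proof -
      have "iem_map ?S y \<in> whole_int ?S" using y by (intro iem_map_whole[OF iS]) (auto simp: iem_dom_def)
      then have "\<bar>\<psi> (iem_map ?S y)\<bar> \<le> C" "\<bar>\<psi> y\<bar> \<le> C" using C sub y by blast+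
      moreover have "Sb T n f \<alpha> y = \<psi> (iem_map ?S y) - \<psi> y" using Sb_coboundary[where f = f and \<psi> = \<psi>, OF T e y] by blast
      ultimately show ?thesis by linarith
    qed
    have cl: "closure ?I = cint T n \<alpha>"
      using rv_len_pos[OF T, of n \<alpha>] by (simp add: top_int_eq[OF iS] cint_eq[OF T])
    have "norm (Sb T n f \<alpha> x) \<le> 2 * C"
    proof (rule continuous_on_closure_norm_le[where f = "Sb T n f \<alpha>" and s = ?I and x = x])
      show "continuous_on (closure ?I) (Sb T n f \<alpha>)" unfolding cl by (rule Sb_continuous[OF T f])
      show "\<forall>y\<in>?I. norm (Sb T n f \<alpha> y) \<le> 2 * C" using b by simp
      show "x \<in> closure ?I" unfolding cl by (rule x)
    qed
    then show ?thesis by simp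
  qed
  then show ?thesis by blast
qed

section \<open>The C^1 norm and functions corrected by constants\<close>

lemma Cr_norm_on_le_Cr_norm: "Cr_norm_on r (top_cint T \<alpha>) (\<phi> \<alpha>) \<le> Cr_norm r T \<phi>"
  for T :: "'a::finite iem"
  unfolding Cr_norm_def by (rule Max_ge) auto

lemma Cr_space_1D:
  fixes T :: "'a::finite iem"
  assumes T: "is_iem T" and f: "\<phi> \<in> Cr_space 1 T" and x: "x \<in> cint T 0 \<alpha>"
  shows "(\<phi> \<alpha> has_real_derivative nderiv_within (top_cint T \<alpha>) 1 (\<phi> \<alpha>) x) (at x within cint T 0 \<alpha>)"
    and "\<bar>\<phi> \<alpha> x\<bar> \<le> Cr_norm 1 T \<phi>" and "\<bar>nderiv_within (top_cint T \<alpha>) 1 (\<phi> \<alpha>) x\<bar> \<le> Cr_norm 1 T \<phi>"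
proof -
  have x: "x \<in> top_cint T \<alpha>" using x by (simp add: rv_0)
  have f: "Cr_on 1 (top_cint T \<alpha>) (\<phi> \<alpha>)" using f by (simp add: Cr_space_def)
  show "(\<phi> \<alpha> has_real_derivative nderiv_within (top_cint T \<alpha>) 1 (\<phi> \<alpha>) x) (at x within cint T 0 \<alpha>)"
    using Cr_on_derivative[OF order_refl f x] by (simp add: rv_0)
  have "topl T \<alpha> \<le> topl T \<alpha> + len T \<alpha>" using is_iemD(1)[OF T, of \<alpha>] by simp
  note b = Cr_norm_on_1_bounds[OF this f[unfolded top_cint_eq[OF T]] x[unfolded top_cint_eq[OF T]],
      folded top_cint_eq[OF T]]
  show "\<bar>\<phi> \<alpha> x\<bar> \<le> Cr_norm 1 T \<phi>" by (rule order_trans[OF b(1) Cr_norm_on_le_Cr_norm[where \<phi> = \<phi>]])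
  show "\<bar>nderiv_within (top_cint T \<alpha>) 1 (\<phi> \<alpha>) x\<bar> \<le> Cr_norm 1 T \<phi>"
    by (rule order_trans[OF b(2) Cr_norm_on_le_Cr_norm[where \<phi> = \<phi>]])
qed

lemma Cr_space_1_continuous:
  fixes T :: "'a::finite iem"
  assumes "is_iem T" "\<phi> \<in> Cr_space 1 T"
  shows "continuous_on (cint T 0 \<alpha>) (\<phi> \<alpha>)"
  using Cr_space_1D(1)[OF assms] DERIV_continuous unfolding continuous_on_eq_continuous_within by blast

text \<open>The variation is at most the Lipschitz constant times the height and the length of one
  tower, an area that cannot exceed |I|.\<close>

lemma C1_oscillation:
  fixes T :: "'a::finite iem"
  assumes T: "good T" and f: "\<phi> \<in> Cr_space 1 T" and x: "x \<in> cint T n \<alpha>" and y: "y \<in> cint T n \<alpha>"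
  shows "\<bar>Sb T n \<phi> \<alpha> x - Sb T n \<phi> \<alpha> y\<bar> \<le> Cr_norm 1 T \<phi> * sum (len T) UNIV"
proof -
  let ?N = "Cr_norm 1 T \<phi>"
  note D = Cr_space_1D[OF goodD(2)[OF T] f]
  have lip: "\<bar>\<phi> \<beta> u - \<phi> \<beta> v\<bar> \<le> ?N * \<bar>u - v\<bar>" if "u \<in> cint T 0 \<beta>" "v \<in> cint T 0 \<beta>" for \<beta> u v
  proof -
    have "norm (\<phi> \<beta> u - \<phi> \<beta> v) \<le> ?N * norm (u - v)"
    proof (rule field_differentiable_bound[OF _ D(1) _ that])
      show "convex (cint T 0 \<beta>)" unfolding cint_eq[OF T] by simp
    qed (use D(3) in auto)
    then show ?thesis by simp
  qed
  have N: "?N \<ge> 0"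
  proof -
    have "topl (rv T 0) \<alpha> \<in> cint T 0 \<alpha>"
      unfolding cint_eq[OF T] using rv_len_pos[OF T, of 0 \<alpha>] by simp
    from order_trans[OF abs_ge_zero D(2)[OF this]] show ?thesis .
  qed
  have "\<bar>Sb T n \<phi> \<alpha> x - Sb T n \<phi> \<alpha> y\<bar> \<le> rowsum (Bp T n) \<alpha> * (?N * \<bar>x - y\<bar>)"
    by (rule Sb_modulus[where w = "\<lambda>d. ?N * d", OF T lip x y])
  also have "\<dots> = ?N * (rowsum (Bp T n) \<alpha> * \<bar>x - y\<bar>)" by simp
  also have "\<dots> \<le> ?N * (rowsum (Bp T n) \<alpha> * len (rv T n) \<alpha>)"
    using N rowsum_Bp_ge_1[of T n \<alpha>] x y by (intro mult_left_mono) (auto simp: cint_eq[OF T])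
  also have "\<dots> \<le> ?N * sum (len T) UNIV" by (rule mult_left_mono[OF rowsum_len_le[OF T] N])
  finally show ?thesis .
qed

lemma Cr_space_mono:
  fixes T :: "'a::finite iem"
  assumes T: "is_iem T" and r: "1 \<le> r" and f: "\<phi> \<in> Cr_space r T"
  shows "\<phi> \<in> Cr_space 1 T" "Cr_norm 1 T \<phi> \<le> Cr_norm r T \<phi>"
proof -
  show "\<phi> \<in> Cr_space 1 T" using f Cr_on_imp_C1[OF r] by (simp add: Cr_space_def)
  have "Cr_norm_on 1 (top_cint T \<alpha>) (\<phi> \<alpha>) \<le> Cr_norm r T \<phi>" for \<alpha>
  proof -
    have "Cr_norm_on 1 (top_cint T \<alpha>) (\<phi> \<alpha>) \<le> Cr_norm_on r (top_cint T \<alpha>) (\<phi> \<alpha>)"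
      unfolding top_cint_eq[OF T]
      by (rule Cr_norm_on_mono[OF _ r]) (use is_iemD(1)[OF T, of \<alpha>] f in \<open>auto simp: Cr_space_def top_cint_eq[OF T]\<close>)
    then show ?thesis using Cr_norm_on_le_Cr_norm[of r T \<alpha> \<phi>] by linarith
  qed
  then show "Cr_norm 1 T \<phi> \<le> Cr_norm r T \<phi>" unfolding Cr_norm_def[of 1] by (simp add: Max_le_iff)
qed

lemma Sb_sub_const: "Sb T n (sub_const \<phi> c) \<alpha> x = Sb T n \<phi> \<alpha> x - (Bp T n *v c) $ \<alpha>"
proof -
  have "sub_const \<phi> c = (\<lambda>\<alpha> x. 1 * \<phi> \<alpha> x + (-1) * gamma_fun c \<alpha> x)" by (simp add: sub_const_def)
  then have "Sb T n (sub_const \<phi> c) = (\<lambda>\<alpha> x. 1 * Sb T n \<phi> \<alpha> x + (-1) * Sb T n (gamma_fun c) \<alpha> x)"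
    by (simp only: Sb_add)
  then show ?thesis by (simp add: Sb_gamma)
qed

lemma sub_const_continuous:
  assumes "continuous_on S (\<phi> \<alpha>)" shows "continuous_on S (sub_const \<phi> c \<alpha>)"
  using assms by (auto simp: sub_const_def gamma_fun_def intro!: continuous_intros)

lemma special_birkhoff_norm_le_iff:
  fixes T :: "'a::finite iem"
  assumes T: "good T" and f: "\<And>\<alpha>. continuous_on (cint T 0 \<alpha>) (\<phi> \<alpha>)"
  shows "Cr_norm 0 (rv T n) (special_birkhoff T 0 n (sub_const \<phi> c)) \<le> k \<longleftrightarrow>
    (\<forall>\<alpha>. \<forall>x\<in>cint T n \<alpha>. \<bar>Sb T n \<phi> \<alpha> x - (Bp T n *v c) $ \<alpha>\<bar> \<le> k)"
proof -
  let ?f = "sub_const \<phi> c"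
  have cf: "continuous_on (cint T 0 \<alpha>) (?f \<alpha>)" for \<alpha> by (rule sub_const_continuous[OF f])
  have e: "special_birkhoff T 0 n ?f \<alpha> x = Sb T n ?f \<alpha> x" if "x \<in> cint T n \<alpha>" for \<alpha> x
    by (rule special_birkhoff_eq[OF T cf that])
  have "continuous_on (cint T n \<alpha>) (special_birkhoff T 0 n ?f \<alpha>)" for \<alpha>
    by (rule continuous_on_eq[OF Sb_continuous[OF T cf] e[symmetric]])
  from Cr_norm_0_le_iff[OF rv_is_iem[OF T] this, of k] show ?thesis
    using e by (simp add: Sb_sub_const)
qed

theorem theorem3p11:
  fixes T :: "'a::finite iem" and Gamma_u :: "(real^'a) set"
  assumes "CARD('a) \<ge> 2"
    and "is_iem T"
    and "no_connection T"
    and "matrix_growth T"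
    and "coherence T"
    and "hyperbolic T"
    and "supplements Gamma_u (Gamma_s T) (Gamma_bd T)"
  shows "\<exists>L1 :: 'a pfun \<Rightarrow> real^'a.
    bounded_linear_op 1 T Gamma_u L1 \<and>
    (\<exists>C :: real \<Rightarrow> real. \<forall>\<tau>>0. \<forall>\<phi>\<in>Cr0_space 1 T. \<forall>n.
       Cr_norm 0 (rv T n) (special_birkhoff T 0 n (sub_const \<phi> (L1 \<phi>)))
         \<le> C \<tau> * Cr_norm 1 T \<phi> * mat_norm (Bmat T 0 n) powr \<tau>) \<and>
    (\<forall>\<phi>\<in>Cr0_space 1 T. \<forall>c\<in>Gamma_u.
       (\<forall>\<tau>>0. \<exists>C. \<forall>n.
          Cr_norm 0 (rv T n) (special_birkhoff T 0 n (sub_const \<phi> c))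
            \<le> C * mat_norm (Bmat T 0 n) powr \<tau>)
       \<longrightarrow> c = L1 \<phi>) \<and>
    (restricted_roth T \<longrightarrow>
       (\<forall>r>1. bounded_linear_op r T Gamma_u L1 \<and>
          (\<forall>\<phi>\<in>Cr0_space r T. \<forall>c\<in>Gamma_u.
             c = L1 \<phi> \<longleftrightarrow>
             (\<exists>\<psi>. continuous_on {upt_u T 0 .. upt_u T CARD('a)} \<psi> \<and>
                  cohomological_eq T \<phi> c \<psi>))))"
proof -
  note iT = assms(2) and mg = assms(4) and coh = assms(5) and hyp = assms(6) and sup = assms(7)
  have T: "good T" unfolding good_def using assms(1-3) no_connection_keane by blast
  note hyps = T mg coh hyp sup
  note u = supplementsD[OF hyps]
  have mn: "mat_norm (Bmat T 0 n) = bnorm T n" for n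
    using Bmat_eq[OF T, of 0 n] by (simp add: bnorm_def rv_0)
  define \<Lambda> where "\<Lambda> = sum (len T) UNIV"
  have L0: "\<Lambda> \<ge> 0" unfolding \<Lambda>_def using is_iemD(1)[OF iT] by (simp add: sum_nonneg less_imp_le)
  define grows where "grows \<phi> c \<longleftrightarrow> (\<forall>\<tau>>0. \<exists>C. \<forall>n \<alpha>. \<forall>p\<in>cint T n \<alpha>.
      \<bar>Sb T n \<phi> \<alpha> p - (Bp T n *v c) $ \<alpha>\<bar> \<le> C * bnorm T n powr \<tau>)" for \<phi> c
  have uniq: "c = c'" if "c \<in> Gamma_u" "c' \<in> Gamma_u" "grows \<phi> c" "grows \<phi> c'" for \<phi> c c'
    by (rule correction_unique[OF hyps that(1,2), of \<phi>]) (use that(3,4) in \<open>simp_all add: grows_def\<close>)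
  \<comment> \<open>\<open>L\<close> is defined from the growth property alone, so that linearity
    and the comparison with the cohomological equation reduce to uniqueness.\<close>
  define L where "L \<phi> = (THE c. c \<in> Gamma_u \<and> grows \<phi> c)" for \<phi>
  have L_eq: "L \<phi> = c" if "c \<in> Gamma_u" "grows \<phi> c" for \<phi> c
    unfolding L_def by (rule the_equality) (use that uniq in blast)+
  obtain K Cf where K: "K \<ge> 0" "\<forall>\<phi> M. (\<forall>C\<in>sigma_cycles T. boundary T \<phi> C = 0) \<longrightarrow>
    (\<forall>\<alpha>. \<forall>x\<in>cint T 0 \<alpha>. \<bar>\<phi> \<alpha> x\<bar> \<le> M) \<longrightarrow>
    (\<forall>n \<alpha>. \<forall>x\<in>cint T n \<alpha>. \<bar>Sb T n \<phi> \<alpha> x - Sb T n \<phi> \<alpha> (topl (rv T n) \<alpha>)\<bar> \<le> M) \<longrightarrow>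
    (\<exists>w\<in>Gamma_u. norm w \<le> K * M \<and>
      (\<forall>\<tau>>0. \<forall>n \<alpha>. \<forall>p\<in>cint T n \<alpha>. \<bar>Sb T n \<phi> \<alpha> p - (Bp T n *v w) $ \<alpha>\<bar> \<le> Cf \<tau> * M * bnorm T n powr \<tau>))"
    using correction_growth[OF hyps] by (elim exE conjE) (rule that)
  have topl_in: "topl (rv T n) \<alpha> \<in> cint T n \<alpha>" for n \<alpha>
    unfolding cint_eq[OF T] using rv_len_pos[OF T, of n \<alpha>] by simp
  have N0: "Cr_norm 1 T \<phi> \<ge> 0" if "\<phi> \<in> Cr_space 1 T" for \<phi>
    by (rule order_trans[OF abs_ge_zero Cr_space_1D(2)[OF iT that topl_in]])
  have L: "L \<phi> \<in> Gamma_u" "grows \<phi> (L \<phi>)" "infnorm (L \<phi>) \<le> K * (1 + \<Lambda>) * Cr_norm 1 T \<phi>"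
    "\<And>\<tau> n \<alpha> p. \<tau> > 0 \<Longrightarrow> p \<in> cint T n \<alpha> \<Longrightarrow>
      \<bar>Sb T n \<phi> \<alpha> p - (Bp T n *v L \<phi>) $ \<alpha>\<bar> \<le> Cf \<tau> * (1 + \<Lambda>) * Cr_norm 1 T \<phi> * bnorm T n powr \<tau>"
    if f: "\<phi> \<in> Cr0_space 1 T" for \<phi>
  proof -
    \<comment> \<open>The factor 1 + \<Lambda> makes one bound serve for \<phi> itself, at most N,
      and for its oscillations, at most N * \<Lambda>.\<close>
    let ?N = "Cr_norm 1 T \<phi>" and ?M = "Cr_norm 1 T \<phi> * (1 + \<Lambda>)"
    have f1: "\<phi> \<in> Cr_space 1 T" and fb: "\<forall>C\<in>sigma_cycles T. boundary T \<phi> C = 0"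
      using f by (auto simp: Cr0_space_def)
    have M: "?N \<le> ?M" "?N * \<Lambda> \<le> ?M" using N0[OF f1] L0 by (simp_all add: distrib_left)
    have 1: "\<forall>\<alpha>. \<forall>x\<in>cint T 0 \<alpha>. \<bar>\<phi> \<alpha> x\<bar> \<le> ?M"
      by (intro allI ballI order_trans[OF Cr_space_1D(2)[OF iT f1] M(1)])
    have 2: "\<forall>n \<alpha>. \<forall>x\<in>cint T n \<alpha>. \<bar>Sb T n \<phi> \<alpha> x - Sb T n \<phi> \<alpha> (topl (rv T n) \<alpha>)\<bar> \<le> ?M"
      by (intro allI ballI order_trans[OF C1_oscillation[OF T f1 _ topl_in, folded \<Lambda>_def] M(2)])
    obtain w where w: "w \<in> Gamma_u" "norm w \<le> K * ?M"
        "\<forall>\<tau>>0. \<forall>n \<alpha>. \<forall>p\<in>cint T n \<alpha>. \<bar>Sb T n \<phi> \<alpha> p - (Bp T n *v w) $ \<alpha>\<bar> \<le> Cf \<tau> * ?M * bnorm T n powr \<tau>"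
      using mp[OF mp[OF mp[OF spec[OF spec[OF K(2), of \<phi>], of ?M] fb] 1] 2] by (elim bexE conjE) (rule that)
    have g: "grows \<phi> w" unfolding grows_def
    proof (intro allI impI)
      fix \<tau> :: real assume "\<tau> > 0"
      then show "\<exists>C. \<forall>n \<alpha>. \<forall>p\<in>cint T n \<alpha>. \<bar>Sb T n \<phi> \<alpha> p - (Bp T n *v w) $ \<alpha>\<bar> \<le> C * bnorm T n powr \<tau>"
        using w(3) by (intro exI[of _ "Cf \<tau> * ?M"]) blast
    qed
    have e: "L \<phi> = w" by (rule L_eq[OF w(1) g])
    show "L \<phi> \<in> Gamma_u" "grows \<phi> (L \<phi>)" unfolding e by (fact w(1) g)+
    show "infnorm (L \<phi>) \<le> K * (1 + \<Lambda>) * ?N"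
      using order_trans[OF infnorm_le_norm w(2)] unfolding e by (simp add: mult_ac)
    fix \<tau> :: real and n \<alpha> p assume "\<tau> > 0" "p \<in> cint T n \<alpha>"
    from w(3)[rule_format, OF this]
    show "\<bar>Sb T n \<phi> \<alpha> p - (Bp T n *v L \<phi>) $ \<alpha>\<bar> \<le> Cf \<tau> * (1 + \<Lambda>) * ?N * bnorm T n powr \<tau>"
      unfolding e by (simp add: mult_ac)
  qed
  \<comment> \<open>The combination of the two corrections has the growth property for the combined
    function, so uniqueness identifies it.\<close>
  have lin: "L (\<lambda>\<alpha> x. a * \<phi> \<alpha> x + b * \<psi> \<alpha> x) = a *\<^sub>R L \<phi> + b *\<^sub>R L \<psi>"
    if f: "\<phi> \<in> Cr0_space 1 T" "\<psi> \<in> Cr0_space 1 T" for \<phi> \<psi> a b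
  proof (rule L_eq)
    show "a *\<^sub>R L \<phi> + b *\<^sub>R L \<psi> \<in> Gamma_u"
      by (intro subspace_add subspace_scale u(1) L(1) f)
    show "grows (\<lambda>\<alpha> x. a * \<phi> \<alpha> x + b * \<psi> \<alpha> x) (a *\<^sub>R L \<phi> + b *\<^sub>R L \<psi>)"
      unfolding grows_def
    proof (intro allI impI)
      fix \<tau> :: real assume t: "\<tau> > 0"
      obtain C1 where C1: "\<forall>n \<alpha>. \<forall>p\<in>cint T n \<alpha>. \<bar>Sb T n \<phi> \<alpha> p - (Bp T n *v L \<phi>) $ \<alpha>\<bar> \<le> C1 * bnorm T n powr \<tau>"
        using L(2)[OF f(1)] t unfolding grows_def by blast
      obtain C2 where C2: "\<forall>n \<alpha>. \<forall>p\<in>cint T n \<alpha>. \<bar>Sb T n \<psi> \<alpha> p - (Bp T n *v L \<psi>) $ \<alpha>\<bar> \<le> C2 * bnorm T n powr \<tau>"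
        using L(2)[OF f(2)] t unfolding grows_def by blast
      show "\<exists>C. \<forall>n \<alpha>. \<forall>p\<in>cint T n \<alpha>. \<bar>Sb T n (\<lambda>\<alpha> x. a * \<phi> \<alpha> x + b * \<psi> \<alpha> x) \<alpha> p
          - (Bp T n *v (a *\<^sub>R L \<phi> + b *\<^sub>R L \<psi>)) $ \<alpha>\<bar> \<le> C * bnorm T n powr \<tau>"
      proof (intro exI[of _ "\<bar>a\<bar> * C1 + \<bar>b\<bar> * C2"] allI ballI)
        fix n \<alpha> p assume p: "p \<in> cint T n \<alpha>"
        let ?x = "Sb T n \<phi> \<alpha> p - (Bp T n *v L \<phi>) $ \<alpha>" and ?y = "Sb T n \<psi> \<alpha> p - (Bp T n *v L \<psi>) $ \<alpha>"
        have "Sb T n (\<lambda>\<alpha> x. a * \<phi> \<alpha> x + b * \<psi> \<alpha> x) \<alpha> p - (Bp T n *v (a *\<^sub>R L \<phi> + b *\<^sub>R L \<psi>)) $ \<alpha> = a * ?x + b * ?y"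
          by (simp add: Sb_add matrix_vector_right_distrib matrix_vector_mult_scaleR algebra_simps)
        also have "\<bar>a * ?x + b * ?y\<bar> \<le> \<bar>a\<bar> * \<bar>?x\<bar> + \<bar>b\<bar> * \<bar>?y\<bar>"
          using abs_triangle_ineq[of "a * ?x" "b * ?y"] by (simp add: abs_mult)
        also have "\<dots> \<le> \<bar>a\<bar> * (C1 * bnorm T n powr \<tau>) + \<bar>b\<bar> * (C2 * bnorm T n powr \<tau>)"
          using C1 C2 p by (intro add_mono mult_left_mono) auto
        finally show "\<bar>Sb T n (\<lambda>\<alpha> x. a * \<phi> \<alpha> x + b * \<psi> \<alpha> x) \<alpha> p - (Bp T n *v (a *\<^sub>R L \<phi> + b *\<^sub>R L \<psi>)) $ \<alpha>\<bar>
            \<le> (\<bar>a\<bar> * C1 + \<bar>b\<bar> * C2) * bnorm T n powr \<tau>" by (simp add: algebra_simps)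
      qed
    qed
  qed
  \<comment> \<open>The C^r norm dominates the C^1 norm, so the bound for r = 1 gives all r \<ge>
    1.\<close>
  have bl: "bounded_linear_op r T Gamma_u L" if r: "1 \<le> r" for r
    unfolding bounded_linear_op_def
  proof (intro conjI ballI allI exI[of _ "K * (1 + \<Lambda>)"])
    have sub: "\<phi> \<in> Cr0_space 1 T" "Cr_norm 1 T \<phi> \<le> Cr_norm r T \<phi>" if "\<phi> \<in> Cr0_space r T" for \<phi>
      using that Cr_space_mono[OF iT r, of \<phi>] by (auto simp: Cr0_space_def)
    fix \<phi> assume f: "\<phi> \<in> Cr0_space r T"
    show "L \<phi> \<in> Gamma_u" by (rule L(1)[OF sub(1)[OF f]])
    have "K * (1 + \<Lambda>) * Cr_norm 1 T \<phi> \<le> K * (1 + \<Lambda>) * Cr_norm r T \<phi>"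
      by (rule mult_left_mono[OF sub(2)[OF f]]) (use K(1) L0 in simp)
    then show "infnorm (L \<phi>) \<le> K * (1 + \<Lambda>) * Cr_norm r T \<phi>" using L(3)[OF sub(1)[OF f]] by linarith
    fix \<psi> a b assume "\<psi> \<in> Cr0_space r T"
    then show "L (\<lambda>\<alpha> x. a * \<phi> \<alpha> x + b * \<psi> \<alpha> x) = a *\<^sub>R L \<phi> + b *\<^sub>R L \<psi>" by (intro lin sub(1) f)
  qed
  have cont: "continuous_on (cint T 0 \<alpha>) (\<phi> \<alpha>)" if "\<phi> \<in> Cr0_space 1 T" for \<phi> \<alpha>
    using that by (intro Cr_space_1_continuous[OF iT]) (simp add: Cr0_space_def)
  have norm_iff: "Cr_norm 0 (rv T n) (special_birkhoff T 0 n (sub_const \<phi> c)) \<le> k \<longleftrightarrow>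
    (\<forall>\<alpha>. \<forall>x\<in>cint T n \<alpha>. \<bar>Sb T n \<phi> \<alpha> x - (Bp T n *v c) $ \<alpha>\<bar> \<le> k)" if "\<phi> \<in> Cr0_space 1 T" for \<phi> n c k
    by (rule special_birkhoff_norm_le_iff[OF T cont[OF that]])
  have bounds: "\<forall>\<tau>>0. \<forall>\<phi>\<in>Cr0_space 1 T. \<forall>n.
       Cr_norm 0 (rv T n) (special_birkhoff T 0 n (sub_const \<phi> (L \<phi>)))
         \<le> (Cf \<tau> * (1 + \<Lambda>)) * Cr_norm 1 T \<phi> * mat_norm (Bmat T 0 n) powr \<tau>"
  proof (intro allI impI ballI)
    fix \<tau> :: real and \<phi> n assume h: "\<tau> > 0" "\<phi> \<in> Cr0_space 1 T"
    show "Cr_norm 0 (rv T n) (special_birkhoff T 0 n (sub_const \<phi> (L \<phi>)))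
         \<le> (Cf \<tau> * (1 + \<Lambda>)) * Cr_norm 1 T \<phi> * mat_norm (Bmat T 0 n) powr \<tau>"
      unfolding norm_iff[OF h(2)] mn by (intro allI ballI L(4)[OF h(2,1)])
  qed
  have char: "\<forall>\<phi>\<in>Cr0_space 1 T. \<forall>c\<in>Gamma_u.
       (\<forall>\<tau>>0. \<exists>C. \<forall>n. Cr_norm 0 (rv T n) (special_birkhoff T 0 n (sub_const \<phi> c))
            \<le> C * mat_norm (Bmat T 0 n) powr \<tau>) \<longrightarrow> c = L \<phi>"
  proof (intro ballI impI)
    fix \<phi> c assume f: "\<phi> \<in> Cr0_space 1 T" and c: "c \<in> Gamma_u" and
      g: "\<forall>\<tau>>0. \<exists>C. \<forall>n. Cr_norm 0 (rv T n) (special_birkhoff T 0 n (sub_const \<phi> c)) \<le> C * mat_norm (Bmat T 0 n) powr \<tau>"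
    have "grows \<phi> c" using g unfolding norm_iff[OF f] mn grows_def .
    then show "c = L \<phi>" using L_eq[OF c] by simp
  qed
  have bpow: "1 \<le> bnorm T n powr \<tau>" if "\<tau> > 0" for n \<tau>
    by (rule ge_one_powr_ge_zero[OF bnorm_ge_1 less_imp_le[OF that]])
  have roth: "c = L \<phi> \<longleftrightarrow> (\<exists>\<psi>. continuous_on {upt_u T 0 .. upt_u T CARD('a)} \<psi> \<and> cohomological_eq T \<phi> c \<psi>)"
    if rr: "restricted_roth T" and r: "1 < r" and fr: "\<phi> \<in> Cr0_space r T" and c: "c \<in> Gamma_u" for r \<phi> c
  proof -
    have gap: "spectral_gap T" using rr by (simp add: restricted_roth_def)
    have r1: "1 \<le> r" using r by simp
    have fb: "\<forall>C\<in>sigma_cycles T. boundary T \<phi> C = 0" and frs: "\<phi> \<in> Cr_space r T" using fr by (auto simp: Cr0_space_def)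
    have f1: "\<phi> \<in> Cr_space 1 T" by (rule Cr_space_mono(1)[OF iT r1 frs])
    then have f: "\<phi> \<in> Cr0_space 1 T" using fb by (simp add: Cr0_space_def)
    let ?f = "sub_const \<phi> c"
    have cf: "continuous_on (cint T 0 \<alpha>) (?f \<alpha>)" for \<alpha> by (rule sub_const_continuous[OF cont[OF f]])
    show ?thesis unfolding upt_u_0[OF iT] upt_u_card[OF iT]
    proof
      assume "\<exists>\<psi>. continuous_on {left_end T .. right_end T} \<psi> \<and> cohomological_eq T \<phi> c \<psi>"
      then obtain \<psi> where psi: "continuous_on {left_end T .. right_end T} \<psi>" "cohomological_eq T \<phi> c \<psi>" by blast
      have e: "?f \<alpha> x = \<psi> (iem_map T x) - \<psi> x" if "x \<in> top_int T \<alpha>" for \<alpha> x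
        using psi(2) that by (simp add: cohomological_eq_def sub_const_def)
      \<comment> \<open>A coboundary has bounded special Birkhoff sums, hence the growth property
        for every positive \<tau>.\<close>
      obtain C where C: "\<forall>n \<alpha>. \<forall>x\<in>cint T n \<alpha>. \<bar>Sb T n ?f \<alpha> x\<bar> \<le> C"
        using Sb_coboundary_bound[where f = ?f and \<psi> = \<psi>, OF T cf e psi(1)] by blast
      have "grows \<phi> c" unfolding grows_def
      proof (intro allI impI exI[of _ "\<bar>C\<bar>"] ballI)
        fix \<tau> :: real and n \<alpha> p assume t: "\<tau> > 0" and p: "p \<in> cint T n \<alpha>"
        have "\<bar>Sb T n \<phi> \<alpha> p - (Bp T n *v c) $ \<alpha>\<bar> \<le> \<bar>C\<bar>" using C p unfolding Sb_sub_const by fastforce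
        also have "\<dots> \<le> \<bar>C\<bar> * bnorm T n powr \<tau>" using mult_left_mono[OF bpow[OF t], of "\<bar>C\<bar>" n] by simp
        finally show "\<bar>Sb T n \<phi> \<alpha> p - (Bp T n *v c) $ \<alpha>\<bar> \<le> \<bar>C\<bar> * bnorm T n powr \<tau>" .
      qed
      then show "c = L \<phi>" using L_eq[OF c] by simp
    next
      assume cL: "c = L \<phi>"
      let ?h = "min 1 (r - 1)" and ?N = "Cr_norm 1 T \<phi>"
      let ?D = "\<lambda>\<alpha>. nderiv_within (top_cint T \<alpha>) 1 (\<phi> \<alpha>)"
      have h: "0 < ?h" "?h \<le> 1" using r by auto
      have "\<exists>H\<ge>0. \<forall>x\<in>cint T 0 \<alpha>. \<forall>y\<in>cint T 0 \<alpha>. \<bar>?D \<alpha> x - ?D \<alpha> y\<bar> \<le> H * \<bar>x - y\<bar> powr ?h" for \<alpha>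
        using Cr_on_derivative_holder[OF r, of "topl T \<alpha>" "topl T \<alpha> + len T \<alpha>" "\<phi> \<alpha>"] frs
        unfolding Cr_space_def by (simp add: rv_0 top_cint_eq[OF iT])
      then obtain Hf where Hf: "\<And>\<alpha>. Hf \<alpha> \<ge> 0"
        "\<And>\<alpha> x y. x \<in> cint T 0 \<alpha> \<Longrightarrow> y \<in> cint T 0 \<alpha> \<Longrightarrow> \<bar>?D \<alpha> x - ?D \<alpha> y\<bar> \<le> Hf \<alpha> * \<bar>x - y\<bar> powr ?h" by metis
      have H: "\<bar>?D \<alpha> x - ?D \<alpha> y\<bar> \<le> sum Hf UNIV * \<bar>x - y\<bar> powr ?h" if "x \<in> cint T 0 \<alpha>" "y \<in> cint T 0 \<alpha>" for \<alpha> x y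
      proof -
        have "Hf \<alpha> \<le> sum Hf UNIV" by (rule member_le_sum) (auto simp: Hf(1))
        then have "Hf \<alpha> * \<bar>x - y\<bar> powr ?h \<le> sum Hf UNIV * \<bar>x - y\<bar> powr ?h" by (rule mult_right_mono) simp
        then show ?thesis using Hf(2)[OF that] by linarith
      qed
      have H0: "sum Hf UNIV \<ge> 0" by (rule sum_nonneg) (rule Hf(1))
      have p: "pairing (rv T n) 0 1 (Sb T n \<phi>) = 0" for n
        by (rule pairing_iterate[OF T pairing_boundary[OF iT fb[rule_format]]]) simp_all
      have "\<exists>\<delta>>0. \<exists>C\<ge>0. \<forall>n \<alpha>. \<forall>x\<in>cint T n \<alpha>.
          \<bar>Sb T n \<phi> \<alpha> x - Sb T n \<phi> \<alpha> (topl (rv T n) \<alpha>)\<bar> \<le> C * bnorm T n powr - \<delta>"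
        by (rule oscillation_decay[where \<phi> = \<phi> and \<phi>' = ?D, OF T mg gap Cr_space_1D(1)[OF iT f1] Cr_space_1D(3)[OF iT f1] h H0 H p])
      then obtain \<delta> C where C: "\<delta> > 0" "C \<ge> 0" "\<forall>n \<alpha>. \<forall>x\<in>cint T n \<alpha>.
          \<bar>Sb T n \<phi> \<alpha> x - Sb T n \<phi> \<alpha> (topl (rv T n) \<alpha>)\<bar> \<le> C * bnorm T n powr - \<delta>"
        by (elim exE conjE) (rule that)
      \<comment> \<open>\<open>correction_decay\<close> asks for one constant in the bound of \<phi>
        and in that of the oscillations; the sum of the two serves.\<close>
      have b1: "\<forall>\<alpha>. \<forall>x\<in>cint T 0 \<alpha>. \<bar>\<phi> \<alpha> x\<bar> \<le> ?N + C"
        using Cr_space_1D(2)[OF iT f1] C(2) by fastforce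
      have b2: "\<forall>n \<alpha>. \<forall>x\<in>cint T n \<alpha>.
          \<bar>Sb T n \<phi> \<alpha> x - Sb T n \<phi> \<alpha> (topl (rv T n) \<alpha>)\<bar> \<le> (?N + C) * bnorm T n powr - \<delta>"
      proof (intro allI ballI)
        fix n \<alpha> x assume "x \<in> cint T n \<alpha>"
        with C(3) have "\<bar>Sb T n \<phi> \<alpha> x - Sb T n \<phi> \<alpha> (topl (rv T n) \<alpha>)\<bar> \<le> C * bnorm T n powr - \<delta>" by blast
        also have "\<dots> \<le> (?N + C) * bnorm T n powr - \<delta>" by (rule mult_right_mono) (use N0[OF f1] in auto)
        finally show "\<bar>Sb T n \<phi> \<alpha> x - Sb T n \<phi> \<alpha> (topl (rv T n) \<alpha>)\<bar> \<le> (?N + C) * bnorm T n powr - \<delta>" .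
      qed
      obtain w s A where w: "w \<in> Gamma_u" "s > 0" "A \<ge> 0"
        "\<forall>n \<alpha>. \<forall>p\<in>cint T n \<alpha>. \<bar>Sb T n \<phi> \<alpha> p - (Bp T n *v w) $ \<alpha>\<bar> \<le> A * bnorm T n powr - s"
        using correction_decay[OF hyps C(1) fb b1 b2] by (elim bexE exE conjE) (rule that)
      \<comment> \<open>Decay implies the growth property, so uniqueness identifies the vector
        obtained from the decay estimate with L \<phi>.\<close>
      have "grows \<phi> w" unfolding grows_def
      proof (intro allI impI exI[of _ A] ballI)
        fix \<tau> :: real and n \<alpha> p assume t: "\<tau> > 0" and p: "p \<in> cint T n \<alpha>"
        have "bnorm T n powr - s \<le> bnorm T n powr \<tau>" by (rule powr_mono[OF _ bnorm_ge_1]) (use t w(2) in simp)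
        then have "A * bnorm T n powr - s \<le> A * bnorm T n powr \<tau>" using w(3) by (rule mult_left_mono)
        then show "\<bar>Sb T n \<phi> \<alpha> p - (Bp T n *v w) $ \<alpha>\<bar> \<le> A * bnorm T n powr \<tau>" using w(4) p by fastforce
      qed
      then have cw: "c = w" using L_eq[OF w(1)] cL by simp
      have E: "\<bar>Sb T n ?f \<alpha> y\<bar> \<le> A * bnorm T n powr - s" if "y \<in> cint T n \<alpha>" for n \<alpha> y
        using w(4) that unfolding Sb_sub_const cw by blast
      have sE: "summable (\<lambda>n. A * bnorm T n powr - s)"
        by (rule summable_mult[OF cocycle.summable_b[OF cocycle_iem[OF T mg coh hyp u(3)] w(2)]])
      obtain \<psi> where psi: "continuous_on {left_end T .. right_end T} \<psi>"
          "\<forall>\<alpha>. \<forall>x\<in>top_int T \<alpha>. ?f \<alpha> x = \<psi> (iem_map T x) - \<psi> x"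
        using cohomological_solution[where E = "\<lambda>n. A * bnorm T n powr - s", OF T cf sE E] by blast
      have "cohomological_eq T \<phi> c \<psi>"
        unfolding cohomological_eq_def
      proof (intro allI ballI)
        fix \<alpha> x assume "x \<in> top_int T \<alpha>"
        with psi(2) have "?f \<alpha> x = \<psi> (iem_map T x) - \<psi> x" by blast
        then show "\<phi> \<alpha> x = gamma_fun c \<alpha> x + \<psi> (iem_map T x) - \<psi> x" by (simp add: sub_const_def)
      qed
      then show "\<exists>\<psi>. continuous_on {left_end T .. right_end T} \<psi> \<and> cohomological_eq T \<phi> c \<psi>" using psi(1) by blast
    qed
  qed
  have "\<exists>C :: real \<Rightarrow> real. \<forall>\<tau>>0. \<forall>\<phi>\<in>Cr0_space 1 T. \<forall>n.
       Cr_norm 0 (rv T n) (special_birkhoff T 0 n (sub_const \<phi> (L \<phi>)))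
         \<le> C \<tau> * Cr_norm 1 T \<phi> * mat_norm (Bmat T 0 n) powr \<tau>"
    by (rule exI[of _ "\<lambda>\<tau>. Cf \<tau> * (1 + \<Lambda>)"]) (rule bounds)
  moreover have "restricted_roth T \<longrightarrow>
       (\<forall>r>1. bounded_linear_op r T Gamma_u L \<and>
          (\<forall>\<phi>\<in>Cr0_space r T. \<forall>c\<in>Gamma_u.
             c = L \<phi> \<longleftrightarrow>
             (\<exists>\<psi>. continuous_on {upt_u T 0 .. upt_u T CARD('a)} \<psi> \<and> cohomological_eq T \<phi> c \<psi>)))"
    by (intro impI allI conjI ballI bl roth) auto
  ultimately show ?thesis using bl[OF order_refl] char by (intro exI[of _ L] conjI)
qed

end
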